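(* Let $\mu$ be a non elementary probability measure on $SL_2(\mathbb{R})$ having an exponential moment, let $(X_n)_{n\ge 1}$ be independent random variables with law $\mu$, and let $S_n=X_n\cdots X_1$. Then for every proper algebraic subvariety $\mathcal{V}$ of $SL_2(\mathbb{R})$, $$\limsup_{n\to\infty}\big[\mathbb{P}(S_n\in\mathcal{V})\big]^{1/n}<1 .$$ In particular, every proper algebraic subvariety $\mathcal V$ is transient, that is, almost surely $S_n\notin\mathcal{V}$ for all $n$ large enough. More precisely, if $P$ is a polynomial with real coefficients in the entries of $2\times 2$ matrices which is non constant on $SL_2(\mathbb{R})$, then there exists $\lambda>0$ such that $$\frac1n\log|P(S_n)|\xrightarrow[n\to\infty]{}\lambda\quad\text{almost surely},$$ and for every $\epsilon>0$, $$\limsup_{n\to\infty}\Big[\mathbb{P}\Big(\Big|\tfrac1n\log|P(S_n)|-\lambda\Big|>\epsilon\Big)\Big]^{1/n}<1 .$$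
   Context: A probability measure $\mu$ on $SL_2(\mathbb{R})$ is non elementary if the group generated by its support is non elementary, i.e. Zariski dense in $SL_2(\mathbb{R})$, or equivalently not virtually solvable. It has an exponential moment if for some $\tau>0$, $\int\|g\|^\tau\,d\mu(g)<\infty$, for some (equivalently any) norm on $M_2(\mathbb{R})$. A proper algebraic subvariety of $SL_2(\mathbb{R})$ is the set of common zeros in $SL_2(\mathbb{R})$ of a family of polynomials in the matrix entries, distinct from $SL_2(\mathbb{R})$. Convention: $\log 0=-\infty$. *)

theory Defs
  imports "HOL-Probability.Probability" "HOL-Algebra.Generated_Groups"
begin

definition SL2 :: "(real^2^2) monoid" where
  "SL2 = \<lparr>carrier = {A. det A = 1}, mult = (**), one = mat 1\<rparr>"

lemma group_SL2: "group SL2"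
proof (rule groupI)
  fix A assume "A \<in> carrier SL2"
  then have d: "det A = 1" by (simp add: SL2_def)
  then have "invertible A" by (simp add: invertible_det_nz)
  then obtain B where B: "A ** B = mat 1" "B ** A = mat 1"
    by (auto simp: invertible_def)
  have "det B * det A = 1" using B(2) by (metis det_I det_mul)
  with d B show "\<exists>B\<in>carrier SL2. B \<otimes>\<^bsub>SL2\<^esub> A = \<one>\<^bsub>SL2\<^esub>"
    by (auto simp: SL2_def)
qed (auto simp: SL2_def det_mul matrix_mul_assoc)

abbreviation SL2_borel :: "(real^2^2) measure" where
  "SL2_borel \<equiv> restrict_space borel (carrier SL2)"

text \<open>Polynomials in the matrix entries are rendered as functions on the whole matrix space
  by \<^const>\<open>real_polynomial_function\<close>. The family \<open>F\<close> of polynomials may be infinite or empty.\<close>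

definition algebraic_subvariety :: "(real^2^2) set \<Rightarrow> bool" where
  "algebraic_subvariety V \<longleftrightarrow>
     (\<exists>F. (\<forall>P\<in>F. real_polynomial_function P) \<and> V = {A \<in> carrier SL2. \<forall>P\<in>F. P A = 0})"

definition proper_algebraic_subvariety :: "(real^2^2) set \<Rightarrow> bool" where
  "proper_algebraic_subvariety V \<longleftrightarrow> algebraic_subvariety V \<and> V \<noteq> carrier SL2"

definition zariski_dense :: "(real^2^2) set \<Rightarrow> bool" where
  "zariski_dense H \<longleftrightarrow> (\<forall>V. algebraic_subvariety V \<and> H \<subseteq> V \<longrightarrow> V = carrier SL2)"

definition measure_support :: "(real^2^2) measure \<Rightarrow> (real^2^2) set" where
  "measure_support \<mu> =
     {A \<in> carrier SL2. \<forall>U. open U \<and> A \<in> U \<longrightarrow> emeasure \<mu> (U \<inter> carrier SL2) > 0}"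

definition non_elementary :: "(real^2^2) measure \<Rightarrow> bool" where
  "non_elementary \<mu> \<longleftrightarrow> zariski_dense (generate SL2 (measure_support \<mu>))"

text \<open>The norm on \<^typ>\<open>real^2^2\<close> is the Frobenius norm.\<close>

definition exponential_moment :: "(real^2^2) measure \<Rightarrow> bool" where
  "exponential_moment \<mu> \<longleftrightarrow> (\<exists>\<tau>>0. integrable \<mu> (\<lambda>g. norm g powr \<tau>))"

text \<open>The walk \<open>S\<^sub>n = X\<^sub>n \<cdots> X\<^sub>1\<close>; the value \<open>X 0\<close> is not used.\<close>

primrec random_walk :: "(nat \<Rightarrow> 'a \<Rightarrow> real^2^2) \<Rightarrow> nat \<Rightarrow> 'a \<Rightarrow> real^2^2" where
  "random_walk X 0 \<omega> = mat 1"
| "random_walk X (Suc n) \<omega> = X (Suc n) \<omega> ** random_walk X n \<omega>"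

text \<open>Logarithm with the convention \<open>log 0 = -\<infinity>\<close>; only used on nonnegative reals.\<close>

definition elog :: "real \<Rightarrow> ereal" where
  "elog x = (if x = 0 then -\<infinity> else ereal (ln x))"

end

theory Submission
  imports Defs "HOL-Computational_Algebra.Fundamental_Theorem_Algebra"
begin

text \<open>The walk is studied through the law \<open>K n\<close> of \<open>S\<^sub>n\<close>, the \<open>n\<close>-th convolution power of the step law,
since all the assertions, the almost sure ones included, follow from exponential bounds on \<open>K n\<close>.
Write \<open>gx\<close> for the image of a unit vector \<open>x\<close> and \<open>x \<and> y\<close> for the determinant of two vectors of the plane.

Positivity of the Lyapunov exponent (\<open>drift_positive\<close>). If the expectation of \<open>ln |S\<^sub>n x|\<close> did not become
uniformly positive in \<open>x\<close>, compactness would give a stationary probability \<open>\<nu>\<close> on the circle with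
\<open>\<integral>\<integral> ln |gx| d\<mu> d\<nu> \<le> 0\<close>, and irreducibility prevents \<open>\<nu>\<close> from charging a line. The logarithmic energy of
\<open>\<nu>\<close>, with kernel \<open>- ln |x \<and> y|\<close>, grows under \<open>g\<close> by \<open>2 \<integral> ln |gx| d\<nu>\<close>, because
\<open>gx \<and> gy = x \<and> y\<close> up to normalisation. The kernel is positive definite, so the mean energy of the images \<open>g\<nu>\<close>
is at least the energy of their mean \<open>\<nu>\<close>, with a defect that controls the variance of the second moments of \<open>g\<nu>\<close>.
The defect therefore vanishes: almost every \<open>g\<nu>\<close> has the same second moments as \<open>\<nu>\<close>, which bounds the norm of
\<open>g\<close>, for all \<open>K n\<close> at once. A bounded walk preserves a positive definite quadratic form, which contradicts
Zariski density. The energy of \<open>\<nu>\<close> may be infinite, so the kernel is truncated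
(\<open>energy_inequality\<close>).

Large deviations. A second order expansion turns the positive drift into \<open>E |S\<^sub>n x|\<^sup>-\<^sup>s \<le> C \<rho>\<^sup>n\<close>. Since the
distance of the directions of \<open>gx\<close> and \<open>gy\<close> is \<open>|x \<and> y| / (|gx| |gy|)\<close>, the walk contracts the circle
in mean, so that \<open>E ln |S\<^sub>n x|\<close> is \<open>n \<lambda>\<close> up to a bounded error, uniformly in \<open>x\<close>
(\<open>drift_linear_growth\<close>), and the same expansion with exponents of both signs gives exponential concentration of
\<open>ln |S\<^sub>n x|\<close> around \<open>n \<lambda>\<close>. The transposed walk has the same exponent, and an identity of plane geometry
then shows that a coefficient \<open>\<langle>S\<^sub>n x, l\<rangle>\<close> is smaller than \<open>e\<^sup>n\<^sup>(\<^sup>\<lambda>\<^sup>-\<^sup>\<epsilon>\<^sup>)\<close> only with exponentially small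
probability (\<open>coefficient_regularity\<close>).

Polynomials. On \<open>SL\<^sub>2\<close> the relation \<open>ae = 1 + bc\<close> between the entries reduces a polynomial to monomials without the
factor \<open>ae\<close>; their restrictions to rank one matrices are linearly independent. If \<open>d\<close> is the degree of the
reduced form \<open>P\<close> of a non constant polynomial, then \<open>d \<ge> 1\<close> and the part of degree \<open>d\<close> is, on
\<open>u w\<^sup>T\<close>, a nonzero form of bidegree \<open>(d, d)\<close> (\<open>top_form\<close>). Cut the walk in two independent factors,
\<open>S\<^sub>n = A G\<close>, with \<open>G\<close> twice as long as \<open>A\<close>. Then \<open>G\<close> is almost of rank one, the coefficients of the form in
\<open>Av\<close> are controlled by the regularity of the transposed walk, and for fixed \<open>G\<close> the regularity of \<open>A\<close> bounds a
binary form in \<open>Av\<close> from below, factor by factor (\<open>binary_form_regular\<close>). Hence \<open>|P(S\<^sub>n)|\<close> is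
\<open>e\<^sup>n\<^sup>(\<^sup>d\<^sup>\<lambda>\<^sup>\<plusminus>\<^sup>\<epsilon>\<^sup>)\<close> outside an exponentially small event (\<open>poly_ldp\<close>). The almost sure limit follows
by Borel and Cantelli, and a proper subvariety lies in the zero set of a polynomial that does not vanish identically.\<close>

section \<open>Plane geometry of matrices of determinant one\<close>

definition wedge :: "real^2 \<Rightarrow> real^2 \<Rightarrow> real" where
  "wedge x y = x$1 * y$2 - x$2 * y$1"

definition quarter_turn :: "real^2 \<Rightarrow> real^2" where
  "quarter_turn x = vector [- x$2, x$1]"

lemma vec2_eqI: "x$1 = y$1 \<Longrightarrow> x$2 = y$2 \<Longrightarrow> x = (y::'b^2)"
  by (simp add: vec_eq_iff forall_2)

lemma quarter_turn_nth [simp]: "quarter_turn x $ 1 = - x$2" "quarter_turn x $ 2 = x$1"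
  by (auto simp: quarter_turn_def)

lemma mv_nth: "((g::real^2^2) *v x)$i = g$i$1 * x$1 + g$i$2 * x$2"
  by (simp add: matrix_vector_mult_def sum_2)

lemma mm_nth: "((g::real^2^2) ** h)$i$j = g$i$1 * h$1$j + g$i$2 * h$2$j"
  by (simp add: matrix_matrix_mult_def sum_2)

lemma inner2: "inner (x::real^2) y = x$1 * y$1 + x$2 * y$2"
  by (simp add: inner_vec_def sum_2)

lemma norm2_sq: "(norm (x::real^2))^2 = (x$1)^2 + (x$2)^2"
  unfolding power2_norm_eq_inner inner2 by (simp add: power2_eq_square)

lemma normm_sq: "(norm (g::real^2^2))^2 = (g$1$1)^2 + (g$1$2)^2 + (g$2$1)^2 + (g$2$2)^2"
  unfolding power2_norm_eq_inner by (simp add: inner_vec_def sum_2 power2_eq_square)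

lemma norm_quarter_turn [simp]: "norm (quarter_turn x) = norm x"
proof -
  have "(norm (quarter_turn x))^2 = (norm x)^2" by (simp add: norm2_sq)
  then show ?thesis by (simp add: power2_eq_iff_nonneg)
qed

lemma wedge_quarter_turn: "wedge x (quarter_turn x) = (norm x)^2"
  unfolding norm2_sq by (simp add: wedge_def power2_eq_square)

lemma wedge_mv: "wedge (g *v x) (g *v y) = det g * wedge x y"
  by (simp add: wedge_def mv_nth det_2 algebra_simps)

lemma wedge_scaleR [simp]: "wedge (a *\<^sub>R x) y = a * wedge x y" "wedge x (a *\<^sub>R y) = a * wedge x y"
  by (auto simp: wedge_def algebra_simps)

lemma wedge_self [simp]: "wedge x x = 0"
  by (simp add: wedge_def)

text \<open>Lagrange's identity in the plane; it converts statements about directions between sines and cosines.\<close>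

lemma wedge_inner: "(wedge x y)^2 + (inner x y)^2 = (norm x)^2 * (norm y)^2"
  unfolding norm2_sq wedge_def inner2 by algebra

lemma wedge_le: "\<bar>wedge x y\<bar> \<le> norm x * norm y"
proof -
  have "(wedge x y)^2 \<le> (norm x * norm y)^2"
    using wedge_inner[of x y] by (simp add: power_mult_distrib) (metis le_add_same_cancel1 zero_le_power2)
  then show ?thesis by (metis abs_le_square_iff abs_mult abs_norm_cancel)
qed

lemma norm_mv_le: "norm ((g::real^2^2) *v x) \<le> norm g * norm x"
proof -
  have "(norm (g *v x))^2 = (inner (g$1) x)^2 + (inner (g$2) x)^2"
    by (simp add: norm2_sq mv_nth inner2)
  also have "\<dots> \<le> (norm (g$1))^2 * (norm x)^2 + (norm (g$2))^2 * (norm x)^2"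
    by (intro add_mono) (metis power_mult_distrib Cauchy_Schwarz_ineq2 abs_le_square_iff abs_mult abs_norm_cancel)+
  also have "\<dots> = (norm g * norm x)^2"
    by (simp add: normm_sq norm2_sq power_mult_distrib algebra_simps)
  finally show ?thesis by (simp add: power2_le_iff_abs_le)
qed

lemma norm_mm_le: "norm ((g::real^2^2) ** (h::real^2^2)) \<le> norm g * norm h"
proof -
  have "(norm (g ** h))^2 = (norm (g *v column 1 h))^2 + (norm (g *v column 2 h))^2"
    by (simp add: normm_sq norm2_sq mm_nth mv_nth column_def)
  also have "\<dots> \<le> (norm g * norm (column 1 h))^2 + (norm g * norm (column 2 h))^2"
    by (intro add_mono power_mono norm_mv_le) auto
  also have "\<dots> = (norm g * norm h)^2"
    by (simp add: power_mult_distrib normm_sq[of h] norm2_sq column_def algebra_simps)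
  finally show ?thesis by (simp add: power2_le_iff_abs_le)
qed

lemma norm_transpose [simp]: "norm (transpose (g::real^2^2)) = norm g"
proof -
  have "(norm (transpose g))^2 = (norm g)^2" by (simp add: normm_sq transpose_def)
  then show ?thesis by (simp add: power2_eq_iff_nonneg)
qed

lemma entry_le: "\<bar>(g::real^2^2)$i$j\<bar> \<le> norm g"
  using order_trans[OF Finite_Cartesian_Product.norm_nth_le[of "g$i" j] Finite_Cartesian_Product.norm_nth_le[of g i]] by simp

lemma det1_norm_ge1: assumes "det (g::real^2^2) = 1" shows "norm g \<ge> 1"
proof -
  have "2 * (g$1$1 * g$2$2 - g$1$2 * g$2$1) \<le> (norm g)^2"
    unfolding normm_sq using sum_squares_ge_zero[of "g$1$1 - g$2$2" "g$1$2 + g$2$1"]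
    by (simp add: power2_eq_square algebra_simps)
  then have "1 \<le> (norm g)^2" using assms by (simp add: det_2)
  then show ?thesis by (metis norm_ge_zero one_le_power power2_le_imp_le one_power2)
qed

lemma det1_mv_nz: assumes "det (g::real^2^2) = 1" "x \<noteq> 0" shows "g *v x \<noteq> 0"
proof
  assume "g *v x = 0"
  then have "wedge (g *v x) (g *v quarter_turn x) = 0" by (simp add: wedge_def)
  then show False using assms by (simp add: wedge_mv wedge_quarter_turn)
qed

text \<open>A matrix of determinant one preserves areas: it cannot shrink \<open>x\<close> by more than it stretches the
orthogonal direction.\<close>

lemma det1_norm_mv_ge: assumes "det (g::real^2^2) = 1" shows "norm (g *v x) * norm g \<ge> norm x"
proof (cases "x = 0")
  case False
  have "(norm x)^2 = wedge (g *v x) (g *v quarter_turn x)" using assms by (simp add: wedge_mv wedge_quarter_turn)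
  also have "\<dots> \<le> norm (g *v x) * norm (g *v quarter_turn x)" using wedge_le abs_le_D1 by blast
  also have "\<dots> \<le> norm (g *v x) * (norm g * norm x)"
    using norm_mv_le[of g "quarter_turn x"] by (intro mult_left_mono) auto
  finally show ?thesis using False by (simp add: power2_eq_square)
qed simp

text \<open>The upper bound is Cauchy and Schwarz, the lower bound is area preservation. This is the domination used for
every integral of \<open>ln |gx|\<close>.\<close>

lemma ln_mv_bound: assumes "det (g::real^2^2) = 1" "norm x = 1" shows "\<bar>ln (norm (g *v x))\<bar> \<le> ln (norm g)"
proof -
  have p: "norm (g *v x) > 0" using det1_mv_nz[OF assms(1), of x] assms(2) by (metis norm_zero zero_less_norm_iff zero_neq_one)
  have g: "norm g \<ge> 1" by (rule det1_norm_ge1) fact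
  have "norm (g *v x) \<le> norm g" using norm_mv_le[of g x] assms by simp
  then have 1: "ln (norm (g *v x)) \<le> ln (norm g)" using p g by (subst ln_le_cancel_iff) auto
  have "0 \<le> ln (norm (g *v x) * norm g)" using det1_norm_mv_ge[OF assms(1), of x] assms(2) by simp
  then have "0 \<le> ln (norm (g *v x)) + ln (norm g)" using p g by (subst (asm) ln_mult_pos) auto
  with 1 show ?thesis by simp
qed

lemma mv_sgn: "(g::real^2^2) *v sgn x = (g *v x) /\<^sub>R norm x"
  by (simp add: sgn_div_norm matrix_vector_mult_scaleR)

lemma sgn_mv_sgn: "x \<noteq> 0 \<Longrightarrow> sgn ((g::real^2^2) *v sgn x) = sgn (g *v x)"
  by (simp add: mv_sgn sgn_scaleR)

section \<open>Measurability of matrix operations\<close>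

lemma borel_vec_nth [measurable (raw)]: "f \<in> borel_measurable M \<Longrightarrow> (\<lambda>x. (f x :: real^2) $ i) \<in> borel_measurable M"
  by (rule measurable_compose[of f M borel "\<lambda>v. v$i"]) (auto intro!: borel_measurable_continuous_onI continuous_intros)

lemma borel_mat_nth [measurable (raw)]: "f \<in> borel_measurable M \<Longrightarrow> (\<lambda>x. (f x :: real^2^2) $ i $ j) \<in> borel_measurable M"
  by (rule measurable_compose[of f M borel "\<lambda>v. v$i$j"]) (auto intro!: borel_measurable_continuous_onI continuous_intros)

lemma vec2_axis: "(v::real^2) = (v$1) *\<^sub>R axis 1 1 + (v$2) *\<^sub>R axis 2 1"
  by (rule vec2_eqI) (simp_all add: axis_def)

lemma borel_vec2I: 
  assumes "(\<lambda>x. (f x :: real^2) $ 1) \<in> borel_measurable M" "(\<lambda>x. f x $ 2) \<in> borel_measurable M"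
  shows "f \<in> borel_measurable M"
proof -
  have "(\<lambda>x. (f x $ 1) *\<^sub>R axis 1 1 + (f x $ 2) *\<^sub>R axis 2 (1::real) :: real^2) \<in> borel_measurable M"
    using assms by measurable
  then show ?thesis by (subst (asm) vec2_axis[symmetric])
qed

lemma mat2_axis: "(v::real^2^2) = (v$1$1) *\<^sub>R axis 1 (axis 1 1) + (v$1$2) *\<^sub>R axis 1 (axis 2 1)
   + (v$2$1) *\<^sub>R axis 2 (axis 1 1) + (v$2$2) *\<^sub>R axis 2 (axis 2 1)"
  by (auto intro!: vec2_eqI simp: axis_def)

lemma borel_mat2I: 
  assumes "\<And>i j. (\<lambda>x. (f x :: real^2^2) $ i $ j) \<in> borel_measurable M"
  shows "f \<in> borel_measurable M"
proof -
  have "(\<lambda>x. (f x $ 1$1) *\<^sub>R axis 1 (axis 1 1) + (f x $1$2) *\<^sub>R axis 1 (axis 2 1)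
   + (f x$2$1) *\<^sub>R axis 2 (axis 1 1) + (f x$2$2) *\<^sub>R axis 2 (axis 2 (1::real)) :: real^2^2) \<in> borel_measurable M"
    using assms by measurable
  then show ?thesis by (subst (asm) mat2_axis[symmetric])
qed

lemma borel_mv [measurable (raw)]:
  assumes [measurable]: "f \<in> borel_measurable M" "h \<in> borel_measurable M"
  shows "(\<lambda>x. (f x :: real^2^2) *v h x) \<in> borel_measurable M"
  by (rule borel_vec2I; simp only: mv_nth; measurable)

lemma borel_mm [measurable (raw)]:
  assumes [measurable]: "f \<in> borel_measurable M" "h \<in> borel_measurable M"
  shows "(\<lambda>x. (f x :: real^2^2) ** (h x :: real^2^2)) \<in> borel_measurable M"
  by (rule borel_mat2I; simp only: mm_nth; measurable)

lemma borel_transpose [measurable (raw)]: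
  assumes [measurable]: "f \<in> borel_measurable M"
  shows "(\<lambda>x. transpose (f x :: real^2^2)) \<in> borel_measurable M"
  by (rule borel_mat2I; simp add: transpose_def)

lemma borel_wedge [measurable (raw)]:
  assumes [measurable]: "f \<in> borel_measurable M" "h \<in> borel_measurable M"
  shows "(\<lambda>x. wedge (f x) (h x)) \<in> borel_measurable M"
  unfolding wedge_def by measurable

lemma borel_det [measurable (raw)]:
  assumes [measurable]: "f \<in> borel_measurable M"
  shows "(\<lambda>x. det (f x :: real^2^2)) \<in> borel_measurable M"
  unfolding det_2 by measurable

lemma borel_det' [measurable]: "det \<in> borel_measurable (borel :: (real^2^2) measure)"
  using borel_det[of "\<lambda>x. x" borel] by simp

lemma sets_det1: "{g::real^2^2. det g = 1} \<in> sets borel"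
proof -
  have "det -` {1} \<inter> space borel \<in> sets (borel :: (real^2^2) measure)"
    by (rule measurable_sets[OF borel_det']) simp
  then show ?thesis by (simp add: vimage_def)
qed

lemma borel_sgn_vec [measurable (raw)]:
  assumes [measurable]: "f \<in> borel_measurable M"
  shows "(\<lambda>x. sgn (f x :: real^2)) \<in> borel_measurable M"
  unfolding sgn_div_norm by measurable

section \<open>Convolution of laws on matrices\<close>

text \<open>The law of a product of two independent matrices, the left factor having the first law. The powers
\<open>mconv_pow\<close> add a new factor on the left, like the random walk.\<close>

definition mconv :: "(real^2^2) measure \<Rightarrow> (real^2^2) measure \<Rightarrow> (real^2^2) measure" where
  "mconv A B = distr (A \<Otimes>\<^sub>M B) borel (\<lambda>(g,h). g ** h)"

primrec mconv_pow :: "(real^2^2) measure \<Rightarrow> nat \<Rightarrow> (real^2^2) measure" where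
  "mconv_pow k 0 = return borel (mat 1)"
| "mconv_pow k (Suc n) = mconv k (mconv_pow k n)"

text \<open>Laws on \<open>SL\<^sub>2\<close> are carried by the whole matrix space, with determinant one almost everywhere, so that no
subspace measures occur in the integrals.\<close>

definition SL2_law :: "(real^2^2) measure \<Rightarrow> bool" where
  "SL2_law k \<longleftrightarrow> prob_space k \<and> sets k = sets borel \<and> (AE g in k. det g = 1)"

lemma lawD: "SL2_law k \<Longrightarrow> prob_space k" "SL2_law k \<Longrightarrow> sets k = sets borel" "SL2_law k \<Longrightarrow> AE g in k. det g = 1"
  by (auto simp: SL2_law_def)

lemma sets_mconv [simp]: "sets (mconv A B) = sets borel" 
  by (simp add: mconv_def)

lemma space_mconv [simp]: "space (mconv A B) = UNIV" 
  by (simp add: mconv_def)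

lemma nn_integral_mconv:
  assumes "SL2_law A" "SL2_law B" and [measurable]: "f \<in> borel_measurable borel"
  shows "(\<integral>\<^sup>+g. f g \<partial>mconv A B) = (\<integral>\<^sup>+g. \<integral>\<^sup>+h. f (g ** h) \<partial>B \<partial>A)"
proof -
  interpret A: prob_space A by (rule lawD) fact
  interpret B: prob_space B by (rule lawD) fact
  note [measurable_cong] = lawD(2)[OF assms(1)] lawD(2)[OF assms(2)]
  show ?thesis unfolding mconv_def 
    apply (subst nn_integral_distr)
    apply (measurable)
    apply (subst B.nn_integral_fst[symmetric])
    apply (auto simp: case_prod_unfold)
    done
qed

lemma law_mconv: assumes "SL2_law A" "SL2_law B" shows "SL2_law (mconv A B)"
proof -
  interpret A: prob_space A by (rule lawD) fact
  interpret B: prob_space B by (rule lawD) fact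
  interpret AB: pair_prob_space A B ..
  note [measurable_cong] = lawD(2)[OF assms(1)] lawD(2)[OF assms(2)]
  have "prob_space (mconv A B)" unfolding mconv_def by (rule AB.prob_space_distr) measurable
  moreover have "AE g in mconv A B. det g = 1"
  proof -
    have m: "(\<lambda>(g,h). g ** h) \<in> borel_measurable (A \<Otimes>\<^sub>M B)" by measurable
    have "AE z in A \<Otimes>\<^sub>M B. det (case z of (g,h) \<Rightarrow> g ** h) = 1"
    proof (rule AB.AE_pair_measure)
      have "(\<lambda>(g,h). g ** h) -` {g. det g = 1} \<inter> space (A \<Otimes>\<^sub>M B) \<in> sets (A \<Otimes>\<^sub>M B)"
        by (rule measurable_sets[OF m sets_det1])
      then show "{z \<in> space (A \<Otimes>\<^sub>M B). det (case z of (g,h) \<Rightarrow> g ** h) = 1} \<in> sets (A \<Otimes>\<^sub>M B)"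
        by (simp add: vimage_def Int_def conj_commute)
      show "AE g in A. AE h in B. det (case (g,h) of (g,h) \<Rightarrow> g ** h) = 1"
        using lawD(3)[OF assms(1)]
      proof (rule eventually_mono)
        fix g :: "real^2^2" assume "det g = 1"
        then show "AE h in B. det (case (g,h) of (g,h) \<Rightarrow> g ** h) = 1"
          using lawD(3)[OF assms(2)] by (simp add: det_mul)
      qed
    qed
    then show ?thesis unfolding mconv_def using sets_det1 by (subst AE_distr_iff[OF m]) auto
  qed
  ultimately show ?thesis by (simp add: SL2_law_def)
qed

lemma law_return: "SL2_law (return borel (mat 1))"
proof -
  interpret prob_space "return borel (mat 1::real^2^2)" by (rule prob_space_return) simp
  show ?thesis unfolding SL2_law_def by (auto simp: AE_return prob_space_axioms)
qed

lemma law_mconv_pow: "SL2_law k \<Longrightarrow> SL2_law (mconv_pow k n)"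
  by (induction n) (auto intro: law_mconv law_return)

text \<open>Integrals of nonnegative functions determine the law; identities between convolutions thus reduce to iterated
integrals.\<close>

lemma law_eqI: 
  assumes "SL2_law A" "SL2_law B" "\<And>f. f \<in> borel_measurable borel \<Longrightarrow> (\<integral>\<^sup>+g. f g \<partial>A) = (\<integral>\<^sup>+g. f g \<partial>B)"
  shows "A = B"
proof (rule measure_eqI)
  show "sets A = sets B" using assms by (simp add: SL2_law_def)
  fix X assume X: "X \<in> sets A"
  then have "X \<in> sets borel" "X \<in> sets B" using assms by (auto simp: SL2_law_def)
  then show "emeasure A X = emeasure B X" using assms(3)[of "indicator X"] X by simp
qed

lemma mconv_assoc: assumes "SL2_law A" "SL2_law B" "SL2_law C" shows "mconv (mconv A B) C = mconv A (mconv B C)"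
proof (rule law_eqI)
  fix f :: "real^2^2 \<Rightarrow> ennreal" assume [measurable]: "f \<in> borel_measurable borel"
  interpret C: prob_space C by (rule lawD) fact
  note [measurable_cong] = lawD(2)[OF assms(1)] lawD(2)[OF assms(2)] lawD(2)[OF assms(3)]
  show "(\<integral>\<^sup>+g. f g \<partial>mconv (mconv A B) C) = (\<integral>\<^sup>+g. f g \<partial>mconv A (mconv B C))"
    using assms by (simp add: nn_integral_mconv law_mconv matrix_mul_assoc)
qed (auto intro: law_mconv assms)

lemma mconv_return: assumes "SL2_law A" shows "mconv (return borel (mat 1)) A = A" "mconv A (return borel (mat 1)) = A"
proof -
  note [measurable_cong] = lawD(2)[OF assms(1)]
  show "mconv (return borel (mat 1)) A = A"
  proof (rule law_eqI)
    fix f :: "real^2^2 \<Rightarrow> ennreal" assume [measurable]: "f \<in> borel_measurable borel"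
    interpret A: prob_space A by (rule lawD) fact
    show "(\<integral>\<^sup>+g. f g \<partial>mconv (return borel (mat 1)) A) = (\<integral>\<^sup>+g. f g \<partial>A)"
      using assms by (simp add: nn_integral_mconv law_return nn_integral_return)
  qed (auto intro: law_mconv law_return assms)
  show "mconv A (return borel (mat 1)) = A"
  proof (rule law_eqI)
    fix f :: "real^2^2 \<Rightarrow> ennreal" assume [measurable]: "f \<in> borel_measurable borel"
    show "(\<integral>\<^sup>+g. f g \<partial>mconv A (return borel (mat 1))) = (\<integral>\<^sup>+g. f g \<partial>A)"
      using assms by (simp add: nn_integral_mconv law_return nn_integral_return)
  qed (auto intro: law_mconv law_return assms)
qed

lemma mconv_pow_add: "SL2_law k \<Longrightarrow> mconv_pow k (m + n) = mconv (mconv_pow k m) (mconv_pow k n)"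
  by (induction m) (auto simp: mconv_return law_mconv_pow mconv_assoc)

lemma mconv_pow_1: "SL2_law k \<Longrightarrow> mconv_pow k 1 = k"
  by (simp add: mconv_return)

lemma mconv_pow_Suc': "SL2_law k \<Longrightarrow> mconv_pow k (Suc n) = mconv (mconv_pow k n) k"
  using mconv_pow_add[of k n 1] mconv_pow_1[of k] by simp

lemma integral_mconv:
  fixes f :: "real^2^2 \<Rightarrow> real"
  assumes "SL2_law A" "SL2_law B" and i: "integrable (mconv A B) f"
  shows "(\<integral>g. f g \<partial>mconv A B) = (\<integral>g. \<integral>h. f (g ** h) \<partial>B \<partial>A)" 
    "(\<integral>g. f g \<partial>mconv A B) = (\<integral>h. \<integral>g. f (g ** h) \<partial>A \<partial>B)"
    "integrable (A \<Otimes>\<^sub>M B) (\<lambda>(g,h). f (g ** h))"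
proof -
  interpret A: prob_space A by (rule lawD) fact
  interpret B: prob_space B by (rule lawD) fact
  interpret AB: pair_prob_space A B ..
  note [measurable_cong] = lawD(2)[OF assms(1)] lawD(2)[OF assms(2)]
  have [measurable]: "f \<in> borel_measurable borel"
    using borel_measurable_integrable[OF i] by (simp add: measurable_cong_sets[of "mconv A B" borel])
  have m: "(\<lambda>(g,h). g ** h) \<in> borel_measurable (A \<Otimes>\<^sub>M B)" by measurable
  show *: "integrable (A \<Otimes>\<^sub>M B) (\<lambda>(g,h). f (g ** h))"
    using i unfolding mconv_def by (subst (asm) integrable_distr_eq) (auto simp: case_prod_unfold)
  have e: "(\<integral>g. f g \<partial>mconv A B) = (\<integral>z. (case z of (g,h) \<Rightarrow> f (g ** h)) \<partial>(A \<Otimes>\<^sub>M B))"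
    unfolding mconv_def by (subst integral_distr) (auto simp: case_prod_unfold)
  show "(\<integral>g. f g \<partial>mconv A B) = (\<integral>g. \<integral>h. f (g ** h) \<partial>B \<partial>A)" 
    unfolding e using AB.integral_fst'[OF *] by simp
  show "(\<integral>g. f g \<partial>mconv A B) = (\<integral>h. \<integral>g. f (g ** h) \<partial>A \<partial>B)" 
    unfolding e using AB.integral_snd[OF *] by simp
qed

section \<open>Compactness of probability measures on the circle\<close>

definition circle_point :: "real \<Rightarrow> real^2" where "circle_point t = vector [cos t, sin t]"

text \<open>An explicit measurable section of \<open>circle_point\<close>. The clipping to \<open>[-1, 1]\<close> only serves to make the
function continuous outside the unit circle.\<close>

definition circle_angle :: "real^2 \<Rightarrow> real" where
  "circle_angle v = (if v$2 \<ge> 0 then arccos (max (-1) (min 1 (v$1))) else 2 * pi - arccos (max (-1) (min 1 (v$1))))"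

lemma circ_nth [simp]: "circle_point t $ 1 = cos t" "circle_point t $ 2 = sin t"
  by (auto simp: circle_point_def)

lemma norm_circ [simp]: "norm (circle_point t) = 1"
proof -
  have "(norm (circle_point t))^2 = 1^2" unfolding norm2_sq by simp
  then show ?thesis by (subst (asm) power2_eq_iff_nonneg) auto
qed

lemma circ_ang: assumes "norm v = 1" shows "circle_point (circle_angle v) = v"
proof -
  have 1: "(v$1)^2 + (v$2)^2 = 1" using norm2_sq[of v] assms by simp
  then have "(v$1)^2 \<le> 1^2" by (simp add: sum_power2_ge_zero) (smt (verit) zero_le_power2)
  then have b: "-1 \<le> v$1" "v$1 \<le> 1" by (auto simp: abs_square_le_1 abs_le_iff)
  then have c: "max (-1) (min 1 (v$1)) = v$1" by simp
  have s: "sin (arccos (v$1)) = \<bar>v$2\<bar>"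
    using b 1 by (simp add: sin_arccos) (metis add_diff_cancel_left' real_sqrt_abs)
  show ?thesis
    by (rule vec2_eqI) (use b s in \<open>auto simp: circle_angle_def c cos_diff sin_diff\<close>)
qed

lemma ang_bounds: "-1 < circle_angle v" "circle_angle v \<le> 7"
proof -
  have b: "0 \<le> arccos (max (-1) (min 1 (v$1)))" "arccos (max (-1) (min 1 (v$1))) \<le> pi"
    by (auto intro!: arccos_lbound arccos_ubound)
  have p: "2 * pi < 7" using pi_approx by simp
  show "-1 < circle_angle v" "circle_angle v \<le> 7" using b p pi_gt_zero unfolding circle_angle_def by (auto simp: not_le)
qed

lemma cont_circ: "continuous_on S circle_point"
proof -
  have "continuous_on S (\<lambda>t. cos t *\<^sub>R axis 1 1 + sin t *\<^sub>R axis 2 (1::real) :: real^2)"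
    by (intro continuous_intros)
  moreover have "(\<lambda>t. cos t *\<^sub>R axis 1 1 + sin t *\<^sub>R axis 2 (1::real) :: real^2) = circle_point"
    by (rule ext, rule vec2_eqI) (simp_all add: axis_def)
  ultimately show ?thesis by (simp only:)
qed

lemma circ_measurable [measurable]: "circle_point \<in> borel_measurable borel"
  by (rule borel_measurable_continuous_onI[OF cont_circ])

lemma ang_measurable [measurable]: "circle_angle \<in> borel_measurable borel"
proof -
  have [measurable]: "(\<lambda>x::real. arccos (max (-1) (min 1 x))) \<in> borel_measurable borel"
    by (intro borel_measurable_continuous_onI continuous_intros) auto
  show ?thesis unfolding circle_angle_def by measurable
qed

definition circle_prob :: "(real^2) measure \<Rightarrow> bool" where
  "circle_prob m \<longleftrightarrow> prob_space m \<and> sets m = sets borel \<and> (AE x in m. norm x = 1)"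

text \<open>Helly's selection theorem is one dimensional, so the measures are pulled back to the angles in
\<open>(-1, 7]\<close>. The test functions are only continuous on the circle, which suffices because they are composed with
its parametrisation.\<close>

lemma circle_compact:
  assumes "\<And>n. circle_prob (m n)"
  shows "\<exists>r \<nu>. strict_mono (r::nat\<Rightarrow>nat) \<and> circle_prob \<nu> \<and> 
    (\<forall>f::real^2\<Rightarrow>real. f \<in> borel_measurable borel \<longrightarrow> continuous_on (sphere 0 1) f \<longrightarrow>
       (\<lambda>n. \<integral>x. f x \<partial>m (r n)) \<longlonglongrightarrow> (\<integral>x. f x \<partial>\<nu>))"
proof -
  define k where "k n = distr (m n) borel circle_angle" for n
  have s[measurable_cong]: "sets (m n) = sets borel" for n using assms by (auto simp: circle_prob_def)
  have p: "prob_space (m n)" for n using assms by (auto simp: circle_prob_def)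
  have rd: "real_distribution (k n)" for n
    unfolding k_def by (rule prob_space.real_distribution_distr[OF p]) measurable
  have "tight k" unfolding tight_def
  proof (intro conjI allI impI rd)
    fix e :: real assume e: "e > 0"
    have "measure (k n) {-1<..7} = 1" for n
    proof -
      have "circle_angle -` {-1<..7} = UNIV" using ang_bounds by auto
      then show ?thesis unfolding k_def using prob_space.prob_space[OF p[of n]]
        by (subst measure_distr) (auto simp: sets_eq_imp_space_eq[OF s])
    qed
    with e show "\<exists>a b. a < b \<and> (\<forall>n. 1 - e < measure (k n) {a<..b})"
      by (intro exI[of _ "-1"] exI[of _ 7]) auto
  qed
  from tight_imp_convergent_subsubsequence[OF this strict_mono_id] obtain r M where
    r: "strict_mono (r::nat\<Rightarrow>nat)" and M: "real_distribution M" and w: "weak_conv_m (k \<circ> r) M" by auto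
  interpret M: real_distribution M by fact
  define \<nu> where "\<nu> = distr M borel circle_point"
  have "circle_prob \<nu>" unfolding circle_prob_def \<nu>_def 
    by (auto intro!: M.prob_space_distr simp: AE_distr_iff)
  moreover have "(\<lambda>n. \<integral>x. f x \<partial>m (r n)) \<longlonglongrightarrow> (\<integral>x. f x \<partial>\<nu>)" 
    if [measurable]: "f \<in> borel_measurable borel" and c: "continuous_on (sphere 0 1) f" for f :: "real^2\<Rightarrow>real"
  proof -
    have cc: "continuous_on UNIV (\<lambda>t. f (circle_point t))"
      by (rule continuous_on_compose2[OF c cont_circ]) auto
    have "bounded (f ` sphere 0 1)" by (intro compact_imp_bounded compact_continuous_image c) simp
    then obtain B where "\<And>x. norm x = 1 \<Longrightarrow> norm (f x) \<le> B" unfolding bounded_iff by (metis (no_types) imageI mem_sphere_0)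
    then have B: "norm (f (circle_point t)) \<le> B" for t by simp
    have "(\<lambda>n. \<integral>t. f (circle_point t) \<partial>(k \<circ> r) n) \<longlonglongrightarrow> (\<integral>t. f (circle_point t) \<partial>M)"
      using cc B by (intro weak_conv_imp_integral_bdd_continuous_conv[where B=B])
        (auto simp: o_def rd w[unfolded o_def] M continuous_on_eq_continuous_at)
    moreover have "(\<integral>t. f (circle_point t) \<partial>M) = (\<integral>x. f x \<partial>\<nu>)" unfolding \<nu>_def by (subst integral_distr) auto
    moreover have "(\<integral>t. f (circle_point t) \<partial>(k \<circ> r) n) = (\<integral>x. f x \<partial>m (r n))" for n
    proof -
      have "(\<integral>t. f (circle_point t) \<partial>(k \<circ> r) n) = (\<integral>x. f (circle_point (circle_angle x)) \<partial>m (r n))"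
        unfolding k_def o_def by (subst integral_distr) auto
      also have "\<dots> = (\<integral>x. f x \<partial>m (r n))"
        using assms[of "r n"] by (intro integral_cong_AE) (auto simp: circle_prob_def circ_ang)
      finally show ?thesis .
    qed
    ultimately show ?thesis by simp
  qed
  ultimately show ?thesis using r by blast
qed

section \<open>Random walks and their drift\<close>

lemma det1_unit_nz: "det (g::real^2^2) = 1 \<Longrightarrow> norm x = 1 \<Longrightarrow> g *v x \<noteq> 0"
  by (rule det1_mv_nz) auto

lemma det1_sgn: "det (g::real^2^2) = 1 \<Longrightarrow> norm x = 1 \<Longrightarrow> norm (sgn (g *v x)) = 1"
  using det1_unit_nz by (simp add: norm_sgn)

text \<open>Zariski density enters only through subgroups that are algebraic and carry the step law. In this form the
hypothesis passes to the transposed walk at once. The exponent \<open>\<tau>\<close> may be decreased, hence \<open>\<tau> \<le> 1\<close>.\<close>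

locale SL2_walk =
  fixes \<kappa> :: "(real^2^2) measure" and \<tau> :: real
  assumes SL2_law: "SL2_law \<kappa>" and tau: "0 < \<tau>" "\<tau> \<le> 1"
    and moment: "integrable \<kappa> (\<lambda>g. norm g powr \<tau>)"
    and nonel: "\<And>V. algebraic_subvariety V \<Longrightarrow> subgroup V SL2 \<Longrightarrow> AE g in \<kappa>. g \<in> V \<Longrightarrow> V = carrier SL2"
begin

abbreviation "K n \<equiv> mconv_pow \<kappa> n"

lemma lawK: "SL2_law (K n)" by (rule law_mconv_pow[OF SL2_law])

lemma prob_K: "prob_space (K n)" using lawK SL2_law_def by blast

lemma sets_K [measurable_cong, simp]: "sets (K n) = sets borel" using lawK SL2_law_def by blast

lemma space_K [simp]: "space (K n) = UNIV" using sets_eq_imp_space_eq[OF sets_K] by simp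

lemma sets_k [measurable_cong, simp]: "sets \<kappa> = sets borel" using SL2_law SL2_law_def by blast

lemma space_k [simp]: "space \<kappa> = UNIV" using sets_eq_imp_space_eq[OF sets_k] by simp

lemma AE_det_K: "AE g in K n. det g = 1" using lawK SL2_law_def by blast

lemma K1: "K (Suc 0) = \<kappa>" using mconv_pow_1[OF SL2_law] by simp

lemma K_add: "K (m + n) = mconv (K m) (K n)" by (rule mconv_pow_add[OF SL2_law])

text \<open>The norm is submultiplicative and at least one on \<open>SL\<^sub>2\<close>, so moments of the convolution powers multiply.\<close>

lemma nn_mom_fin: assumes "0 \<le> s" "s \<le> \<tau>" shows "(\<integral>\<^sup>+g. ennreal (norm g powr s) \<partial>K n) < \<infinity>"
proof (induction n)
  case 0
  show ?case by (simp add: nn_integral_return)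
next
  case (Suc n)
  interpret k: prob_space \<kappa> using SL2_law SL2_law_def by blast
  have "(\<integral>\<^sup>+g. ennreal (norm g powr s) \<partial>K (Suc n)) = (\<integral>\<^sup>+g. \<integral>\<^sup>+h. ennreal (norm (g ** h) powr s) \<partial>K n \<partial>\<kappa>)"
    using SL2_law lawK by (simp add: nn_integral_mconv)
  also have "\<dots> \<le> (\<integral>\<^sup>+g. \<integral>\<^sup>+h. ennreal (norm g powr s) * ennreal (norm h powr s) \<partial>K n \<partial>\<kappa>)"
    using assms by (intro nn_integral_mono) 
      (auto simp: ennreal_mult[symmetric] powr_mult[symmetric] intro!: ennreal_leI powr_mono2 norm_mm_le)
  also have "\<dots> = (\<integral>\<^sup>+g. ennreal (norm g powr s) \<partial>\<kappa>) * (\<integral>\<^sup>+g. ennreal (norm g powr s) \<partial>K n)"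
    by (simp add: nn_integral_cmult nn_integral_multc)
  also have "(\<integral>\<^sup>+g. ennreal (norm g powr s) \<partial>\<kappa>) \<le> (\<integral>\<^sup>+g. ennreal (norm g powr \<tau>) \<partial>\<kappa>)"
    using lawD(3)[OF SL2_law] 
    by (intro nn_integral_mono_AE) (auto elim!: eventually_mono intro!: ennreal_leI powr_mono assms det1_norm_ge1)
  also have "(\<integral>\<^sup>+g. ennreal (norm g powr \<tau>) \<partial>\<kappa>) = ennreal (\<integral>g. norm g powr \<tau> \<partial>\<kappa>)"
    by (rule nn_integral_eq_integral[OF moment]) auto
  finally show ?case using Suc by (simp add: ennreal_mult_less_top mult_right_mono order_le_less_trans)
qed

lemma mom_K: assumes "0 \<le> s" "s \<le> \<tau>" shows "integrable (K n) (\<lambda>g. norm g powr s)"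
  using nn_mom_fin[OF assms, of n] by (intro integrableI_nonneg) auto

lemma ln_le_powr: assumes "0 < s" "1 \<le> (t::real)" shows "ln t \<le> t powr s / s"
proof -
  have "s * ln t = ln (t powr s)" using assms by (simp add: ln_powr)
  also have "\<dots> \<le> t powr s - 1" using assms by (intro ln_le_minus_one) auto
  finally show ?thesis using assms by (simp add: field_simps)
qed

lemma int_ln_norm: "integrable (K n) (\<lambda>g. ln (norm g))"
proof (rule Bochner_Integration.integrable_bound)
  show "integrable (K n) (\<lambda>g. norm g powr \<tau> / \<tau>)" using mom_K[of \<tau> n] tau by simp
  show "AE g in K n. norm (ln (norm g)) \<le> norm (norm g powr \<tau> / \<tau>)"
    using AE_det_K
  proof (rule eventually_mono)
    fix g :: "real^2^2" assume "det g = 1"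
    then have "1 \<le> norm g" by (rule det1_norm_ge1)
    then show "norm (ln (norm g)) \<le> norm (norm g powr \<tau> / \<tau>)" using ln_le_powr[of \<tau> "norm g"] tau by simp
  qed
qed auto

lemma int_ln: assumes "norm x = 1" shows "integrable (K n) (\<lambda>g. ln (norm (g *v x)))"
proof (rule Bochner_Integration.integrable_bound[OF int_ln_norm])
  show "AE g in K n. norm (ln (norm (g *v x))) \<le> norm (ln (norm g))"
    using AE_det_K by (rule eventually_mono) (use ln_mv_bound[OF _ assms] in fastforce)
qed auto

definition drift :: "nat \<Rightarrow> real^2 \<Rightarrow> real" where
  "drift n x = (\<integral>g. ln (norm (g *v x)) \<partial>K n)"

lemma drift_measurable [measurable]: "drift n \<in> borel_measurable borel"
proof -
  interpret prob_space "K n" by (rule prob_K)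
  show ?thesis unfolding drift_def by measurable
qed

lemma drift_bound: assumes "norm x = 1" shows "\<bar>drift n x\<bar> \<le> (\<integral>g. ln (norm g) \<partial>K n)"
  unfolding drift_def using AE_det_K[of n] 
  by (intro order_trans[OF integral_abs_bound] integral_mono_AE integrable_abs int_ln int_ln_norm assms)
    (auto elim!: eventually_mono intro!: ln_mv_bound assms)

lemma ln_mv_split: "det (h::real^2^2) = 1 \<Longrightarrow> det (g::real^2^2) = 1 \<Longrightarrow> norm x = 1 \<Longrightarrow> 
  ln (norm ((g ** h) *v x)) = ln (norm (h *v x)) + ln (norm (g *v sgn (h *v x)))"
proof -
  assume d: "det (h::real^2^2) = 1" "det (g::real^2^2) = 1" "norm x = 1"
  then have x: "h *v x \<noteq> 0" using det1_mv_nz[of h x] by (metis norm_zero zero_neq_one)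
  then have y: "g *v (h *v x) \<noteq> 0" using det1_mv_nz d by blast
  have "norm (g *v sgn (h *v x)) = norm (g *v (h *v x)) / norm (h *v x)"
    by (simp add: mv_sgn divide_inverse_commute)
  then show ?thesis using x y by (simp add: matrix_vector_mul_assoc ln_div)
qed

text \<open>The cocycle relation: after \<open>n\<close> steps the vector \<open>x\<close> has been stretched by \<open>hx\<close> and points in
the direction \<open>sgn (hx)\<close>, from which the next \<open>m\<close> steps start.\<close>

lemma drift_add: assumes x: "norm x = 1" 
  shows "drift (m + n) x = drift n x + (\<integral>h. drift m (sgn (h *v x)) \<partial>K n)"
    "integrable (K n) (\<lambda>h. drift m (sgn (h *v x)))"
proof -
  interpret m: prob_space "K m" by (rule prob_K)
  interpret n: prob_space "K n" by (rule prob_K)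
  have nz: "AE h in K n. norm (sgn (h *v x)) = 1" using AE_det_K
    by (rule eventually_mono) (rule det1_sgn[OF _ x])
  show i: "integrable (K n) (\<lambda>h. drift m (sgn (h *v x)))"
    by (rule n.integrable_const_bound[where B="\<integral>g. ln (norm g) \<partial>K m"])
      (use nz drift_bound in \<open>auto elim!: eventually_mono\<close>)
  have "drift (m + n) x = (\<integral>h. \<integral>g. ln (norm ((g ** h) *v x)) \<partial>K m \<partial>K n)"
    unfolding drift_def K_add
    by (rule integral_mconv(2)[OF lawK lawK]) (use int_ln[OF x, of "m + n"] in \<open>simp add: K_add\<close>)
  also have "\<dots> = (\<integral>h. ln (norm (h *v x)) + drift m (sgn (h *v x)) \<partial>K n)"
  proof (rule integral_cong_AE)
    show "AE h in K n. (\<integral>g. ln (norm ((g ** h) *v x)) \<partial>K m) = ln (norm (h *v x)) + drift m (sgn (h *v x))"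
      using AE_det_K[of n] nz
    proof eventually_elim
      fix h :: "real^2^2" assume h: "det h = 1" and s: "norm (sgn (h *v x)) = 1"
      have "(\<integral>g. ln (norm ((g ** h) *v x)) \<partial>K m) = (\<integral>g. ln (norm (h *v x)) + ln (norm (g *v sgn (h *v x))) \<partial>K m)"
        by (rule integral_cong_AE) (use AE_det_K[of m] ln_mv_split[OF h _ x] in \<open>auto elim!: eventually_mono\<close>)
      also have "\<dots> = ln (norm (h *v x)) + drift m (sgn (h *v x))"
        unfolding drift_def using int_ln[OF s, of m] by (subst Bochner_Integration.integral_add) (auto simp: m.prob_space[unfolded space_K])
      finally show "(\<integral>g. ln (norm ((g ** h) *v x)) \<partial>K m) = ln (norm (h *v x)) + drift m (sgn (h *v x))" .
    qed
  qed measurable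
  also have "\<dots> = drift n x + (\<integral>h. drift m (sgn (h *v x)) \<partial>K n)"
    unfolding drift_def[of n] using int_ln[OF x] i by (rule Bochner_Integration.integral_add)
  finally show "drift (m + n) x = drift n x + (\<integral>h. drift m (sgn (h *v x)) \<partial>K n)" .
qed

end

section \<open>Stationary measures on the circle\<close>

text \<open>The indicator of a closed set is the limit of the continuous functions
\<open>max 0 (1 - k dist(x, C))\<close>, and closed sets generate the Borel sets and are stable under intersection.\<close>

lemma closed_cts_measure_eqI:
  fixes A B :: "(real^2) measure"
  assumes "prob_space A" "prob_space B" and sA: "sets A = sets borel" and sB: "sets B = sets borel"
    and eq: "\<And>f::real^2\<Rightarrow>real. continuous_on UNIV f \<Longrightarrow> (\<And>x. \<bar>f x\<bar> \<le> 1) \<Longrightarrow> (\<integral>x. f x \<partial>A) = (\<integral>x. f x \<partial>B)"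
  shows "A = B"
proof -
  interpret A: prob_space A by fact
  interpret B: prob_space B by fact
  note [measurable_cong] = sA sB
  have *: "A.prob C = B.prob C" if C: "closed C" for C
  proof (cases "C = {}")
    case False
    define f where "f k x = max 0 (1 - real k * infdist x C)" for k x
    have c: "continuous_on UNIV (f k)" for k unfolding f_def by (intro continuous_intros)
    have [measurable]: "f k \<in> borel_measurable borel" for k
      by (rule borel_measurable_continuous_onI[OF c])
    have b: "\<bar>f k x\<bar> \<le> 1" for k x unfolding f_def using infdist_nonneg[of x C] by auto
    have [measurable]: "C \<in> sets borel" using C by simp
    have l: "(\<lambda>k. f k x) \<longlonglongrightarrow> indicator C x" for x
    proof (cases "x \<in> C")
      case True then show ?thesis by (simp add: f_def)
    next
      case n: False
      then have d: "infdist x C > 0" using C False by (metis in_closed_iff_infdist_zero infdist_nonneg less_eq_real_def)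
      have "\<forall>\<^sub>F k in sequentially. f k x = 0"
      proof -
        obtain k0 :: nat where "1 / infdist x C < k0" using reals_Archimedean2 by blast
        then have "f k x = 0" if "k \<ge> k0" for k
        proof -
          have "1 < real k0 * infdist x C" using \<open>_ < real k0\<close> d by (simp add: field_simps)
          also have "\<dots> \<le> real k * infdist x C" using that d by (intro mult_right_mono) auto
          finally show ?thesis by (simp add: f_def)
        qed
        then show ?thesis by (auto simp: eventually_sequentially)
      qed
      then show ?thesis using n by (auto intro: tendsto_eventually)
    qed
    have "(\<lambda>k. \<integral>x. f k x \<partial>A) \<longlonglongrightarrow> (\<integral>x. indicator C x \<partial>A)"
      by (rule integral_dominated_convergence[where w="\<lambda>_. 1"]) (use b l in auto)
    moreover have "(\<lambda>k. \<integral>x. f k x \<partial>B) \<longlonglongrightarrow> (\<integral>x. indicator C x \<partial>B)"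
      by (rule integral_dominated_convergence[where w="\<lambda>_. 1"]) (use b l in auto)
    ultimately have "(\<integral>x. indicat_real C x \<partial>A) = (\<integral>x. indicator C x \<partial>B)"
      using eq[OF c b] LIMSEQ_unique by simp
    then show ?thesis by (simp add: A.emeasure_eq_measure sets_eq_imp_space_eq[OF sA] sets_eq_imp_space_eq[OF sB])
  qed simp
  show ?thesis
  proof (rule measure_eqI_generator_eq[where E="Collect closed" and \<Omega>=UNIV and A="\<lambda>_. UNIV"])
    show "Int_stable (Collect (closed::(real^2) set \<Rightarrow> bool))" by (auto simp: Int_stable_def)
    show "sets A = sigma_sets UNIV (Collect closed)" "sets B = sigma_sets UNIV (Collect closed)"
      unfolding sA sB borel_eq_closed by auto
  qed (auto simp: * A.emeasure_eq_measure B.emeasure_eq_measure)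
qed

text \<open>The law of the direction of \<open>gx\<close> for independent \<open>g\<close> and \<open>x\<close>; a fixed point is a stationary measure.\<close>

definition circle_act :: "(real^2^2) measure \<Rightarrow> (real^2) measure \<Rightarrow> (real^2) measure" where
  "circle_act k m = distr (k \<Otimes>\<^sub>M m) borel (\<lambda>(g,x). sgn (g *v x))"

lemma circle_probD: "circle_prob m \<Longrightarrow> prob_space m" "circle_prob m \<Longrightarrow> sets m = sets borel"
  "circle_prob m \<Longrightarrow> AE x in m. norm x = 1" "circle_prob m \<Longrightarrow> space m = UNIV"
  using sets_eq_imp_space_eq[of m borel] by (auto simp: circle_prob_def)

lemma nn_integral_act:
  assumes "SL2_law k" "circle_prob m" and [measurable]: "f \<in> borel_measurable borel"
  shows "(\<integral>\<^sup>+x. f x \<partial>circle_act k m) = (\<integral>\<^sup>+g. \<integral>\<^sup>+x. f (sgn (g *v x)) \<partial>m \<partial>k)"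
proof -
  interpret A: prob_space k by (rule lawD) fact
  interpret B: prob_space m by (rule circle_probD) fact
  note [measurable_cong] = lawD(2)[OF assms(1)] circle_probD(2)[OF assms(2)]
  show ?thesis unfolding circle_act_def 
    apply (subst nn_integral_distr)
      apply measurable
    apply (subst B.nn_integral_fst[symmetric])
     apply (auto simp: case_prod_unfold)
    done
qed

lemma integral_act:
  fixes f :: "real^2 \<Rightarrow> real"
  assumes "SL2_law k" "circle_prob m" and [measurable]: "f \<in> borel_measurable borel" and b: "\<And>x. norm x = 1 \<Longrightarrow> \<bar>f x\<bar> \<le> B"
  shows "(\<integral>x. f x \<partial>circle_act k m) = (\<integral>g. \<integral>x. f (sgn (g *v x)) \<partial>m \<partial>k)"
    "(\<integral>x. f x \<partial>circle_act k m) = (\<integral>x. \<integral>g. f (sgn (g *v x)) \<partial>k \<partial>m)"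
proof -
  interpret A: prob_space k by (rule lawD) fact
  interpret B: prob_space m by (rule circle_probD) fact
  interpret AB: pair_prob_space k m ..
  note [measurable_cong] = lawD(2)[OF assms(1)] circle_probD(2)[OF assms(2)]
  have "\<bar>f (sgn y)\<bar> \<le> \<bar>f 0\<bar> + \<bar>B\<bar>" for y using b[of "sgn y"] by (cases "y = 0") (auto simp: norm_sgn)
  then have *: "integrable (k \<Otimes>\<^sub>M m) (\<lambda>(g,x). f (sgn (g *v x)))"
    by (intro AB.P.integrable_const_bound[where B="\<bar>f 0\<bar> + \<bar>B\<bar>"]) (auto simp: case_prod_unfold)
  have e: "(\<integral>x. f x \<partial>circle_act k m) = (\<integral>z. (case z of (g,x) \<Rightarrow> f (sgn (g *v x))) \<partial>(k \<Otimes>\<^sub>M m))"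
    unfolding circle_act_def by (subst integral_distr) (auto simp: case_prod_unfold)
  show "(\<integral>x. f x \<partial>circle_act k m) = (\<integral>g. \<integral>x. f (sgn (g *v x)) \<partial>m \<partial>k)"
    unfolding e using AB.integral_fst'[OF *] by simp
  show "(\<integral>x. f x \<partial>circle_act k m) = (\<integral>x. \<integral>g. f (sgn (g *v x)) \<partial>k \<partial>m)"
    unfolding e using AB.integral_snd[OF *] by simp
qed

lemma prob_act: assumes "SL2_law k" "circle_prob m" shows "prob_space (circle_act k m)"
proof -
  interpret A: prob_space k by (rule lawD) fact
  interpret B: prob_space m by (rule circle_probD) fact
  interpret AB: pair_prob_space k m ..
  note [measurable_cong] = lawD(2)[OF assms(1)] circle_probD(2)[OF assms(2)]
  show ?thesis unfolding circle_act_def by (rule AB.prob_space_distr) measurable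
qed

text \<open>Dominated convergence along sequences.\<close>

lemma cont_on_integral:
  fixes F :: "'a \<Rightarrow> real^2 \<Rightarrow> real"
  assumes "AE g in M. continuous_on S (F g)" "AE g in M. \<forall>x\<in>S. \<bar>F g x\<bar> \<le> w g" "integrable M w" 
    "\<And>x. x \<in> S \<Longrightarrow> (\<lambda>g. F g x) \<in> borel_measurable M"
  shows "continuous_on S (\<lambda>x. \<integral>g. F g x \<partial>M)"
  unfolding continuous_on_sequentially o_def
proof (intro allI ballI impI, elim conjE)
  fix u a assume u: "a \<in> S" "\<forall>n. u n \<in> S" "u \<longlonglongrightarrow> a"
  show "(\<lambda>n. \<integral>g. F g (u n) \<partial>M) \<longlonglongrightarrow> (\<integral>g. F g a \<partial>M)"
  proof (rule integral_dominated_convergence)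
    show "AE g in M. (\<lambda>n. F g (u n)) \<longlonglongrightarrow> F g a" using assms(1)
      by (rule eventually_mono) (use u in \<open>auto simp: continuous_on_sequentially o_def\<close>)
    show "AE g in M. norm (F g (u n)) \<le> w g" for n using assms(2)
      by (rule eventually_mono) (use u in auto)
  qed (use assms u in auto)
qed

lemma sphere_bound:
  assumes c: "continuous_on (sphere 0 1) (f::real^2\<Rightarrow>real)" shows "\<exists>B. \<forall>x. norm x = 1 \<longrightarrow> \<bar>f x\<bar> \<le> B"
proof -
  have "bounded (f ` sphere 0 1)" by (intro compact_imp_bounded compact_continuous_image c) simp
  then obtain B where "\<forall>y \<in> f ` sphere 0 1. norm y \<le> B" by (auto simp: bounded_iff)
  then show ?thesis by (intro exI[of _ B]) auto
qed

context SL2_walk begin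

lemma cont_sgn_mv: "det (g::real^2^2) = 1 \<Longrightarrow> continuous_on (sphere 0 1) (\<lambda>x. sgn (g *v x))"
  by (intro continuous_on_sgn ballI det1_unit_nz linear_continuous_on matrix_vector_mul_bounded_linear) auto

lemma transfer_continuous:
  assumes [measurable]: "f \<in> borel_measurable borel" and c: "continuous_on (sphere 0 1) (f::real^2\<Rightarrow>real)"
  shows "continuous_on (sphere 0 1) (\<lambda>x. \<integral>g. f (sgn (g *v x)) \<partial>\<kappa>)"
proof -
  interpret prob_space \<kappa> using SL2_law SL2_law_def by blast
  obtain B where B: "\<And>x. norm x = 1 \<Longrightarrow> \<bar>f x\<bar> \<le> B" using sphere_bound[OF c] by auto
  show ?thesis
  proof (rule cont_on_integral[where w="\<lambda>_. B"])
    show "AE g in \<kappa>. continuous_on (sphere 0 1) (\<lambda>x. f (sgn (g *v x)))"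
      using lawD(3)[OF SL2_law]
      by (rule eventually_mono) (intro continuous_on_compose2[OF c cont_sgn_mv], use det1_sgn in auto)
    show "AE g in \<kappa>. \<forall>x\<in>sphere 0 1. \<bar>f (sgn (g *v x))\<bar> \<le> B"
      using lawD(3)[OF SL2_law]
      by (rule eventually_mono) (use det1_sgn B in auto)
  qed auto
qed

lemma cont_drift: "continuous_on (sphere 0 1) (drift n)"
  unfolding drift_def
proof (rule cont_on_integral[where w="\<lambda>g. ln (norm g)"])
  show "AE g in K n. continuous_on (sphere 0 1) (\<lambda>x. ln (norm (g *v x)))"
    using AE_det_K
    by (rule eventually_mono) (intro continuous_on_ln continuous_on_norm linear_continuous_on matrix_vector_mul_bounded_linear,
       use det1_unit_nz in auto)
  show "AE g in K n. \<forall>x\<in>sphere 0 1. \<bar>ln (norm (g *v x))\<bar> \<le> ln (norm g)"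
    using AE_det_K by (rule eventually_mono) (use ln_mv_bound in auto)
qed (auto simp: int_ln_norm)

text \<open>The Markov property of the direction of the walk: the last step is separated from the first \<open>n\<close>.\<close>

lemma transfer_Suc:
  assumes [measurable]: "f \<in> borel_measurable borel" and B: "\<And>y. norm y = 1 \<Longrightarrow> \<bar>f y\<bar> \<le> (B::real)" and x: "norm x = 1"
  shows "(\<integral>g. f (sgn (g *v x)) \<partial>K (Suc n)) = (\<integral>h. (\<integral>g. f (sgn (g *v sgn (h *v x))) \<partial>\<kappa>) \<partial>K n)"
proof -
  interpret prob_space "K (Suc n)" by (rule prob_K)
  interpret k: prob_space \<kappa> using SL2_law SL2_law_def by blast
  have "AE g in K (Suc n). \<bar>f (sgn (g *v x))\<bar> \<le> B" using AE_det_K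
    by (rule eventually_mono) (use det1_sgn[OF _ x] B in auto)
  then have "integrable (K (Suc n)) (\<lambda>g. f (sgn (g *v x)))"
    by (intro integrable_const_bound[where B=B]) (auto simp del: mconv_pow.simps)
  then have "(\<integral>g. f (sgn (g *v x)) \<partial>K (Suc n)) = (\<integral>h. (\<integral>g. f (sgn ((g ** h) *v x)) \<partial>\<kappa>) \<partial>K n)"
    using integral_mconv(2)[OF SL2_law lawK, of n "\<lambda>g. f (sgn (g *v x))"] by simp
  also have "\<dots> = (\<integral>h. (\<integral>g. f (sgn (g *v sgn (h *v x))) \<partial>\<kappa>) \<partial>K n)"
  proof (rule integral_cong_AE)
    show "AE h in K n. (\<integral>g. f (sgn ((g ** h) *v x)) \<partial>\<kappa>) = (\<integral>g. f (sgn (g *v sgn (h *v x))) \<partial>\<kappa>)"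
      using AE_det_K by (rule eventually_mono) (use det1_unit_nz[OF _ x] in \<open>simp add: sgn_mv_sgn matrix_vector_mul_assoc\<close>)
  qed measurable
  finally show ?thesis .
qed

lemma drift_0: "norm x = 1 \<Longrightarrow> drift 0 x = 0"
  by (simp add: drift_def integral_return)

text \<open>The measures \<open>m n\<close> are the averages of the laws of the directions of \<open>S\<^sub>k x\<^sub>n\<close> over
\<open>k < n\<close>. A step of the walk changes such an average by \<open>O(1/n)\<close>, so limits are stationary; by the cocycle
relation the mean drift of \<open>m n\<close> telescopes to \<open>drift n x\<^sub>n / n\<close>, so it is nonpositive in the limit.\<close>

theorem stationary_exists:
  assumes x: "\<And>n. norm (x n) = 1" and d: "\<And>n. n \<ge> 1 \<Longrightarrow> drift n (x n) \<le> 1"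
  shows "\<exists>\<nu>. circle_prob \<nu> \<and> circle_act \<kappa> \<nu> = \<nu> \<and> (\<integral>x. drift 1 x \<partial>\<nu>) \<le> 0"
proof -
  define N where "N n k = distr (K k) borel (\<lambda>g. sgn (g *v x n))" for n k
  define m where "m n = measure_pmf (pmf_of_set {..<Suc n}) \<bind> N (Suc n)" for n
  have pN: "prob_space (N n k)" for n k unfolding N_def by (rule prob_space.prob_space_distr[OF prob_K]) measurable
  have sN: "sets (N n k) = sets borel" for n k by (simp add: N_def)
  have kern: "N n \<in> measurable (measure_pmf (pmf_of_set {..<Suc j})) (subprob_algebra borel)" for n j
    by (subst measurable_cong_sets[OF sets_measure_pmf_count_space refl])
       (auto simp: measurable_count_space_eq1 space_subprob_algebra sN prob_space_imp_subprob_space[OF pN])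
  have sm: "sets (m n) = sets borel" for n unfolding m_def by (rule sets_bind[OF sN]) auto
  have pm: "prob_space (m n)" for n
    unfolding m_def by (rule measure_pmf.prob_space_bind[OF _ kern]) (simp add: pN)
  have nm: "AE y in m n. norm y = 1" for n
  proof -
    have "AE y in N (Suc n) k. norm y = 1" for k unfolding N_def
      by (subst AE_distr_iff) (use AE_det_K[of k] det1_sgn[OF _ x] in \<open>auto elim!: eventually_mono\<close>)
    then show ?thesis unfolding m_def
      by (subst AE_bind[OF kern]) auto
  qed
  have cm: "circle_prob (m n)" for n by (simp add: circle_prob_def sm pm nm)
  have im: "(\<integral>y. f y \<partial>m n) = (\<Sum>k<Suc n. \<integral>g. f (sgn (g *v x (Suc n))) \<partial>K k) / Suc n"
    if [measurable]: "f \<in> borel_measurable borel" and B: "\<And>y. norm y = 1 \<Longrightarrow> \<bar>f y\<bar> \<le> (B::real)" for f B n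
  proof -
    define f' where "f' y = (if norm y = 1 then f y else 0)" for y
    have [measurable]: "f' \<in> borel_measurable borel" unfolding f'_def by measurable
    have "(\<integral>y. f y \<partial>m n) = (\<integral>y. f' y \<partial>m n)"
      using nm[of n] by (intro integral_cong_AE) (auto simp: f'_def measurable_cong_sets[OF sm refl])
    also have "\<dots> = (\<integral>k. (\<integral>y. f' y \<partial>N (Suc n) k) \<partial>measure_pmf (pmf_of_set {..<Suc n}))"
      unfolding m_def
    proof (rule integral_bind[OF _ _ kern])
      show "\<bar>f' y\<bar> \<le> \<bar>B\<bar>" for y using B[of y] by (auto simp: f'_def)
      show "AE k in measure_pmf (pmf_of_set {..<Suc n}). emeasure (N (Suc n) k) (space (N (Suc n) k)) \<le> ennreal 1"
        using prob_space.emeasure_space_1[OF pN] by simp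
    qed (auto intro: measure_pmf.finite_measure)
    also have "\<dots> = (\<Sum>k<Suc n. \<integral>y. f' y \<partial>N (Suc n) k) / Suc n"
      by (subst integral_pmf_of_set) (auto simp: sum_divide_distrib)
    also have "(\<Sum>k<Suc n. \<integral>y. f' y \<partial>N (Suc n) k) = (\<Sum>k<Suc n. \<integral>g. f (sgn (g *v x (Suc n))) \<partial>K k)"
    proof (rule sum.cong[OF refl])
      fix k
      have "(\<integral>y. f' y \<partial>N (Suc n) k) = (\<integral>g. f' (sgn (g *v x (Suc n))) \<partial>K k)"
        unfolding N_def by (subst integral_distr) auto
      also have "\<dots> = (\<integral>g. f (sgn (g *v x (Suc n))) \<partial>K k)"
        by (rule integral_cong_AE) (use AE_det_K[of k] det1_sgn[OF _ x] in \<open>auto elim!: eventually_mono simp: f'_def\<close>)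
      finally show "(\<integral>y. f' y \<partial>N (Suc n) k) = (\<integral>g. f (sgn (g *v x (Suc n))) \<partial>K k)" .
    qed
    finally show ?thesis .
  qed
  from circle_compact[of m, OF cm] obtain r \<nu> where r: "strict_mono (r::nat\<Rightarrow>nat)" and \<nu>: "circle_prob \<nu>" and
    mconv: "\<And>f::real^2\<Rightarrow>real. f \<in> borel_measurable borel \<Longrightarrow> continuous_on (sphere 0 1) f \<Longrightarrow>
       (\<lambda>n. \<integral>x. f x \<partial>m (r n)) \<longlonglongrightarrow> (\<integral>x. f x \<partial>\<nu>)" by blast
  have inv: "(\<lambda>n. c / real (Suc (r n))) \<longlonglongrightarrow> 0" for c :: real
  proof -
    have "(\<lambda>n. c / real (Suc n)) \<longlonglongrightarrow> 0" using lim_inverse_n'[THEN LIMSEQ_Suc, THEN tendsto_mult_left[of _ _ _ c]]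
      by simp
    from LIMSEQ_subseq_LIMSEQ[OF this r] show ?thesis by (simp add: o_def)
  qed
  have "circle_act \<kappa> \<nu> = \<nu>"
  proof (rule closed_cts_measure_eqI)
    show "prob_space (circle_act \<kappa> \<nu>)" by (rule prob_act[OF SL2_law \<nu>])
    show "prob_space \<nu>" "sets \<nu> = sets borel" using \<nu> circle_probD by auto
    show "sets (circle_act \<kappa> \<nu>) = sets borel" by (simp add: circle_act_def)
    fix f :: "real^2 \<Rightarrow> real" assume c: "continuous_on UNIV f" and b: "\<And>x. \<bar>f x\<bar> \<le> 1"
    interpret k: prob_space \<kappa> using SL2_law SL2_law_def by blast
    have fm [measurable]: "f \<in> borel_measurable borel" by (rule borel_measurable_continuous_onI[OF c])
    define Pf where "Pf y = (\<integral>g. f (sgn (g *v y)) \<partial>\<kappa>)" for y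
    have Pm [measurable]: "Pf \<in> borel_measurable borel" unfolding Pf_def by measurable
    have c1: "continuous_on (sphere 0 1) f" using c continuous_on_subset by blast
    have c2: "continuous_on (sphere 0 1) Pf" unfolding Pf_def by (rule transfer_continuous[OF fm c1])
    have bP: "\<bar>Pf y\<bar> \<le> 1" for y unfolding Pf_def
      by (rule order_trans[OF integral_abs_bound], rule k.integral_le_const)
        (auto intro!: integrable_abs k.integrable_const_bound[where B=1] b)
    have "(\<lambda>n. (\<integral>y. Pf y \<partial>m (r n)) - (\<integral>y. f y \<partial>m (r n))) \<longlonglongrightarrow> (\<integral>y. Pf y \<partial>\<nu>) - (\<integral>y. f y \<partial>\<nu>)"
      by (intro tendsto_diff mconv fm Pm c1 c2)
    moreover have "(\<lambda>n. (\<integral>y. Pf y \<partial>m (r n)) - (\<integral>y. f y \<partial>m (r n))) \<longlonglongrightarrow> 0"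
    proof (rule tendsto_rabs_zero_cancel, rule tendsto_sandwich[OF _ _ tendsto_const inv[of 2]])
      have "\<bar>(\<integral>y. Pf y \<partial>m n) - (\<integral>y. f y \<partial>m n)\<bar> \<le> 2 / Suc n" for n
      proof -
        define T where "T k = (\<integral>g. f (sgn (g *v x (Suc n))) \<partial>K k)" for k
        have "(\<integral>g. Pf (sgn (g *v x (Suc n))) \<partial>K k) = T (Suc k)" for k
          unfolding T_def Pf_def by (rule transfer_Suc[symmetric, OF fm b x])
        then have "(\<integral>y. Pf y \<partial>m n) - (\<integral>y. f y \<partial>m n) = ((\<Sum>k<Suc n. T (Suc k)) - (\<Sum>k<Suc n. T k)) / Suc n"
          using im[OF Pm bP, of n] im[OF fm b, of n] by (simp add: T_def diff_divide_distrib)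
        also have "(\<Sum>k<Suc n. T (Suc k)) - (\<Sum>k<Suc n. T k) = T (Suc n) - T 0"
          by (simp only: sum_subtractf[symmetric] sum_lessThan_telescope)
        finally have e: "(\<integral>y. Pf y \<partial>m n) - (\<integral>y. f y \<partial>m n) = (T (Suc n) - T 0) / Suc n" .
        have "\<bar>T k\<bar> \<le> 1" for k
        proof -
          interpret prob_space "K k" by (rule prob_K)
          show ?thesis unfolding T_def
            by (rule order_trans[OF integral_abs_bound], rule integral_le_const)
              (auto intro!: integrable_abs integrable_const_bound[where B=1] b)
        qed
        from this[of "Suc n"] this[of 0] have "\<bar>T (Suc n) - T 0\<bar> \<le> 2" by linarith
        then show ?thesis unfolding e by (simp add: divide_right_mono)
      qed
      then show "\<forall>\<^sub>F n in sequentially. \<bar>(\<integral>y. Pf y \<partial>m (r n)) - (\<integral>y. f y \<partial>m (r n))\<bar> \<le> 2 / real (Suc (r n))"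
        by auto
    qed auto
    ultimately have "(\<integral>y. Pf y \<partial>\<nu>) = (\<integral>y. f y \<partial>\<nu>)" using LIMSEQ_unique by fastforce
    moreover have "(\<integral>y. f y \<partial>circle_act \<kappa> \<nu>) = (\<integral>y. Pf y \<partial>\<nu>)"
      unfolding Pf_def by (rule integral_act(2)[OF SL2_law \<nu> fm b])
    ultimately show "(\<integral>y. f y \<partial>circle_act \<kappa> \<nu>) = (\<integral>y. f y \<partial>\<nu>)" by simp
  qed
  moreover have "(\<integral>y. drift 1 y \<partial>\<nu>) \<le> 0"
  proof (rule tendsto_le[OF _ inv[of 1] mconv])
    show "\<forall>\<^sub>F n in sequentially. (\<integral>y. drift 1 y \<partial>m (r n)) \<le> 1 / real (Suc (r n))"
    proof (intro always_eventually allI)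
      fix j
      define n where "n = r j"
      have tele: "(\<Sum>k<j. \<integral>g. drift 1 (sgn (g *v y)) \<partial>K k) = drift j y" if y: "norm y = 1" for j y
      proof (induction j)
        case (Suc j)
        then show ?case using drift_add(1)[OF y, of 1 j] by simp
      qed (simp add: drift_0 y)
      have "(\<integral>y. drift 1 y \<partial>m n) = drift (Suc n) (x (Suc n)) / Suc n"
        using im[where f="drift 1" and n=n, OF drift_measurable drift_bound] by (simp only: tele[OF x])
      also have "\<dots> \<le> 1 / Suc n" using d[of "Suc n"] by (intro divide_right_mono) auto
      finally show "(\<integral>y. drift 1 y \<partial>m (r j)) \<le> 1 / real (Suc (r j))" by (simp add: n_def)
    qed
  qed (auto intro: cont_drift)
  ultimately show ?thesis using \<nu> by blast
qed

end

section \<open>Absence of atoms on lines\<close>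

text \<open>Multiplication by the adjugate matrix, which is the inverse when the determinant is one, without the division.\<close>

definition adjugate_mv :: "real^2^2 \<Rightarrow> real^2 \<Rightarrow> real^2" where
  "adjugate_mv g y = vector [g$2$2 * y$1 - g$1$2 * y$2, g$1$1 * y$2 - g$2$1 * y$1]"

lemma adjv_nth [simp]: "adjugate_mv g y $ 1 = g$2$2 * y$1 - g$1$2 * y$2" "adjugate_mv g y $ 2 = g$1$1 * y$2 - g$2$1 * y$1"
  by (auto simp: adjugate_mv_def)

lemma wedge_adjv: "wedge (g *v x) y = wedge x (adjugate_mv g y)"
  by (simp add: wedge_def mv_nth algebra_simps)

lemma mv_adjv: "g *v adjugate_mv g y = det g *\<^sub>R y"
  by (rule vec2_eqI) (simp_all add: mv_nth det_2 algebra_simps)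

lemma adjv_measurable [measurable]: "(\<lambda>g. adjugate_mv g y) \<in> borel_measurable borel"
  by (rule borel_vec2I) simp_all

lemma wedge_sym0: "wedge x y = 0 \<Longrightarrow> wedge y x = 0"
  by (simp add: wedge_def mult.commute)

lemma parallel_trans: "wedge x y = 0 \<Longrightarrow> wedge y z = 0 \<Longrightarrow> y \<noteq> 0 \<Longrightarrow> wedge x z = 0"
proof -
  assume a: "wedge x y = 0" "wedge y z = 0" "y \<noteq> 0"
  then have "y$1 \<noteq> 0 \<or> y$2 \<noteq> 0" by (metis vec2_eqI zero_index)
  moreover have "y$1 * wedge x z = x$1 * wedge y z + z$1 * wedge x y" "y$2 * wedge x z = x$2 * wedge y z + z$2 * wedge x y"
    unfolding wedge_def by (auto simp: algebra_simps)
  ultimately show ?thesis using a by auto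
qed

lemma SL2_simps: "A \<in> carrier SL2 \<longleftrightarrow> det A = 1" "A \<otimes>\<^bsub>SL2\<^esub> B = A ** B" "\<one>\<^bsub>SL2\<^esub> = mat 1"
  by (auto simp: SL2_def)

lemma subgroup_SL2I:
  assumes "H \<subseteq> {A. det A = 1}" "mat 1 \<in> H" "\<And>g h. g \<in> H \<Longrightarrow> h \<in> H \<Longrightarrow> g ** h \<in> H"
    "\<And>g h. g \<in> H \<Longrightarrow> det h = 1 \<Longrightarrow> g ** h = mat 1 \<Longrightarrow> h ** g = mat 1 \<Longrightarrow> h \<in> H"
  shows "subgroup H SL2"
proof (rule group.subgroupI[OF group_SL2])
  interpret group SL2 by (rule group_SL2)
  show "H \<subseteq> carrier SL2" "H \<noteq> {}" using assms by (auto simp: SL2_simps)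
  fix g assume g: "g \<in> H"
  then have c: "g \<in> carrier SL2" using assms(1) by (auto simp: SL2_simps)
  show "inv\<^bsub>SL2\<^esub> g \<in> H" using r_inv[OF c] l_inv[OF c] inv_closed[OF c]
    by (intro assms(4)[OF g]) (auto simp: SL2_simps)
qed (use assms in \<open>auto simp: SL2_simps\<close>)

lemma linear_entry: "bounded_linear (\<lambda>h. (h::real^2^2)$i$j)"
  using bounded_linear_compose[OF bounded_linear_vec_nth[of j] bounded_linear_vec_nth[of i]] .

lemma real_polynomial_entry [intro]: "real_polynomial_function (\<lambda>h. (h::real^2^2)$i$j)"
  by (intro real_polynomial_function.intros(1) linear_entry)

lemma real_polynomial_wedge: "real_polynomial_function (\<lambda>h::real^2^2. wedge (h *v x) y)"
  unfolding wedge_def mv_nth by (intro real_polynomial_function.intros real_polynomial_function_diff real_polynomial_entry)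

text \<open>The matrices that map the finite set of lines through \<open>F\<close> onto itself form a subgroup, and the
condition on \<open>h\<close> is polynomial: for each \<open>y\<close> the product of the \<open>hz \<and> y\<close> over \<open>z\<close> in \<open>F\<close>
vanishes. This subvariety is proper, as some rotation moves a given line away from all the lines of \<open>F\<close>.\<close>

lemma (in SL2_walk) no_finite_lines:
  assumes F: "finite F" "F \<noteq> {}" "\<And>y. y \<in> F \<Longrightarrow> y \<noteq> 0" 
    and np: "\<And>y z. y \<in> F \<Longrightarrow> z \<in> F \<Longrightarrow> wedge y z = 0 \<Longrightarrow> y = z"
    and ae: "AE g in \<kappa>. \<forall>y\<in>F. \<exists>z\<in>F. wedge (g *v z) y = 0"
  shows False
proof -
  define V where "V = {h. det (h::real^2^2) = 1 \<and> (\<forall>y\<in>F. \<exists>z\<in>F. wedge (h *v z) y = 0)}"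
  have "algebraic_subvariety V" unfolding algebraic_subvariety_def
  proof (intro exI conjI ballI)
    show "V = {A \<in> carrier SL2. \<forall>P\<in>(\<lambda>y h. \<Prod>z\<in>F. wedge (h *v z) y) ` F. P A = 0}"
      unfolding V_def using F(1) by (auto simp: SL2_simps)
    fix P assume "P \<in> (\<lambda>y h. \<Prod>z\<in>F. wedge (h *v z) y) ` F"
    then show "real_polynomial_function P" using F(1) by (auto intro!: real_polynomial_function_prod real_polynomial_wedge)
  qed
  moreover have "subgroup V SL2"
  proof (rule subgroup_SL2I)
    show "mat 1 \<in> V" by (auto simp: V_def intro!: bexI)
    show "g ** h \<in> V" if gh: "g \<in> V" "h \<in> V" for g h
    proof -
      have "\<exists>z\<in>F. wedge ((g ** h) *v z) y = 0" if y: "y \<in> F" for y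
      proof -
        obtain z where z: "z \<in> F" "wedge (g *v z) y = 0" using gh y by (auto simp: V_def)
        obtain u where u: "u \<in> F" "wedge (h *v u) z = 0" using gh z by (auto simp: V_def)
        have "wedge (g *v (h *v u)) (g *v z) = 0" using u by (simp add: wedge_mv)
        then have "wedge (g *v (h *v u)) y = 0" 
          using parallel_trans[OF _ z(2)] det1_mv_nz[of g z] F(3)[OF z(1)] gh by (auto simp: V_def)
        then show ?thesis using u by (auto simp: matrix_vector_mul_assoc)
      qed
      then show ?thesis using gh by (auto simp: V_def det_mul)
    qed
    show "h \<in> V" if g: "g \<in> V" "det h = 1" "g ** h = mat 1" "h ** g = mat 1" for g h
    proof -
      have "\<forall>y\<in>F. \<exists>z\<in>F. wedge (g *v z) y = 0" using g by (auto simp: V_def)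
      then obtain s where s: "\<And>y. y \<in> F \<Longrightarrow> s y \<in> F \<and> wedge (g *v s y) y = 0" by metis
      have "inj_on s F"
      proof (rule inj_onI)
        fix y z assume yz: "y \<in> F" "z \<in> F" "s y = s z"
        have "g *v s y \<noteq> 0" using det1_mv_nz[of g] F(3) s yz g by (auto simp: V_def)
        then show "y = z" using parallel_trans[of y "g *v s y" z] s[OF yz(1)] s[OF yz(2)] yz np wedge_sym0 by metis
      qed
      then have "s ` F = F" using s F(1) endo_inj_surj[of F s] by blast
      have "\<exists>z\<in>F. wedge (h *v z) y = 0" if "y \<in> F" for y
      proof -
        have "y \<in> s ` F" by (simp only: \<open>s ` F = F\<close> that)
        then obtain z where z: "z \<in> F" "y = s z" by (rule imageE)
        have "wedge (g *v y) z = 0" unfolding z(2) using s[OF z(1)] by (rule conjunct2)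
        then have "wedge (h *v (g *v y)) (h *v z) = 0" by (simp only: wedge_mv mult_zero_right)
        moreover have "h *v (g *v y) = y" using g(4) by (simp add: matrix_vector_mul_assoc)
        ultimately have "wedge (h *v z) y = 0" using wedge_sym0 by metis
        then show ?thesis using z by auto
      qed
      then show ?thesis using g by (auto simp: V_def)
    qed
  qed (auto simp: V_def)
  moreover have "AE g in \<kappa>. g \<in> V" using ae lawD(3)[OF SL2_law] by (auto simp: V_def)
  ultimately have V: "V = carrier SL2" by (rule nonel)
  obtain y where y: "y \<in> F" using F by auto
  have "finite ((\<lambda>z. - wedge z y / wedge (quarter_turn z) y) ` F)" using F by simp
  then obtain t where t: "t \<notin> (\<lambda>z. - wedge z y / wedge (quarter_turn z) y) ` F" using ex_new_if_finite infinite_UNIV_char_0 by blast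
  \<comment> \<open>Rotations parametrised by the tangent \<open>t\<close> of the angle: each pair of lines excludes at most one \<open>t\<close>.\<close>
  define w where "w = 1 / sqrt (1 + t^2)"
  have pos: "1 + t^2 > 0" by (smt (verit) zero_le_power2)
  have w: "w > 0" "w^2 * (1 + t^2) = 1" using pos by (auto simp: w_def power_divide)
  define h :: "real^2^2" where "h = vector [vector [w, - (w * t)], vector [w * t, w]]"
  have hm: "h *v z = w *\<^sub>R (z + t *\<^sub>R quarter_turn z)" for z
    by (rule vec2_eqI) (simp_all add: mv_nth h_def algebra_simps)
  have "det h = 1" using w by (simp add: det_2 h_def power2_eq_square algebra_simps)
  then have "h \<in> V" using V by (simp add: SL2_simps)
  then obtain z where z: "z \<in> F" "wedge (h *v z) y = 0" using y by (auto simp: V_def)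
  then have e: "wedge z y + t * wedge (quarter_turn z) y = 0" using w
    by (simp add: hm) (simp add: wedge_def algebra_simps)
  show False
  proof (cases "wedge (quarter_turn z) y = 0")
    case True
    then have "wedge z y = 0" using e by simp
    then have "y = z" using np[OF z(1) y] by simp
    then have "wedge (quarter_turn z) z = 0" using True by simp
    then show False using F(3)[OF z(1)] wedge_quarter_turn[of z] wedge_sym0[of "quarter_turn z" z] by auto
  next
    case False
    then have "t = - wedge z y / wedge (quarter_turn z) y" using e by (simp add: field_simps)
    then show False using t z by auto
  qed
qed

text \<open>The mass \<open>q y\<close> of the line through \<open>y\<close> is the mean of its values at \<open>g\<^sup>-\<^sup>1 y\<close>, by
stationarity. Only finitely many lines have mass at least a given positive number, so the maximum of \<open>q\<close> is attained, on a
finite set of lines; at a maximum the mean value property forces \<open>q (g\<^sup>-\<^sup>1 y)\<close> to be maximal for almost every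
\<open>g\<close>, so this finite set is invariant.\<close>

lemma (in SL2_walk) no_atoms:
  assumes \<nu>: "circle_prob \<nu>" and st: "circle_act \<kappa> \<nu> = \<nu>" and y: "y \<noteq> 0"
  shows "measure \<nu> {x. wedge x y = 0} = 0"
proof (rule ccontr)
  interpret N: prob_space \<nu> using \<nu> circle_probD by blast
  interpret k: prob_space \<kappa> using SL2_law SL2_law_def by blast
  note [measurable_cong] = circle_probD(2)[OF \<nu>]
  have [simp]: "space \<nu> = UNIV" by (rule circle_probD(4)[OF \<nu>])
  have ls [measurable]: "{x. wedge x y = 0} \<in> sets borel" for y
    using measurable_sets[of "\<lambda>x. wedge x y" borel borel "{0}"] by (auto simp: vimage_def)
  have ln [measurable]: "{x. wedge x y = 0} \<in> sets \<nu>" for y by (simp add: circle_probD(2)[OF \<nu>])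
  define q where "q y = N.prob {x. wedge x y = 0}" for y
  assume "\<not> ?thesis"
  then have a0: "q y > 0" using N.prob_space by (simp add: q_def zero_less_measure_iff)
  define a where "a = q y"
  have qpar: "q u = q v" if "wedge u v = 0" "u \<noteq> 0" "v \<noteq> 0" for u v
  proof -
    have "{x. wedge x u = 0} = {x. wedge x v = 0}"
      using parallel_trans[of _ u v] parallel_trans[of _ v u] that wedge_sym0[of u v] by auto
    then show ?thesis by (simp add: q_def)
  qed
  \<comment> \<open>Sets of representatives of distinct lines of mass at least \<open>a\<close>; one of maximal size meets all such lines.\<close>
  define ok where "ok Y \<longleftrightarrow> finite Y \<and> (\<forall>u\<in>Y. u \<noteq> 0 \<and> q u \<ge> a) \<and> (\<forall>u\<in>Y. \<forall>v\<in>Y. wedge u v = 0 \<longrightarrow> u = v)" for Y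
  have card: "real (card Y) * a \<le> 1" if Y: "ok Y" for Y
  proof -
    have fY: "finite Y" using Y by (simp add: ok_def)
    have "real (card Y) * a = (\<Sum>u\<in>Y. a)" by simp
    also have "\<dots> \<le> (\<Sum>u\<in>Y. N.prob {x. wedge x u = 0})" using Y by (intro sum_mono) (auto simp: ok_def q_def)
    also have "\<dots> = (\<Sum>u\<in>Y. N.prob ({x. wedge x u = 0} - {0}))"
    proof (rule sum.cong[OF refl], rule N.finite_measure_eq_AE)
      show "AE x in \<nu>. (x \<in> {x. wedge x u = 0}) = (x \<in> {x. wedge x u = 0} - {0})" for u
        using circle_probD(3)[OF \<nu>] by (rule eventually_mono) auto
      show "{x. wedge x u = 0} - {0} \<in> N.events" for u using ln by (simp add: circle_probD(2)[OF \<nu>])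
    qed (rule ln)
    also have "\<dots> = N.prob (\<Union>u\<in>Y. {x. wedge x u = 0} - {0})"
    proof (rule N.finite_measure_finite_Union[symmetric, OF fY])
      show "disjoint_family_on (\<lambda>u. {x. wedge x u = 0} - {0}) Y"
        unfolding disjoint_family_on_def
      proof (intro ballI impI)
        fix u v assume uv: "u \<in> Y" "v \<in> Y" "u \<noteq> v"
        show "({x. wedge x u = 0} - {0}) \<inter> ({x. wedge x v = 0} - {0}) = {}"
          using parallel_trans[of u _ v] uv Y wedge_sym0[of _ u] unfolding ok_def by blast
      qed
    qed (auto simp: circle_probD(2)[OF \<nu>])
    also have "\<dots> \<le> 1" by simp
    finally show ?thesis .
  qed
  have "ok {y}" using y by (auto simp: ok_def a_def)
  moreover have "\<forall>Y. ok Y \<longrightarrow> card Y < Suc (nat \<lceil>1 / a\<rceil>)"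
  proof (intro allI impI)
    fix Y assume "ok Y"
    then have "real (card Y) \<le> 1 / a" using card[of Y] a0 by (simp add: a_def field_simps)
    then show "card Y < Suc (nat \<lceil>1 / a\<rceil>)" by linarith
  qed
  ultimately obtain Y where Y: "ok Y" "\<And>Z. ok Z \<Longrightarrow> card Z \<le> card Y"
    using ex_has_greatest_nat[of ok "{y}" card] by blast
  have fY: "finite Y" using Y by (simp add: ok_def)
  have par: "\<exists>v\<in>Y. wedge u v = 0" if u: "u \<noteq> 0" "q u \<ge> a" for u
  proof (rule ccontr)
    assume n: "\<not> ?thesis"
    then have "u \<notin> Y" by auto
    moreover have "ok (insert u Y)" using n Y u wedge_sym0[of _ u] unfolding ok_def by (metis finite_insert insert_iff)
    ultimately show False using Y(2)[of "insert u Y"] fY by simp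
  qed
  have ne: "Y \<noteq> {}" using par[of y] y by (auto simp: a_def)
  define m where "m = Max (q ` Y)"
  have Y0: "u \<noteq> 0" "q u \<ge> a" if "u \<in> Y" for u using Y(1) that by (auto simp: ok_def)
  have Yinj: "u = v" if "u \<in> Y" "v \<in> Y" "wedge u v = 0" for u v using Y(1) that by (auto simp: ok_def)
  have Mx: "q v \<le> m" if "v \<in> Y" for v unfolding m_def using fY that by (intro Max_ge) auto
  obtain v0 where "v0 \<in> Y" using ne by blast
  then have am: "a \<le> m" using Y0(2)[of v0] Mx[of v0] by linarith
  have qm: "q u \<le> m" if u: "u \<noteq> 0" for u
  proof (cases "q u \<ge> a")
    case True
    then obtain v where v: "v \<in> Y" "wedge u v = 0" using par u by auto
    then have "q u = q v" using Y0 u by (intro qpar) 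
    also have "\<dots> \<le> m" by (rule Mx[OF v(1)])
    finally show ?thesis .
  qed (use am in auto)
  define F where "F = {u \<in> Y. q u = m}"
  have "m \<in> q ` Y" unfolding m_def using fY ne by (intro Max_in) auto
  then have Fne: "F \<noteq> {}" by (auto simp: F_def)
  have inv: "AE g in \<kappa>. q (adjugate_mv g u) = m" if u: "u \<in> F" for u
  proof -
    have u0: "u \<noteq> 0" using u Y0 by (auto simp: F_def)
    have qmeas: "(\<lambda>g. q (adjugate_mv g u)) \<in> borel_measurable \<kappa>"
    proof -
      have "(\<lambda>g. N.prob {x. wedge (g *v x) u = 0}) \<in> borel_measurable \<kappa>"
      proof -
        have "(\<lambda>g. \<integral>x. indicat_real {0} (wedge (g *v x) u) \<partial>\<nu>) \<in> borel_measurable \<kappa>" by measurable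
        moreover have "(\<integral>x. indicat_real {0} (wedge (g *v x) u) \<partial>\<nu>) = N.prob {x. wedge (g *v x) u = 0}" for g
        proof -
          have "(\<integral>x. indicat_real {0} (wedge (g *v x) u) \<partial>\<nu>) = (\<integral>x. indicat_real {x. wedge (g *v x) u = 0} x \<partial>\<nu>)"
            by (rule Bochner_Integration.integral_cong) (auto simp: indicator_def)
          then show ?thesis by simp
        qed
        ultimately show ?thesis by simp
      qed
      then show ?thesis by (simp add: q_def wedge_adjv)
    qed
    have qb: "q v \<le> 1" "0 \<le> q v" for v by (auto simp: q_def)
    have i: "integrable \<kappa> (\<lambda>g. q (adjugate_mv g u))"
      using qb by (intro k.integrable_const_bound[where B=1] qmeas) auto
    have "m = q u" using u by (simp add: F_def)
    also have "\<dots> = (\<integral>x. indicat_real {0} (wedge x u) \<partial>\<nu>)"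
    proof -
      have "(\<integral>x. indicat_real {0} (wedge x u) \<partial>\<nu>) = (\<integral>x. indicat_real {x. wedge x u = 0} x \<partial>\<nu>)"
        by (rule Bochner_Integration.integral_cong) (auto simp: indicator_def)
      then show ?thesis by (simp add: q_def)
    qed
    also have "\<dots> = (\<integral>g. \<integral>x. indicat_real {0} (wedge (sgn (g *v x)) u) \<partial>\<nu> \<partial>\<kappa>)"
      using integral_act(1)[OF SL2_law \<nu>, of "\<lambda>x. indicat_real {0} (wedge x u)" 1] st by (simp add: indicator_def)
    also have "\<dots> = (\<integral>g. q (adjugate_mv g u) \<partial>\<kappa>)"
    proof (rule Bochner_Integration.integral_cong[OF refl])
      fix g
      have "wedge (sgn v) u = 0 \<longleftrightarrow> wedge v u = 0" for v by (cases "v = 0") (auto simp: sgn_div_norm)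
      then have "(\<integral>x. indicat_real {0} (wedge (sgn (g *v x)) u) \<partial>\<nu>) = (\<integral>x. indicat_real {x. wedge x (adjugate_mv g u) = 0} x \<partial>\<nu>)"
        by (intro Bochner_Integration.integral_cong) (auto simp: indicator_def wedge_adjv)
      then show "(\<integral>x. indicat_real {0} (wedge (sgn (g *v x)) u) \<partial>\<nu>) = q (adjugate_mv g u)" by (simp add: q_def)
    qed
    finally have "(\<integral>g. m - q (adjugate_mv g u) \<partial>\<kappa>) = 0" using i k.prob_space
      by (subst Bochner_Integration.integral_diff) auto
    moreover have "AE g in \<kappa>. 0 \<le> m - q (adjugate_mv g u)" using lawD(3)[OF SL2_law]
    proof (rule eventually_mono)
      fix g :: "real^2^2" assume "det g = 1"
      then have "adjugate_mv g u \<noteq> 0" using mv_adjv[of g u] u0 by auto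
      then show "0 \<le> m - q (adjugate_mv g u)" using qm by simp
    qed
    ultimately have "AE g in \<kappa>. m - q (adjugate_mv g u) = 0"
      using i by (subst integral_nonneg_eq_0_iff_AE[symmetric]) auto
    then show ?thesis by (rule eventually_mono) simp
  qed
  have fF: "finite F" using fY by (simp add: F_def)
  have "AE g in \<kappa>. \<forall>u\<in>F. q (adjugate_mv g u) = m" using inv fF by (subst AE_finite_all) auto
  then have "AE g in \<kappa>. \<forall>y\<in>F. \<exists>z\<in>F. wedge (g *v z) y = 0" using lawD(3)[OF SL2_law]
  proof eventually_elim
    case (elim g)
    show ?case
    proof
      fix u assume u: "u \<in> F"
      then have u0: "u \<noteq> 0" using Y0 by (auto simp: F_def)
      have nz: "adjugate_mv g u \<noteq> 0" using mv_adjv[of g u] u0 elim by auto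
      obtain v where v: "v \<in> Y" "wedge (adjugate_mv g u) v = 0" using par[OF nz] elim u am by auto
      then have "q v = m" using qpar[OF v(2) nz Y0(1)[OF v(1)]] elim u by simp
      then have "v \<in> F" using v by (simp add: F_def)
      moreover have "wedge (g *v v) u = 0" using wedge_sym0[OF v(2)] by (simp add: wedge_adjv)
      ultimately show "\<exists>z\<in>F. wedge (g *v z) u = 0" by auto
    qed
  qed
  from no_finite_lines[OF fF Fne _ _ this] show False using Y0 Yinj by (auto simp: F_def)
qed

section \<open>Logarithmic energy of a stationary measure\<close>

text \<open>With \<open>w = |x \<and> y|\<^sup>2\<close> and \<open>N = |gx|\<^sup>2 |gy|\<^sup>2\<close>, the quotient of the two arguments lies between 1
and \<open>N\<close>. It bounds the change of the truncated kernel uniformly in the truncation \<open>e\<close>.\<close>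

lemma energy_ratio_bound:
  fixes e w N :: real
  assumes e: "0 < e" "e < 1" and w: "0 \<le> w" and N: "0 < N"
  shows "\<bar>ln (e + (1 - e) * w) - ln (e + (1 - e) * (w / N))\<bar> \<le> \<bar>ln N\<bar>"
proof -
  define A where "A = e + (1 - e) * w"
  define B where "B = e + (1 - e) * (w / N)"
  have A: "A > 0" unfolding A_def using e w by (intro add_pos_nonneg mult_nonneg_nonneg) auto
  have B: "B > 0" unfolding B_def using e w N by (intro add_pos_nonneg mult_nonneg_nonneg) auto
  have NB: "N * B = N * e + (1 - e) * w" unfolding B_def using N by (simp add: field_simps)
  have lN: "ln (N * B) = ln N + ln B" using N B by (rule ln_mult_pos)
  have "\<bar>ln A - ln B\<bar> \<le> \<bar>ln N\<bar>"
  proof (cases "N \<ge> 1")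
    case True
    have "1 * e \<le> N * e" using True e by (intro mult_right_mono) auto
    then have "A \<le> N * B" unfolding NB A_def by simp
    then have 1: "ln A \<le> ln N + ln B" using A B lN by (metis ln_mono)
    have "w / N \<le> w / 1" using True w by (intro divide_left_mono) auto
    then have "B \<le> A" unfolding A_def B_def using e by (intro add_left_mono mult_left_mono) auto
    then have "ln B \<le> ln A" using B by (intro ln_mono) auto
    with 1 show ?thesis by linarith
  next
    case False
    have "N * e \<le> 1 * e" using False e by (intro mult_right_mono) auto
    then have "N * B \<le> A" unfolding NB A_def by simp
    then have 1: "ln N + ln B \<le> ln A" using A B N lN by (metis ln_mono mult_pos_pos)
    have "w / 1 \<le> w / N" using False w N by (intro divide_left_mono) auto
    then have "A \<le> B" unfolding A_def B_def using e by (intro add_left_mono mult_left_mono) auto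
    then have "ln A \<le> ln B" using A by (intro ln_mono) auto
    with 1 show ?thesis by linarith
  qed
  then show ?thesis by (simp add: A_def B_def)
qed

lemma borel_mv_const [measurable]: "(*v) (g::real^2^2) \<in> borel_measurable borel"
  using borel_mv[of "\<lambda>_. g" borel "\<lambda>x. x"] by simp

lemma integral_pair_prod:
  fixes a b :: "'a \<Rightarrow> real"
  assumes "prob_space m" and [measurable]: "a \<in> borel_measurable m" "b \<in> borel_measurable m"
    and A: "AE x in m. \<bar>a x\<bar> \<le> 1" "AE x in m. \<bar>b x\<bar> \<le> 1"
  shows "(\<integral>z. a (fst z) * b (snd z) \<partial>(m \<Otimes>\<^sub>M m)) = (\<integral>x. a x \<partial>m) * (\<integral>x. b x \<partial>m)"
proof -
  interpret m: prob_space m by fact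
  interpret pair_prob_space m m ..
  have ia: "integrable m a" "integrable m b" using A by (auto intro!: m.integrable_const_bound[where B=1])
  have "AE z in m \<Otimes>\<^sub>M m. \<bar>a (fst z) * b (snd z)\<bar> \<le> 1"
  proof (rule AE_pair_measure)
    show "AE x in m. AE y in m. \<bar>a (fst (x,y)) * b (snd (x,y))\<bar> \<le> 1" using A(1)
    proof (rule eventually_mono)
      fix x assume x: "\<bar>a x\<bar> \<le> 1"
      show "AE y in m. \<bar>a (fst (x,y)) * b (snd (x,y))\<bar> \<le> 1" using A(2)
        by (rule eventually_mono) (use x in \<open>auto simp: abs_mult intro!: mult_le_one\<close>)
    qed
  qed measurable
  then have i: "integrable (m \<Otimes>\<^sub>M m) (\<lambda>z. a (fst z) * b (snd z))"
    by (intro P.integrable_const_bound[where B=1]) auto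
  have "(\<integral>z. a (fst z) * b (snd z) \<partial>(m \<Otimes>\<^sub>M m)) = (\<integral>x. \<integral>y. a x * b y \<partial>m \<partial>m)"
    using integral_fst'[of "\<lambda>z. a (fst z) * b (snd z)"] i by simp
  then show ?thesis using ia by simp
qed

text \<open>Both parts come from the variance \<open>\<integral> (f - c)\<^sup>2\<close> with \<open>c\<close> the mean of \<open>f\<close>.\<close>

lemma square_integral_le:
  fixes f :: "'a \<Rightarrow> real"
  assumes "prob_space m" and i: "integrable m f" "integrable m (\<lambda>x. (f x)\<^sup>2)"
  shows "(\<integral>x. f x \<partial>m)\<^sup>2 \<le> (\<integral>x. (f x)\<^sup>2 \<partial>m)" 
    "(\<integral>x. (f x)\<^sup>2 \<partial>m) \<le> (\<integral>x. f x \<partial>m)\<^sup>2 \<Longrightarrow> AE x in m. f x = (\<integral>x. f x \<partial>m)"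
proof -
  interpret m: prob_space m by fact
  define c where "c = (\<integral>x. f x \<partial>m)"
  have e: "(f x - c)\<^sup>2 = (f x)\<^sup>2 - 2 * c * f x + c\<^sup>2" for x by (simp add: power2_diff)
  have i2: "integrable m (\<lambda>x. (f x - c)\<^sup>2)" unfolding e using i by auto
  have v: "(\<integral>x. (f x - c)\<^sup>2 \<partial>m) = (\<integral>x. (f x)\<^sup>2 \<partial>m) - c\<^sup>2"
    unfolding e using i by (simp add: m.prob_space c_def[symmetric] power2_eq_square)
  have "0 \<le> (\<integral>x. (f x - c)\<^sup>2 \<partial>m)" by (intro integral_nonneg_AE) auto
  then show "(\<integral>x. f x \<partial>m)\<^sup>2 \<le> (\<integral>x. (f x)\<^sup>2 \<partial>m)" unfolding c_def[symmetric] using v by linarith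
  assume "(\<integral>x. (f x)\<^sup>2 \<partial>m) \<le> (\<integral>x. f x \<partial>m)\<^sup>2"
  then have "(\<integral>x. (f x - c)\<^sup>2 \<partial>m) = 0" using v \<open>0 \<le> (\<integral>x. (f x - c)\<^sup>2 \<partial>m)\<close> by (simp add: c_def)
  then have "AE x in m. (f x - c)\<^sup>2 = 0" using i2 by (subst (asm) integral_nonneg_eq_0_iff_AE) auto
  then show "AE x in m. f x = (\<integral>x. f x \<partial>m)" by (auto simp: c_def)
qed

lemma unit_nth_le: "norm (x::real^2) \<le> 1 \<Longrightarrow> \<bar>x$i\<bar> \<le> 1"
  using component_le_norm_cart[of x i] by linarith

lemma norm_sgn_le: "norm (sgn (x::real^2)) \<le> 1" by (simp add: norm_sgn)

text \<open>A law together with a stationary measure that charges no line. The law will be any convolution power of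
the step law.\<close>

locale stationary_pair =
  fixes k :: "(real^2^2) measure" and \<nu> :: "(real^2) measure"
  assumes lawk: "SL2_law k" and nu: "circle_prob \<nu>" and st: "circle_act k \<nu> = \<nu>"
    and il: "integrable k (\<lambda>g. ln (norm g))"
    and no_line_atoms: "\<And>y. y \<noteq> 0 \<Longrightarrow> measure \<nu> {x. wedge x y = 0} = 0"
begin

sublocale k: prob_space k by (rule lawD(1)[OF lawk])
sublocale N: prob_space \<nu> by (rule circle_probD(1)[OF nu])
sublocale NN: pair_prob_space \<nu> \<nu> ..
sublocale T: pair_prob_space k "\<nu> \<Otimes>\<^sub>M \<nu>" ..

lemma sets_k [measurable_cong, simp]: "sets k = sets borel" by (rule lawD(2)[OF lawk])
lemma sets_n [measurable_cong, simp]: "sets \<nu> = sets borel" by (rule circle_probD(2)[OF nu])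
lemma space_n [simp]: "space \<nu> = UNIV" by (rule circle_probD(4)[OF nu])
lemma space_k [simp]: "space k = UNIV" using sets_eq_imp_space_eq[OF sets_k] by simp

text \<open>The mean of \<open>\<langle>x, y\<rangle>\<^sup>n\<close> for two independent points of the image measure \<open>g\<nu>\<close>.
It is a sum of squares of moments of \<open>g\<nu>\<close>, which is the positivity of the kernel.\<close>

definition \<Phi> :: "nat \<Rightarrow> real^2^2 \<Rightarrow> real" where
  "\<Phi> n g = (\<integral>z. (inner (sgn (g *v fst z)) (sgn (g *v snd z))) ^ n \<partial>(\<nu> \<Otimes>\<^sub>M \<nu>))"

definition \<Phi>0 :: "nat \<Rightarrow> real" where
  "\<Phi>0 n = (\<integral>z. (inner (fst z) (snd z)) ^ n \<partial>(\<nu> \<Otimes>\<^sub>M \<nu>))"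

lemma AE_norm1: "AE x in \<nu>. norm x = 1" by (rule circle_probD(3)[OF nu])

lemma AE_NN_norm1: "AE z in \<nu> \<Otimes>\<^sub>M \<nu>. norm (fst z) = 1 \<and> norm (snd z) = 1"
proof (rule NN.AE_pair_measure)
  show "AE x in \<nu>. AE y in \<nu>. norm (fst (x, y)) = 1 \<and> norm (snd (x, y)) = 1"
    using AE_norm1 by (rule eventually_mono) (use AE_norm1 in \<open>auto elim!: eventually_mono\<close>)
qed measurable

definition bin_monomial :: "nat \<Rightarrow> nat \<Rightarrow> real^2 \<Rightarrow> real" where
  "bin_monomial n j x = (x$1)^j * (x$2)^(n-j)"

lemma bin_monomial_measurable [measurable]: "bin_monomial n j \<in> borel_measurable borel"
  unfolding bin_monomial_def by measurable

lemma bin_monomial_bound: "norm x \<le> 1 \<Longrightarrow> \<bar>bin_monomial n j x\<bar> \<le> 1"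
  unfolding bin_monomial_def abs_mult power_abs by (intro mult_le_one power_le_one) (auto intro: unit_nth_le)

text \<open>The binomial formula writes \<open>\<langle>x, y\<rangle>\<^sup>n\<close> as a combination with positive coefficients
of products of a function of \<open>x\<close> and the same function of \<open>y\<close>.\<close>

lemma inner_power: "(inner x y)^n = (\<Sum>j\<le>n. real (n choose j) * (bin_monomial n j x * bin_monomial n j y))"
  unfolding inner2 binomial_ring bin_monomial_def
  by (intro sum.cong) (auto simp: power_mult_distrib)

lemma \<Phi>_sum: "\<Phi> n g = (\<Sum>j\<le>n. real (n choose j) * (\<integral>x. bin_monomial n j (sgn (g *v x)) \<partial>\<nu>)\<^sup>2)"
proof -
  have b: "AE x in \<nu>. \<bar>bin_monomial n j (sgn (g *v x))\<bar> \<le> 1" for j using bin_monomial_bound norm_sgn_le by auto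
  have "\<Phi> n g = (\<Sum>j\<le>n. \<integral>z. real (n choose j) * (bin_monomial n j (sgn (g *v fst z)) * bin_monomial n j (sgn (g *v snd z))) \<partial>(\<nu> \<Otimes>\<^sub>M \<nu>))"
    unfolding \<Phi>_def inner_power
    by (intro Bochner_Integration.integral_sum NN.P.integrable_const_bound[where B="real (n choose j)" for j] AE_I2)
      (auto simp: abs_mult intro!: mult_left_le mult_le_one bin_monomial_bound norm_sgn_le)
  also have "\<dots> = (\<Sum>j\<le>n. real (n choose j) * (\<integral>x. bin_monomial n j (sgn (g *v x)) \<partial>\<nu>)\<^sup>2)"
  proof (rule sum.cong[OF refl])
    fix j
    show "(\<integral>z. real (n choose j) * (bin_monomial n j (sgn (g *v fst z)) * bin_monomial n j (sgn (g *v snd z))) \<partial>(\<nu> \<Otimes>\<^sub>M \<nu>)) = 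
       real (n choose j) * (\<integral>x. bin_monomial n j (sgn (g *v x)) \<partial>\<nu>)\<^sup>2"
      using integral_pair_prod[OF N.prob_space_axioms _ _ b b, of j j] by (simp add: power2_eq_square)
  qed
  finally show ?thesis .
qed

lemma \<Phi>0_sum: "\<Phi>0 n = (\<Sum>j\<le>n. real (n choose j) * (\<integral>x. bin_monomial n j x \<partial>\<nu>)\<^sup>2)"
proof -
  have "\<Phi>0 n = \<Phi> n (mat 1)" unfolding \<Phi>_def \<Phi>0_def
    by (intro integral_cong_AE; (measurable)?) (rule eventually_mono[OF AE_NN_norm1], simp add: sgn_div_norm)
  moreover have "(\<integral>x. bin_monomial n j (sgn (mat 1 *v x)) \<partial>\<nu>) = (\<integral>x. bin_monomial n j x \<partial>\<nu>)" for j
    by (intro integral_cong_AE; (measurable)?) (rule eventually_mono[OF AE_norm1], simp add: sgn_div_norm)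
  ultimately show ?thesis by (simp add: \<Phi>_sum)
qed

lemma bin_monomial_stat: "(\<integral>x. bin_monomial n j x \<partial>\<nu>) = (\<integral>g. (\<integral>x. bin_monomial n j (sgn (g *v x)) \<partial>\<nu>) \<partial>k)"
  using integral_act(1)[OF lawk nu, of "bin_monomial n j" 1] st bin_monomial_bound by simp

lemma bin_monomial_abs: "\<bar>\<integral>x. bin_monomial n j (sgn (g *v x)) \<partial>\<nu>\<bar> \<le> 1"
  by (rule order_trans[OF integral_abs_bound], rule N.integral_le_const)
    (auto intro!: integrable_abs N.integrable_const_bound[where B=1] bin_monomial_bound norm_sgn_le)

lemma bin_monomial_integrable: "integrable k (\<lambda>g. (\<integral>x. bin_monomial n j (sgn (g *v x)) \<partial>\<nu>))" 
    "integrable k (\<lambda>g. (\<integral>x. bin_monomial n j (sgn (g *v x)) \<partial>\<nu>)\<^sup>2)"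
proof -
  have "\<bar>\<integral>x. bin_monomial n j (sgn (g *v x)) \<partial>\<nu>\<bar>^2 \<le> 1" for g using bin_monomial_abs by (intro power_le_one) auto
  then show "integrable k (\<lambda>g. (\<integral>x. bin_monomial n j (sgn (g *v x)) \<partial>\<nu>)\<^sup>2)"
    by (intro k.integrable_const_bound[where B=1]) auto
qed (auto intro!: k.integrable_const_bound[where B=1] bin_monomial_abs)

lemma \<Phi>_measurable [measurable]: "\<Phi> n \<in> borel_measurable borel"
  unfolding \<Phi>_def by measurable

lemma \<Phi>_integral: "(\<integral>g. \<Phi> n g \<partial>k) = (\<Sum>j\<le>n. real (n choose j) * (\<integral>g. (\<integral>x. bin_monomial n j (sgn (g *v x)) \<partial>\<nu>)\<^sup>2 \<partial>k))"
  unfolding \<Phi>_sum using bin_monomial_integrable by (subst Bochner_Integration.integral_sum) auto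

text \<open>The moments of \<open>\<nu>\<close> are the means of the moments of \<open>g\<nu>\<close> by stationarity, and the square of a mean
is at most the mean of the squares.\<close>

lemma \<Phi>_ge: "\<Phi>0 n \<le> (\<integral>g. \<Phi> n g \<partial>k)"
  unfolding \<Phi>_integral \<Phi>0_sum bin_monomial_stat
  by (intro sum_mono mult_left_mono square_integral_le(1) k.prob_space_axioms bin_monomial_integrable) auto

text \<open>Equality in the sum forces equality in each Jensen inequality, so every moment of degree \<open>n\<close> of \<open>g\<nu>\<close>
is almost surely constant.\<close>

lemma \<Phi>_eq: assumes "(\<integral>g. \<Phi> n g \<partial>k) \<le> \<Phi>0 n" shows "AE g in k. \<Phi> n g = \<Phi>0 n"
proof -
  define c where "c j = real (n choose j) * (\<integral>g. (\<integral>x. bin_monomial n j (sgn (g *v x)) \<partial>\<nu>)\<^sup>2 \<partial>k)" for j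
  define d where "d j = real (n choose j) * (\<integral>x. bin_monomial n j x \<partial>\<nu>)\<^sup>2" for j
  have le: "d j \<le> c j" for j unfolding c_def d_def bin_monomial_stat
    by (intro mult_left_mono square_integral_le(1) k.prob_space_axioms bin_monomial_integrable) auto
  have s: "sum c {..n} \<le> sum d {..n}" using assms unfolding \<Phi>_integral \<Phi>0_sum c_def d_def .
  have "c j = d j" if "j \<le> n" for j
  proof (rule ccontr)
    assume "c j \<noteq> d j"
    then have "d j < c j" using le[of j] by linarith
    then have "sum d {..n} < sum c {..n}" using that
      by (intro sum_strict_mono_ex1) (auto simp: le intro!: bexI[of _ j])
    then show False using s by simp
  qed
  then have "(\<integral>g. (\<integral>x. bin_monomial n j (sgn (g *v x)) \<partial>\<nu>)\<^sup>2 \<partial>k) = (\<integral>x. bin_monomial n j x \<partial>\<nu>)\<^sup>2" if "j \<le> n" for j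
    using that by (fastforce simp: c_def d_def)
  then have "AE g in k. (\<integral>x. bin_monomial n j (sgn (g *v x)) \<partial>\<nu>) = (\<integral>x. bin_monomial n j x \<partial>\<nu>)" if "j \<le> n" for j
    using square_integral_le(2)[OF k.prob_space_axioms bin_monomial_integrable, of n j] that by (simp add: bin_monomial_stat[symmetric])
  then have "AE g in k. \<forall>j\<in>{..n}. (\<integral>x. bin_monomial n j (sgn (g *v x)) \<partial>\<nu>) = (\<integral>x. bin_monomial n j x \<partial>\<nu>)"
    by (subst AE_finite_all) auto
  then show ?thesis by (rule eventually_mono) (simp add: \<Phi>_sum \<Phi>0_sum)
qed

lemma na_NN: "AE z in \<nu> \<Otimes>\<^sub>M \<nu>. wedge (fst z) (snd z) \<noteq> 0"
proof (rule NN.AE_pair_measure)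
  show "{z \<in> space (\<nu> \<Otimes>\<^sub>M \<nu>). wedge (fst z) (snd z) \<noteq> 0} \<in> sets (\<nu> \<Otimes>\<^sub>M \<nu>)" by measurable
  show "AE x in \<nu>. AE y in \<nu>. wedge (fst (x, y)) (snd (x, y)) \<noteq> 0"
    using AE_norm1
  proof (rule eventually_mono)
    fix x :: "real^2" assume "norm x = 1"
    then have "measure \<nu> {y. wedge y x = 0} = 0" by (intro no_line_atoms) auto
    moreover have "{y. wedge y x = 0} \<in> sets \<nu>" 
      using measurable_sets[of "\<lambda>y. wedge y x" borel borel "{0}"] by (auto simp: vimage_def)
    ultimately have "AE y in \<nu>. y \<notin> {y. wedge y x = 0}" by (subst N.prob_eq_0[symmetric]) auto
    then show "AE y in \<nu>. wedge (fst (x, y)) (snd (x, y)) \<noteq> 0"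
      by (rule eventually_mono) (auto dest: wedge_sym0)
  qed
qed

abbreviation "TT \<equiv> k \<Otimes>\<^sub>M (\<nu> \<Otimes>\<^sub>M \<nu>)"

lemma AE_TT: "AE t in TT. det (fst t) = 1 \<and> norm (fst (snd t)) = 1 \<and> norm (snd (snd t)) = 1 \<and> wedge (fst (snd t)) (snd (snd t)) \<noteq> 0"
proof (rule T.AE_pair_measure)
  have 1: "det \<circ> fst \<in> borel_measurable TT" by measurable
  have 2: "(\<lambda>t. norm (fst (snd t))) \<in> borel_measurable TT" "(\<lambda>t. norm (snd (snd t))) \<in> borel_measurable TT"
    "(\<lambda>t. wedge (fst (snd t)) (snd (snd t))) \<in> borel_measurable TT" by measurable
  have "{t \<in> space TT. det (fst t) = 1 \<and> norm (fst (snd t)) = 1 \<and> norm (snd (snd t)) = 1 \<and> wedge (fst (snd t)) (snd (snd t)) \<noteq> 0}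
    = ((det \<circ> fst) -` {1} \<inter> space TT) \<inter> ((\<lambda>t. norm (fst (snd t))) -` {1} \<inter> space TT) \<inter> ((\<lambda>t. norm (snd (snd t))) -` {1} \<inter> space TT)
      \<inter> ((\<lambda>t. wedge (fst (snd t)) (snd (snd t))) -` (-{0}) \<inter> space TT)" by auto
  also have "\<dots> \<in> sets TT"
  proof -
    have a: "(det \<circ> fst) -` {1} \<inter> space TT \<in> sets TT" by (rule measurable_sets[OF 1]) simp
    have b: "(\<lambda>t. norm (fst (snd t))) -` {1} \<inter> space TT \<in> sets TT" by (rule measurable_sets[OF 2(1)]) simp
    have c: "(\<lambda>t. norm (snd (snd t))) -` {1} \<inter> space TT \<in> sets TT" by (rule measurable_sets[OF 2(2)]) simp
    have d: "(\<lambda>t. wedge (fst (snd t)) (snd (snd t))) -` (-{0}) \<inter> space TT \<in> sets TT" by (rule measurable_sets[OF 2(3)]) simp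
    show ?thesis by (rule sets.Int[OF sets.Int[OF sets.Int[OF a b] c] d])
  qed
  finally show "{t \<in> space TT. det (fst t) = 1 \<and> norm (fst (snd t)) = 1 \<and> norm (snd (snd t)) = 1 \<and> wedge (fst (snd t)) (snd (snd t)) \<noteq> 0} \<in> sets TT" .
  show "AE g in k. AE z in \<nu> \<Otimes>\<^sub>M \<nu>. det (fst (g,z)) = 1 \<and> norm (fst (snd (g,z))) = 1 \<and> norm (snd (snd (g,z))) = 1 \<and> wedge (fst (snd (g,z))) (snd (snd (g,z))) \<noteq> 0"
    using lawD(3)[OF lawk] by (rule eventually_mono) (use AE_NN_norm1 na_NN in \<open>auto elim: eventually_elim2\<close>)
qed

definition log_kernel :: "real \<Rightarrow> real \<Rightarrow> real" where "log_kernel q t = - ln (1 - q * t\<^sup>2)"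
text \<open>For \<open>q = 1 - e\<close> and unit vectors, \<open>1 - q \<langle>x, y\<rangle>\<^sup>2\<close> is
\<open>e + q |x \<and> y|\<^sup>2\<close>, so \<open>log_kernel\<close> is the kernel \<open>- 2 ln |x \<and> y|\<close> truncated at the
diagonal. The partial sums of its power series have nonnegative coefficients. The term of index 0 is 0, as division by 0 gives 0.\<close>

definition log_kernel_sum :: "real \<Rightarrow> nat \<Rightarrow> real \<Rightarrow> real" where "log_kernel_sum q n t = (\<Sum>i<n. (q * t\<^sup>2)^i / real i)"

text \<open>This is the power series of the logarithm.\<close>

lemma log_kernel_sum_lim: assumes "0 < q" "q < 1" "\<bar>t\<bar> \<le> 1" shows "(\<lambda>n. log_kernel_sum q n t) \<longlonglongrightarrow> log_kernel q t"
proof -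
  have "t\<^sup>2 \<le> 1" using assms by (simp add: abs_square_le_1)
  then have "q * t\<^sup>2 \<le> q" using assms by (simp add: mult_left_le)
  then have "q * t\<^sup>2 < 1" using assms by linarith
  moreover have "0 \<le> q * t\<^sup>2" using assms by simp
  ultimately have "\<bar>- (q * t\<^sup>2)\<bar> < 1" by linarith
  from ln_series'[OF this] have "(\<lambda>n. (q * t\<^sup>2) ^ n / real n) sums (- ln (1 - q * t\<^sup>2))"
    using sums_minus by fastforce
  then show ?thesis by (simp add: sums_def log_kernel_sum_def log_kernel_def)
qed

lemma log_kernel_sum_bound: assumes "0 < q" "q < 1" "\<bar>t\<bar> \<le> 1" shows "0 \<le> log_kernel_sum q n t" "log_kernel_sum q n t \<le> log_kernel q 1"
proof -
  show p: "0 \<le> log_kernel_sum q n t" unfolding log_kernel_sum_def using assms by (intro sum_nonneg divide_nonneg_nonneg) auto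
  have t: "t\<^sup>2 \<le> 1" using assms by (simp add: abs_square_le_1)
  have "q * t\<^sup>2 \<le> q * 1\<^sup>2" using assms t by simp
  then have "log_kernel_sum q n t \<le> log_kernel_sum q n 1" unfolding log_kernel_sum_def using assms
    by (intro sum_mono divide_right_mono power_mono) auto
  also have "\<dots> \<le> log_kernel q 1"
  proof (rule incseq_le[OF _ log_kernel_sum_lim])
    show "incseq (\<lambda>n. log_kernel_sum q n 1)" unfolding log_kernel_sum_def using assms by (intro incseq_SucI) auto
  qed (use assms in auto)
  finally show "log_kernel_sum q n t \<le> log_kernel q 1" .
qed

definition kernel_sum_gain :: "real \<Rightarrow> nat \<Rightarrow> _ \<Rightarrow> real" where
  "kernel_sum_gain q n = (\<lambda>(g::real^2^2,x,y). log_kernel_sum q n (inner (sgn (g *v x)) (sgn (g *v y))) - log_kernel_sum q n (inner x y))"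
definition kernel_gain :: "real \<Rightarrow> _ \<Rightarrow> real" where
  "kernel_gain q = (\<lambda>(g::real^2^2,x,y). log_kernel q (inner (sgn (g *v x)) (sgn (g *v y))) - log_kernel q (inner x y))"

lemma inner_le1: "norm (x::real^2) \<le> 1 \<Longrightarrow> norm y \<le> 1 \<Longrightarrow> \<bar>inner x y\<bar> \<le> 1"
  using Cauchy_Schwarz_ineq2[of x y] mult_le_one[of "norm x" "norm y"] by auto

lemma inner_power_integrals: "integrable TT (\<lambda>(g,x,y). inner (sgn (g *v x)) (sgn (g *v y)) ^ n)" 
  "integrable TT (\<lambda>(g,x,y). inner x y ^ n)"
  "(\<integral>t. (case t of (g,x,y) \<Rightarrow> inner (sgn (g *v x)) (sgn (g *v y)) ^ n) \<partial>TT) = (\<integral>g. \<Phi> n g \<partial>k)"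
  "(\<integral>t. (case t of (g,x,y) \<Rightarrow> inner x y ^ n) \<partial>TT) = \<Phi>0 n"
proof -
  show i1: "integrable TT (\<lambda>(g,x,y). inner (sgn (g *v x)) (sgn (g *v y)) ^ n)"
    by (intro T.P.integrable_const_bound[where B=1] AE_I2)
      (auto simp: case_prod_unfold power_abs intro!: power_le_one inner_le1 norm_sgn_le)
  have "AE t in TT. \<bar>inner (fst (snd t)) (snd (snd t)) ^ n\<bar> \<le> 1" using AE_TT
    by (rule eventually_mono) (auto simp: power_abs intro!: power_le_one inner_le1)
  then show i2: "integrable TT (\<lambda>(g,x,y). inner x y ^ n)"
    by (intro T.P.integrable_const_bound[where B=1]) (auto simp: case_prod_unfold)
  show "(\<integral>t. (case t of (g,x,y) \<Rightarrow> inner (sgn (g *v x)) (sgn (g *v y)) ^ n) \<partial>TT) = (\<integral>g. \<Phi> n g \<partial>k)"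
    using T.integral_fst'[OF i1] by (simp add: \<Phi>_def case_prod_unfold)
  show "(\<integral>t. (case t of (g,x,y) \<Rightarrow> inner x y ^ n) \<partial>TT) = \<Phi>0 n"
    using T.integral_fst'[OF i2] by (simp add: \<Phi>0_def case_prod_unfold k.prob_space[unfolded space_k])
qed

text \<open>Each term of the series contributes a nonnegative amount by \<open>\<Phi>_ge\<close>; only the term of
index 1 is retained.\<close>

lemma kernel_sum_gain_integral: assumes q: "0 < q" "n \<ge> 2" shows "(\<integral>t. kernel_sum_gain q n t \<partial>TT) \<ge> q * ((\<integral>g. \<Phi> 2 g \<partial>k) - \<Phi>0 2)"
proof -
  have e: "kernel_sum_gain q n = (\<lambda>t. \<Sum>i<n. q^i / real i * ((case t of (g,x,y) \<Rightarrow> inner (sgn (g *v x)) (sgn (g *v y)) ^ (2*i)) - (case t of (g,x,y) \<Rightarrow> inner x y ^ (2*i))))"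
  proof (rule ext)
    fix t :: "(real^2^2) \<times> (real^2) \<times> (real^2)"
    have "(q * u\<^sup>2)^i / real i - (q * v\<^sup>2)^i / real i = q^i / real i * (u^(2*i) - v^(2*i))" for u v i
      by (simp add: power_mult_distrib power_mult[symmetric] algebra_simps diff_divide_distrib)
    then show "kernel_sum_gain q n t = (\<Sum>i<n. q^i / real i * ((case t of (g,x,y) \<Rightarrow> inner (sgn (g *v x)) (sgn (g *v y)) ^ (2*i)) - (case t of (g,x,y) \<Rightarrow> inner x y ^ (2*i))))"
      by (simp only: kernel_sum_gain_def log_kernel_sum_def case_prod_unfold sum_subtractf[symmetric])
  qed
  have "(\<integral>t. kernel_sum_gain q n t \<partial>TT) = (\<Sum>i<n. q^i / real i * ((\<integral>g. \<Phi> (2*i) g \<partial>k) - \<Phi>0 (2*i)))"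
  proof -
    define A where "A i = (\<lambda>t. case t of (g::real^2^2,x,y) \<Rightarrow> inner (sgn (g *v x)) (sgn (g *v y)) ^ (2*i))" for i :: nat
    define B where "B i = (\<lambda>t. case t of (g::real^2^2,x::real^2,y) \<Rightarrow> inner x y ^ (2*i))" for i :: nat
    have AB: "integrable TT (A i)" "integrable TT (B i)" "integral\<^sup>L TT (A i) = (\<integral>g. \<Phi> (2*i) g \<partial>k)" "integral\<^sup>L TT (B i) = \<Phi>0 (2*i)" for i
      unfolding A_def B_def by (rule inner_power_integrals)+
    have "kernel_sum_gain q n = (\<lambda>t. \<Sum>i<n. q^i / real i * (A i t - B i t))" unfolding e A_def B_def ..
    then show ?thesis using AB by simp
  qed
  also have "\<dots> \<ge> (\<Sum>i\<in>{1}. q^i / real i * ((\<integral>g. \<Phi> (2*i) g \<partial>k) - \<Phi>0 (2*i)))"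
    using q \<Phi>_ge by (intro sum_mono2) (auto intro!: mult_nonneg_nonneg divide_nonneg_nonneg)
  finally show ?thesis by simp
qed

lemma kernel_gain_integral: assumes q: "0 < q" "q < 1" shows "(\<integral>t. kernel_gain q t \<partial>TT) \<ge> q * ((\<integral>g. \<Phi> 2 g \<partial>k) - \<Phi>0 2)"
proof -
  have m: "log_kernel q \<in> borel_measurable borel" "log_kernel_sum q n \<in> borel_measurable borel" for n
    unfolding log_kernel_def log_kernel_sum_def by measurable
  note [measurable] = m
  have lim: "(\<lambda>n. \<integral>t. kernel_sum_gain q n t \<partial>TT) \<longlonglongrightarrow> (\<integral>t. kernel_gain q t \<partial>TT)"
  proof (rule integral_dominated_convergence[where w="\<lambda>_. log_kernel q 1"])
    show "kernel_gain q \<in> borel_measurable TT" "kernel_sum_gain q n \<in> borel_measurable TT" for n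
      unfolding kernel_gain_def kernel_sum_gain_def by measurable
    show "AE t in TT. (\<lambda>n. kernel_sum_gain q n t) \<longlonglongrightarrow> kernel_gain q t" using AE_TT
      by (rule eventually_mono) (auto simp: kernel_sum_gain_def kernel_gain_def case_prod_unfold intro!: tendsto_diff log_kernel_sum_lim q inner_le1 norm_sgn_le)
    show "AE t in TT. norm (kernel_sum_gain q n t) \<le> log_kernel q 1" for n using AE_TT
    proof (rule eventually_mono)
      fix t :: "(real^2^2) \<times> (real^2) \<times> (real^2)" 
      assume "det (fst t) = 1 \<and> norm (fst (snd t)) = 1 \<and> norm (snd (snd t)) = 1 \<and> wedge (fst (snd t)) (snd (snd t)) \<noteq> 0"
      then have "\<bar>inner (fst (snd t)) (snd (snd t))\<bar> \<le> 1" by (intro inner_le1) auto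
      from log_kernel_sum_bound[OF q this, of n] log_kernel_sum_bound[OF q inner_le1[OF norm_sgn_le norm_sgn_le], of n "fst t *v fst (snd t)" "fst t *v snd (snd t)"]
      show "norm (kernel_sum_gain q n t) \<le> log_kernel q 1" by (auto simp: kernel_sum_gain_def case_prod_unfold)
    qed
  qed auto
  show ?thesis
    by (rule LIMSEQ_le_const[OF lim]) (use kernel_sum_gain_integral[OF q(1)] in blast)
qed

lemma sgn_wedge: "g *v x \<noteq> 0 \<Longrightarrow> g *v y \<noteq> 0 \<Longrightarrow> det g = 1 \<Longrightarrow> 
  wedge (sgn (g *v x)) (sgn (g *v y)) = wedge x y / (norm (g *v x) * norm (g *v y))"
  by (simp add: sgn_div_norm wedge_mv divide_inverse)

lemma unit_inner_wedge: "norm x = 1 \<Longrightarrow> norm y = 1 \<Longrightarrow> (inner x y)\<^sup>2 = 1 - (wedge x y)\<^sup>2"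
  using wedge_inner[of x y] by simp

text \<open>For unit vectors cosines become sines, and the normalised \<open>gx \<and> gy\<close> is
\<open>x \<and> y\<close> divided by the two norms.\<close>

lemma kernel_gain_form:
  assumes "det g = 1" "norm x = 1" "norm y = 1" 
  shows "kernel_gain (1 - e) (g,x,y) = ln (e + (1 - e) * (wedge x y)\<^sup>2) - ln (e + (1 - e) * ((wedge x y)\<^sup>2 / (norm (g *v x) * norm (g *v y))\<^sup>2))"
proof -
  have s: "norm (sgn (g *v x)) = 1" "norm (sgn (g *v y)) = 1" using assms det1_sgn by auto
  have nz: "g *v x \<noteq> 0" "g *v y \<noteq> 0" using det1_unit_nz assms by auto
  show ?thesis unfolding kernel_gain_def log_kernel_def prod.case unit_inner_wedge[OF s] unit_inner_wedge[OF assms(2,3)] sgn_wedge[OF nz assms(1)]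
    by (simp add: power_divide algebra_simps)
qed

lemma ln_norm_triple_integrable: "integrable TT (\<lambda>t. ln (norm (fst t)))"
proof -
  have "integrable (distr TT k fst) (\<lambda>g. ln (norm g))"
    using il T.distr_pair_fst by (metis NN.P.distr_pair_fst)
  then show ?thesis by (subst (asm) integrable_distr_eq) auto
qed

lemma ln_triple_integrable: "integrable TT (\<lambda>t. ln (norm (fst t *v fst (snd t))))" "integrable TT (\<lambda>t. ln (norm (fst t *v snd (snd t))))"
proof -
  have a: "norm (ln (norm (g *v x))) \<le> norm (ln (norm g))" if "det g = 1" "norm x = 1" for g :: "real^2^2" and x
    using ln_mv_bound[OF that] by simp
  show "integrable TT (\<lambda>t. ln (norm (fst t *v fst (snd t))))"
    by (rule Bochner_Integration.integrable_bound[OF ln_norm_triple_integrable], measurable) (rule eventually_mono[OF AE_TT], blast intro: a)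
  show "integrable TT (\<lambda>t. ln (norm (fst t *v snd (snd t))))"
    by (rule Bochner_Integration.integrable_bound[OF ln_norm_triple_integrable], measurable) (rule eventually_mono[OF AE_TT], blast intro: a)
qed

lemma ln_triple_integral: 
   "(\<integral>t. ln (norm (fst t *v fst (snd t))) \<partial>TT) = (\<integral>g. \<integral>x. ln (norm (g *v x)) \<partial>\<nu> \<partial>k)" 
   "(\<integral>t. ln (norm (fst t *v snd (snd t))) \<partial>TT) = (\<integral>g. \<integral>x. ln (norm (g *v x)) \<partial>\<nu> \<partial>k)" 
proof -
  have f: "distr (\<nu> \<Otimes>\<^sub>M \<nu>) \<nu> fst = \<nu>"
    by (simp add: N.distr_pair_fst)
  have 1: "(\<integral>z. ln (norm (g *v fst z)) \<partial>(\<nu> \<Otimes>\<^sub>M \<nu>)) = (\<integral>x. ln (norm (g *v x)) \<partial>\<nu>)" for g :: "real^2^2"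
  proof -
    have "(\<integral>z. ln (norm (g *v fst z)) \<partial>(\<nu> \<Otimes>\<^sub>M \<nu>)) = (\<integral>x. ln (norm (g *v x)) \<partial>distr (\<nu> \<Otimes>\<^sub>M \<nu>) \<nu> fst)"
      by (subst integral_distr; measurable)
    then show ?thesis by (simp only: f)
  qed
  have 2: "(\<integral>z. ln (norm (g *v snd z)) \<partial>(\<nu> \<Otimes>\<^sub>M \<nu>)) = (\<integral>z. ln (norm (g *v fst z)) \<partial>(\<nu> \<Otimes>\<^sub>M \<nu>))" for g :: "real^2^2"
  proof -
    have "(\<integral>z. ln (norm (g *v fst z)) \<partial>(\<nu> \<Otimes>\<^sub>M \<nu>)) = (\<integral>z. ln (norm (g *v fst z)) \<partial>distr (\<nu> \<Otimes>\<^sub>M \<nu>) (\<nu> \<Otimes>\<^sub>M \<nu>) (\<lambda>(x, y). (y, x)))"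
      using NN.distr_pair_swap by simp
    also have "\<dots> = (\<integral>z. ln (norm (g *v snd z)) \<partial>(\<nu> \<Otimes>\<^sub>M \<nu>))"
      by (subst integral_distr) (auto simp: case_prod_unfold)
    finally show ?thesis by simp
  qed
  show "(\<integral>t. ln (norm (fst t *v fst (snd t))) \<partial>TT) = (\<integral>g. \<integral>x. ln (norm (g *v x)) \<partial>\<nu> \<partial>k)" 
   "(\<integral>t. ln (norm (fst t *v snd (snd t))) \<partial>TT) = (\<integral>g. \<integral>x. ln (norm (g *v x)) \<partial>\<nu> \<partial>k)" 
    using T.integral_fst'[OF ln_triple_integrable(1)] T.integral_fst'[OF ln_triple_integrable(2)] by (simp_all add: 1 2)
qed

text \<open>The gain of the truncated energy under \<open>g\<close>, averaged over \<open>g\<close>, is at least the defect of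
second moments. As the truncation disappears the gain converges to \<open>2 ln |gx| + 2 ln |gy|\<close> off the diagonal, which has
measure zero because no line is charged, and \<open>4 ln |g|\<close> dominates it. The energy itself need not be finite.\<close>

theorem energy_inequality: "(\<integral>g. \<Phi> 2 g \<partial>k) - \<Phi>0 2 \<le> 4 * (\<integral>g. \<integral>x. ln (norm (g *v x)) \<partial>\<nu> \<partial>k)"
proof -
  \<comment> \<open>A truncation that tends to 0 and stays in \<open>(0, 1)\<close>.\<close>
  define e where "e n = 1 / (real n + 2)" for n
  have e: "0 < e n" "e n < 1" for n by (auto simp: e_def)
  have el: "e \<longlonglongrightarrow> 0" unfolding e_def by real_asymp
  have [measurable]: "log_kernel q \<in> borel_measurable borel" for q unfolding log_kernel_def by measurable
  define lim where "lim t = 2 * ln (norm (fst t *v fst (snd t))) + 2 * ln (norm (fst t *v snd (snd t)))" for t :: "(real^2^2) \<times> (real^2) \<times> (real^2)"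
  have "(\<lambda>n. \<integral>t. kernel_gain (1 - e n) t \<partial>TT) \<longlonglongrightarrow> (\<integral>t. lim t \<partial>TT)"
  proof (rule integral_dominated_convergence[where w="\<lambda>t. 4 * ln (norm (fst t))"])
    show "lim \<in> borel_measurable TT" unfolding lim_def by measurable
    show "kernel_gain (1 - e n) \<in> borel_measurable TT" for n unfolding kernel_gain_def by measurable
    show "integrable TT (\<lambda>t. 4 * ln (norm (fst t)))" using ln_norm_triple_integrable by simp
    show "AE t in TT. (\<lambda>n. kernel_gain (1 - e n) t) \<longlonglongrightarrow> lim t" using AE_TT
    proof (rule eventually_mono)
      fix t :: "(real^2^2) \<times> (real^2) \<times> (real^2)" 
      obtain g x y where t: "t = (g,x,y)" by (cases t)
      assume "det (fst t) = 1 \<and> norm (fst (snd t)) = 1 \<and> norm (snd (snd t)) = 1 \<and> wedge (fst (snd t)) (snd (snd t)) \<noteq> 0"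
      then have a: "det g = 1" "norm x = 1" "norm y = 1" "wedge x y \<noteq> 0" by (auto simp: t)
      have nz: "g *v x \<noteq> 0" "g *v y \<noteq> 0" using det1_unit_nz a by auto
      have "(\<lambda>n. ln (e n + (1 - e n) * (wedge x y)\<^sup>2) - ln (e n + (1 - e n) * ((wedge x y)\<^sup>2 / (norm (g *v x) * norm (g *v y))\<^sup>2)))
        \<longlonglongrightarrow> ln (0 + (1 - 0) * (wedge x y)\<^sup>2) - ln (0 + (1 - 0) * ((wedge x y)\<^sup>2 / (norm (g *v x) * norm (g *v y))\<^sup>2))"
        using a nz by (intro tendsto_intros el) auto
      also have "ln (0 + (1 - 0) * (wedge x y)\<^sup>2) - ln (0 + (1 - 0) * ((wedge x y)\<^sup>2 / (norm (g *v x) * norm (g *v y))\<^sup>2)) = lim t"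
        using a nz by (simp add: lim_def t ln_div ln_mult ln_realpow)
      finally show "(\<lambda>n. kernel_gain (1 - e n) t) \<longlonglongrightarrow> lim t" unfolding t kernel_gain_form[OF a(1-3)] .
    qed
    show "AE t in TT. norm (kernel_gain (1 - e n) t) \<le> 4 * ln (norm (fst t))" for n using AE_TT
    proof (rule eventually_mono)
      fix t :: "(real^2^2) \<times> (real^2) \<times> (real^2)" 
      obtain g x y where t: "t = (g,x,y)" by (cases t)
      assume "det (fst t) = 1 \<and> norm (fst (snd t)) = 1 \<and> norm (snd (snd t)) = 1 \<and> wedge (fst (snd t)) (snd (snd t)) \<noteq> 0"
      then have a: "det g = 1" "norm x = 1" "norm y = 1" by (auto simp: t)
      have nz: "g *v x \<noteq> 0" "g *v y \<noteq> 0" using det1_unit_nz a by auto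
      have "\<bar>kernel_gain (1 - e n) t\<bar> \<le> \<bar>ln ((norm (g *v x) * norm (g *v y))\<^sup>2)\<bar>"
        unfolding t kernel_gain_form[OF a] using e[of n] nz by (intro energy_ratio_bound) auto
      also have "ln ((norm (g *v x) * norm (g *v y))\<^sup>2) = 2 * ln (norm (g *v x)) + 2 * ln (norm (g *v y))"
        using nz by (simp add: ln_mult ln_realpow)
      also have "\<bar>\<dots>\<bar> \<le> 4 * ln (norm g)" using ln_mv_bound[OF a(1) a(2)] ln_mv_bound[OF a(1) a(3)] by linarith
      finally show "norm (kernel_gain (1 - e n) t) \<le> 4 * ln (norm (fst t))" by (simp add: t)
    qed
  qed
  moreover have "(\<lambda>n. (1 - e n) * ((\<integral>g. \<Phi> 2 g \<partial>k) - \<Phi>0 2)) \<longlonglongrightarrow> (1 - 0) * ((\<integral>g. \<Phi> 2 g \<partial>k) - \<Phi>0 2)"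
    by (intro tendsto_intros el)
  ultimately have "(1 - 0) * ((\<integral>g. \<Phi> 2 g \<partial>k) - \<Phi>0 2) \<le> (\<integral>t. lim t \<partial>TT)"
    using kernel_gain_integral e by (intro LIMSEQ_le) (auto intro!: exI[of _ 0])
  also have "(\<integral>t. lim t \<partial>TT) = 4 * (\<integral>g. \<integral>x. ln (norm (g *v x)) \<partial>\<nu> \<partial>k)"
    unfolding lim_def using ln_triple_integrable ln_triple_integral by simp
  finally show ?thesis by simp
qed

corollary energy_rigidity: "(\<integral>g. \<integral>x. ln (norm (g *v x)) \<partial>\<nu> \<partial>k) \<le> 0 \<Longrightarrow> AE g in k. \<Phi> 2 g = \<Phi>0 2"
  using energy_inequality by (intro \<Phi>_eq) linarith

end

section \<open>Positivity of the drift\<close>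

text \<open>The symmetric bilinear form with matrix entries \<open>a, b, b, c\<close>.\<close>

definition sym_form :: "real \<Rightarrow> real \<Rightarrow> real \<Rightarrow> real^2 \<Rightarrow> real^2 \<Rightarrow> real" where
  "sym_form a b c x y = a * x$1 * y$1 + b * (x$1 * y$2 + x$2 * y$1) + c * x$2 * y$2"

lemma sym_form_mv: "sym_form a b c (h *v x) (h *v x) = 
   sym_form (sym_form a b c (column 1 h) (column 1 h)) (sym_form a b c (column 1 h) (column 2 h)) (sym_form a b c (column 2 h) (column 2 h)) x x"
  by (simp add: sym_form_def mv_nth column_def algebra_simps)

lemma sym_form_det: "sym_form a b c (column 1 h) (column 1 h) * sym_form a b c (column 2 h) (column 2 h) - (sym_form a b c (column 1 h) (column 2 h))\<^sup>2
    = (a * c - b\<^sup>2) * (det h)\<^sup>2"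
  unfolding sym_form_def det_2 column_def by (simp add: power2_eq_square) algebra

text \<open>For positive definite \<open>Q, Q'\<close> of the same determinant \<open>D\<close>, the arithmetic and geometric
means of the eigenvalues of \<open>Q\<^sup>-\<^sup>1 Q'\<close> give \<open>tr (adj Q Q') \<ge> 2 D\<close>, with equality only for
\<open>Q = Q'\<close>. The proof is an explicit sum of squares.\<close>

lemma adjugate_trace_rigid:
  fixes a b c a' b' c' :: real
  assumes a: "a > 0" "a' > 0" and D: "a * c - b\<^sup>2 = D" "a' * c' - b'\<^sup>2 = D" "D > 0"
  shows "c * a' - 2 * b * b' + a * c' \<ge> 2 * D"
    "c * a' - 2 * b * b' + a * c' = 2 * D \<Longrightarrow> a' = a \<and> b' = b \<and> c' = c"
proof -
  have e: "a * a' * (c * a' - 2 * b * b' + a * c' - 2 * D) = D * (a - a')\<^sup>2 + (b * a' - b' * a)\<^sup>2"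
  proof -
    have c: "a * c = D + b\<^sup>2" "a' * c' = D + b'\<^sup>2" using D by auto
    have "a * a' * (c * a' - 2 * b * b' + a * c' - 2 * D) = (a * c) * a'\<^sup>2 - 2 * b * b' * a * a' + a\<^sup>2 * (a' * c') - 2 * D * a * a'"
      by (simp add: power2_eq_square algebra_simps)
    then show ?thesis unfolding c by (simp add: power2_eq_square algebra_simps)
  qed
  have "a * a' * (c * a' - 2 * b * b' + a * c' - 2 * D) \<ge> 0" unfolding e using D by simp
  then show "c * a' - 2 * b * b' + a * c' \<ge> 2 * D" using mult_pos_pos[OF a] by (simp add: zero_le_mult_iff)
  assume "c * a' - 2 * b * b' + a * c' = 2 * D"
  then have z: "D * (a - a')\<^sup>2 + (b * a' - b' * a)\<^sup>2 = 0" using e by simp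
  have "D * (a - a')\<^sup>2 \<ge> 0" using D by simp
  then have "D * (a - a')\<^sup>2 = 0" "(b * a' - b' * a)\<^sup>2 = 0" using z zero_le_power2[of "b * a' - b' * a"] by linarith+
  then have aa: "a' = a" and "b * a' = b' * a" using D by auto
  then have bb: "b' = b" using a by simp
  have "a * c = a * c'" using D(1) D(2)[unfolded aa bb] by linarith
  then show "a' = a \<and> b' = b \<and> c' = c" using aa bb a by simp
qed

context SL2_walk begin

text \<open>The stabiliser of a quadratic form is an algebraic subgroup, and \<open>diag (2, 1/2)\<close> is not in it.\<close>

lemma no_invariant_form:
  assumes a: "a > 0" and ae: "AE h in \<kappa>. \<forall>x. sym_form a b c (h *v x) (h *v x) = sym_form a b c x x"
  shows False
proof -
  define V where "V = {h. det (h::real^2^2) = 1 \<and> (\<forall>x. sym_form a b c (h *v x) (h *v x) = sym_form a b c x x)}"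
  have "algebraic_subvariety V" unfolding algebraic_subvariety_def
  proof (intro exI conjI ballI)
    show "V = {A \<in> carrier SL2. \<forall>P\<in>range (\<lambda>x h. sym_form a b c (h *v x) (h *v x) - sym_form a b c x x). P A = 0}"
      unfolding V_def by (auto simp: SL2_simps)
    fix P assume "P \<in> range (\<lambda>x h. sym_form a b c ((h::real^2^2) *v x) (h *v x) - sym_form a b c x x)"
    then obtain x where "P = (\<lambda>h. sym_form a b c (h *v x) (h *v x) - sym_form a b c x x)" by auto
    then show "real_polynomial_function P"
      unfolding sym_form_def mv_nth
      by (auto intro!: real_polynomial_function_diff real_polynomial_function.intros(2-) real_polynomial_entry)
  qed
  moreover have "subgroup V SL2"
  proof (rule subgroup_SL2I)
    fix g h assume "g \<in> V" "det h = 1" "g ** h = mat 1" "h ** g = mat 1"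
    then show "h \<in> V" unfolding V_def by (auto simp: matrix_vector_mul_assoc) (metis matrix_vector_mul_assoc matrix_vector_mul_lid)
  qed (auto simp: V_def det_mul matrix_vector_mul_assoc[symmetric])
  moreover have "AE g in \<kappa>. g \<in> V" using ae lawD(3)[OF SL2_law] by (auto simp: V_def)
  ultimately have V: "V = carrier SL2" by (rule nonel)
  define h :: "real^2^2" where "h = vector [vector [2, 0], vector [0, 1/2]]"
  have "h \<in> V" unfolding V by (simp add: SL2_simps det_2 h_def)
  then have "sym_form a b c (h *v axis 1 1) (h *v axis 1 1) = sym_form a b c (axis 1 1) (axis 1 1)" by (simp add: V_def)
  then show False using a by (simp add: sym_form_def mv_nth h_def axis_def)
qed

text \<open>If the walk stayed bounded, a limit of the averages of the forms \<open>x \<mapsto> E |S\<^sub>k x|\<^sup>2\<close>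
would be a positive definite form \<open>Q\<close> equal to the mean of its images under the steps. The function
\<open>tr (adj Q h\<^sup>TQh)\<close> then has mean \<open>2 det Q\<close>, its minimum, so almost every \<open>h\<close> preserves \<open>Q\<close>.\<close>

lemma no_uniform_norm_bound: 
  assumes C: "\<And>n. AE g in K n. norm g \<le> C" 
  shows False
proof -
  define e1 e2 :: "real^2" where "e1 = axis 1 1" and "e2 = axis 2 1"
  have col: "h *v e1 = column 1 h" "h *v e2 = column 2 h" for h :: "real^2^2"
    by (auto simp: e1_def e2_def column_def mv_nth axis_def intro!: vec2_eqI)
  have C1: "C \<ge> 1"
  proof -
    interpret prob_space "K 0" by (rule prob_K)
    have "AE g in K 0. 1 \<le> C" using C[of 0] AE_det_K[of 0]
      by eventually_elim (use det1_norm_ge1 in fastforce)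
    then show ?thesis by simp
  qed
  define al where "al n = (\<integral>g. inner (g *v e1) (g *v e1) \<partial>K n)" for n
  define be where "be n = (\<integral>g. inner (g *v e1) (g *v e2) \<partial>K n)" for n
  define ga where "ga n = (\<integral>g. inner (g *v e2) (g *v e2) \<partial>K n)" for n
  have moment_le: "\<bar>inner (g *v x) (g *v y)\<bar> \<le> C\<^sup>2 * (norm x * norm y)" if "norm g \<le> C" for g :: "real^2^2" and x y
  proof -
    have "\<bar>inner (g *v x) (g *v y)\<bar> \<le> norm (g *v x) * norm (g *v y)" by (rule Cauchy_Schwarz_ineq2)
    also have "\<dots> \<le> (norm g * norm x) * (norm g * norm y)" by (intro mult_mono norm_mv_le) auto
    also have "\<dots> = (norm g)\<^sup>2 * (norm x * norm y)" by (simp add: power2_eq_square)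
    also have "\<dots> \<le> C\<^sup>2 * (norm x * norm y)" using that by (intro mult_right_mono power_mono) auto
    finally show ?thesis .
  qed
  have int: "integrable (K n) (\<lambda>g. inner (g *v x) (g *v y))" for n x y
  proof -
    interpret prob_space "K n" by (rule prob_K)
    show ?thesis by (rule integrable_const_bound[where B="C\<^sup>2 * (norm x * norm y)"])
      (rule eventually_mono[OF C[of n]], use moment_le in auto)
  qed
  have absI: "\<bar>\<integral>g. inner (g *v x) (g *v y) \<partial>K n\<bar> \<le> C\<^sup>2 * (norm x * norm y)" for n x y
  proof -
    interpret prob_space "K n" by (rule prob_K)
    show ?thesis by (rule order_trans[OF integral_abs_bound], rule integral_le_const)
       (use int[of n x y] in simp, rule eventually_mono[OF C[of n]], use moment_le in auto)
  qed
  have Q: "(\<integral>g. inner (g *v x) (g *v y) \<partial>K n) = sym_form (al n) (be n) (ga n) x y" for n x y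
  proof -
    have "inner (g *v x) (g *v y) = x$1 * y$1 * inner (g *v e1) (g *v e1) + (x$1 * y$2 + x$2 * y$1) * inner (g *v e1) (g *v e2)
         + x$2 * y$2 * inner (g *v e2) (g *v e2)" for g :: "real^2^2"
      by (simp add: inner2 mv_nth e1_def e2_def axis_def algebra_simps)
    then show ?thesis using int by (simp add: al_def be_def ga_def sym_form_def algebra_simps)
  qed
  have rec: "(\<integral>g. inner (g *v x) (g *v y) \<partial>K (Suc n)) = (\<integral>h. sym_form (al n) (be n) (ga n) (h *v x) (h *v y) \<partial>\<kappa>)" for n x y
  proof -
    have "K (Suc n) = mconv (K n) \<kappa>" by (rule mconv_pow_Suc'[OF SL2_law])
    then have "(\<integral>g. inner (g *v x) (g *v y) \<partial>K (Suc n)) = (\<integral>h. \<integral>g. inner ((g ** h) *v x) ((g ** h) *v y) \<partial>K n \<partial>\<kappa>)"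
      using integral_mconv(2)[OF lawK SL2_law, of n "\<lambda>g. inner (g *v x) (g *v y)"] int[of "Suc n" x y] by simp
    then show ?thesis by (simp add: matrix_vector_mul_assoc[symmetric] Q)
  qed
  define t where "t i j p q = (\<integral>h. ((h::real^2^2) $ i $ j) * (h $ p $ q) \<partial>\<kappa>)" for i j p q
  have intt: "integrable \<kappa> (\<lambda>h. (h $ i $ j) * (h $ p $ q))" for i j p q
  proof -
    interpret prob_space \<kappa> using SL2_law SL2_law_def by blast
    have "AE h in \<kappa>. norm h \<le> C" using C[of "Suc 0"] by (simp only: K1)
    then have "AE h in \<kappa>. norm ((h $ i $ j) * (h $ p $ q)) \<le> C * C"
      by (rule eventually_mono) (use C1 in \<open>auto simp: abs_mult intro!: mult_mono order_trans[OF entry_le]\<close>)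
    then show ?thesis by (intro integrable_const_bound[where B="C * C"]) auto
  qed
  have T: "(\<integral>h. sym_form a b c (h *v x) (h *v y) \<partial>\<kappa>) = 
     a * (x$1 * y$1 * t 1 1 1 1 + x$1 * y$2 * t 1 1 1 2 + x$2 * y$1 * t 1 2 1 1 + x$2 * y$2 * t 1 2 1 2) +
     b * (x$1 * y$1 * t 1 1 2 1 + x$1 * y$2 * t 1 1 2 2 + x$2 * y$1 * t 1 2 2 1 + x$2 * y$2 * t 1 2 2 2 +
          x$1 * y$1 * t 2 1 1 1 + x$1 * y$2 * t 2 1 1 2 + x$2 * y$1 * t 2 2 1 1 + x$2 * y$2 * t 2 2 1 2) +
     c * (x$1 * y$1 * t 2 1 2 1 + x$1 * y$2 * t 2 1 2 2 + x$2 * y$1 * t 2 2 2 1 + x$2 * y$2 * t 2 2 2 2)" (is "_ = ?T a b c x y")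
    "integrable \<kappa> (\<lambda>h. sym_form a b c (h *v x) (h *v y))" for a b c x y
  proof -
    have e: "sym_form a b c (h *v x) (h *v y) = 
     a * (x$1 * y$1 * (h$1$1 * h$1$1) + x$1 * y$2 * (h$1$1 * h$1$2) + x$2 * y$1 * (h$1$2 * h$1$1) + x$2 * y$2 * (h$1$2 * h$1$2)) +
     b * (x$1 * y$1 * (h$1$1 * h$2$1) + x$1 * y$2 * (h$1$1 * h$2$2) + x$2 * y$1 * (h$1$2 * h$2$1) + x$2 * y$2 * (h$1$2 * h$2$2) +
          x$1 * y$1 * (h$2$1 * h$1$1) + x$1 * y$2 * (h$2$1 * h$1$2) + x$2 * y$1 * (h$2$2 * h$1$1) + x$2 * y$2 * (h$2$2 * h$1$2)) +
     c * (x$1 * y$1 * (h$2$1 * h$2$1) + x$1 * y$2 * (h$2$1 * h$2$2) + x$2 * y$1 * (h$2$2 * h$2$1) + x$2 * y$2 * (h$2$2 * h$2$2))" for h :: "real^2^2"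
      by (simp add: sym_form_def mv_nth algebra_simps)
    show "(\<integral>h. sym_form a b c (h *v x) (h *v y) \<partial>\<kappa>) = ?T a b c x y"
      unfolding e t_def
      by (simp only: intt Bochner_Integration.integral_add Bochner_Integration.integrable_add integrable_mult_right integral_mult_right_zero)
    show "integrable \<kappa> (\<lambda>h. sym_form a b c (h *v x) (h *v y))"
      unfolding e using intt by (intro Bochner_Integration.integrable_add integrable_mult_right) auto
  qed
  define TT where "TT a b c x y = (\<integral>h. sym_form a b c (h *v x) (h *v y) \<partial>\<kappa>)" for a b c x y
  \<comment> \<open>The averaged image of a form is linear in the form; it thus commutes with Cesaro means.\<close>
  have TTlin: "TT (\<Sum>k\<in>S. a k) (\<Sum>k\<in>S. b k) (\<Sum>k\<in>S. c k) x y = (\<Sum>k\<in>S. TT (a k) (b k) (c k) x y)" for S :: "nat set" and a b c x y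
    unfolding TT_def T by (simp add: sum.distrib sum_distrib_right)
  have TTsc: "TT (a / r) (b / r) (c / r) x y = TT a b c x y / r" for a b c r x y
    unfolding TT_def T by (simp add: add_divide_distrib)
  define av where "av u n = (\<Sum>k<Suc n. u k) / real (Suc n)" for u :: "nat \<Rightarrow> real" and n
  have qfav: "sym_form (av al n) (av be n) (av ga n) x y = av (\<lambda>k. sym_form (al k) (be k) (ga k) x y) n" for n x y
  proof -
    have "(\<Sum>k<Suc n. sym_form (al k) (be k) (ga k) x y) = sym_form (\<Sum>k<Suc n. al k) (\<Sum>k<Suc n. be k) (\<Sum>k<Suc n. ga k) x y"
      unfolding sym_form_def by (simp only: sum.distrib sum_distrib_right)
    moreover have "sym_form (A / r) (B / r) (G / r) x y = sym_form A B G x y / r" for A B G r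
      by (simp add: sym_form_def add_divide_distrib)
    ultimately show ?thesis unfolding av_def by (simp only:)
  qed
  have TTav: "TT (av al n) (av be n) (av ga n) x y = av (\<lambda>k. sym_form (al (Suc k)) (be (Suc k)) (ga (Suc k)) x y) n" for n x y
  proof -
    have "TT (al k) (be k) (ga k) x y = sym_form (al (Suc k)) (be (Suc k)) (ga (Suc k)) x y" for k
      unfolding TT_def using rec[where n=k and x=x and y=y] Q[where n="Suc k" and x=x and y=y] by (simp only:)
    then show ?thesis unfolding av_def TTsc TTlin by (simp only:)
  qed
  have qfb: "\<bar>sym_form (al n) (be n) (ga n) x y\<bar> \<le> C\<^sup>2 * (norm x * norm y)" for n x y
    using absI[where n=n and x=x and y=y] Q by simp
  have avb: "\<bar>av u n\<bar> \<le> B" if "\<And>k. \<bar>u k\<bar> \<le> B" for u B n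
  proof -
    have "\<bar>\<Sum>k<Suc n. u k\<bar> \<le> (\<Sum>k<Suc n. B)" by (rule order_trans[OF sum_abs sum_mono]) (rule that)
    also have "\<dots> = real (Suc n) * B" by simp
    finally show ?thesis unfolding av_def abs_divide by (simp add: pos_divide_le_eq mult.commute)
  qed
  have n12: "norm e1 = 1" "norm e2 = 1" by (auto simp: e1_def e2_def)
  have b3: "\<bar>al k\<bar> \<le> C\<^sup>2" "\<bar>be k\<bar> \<le> C\<^sup>2" "\<bar>ga k\<bar> \<le> C\<^sup>2" for k
    using absI[where n=k and x=e1 and y=e1] absI[where n=k and x=e1 and y=e2] absI[where n=k and x=e2 and y=e2] n12
    by (auto simp: al_def be_def ga_def)
  have "bounded (range (\<lambda>n. (av al n, av be n, av ga n)))"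
  proof -
    have "range (\<lambda>n. (av al n, av be n, av ga n)) \<subseteq> {-(C\<^sup>2)..C\<^sup>2} \<times> {-(C\<^sup>2)..C\<^sup>2} \<times> {-(C\<^sup>2)..C\<^sup>2}"
    proof -
      have "\<bar>av al n\<bar> \<le> C\<^sup>2" "\<bar>av be n\<bar> \<le> C\<^sup>2" "\<bar>av ga n\<bar> \<le> C\<^sup>2" for n
        by (rule avb, rule b3)+
      then show ?thesis by (auto simp: abs_le_iff minus_le_iff)
    qed
    then show ?thesis by (rule bounded_subset[rotated]) (intro bounded_Times bounded_closed_interval)
  qed
  from bounded_imp_convergent_subsequence[OF this] obtain l r where r: "strict_mono (r::nat\<Rightarrow>nat)" 
    and l: "((\<lambda>n. (av al n, av be n, av ga n)) \<circ> r) \<longlonglongrightarrow> l" by blast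
  obtain a b c where abc: "l = (a, b, c)" by (cases l)
  have la: "(\<lambda>n. av al (r n)) \<longlonglongrightarrow> a" and lb: "(\<lambda>n. av be (r n)) \<longlonglongrightarrow> b" and lc: "(\<lambda>n. av ga (r n)) \<longlonglongrightarrow> c"
    using tendsto_fst[OF l] tendsto_fst[OF tendsto_snd[OF l]] tendsto_snd[OF tendsto_snd[OF l]] by (auto simp: abc o_def)
  have lq: "(\<lambda>n. sym_form (av al (r n)) (av be (r n)) (av ga (r n)) x y) \<longlonglongrightarrow> sym_form a b c x y" for x y
    unfolding sym_form_def by (intro tendsto_intros la lb lc)
  have lT: "(\<lambda>n. TT (av al (r n)) (av be (r n)) (av ga (r n)) x y) \<longlonglongrightarrow> TT a b c x y" for x y
    unfolding TT_def T by (intro tendsto_intros la lb lc)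
  have inv: "(\<lambda>n. w / real (Suc (r n))) \<longlonglongrightarrow> 0" for w :: real
  proof -
    have "(\<lambda>n. w / real (Suc n)) \<longlonglongrightarrow> 0" using lim_inverse_n'[THEN LIMSEQ_Suc, THEN tendsto_mult_left[of _ _ _ w]]
      by simp
    from LIMSEQ_subseq_LIMSEQ[OF this r] show ?thesis by (simp add: o_def)
  qed
  have fixp: "TT a b c x y = sym_form a b c x y" for x y
  proof -
    define u where "u k = sym_form (al k) (be k) (ga k) x y" for k
    define B where "B = C\<^sup>2 * (norm x * norm y)"
    have "(\<lambda>n. TT (av al (r n)) (av be (r n)) (av ga (r n)) x y - sym_form (av al (r n)) (av be (r n)) (av ga (r n)) x y) \<longlonglongrightarrow> TT a b c x y - sym_form a b c x y"
      by (intro tendsto_diff lT lq)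
    moreover have "(\<lambda>n. TT (av al (r n)) (av be (r n)) (av ga (r n)) x y - sym_form (av al (r n)) (av be (r n)) (av ga (r n)) x y) \<longlonglongrightarrow> 0"
    proof (rule tendsto_rabs_zero_cancel, rule tendsto_sandwich[OF _ _ tendsto_const inv[of "2 * B"]])
      have "\<bar>av (\<lambda>k. u (Suc k)) n - av u n\<bar> \<le> 2 * B / real (Suc n)" for n
      proof -
        have "av (\<lambda>k. u (Suc k)) n - av u n = (u (Suc n) - u 0) / real (Suc n)"
          unfolding av_def by (simp only: diff_divide_distrib[symmetric] sum_subtractf[symmetric] sum_lessThan_telescope)
        moreover have "\<bar>u (Suc n) - u 0\<bar> \<le> 2 * B" using qfb[of "Suc n" x y] qfb[of 0 x y] unfolding u_def B_def by linarith
        ultimately show ?thesis by (simp add: divide_right_mono)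
      qed
      then show "\<forall>\<^sub>F n in sequentially. \<bar>TT (av al (r n)) (av be (r n)) (av ga (r n)) x y - sym_form (av al (r n)) (av be (r n)) (av ga (r n)) x y\<bar> \<le> 2 * B / real (Suc (r n))"
        unfolding TTav qfav u_def by auto
    qed auto
    ultimately show ?thesis using LIMSEQ_unique by fastforce
  qed
  have pos: "sym_form a b c x x \<ge> (norm x)\<^sup>2 / C\<^sup>2" for x
  proof (rule LIMSEQ_le_const[OF lq], intro exI allI impI)
    fix n
    have "sym_form (al k) (be k) (ga k) x x \<ge> (norm x)\<^sup>2 / C\<^sup>2" for k
    proof -
      interpret prob_space "K k" by (rule prob_K)
      have "AE g in K k. (norm x)\<^sup>2 / C\<^sup>2 \<le> inner (g *v x) (g *v x)" using C[of k] AE_det_K[of k]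
      proof eventually_elim
        case (elim g)
        have "norm x \<le> norm (g *v x) * norm g" by (rule det1_norm_mv_ge[OF elim(2)])
        also have "\<dots> \<le> norm (g *v x) * C" using elim by (intro mult_left_mono) auto
        finally have "(norm x)\<^sup>2 \<le> (norm (g *v x) * C)\<^sup>2" by (intro power_mono) auto
        then show ?case using C1 by (simp add: power_mult_distrib pos_divide_le_eq power2_norm_eq_inner)
      qed
      then show ?thesis using integral_ge_const[OF int[of k x x]] Q by simp
    qed
    then have "(\<Sum>i<Suc (r n). (norm x)\<^sup>2 / C\<^sup>2) \<le> (\<Sum>i<Suc (r n). sym_form (al i) (be i) (ga i) x x)" by (intro sum_mono)
    then show "(norm x)\<^sup>2 / C\<^sup>2 \<le> sym_form (av al (r n)) (av be (r n)) (av ga (r n)) x x"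
      unfolding qfav unfolding av_def by (simp add: pos_le_divide_eq mult.commute del: sum.lessThan_Suc)
  qed
  have ps: "sym_form a b c x x > 0" if "x \<noteq> 0" for x
    using pos[of x] that C1 by (smt (verit) divide_pos_pos zero_less_norm_iff zero_less_power)
  have "e1 \<noteq> 0" using n12(1) by (metis norm_zero zero_neq_one)
  from ps[OF this] have a0: "a > 0" by (simp add: sym_form_def e1_def axis_def)
  define D where "D = a * c - b\<^sup>2"
  have D: "D > 0"
  proof -
    define x :: "real^2" where "x = vector [- b, a]"
    have "x \<noteq> 0" using a0 by (auto simp: x_def vec_eq_iff forall_2)
    from ps[OF this] have "0 < a * D" by (simp add: sym_form_def x_def D_def power2_eq_square algebra_simps)
    then show ?thesis using a0 by (simp add: zero_less_mult_iff)
  qed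
  \<comment> \<open>The trace of the adjugate of the form times its image under \<open>h\<close>.\<close>
  define f where "f h = c * sym_form a b c (h *v e1) (h *v e1) - 2 * b * sym_form a b c (h *v e1) (h *v e2) + a * sym_form a b c (h *v e2) (h *v e2)" for h :: "real^2^2"
  have dr: "f h \<ge> 2 * D" "f h = 2 * D \<Longrightarrow> \<forall>x. sym_form a b c (h *v x) (h *v x) = sym_form a b c x x" if h: "det h = 1" for h
  proof -
    have "h *v e1 \<noteq> 0" by (rule det1_unit_nz[OF h n12(1)])
    then have p: "sym_form a b c (h *v e1) (h *v e1) > 0" by (rule ps)
    have d: "sym_form a b c (h *v e1) (h *v e1) * sym_form a b c (h *v e2) (h *v e2) - (sym_form a b c (h *v e1) (h *v e2))\<^sup>2 = D"
      unfolding col sym_form_det D_def h by simp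
    from adjugate_trace_rigid[OF a0 p D_def[symmetric] d D] 
    show "f h \<ge> 2 * D" "f h = 2 * D \<Longrightarrow> \<forall>x. sym_form a b c (h *v x) (h *v x) = sym_form a b c x x"
      unfolding f_def sym_form_mv[of a b c h] col by auto
  qed
  have fi: "integrable \<kappa> f" unfolding f_def using T(2) by auto
  have "(\<integral>h. f h \<partial>\<kappa>) = c * TT a b c e1 e1 - 2 * b * TT a b c e1 e2 + a * TT a b c e2 e2"
    unfolding f_def TT_def using T(2) by simp
  also have "\<dots> = 2 * D" unfolding fixp by (simp add: sym_form_def e1_def e2_def axis_def D_def power2_eq_square)
  finally have fI: "(\<integral>h. f h \<partial>\<kappa>) = 2 * D" .
  interpret k: prob_space \<kappa> using SL2_law SL2_law_def by blast
  have "(\<integral>h. f h - 2 * D \<partial>\<kappa>) = 0" using fi fI k.prob_space by simp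
  moreover have "AE h in \<kappa>. 0 \<le> f h - 2 * D" using lawD(3)[OF SL2_law] by (rule eventually_mono) (use dr in auto)
  ultimately have "AE h in \<kappa>. f h - 2 * D = 0" using fi by (subst integral_nonneg_eq_0_iff_AE[symmetric]) auto
  then have "AE h in \<kappa>. \<forall>x. sym_form a b c (h *v x) (h *v x) = sym_form a b c x x" using lawD(3)[OF SL2_law]
    by eventually_elim (use dr in auto)
  then show False by (rule no_invariant_form[OF a0])
qed

end

context stationary_pair begin

lemma wedge_second_moment: assumes "det g = 1" shows "(\<integral>z. (wedge (sgn (g *v fst z)) (sgn (g *v snd z)))\<^sup>2 \<partial>(\<nu> \<Otimes>\<^sub>M \<nu>)) = 1 - \<Phi> 2 g"
proof -
  have i: "integrable (\<nu> \<Otimes>\<^sub>M \<nu>) (\<lambda>z. (inner (sgn (g *v fst z)) (sgn (g *v snd z))) ^ 2)"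
    by (intro NN.P.integrable_const_bound[where B=1] AE_I2)
      (auto simp: abs_square_le_1 intro!: inner_le1 norm_sgn_le)
  have "(\<integral>z. (wedge (sgn (g *v fst z)) (sgn (g *v snd z)))\<^sup>2 \<partial>(\<nu> \<Otimes>\<^sub>M \<nu>)) 
    = (\<integral>z. 1 - (inner (sgn (g *v fst z)) (sgn (g *v snd z))) ^ 2 \<partial>(\<nu> \<Otimes>\<^sub>M \<nu>))"
    by (intro integral_cong_AE; (measurable)?) 
      (rule eventually_mono[OF AE_NN_norm1], use unit_inner_wedge det1_sgn[OF assms] in auto)
  also have "\<dots> = 1 - \<Phi> 2 g" unfolding \<Phi>_def using i NN.P.prob_space by simp
  finally show ?thesis .
qed

text \<open>Two independent points of \<open>\<nu>\<close> are almost surely not parallel.\<close>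

lemma inner_moment_less_1: "\<Phi>0 2 < 1"
proof -
  have m: "(\<lambda>z. (wedge (fst z) (snd z))\<^sup>2) \<in> borel_measurable (\<nu> \<Otimes>\<^sub>M \<nu>)" by measurable
  have i: "integrable (\<nu> \<Otimes>\<^sub>M \<nu>) (\<lambda>z. (inner (fst z) (snd z)) ^ 2)"
    by (intro NN.P.integrable_const_bound[where B=1]; (measurable)?)
       (rule eventually_mono[OF AE_NN_norm1], auto simp: abs_square_le_1 intro!: inner_le1)
  have AEeq: "AE z in \<nu> \<Otimes>\<^sub>M \<nu>. (wedge (fst z) (snd z))\<^sup>2 = 1 - (inner (fst z) (snd z)) ^ 2"
    by (rule eventually_mono[OF AE_NN_norm1]) (use unit_inner_wedge in auto)
  have i2: "integrable (\<nu> \<Otimes>\<^sub>M \<nu>) (\<lambda>z. (wedge (fst z) (snd z))\<^sup>2)"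
    using i by (subst integrable_cong_AE[OF _ _ AEeq]) auto
  have e: "(\<integral>z. (wedge (fst z) (snd z))\<^sup>2 \<partial>(\<nu> \<Otimes>\<^sub>M \<nu>)) = 1 - \<Phi>0 2"
    unfolding \<Phi>0_def using i NN.P.prob_space by (subst integral_cong_AE[OF _ _ AEeq]) auto
  have "0 \<le> (\<integral>z. (wedge (fst z) (snd z))\<^sup>2 \<partial>(\<nu> \<Otimes>\<^sub>M \<nu>))" by (rule integral_nonneg_AE) auto
  moreover have "(\<integral>z. (wedge (fst z) (snd z))\<^sup>2 \<partial>(\<nu> \<Otimes>\<^sub>M \<nu>)) \<noteq> 0"
  proof
    assume "(\<integral>z. (wedge (fst z) (snd z))\<^sup>2 \<partial>(\<nu> \<Otimes>\<^sub>M \<nu>)) = 0"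
    then have "AE z in \<nu> \<Otimes>\<^sub>M \<nu>. (wedge (fst z) (snd z))\<^sup>2 = 0" using i2 by (subst (asm) integral_nonneg_eq_0_iff_AE) auto
    then have "AE z in \<nu> \<Otimes>\<^sub>M \<nu>. False" using na_NN by eventually_elim auto
    then show False by simp
  qed
  ultimately show ?thesis using e by linarith
qed

text \<open>If \<open>g\<^sub>n\<close> tends to infinity, a limit of \<open>g\<^sub>n / |g\<^sub>n|\<close> is nonzero and
its kernel is contained in a line, which is not charged. Hence \<open>|g\<^sub>n x|\<close> tends to infinity for almost every \<open>x\<close>,
the normalised \<open>g\<^sub>n x \<and> g\<^sub>n y\<close> tends to 0, and \<open>\<Phi> 2 (g\<^sub>n)\<close> tends to 1, which is not its
prescribed value.\<close>

lemma moment_level_bounded: "\<exists>C. \<forall>g. det g = 1 \<and> \<Phi> 2 g = \<Phi>0 2 \<longrightarrow> norm g \<le> C"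
proof (rule ccontr)
  assume "\<not> ?thesis"
  then have "\<forall>n::nat. \<exists>g. det g = 1 \<and> \<Phi> 2 g = \<Phi>0 2 \<and> norm g > real n" by (meson not_le)
  then obtain g where g: "\<And>n. det (g n) = 1" "\<And>n. \<Phi> 2 (g n) = \<Phi>0 2" "\<And>n::nat. norm (g n) > real n" by metis
  \<comment> \<open>Since \<open>det (g n) = 1\<close>, the limit of the normalised matrices is singular; only its kernel matters.\<close>
  define A where "A n = g n /\<^sub>R norm (g n)" for n
  have gn: "norm (g n) \<ge> 1" for n using det1_norm_ge1 g by blast
  then have gn0: "g n \<noteq> 0" for n by (metis norm_zero not_one_le_zero)
  have nA: "norm (A n) = 1" for n using gn0[of n] by (simp add: A_def)
  have "bounded (range A)" using nA by (intro boundedI[of _ 1]) auto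
  from bounded_imp_convergent_subsequence[OF this] obtain B r where r: "strict_mono (r::nat\<Rightarrow>nat)" and B: "(A \<circ> r) \<longlonglongrightarrow> B" by blast
  have "norm B = 1" using tendsto_norm[OF B] nA by (simp add: o_def LIMSEQ_const_iff)
  then have "\<exists>i. B $ i \<noteq> 0" by (metis norm_zero vec_eq_iff zero_index zero_neq_one)
  then obtain i where i: "B $ i \<noteq> 0" by auto
  define y where "y = quarter_turn (B $ i)"
  have y0: "y \<noteq> 0" using i norm_quarter_turn[of "B $ i"] by (metis norm_eq_zero y_def)
  have ker: "wedge x y = 0" if "B *v x = 0" for x
  proof -
    have "(B *v x) $ i = 0" using that by simp
    then show ?thesis by (simp add: mv_nth wedge_def y_def algebra_simps)
  qed
  have AEx: "AE x in \<nu>. wedge x y \<noteq> 0"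
  proof -
    have "{x. wedge x y = 0} \<in> sets \<nu>" 
      using measurable_sets[of "\<lambda>x. wedge x y" borel borel "{0}"] by (auto simp: vimage_def)
    then have "AE x in \<nu>. x \<notin> {x. wedge x y = 0}" using no_line_atoms[OF y0] by (subst N.prob_eq_0[symmetric]) auto
    then show ?thesis by simp
  qed
  have AEz: "AE z in \<nu> \<Otimes>\<^sub>M \<nu>. wedge (fst z) y \<noteq> 0 \<and> wedge (snd z) y \<noteq> 0"
  proof (rule NN.AE_pair_measure)
    show "AE x in \<nu>. AE x' in \<nu>. wedge (fst (x, x')) y \<noteq> 0 \<and> wedge (snd (x, x')) y \<noteq> 0"
      using AEx by (rule eventually_mono) (use AEx in \<open>auto elim!: eventually_mono\<close>)
  qed measurable
  have inf: "filterlim (\<lambda>n. norm (g (r n) *v x)) at_top sequentially" if x: "wedge x y \<noteq> 0" for x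
  proof -
    have "B *v x \<noteq> 0" using ker x by auto
    have l: "(\<lambda>n. norm (A (r n) *v x)) \<longlonglongrightarrow> norm (B *v x)"
    proof -
      have "(\<lambda>n. A (r n) $ i $ j) \<longlonglongrightarrow> B $ i $ j" for i j using B by (auto simp: o_def intro!: tendsto_vec_nth)
      then have "(\<lambda>n. (norm (A (r n) *v x))\<^sup>2) \<longlonglongrightarrow> (norm (B *v x))\<^sup>2"
        unfolding norm2_sq mv_nth by (auto intro!: tendsto_power tendsto_add tendsto_mult_right tendsto_mult_left)
      from tendsto_real_sqrt[OF this] show ?thesis by simp
    qed
    have "filterlim (\<lambda>n. norm (g (r n))) at_top sequentially"
    proof (rule filterlim_at_top_mono[OF filterlim_real_sequentially], rule always_eventually, rule allI)
      fix n show "real n \<le> norm (g (r n))" using g(3)[of "r n"] seq_suble[OF r, of n] by linarith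
    qed
    from filterlim_tendsto_pos_mult_at_top[OF l _ this] \<open>B *v x \<noteq> 0\<close>
    have "filterlim (\<lambda>n. norm (A (r n) *v x) * norm (g (r n))) at_top sequentially" by simp
    moreover have "norm (A n *v x) * norm (g n) = norm (g n *v x)" for n
      using gn0[of n] by (simp add: A_def scaleR_matrix_vector_assoc[symmetric])
    ultimately show ?thesis by simp
  qed
  have "(\<lambda>n. \<integral>z. (wedge (sgn (g (r n) *v fst z)) (sgn (g (r n) *v snd z)))\<^sup>2 \<partial>(\<nu> \<Otimes>\<^sub>M \<nu>)) \<longlonglongrightarrow> (\<integral>z. 0 \<partial>(\<nu> \<Otimes>\<^sub>M \<nu>))"
  proof (rule integral_dominated_convergence[where w="\<lambda>_. 1"])
    show "AE z in \<nu> \<Otimes>\<^sub>M \<nu>. norm ((wedge (sgn (g (r n) *v fst z)) (sgn (g (r n) *v snd z)))\<^sup>2) \<le> 1" for n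
    proof (rule AE_I2)
      fix z
      have "\<bar>wedge (sgn (g (r n) *v fst z)) (sgn (g (r n) *v snd z))\<bar> \<le> 1"
        by (rule order_trans[OF wedge_le]) (intro mult_le_one norm_sgn_le norm_ge_zero)
      then show "norm ((wedge (sgn (g (r n) *v fst z)) (sgn (g (r n) *v snd z)))\<^sup>2) \<le> 1" by (simp add: abs_square_le_1)
    qed
    show "AE z in \<nu> \<Otimes>\<^sub>M \<nu>. (\<lambda>n. (wedge (sgn (g (r n) *v fst z)) (sgn (g (r n) *v snd z)))\<^sup>2) \<longlonglongrightarrow> 0"
      using AEz AE_NN_norm1
    proof eventually_elim
      case (elim z)
      have nz: "g n *v fst z \<noteq> 0" "g n *v snd z \<noteq> 0" for n using elim det1_unit_nz g(1) by auto
      have "filterlim (\<lambda>n. norm (g (r n) *v fst z) * norm (g (r n) *v snd z)) at_top sequentially"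
        using inf elim by (intro filterlim_at_top_mult_at_top) auto
      then have "(\<lambda>n. wedge (fst z) (snd z) / (norm (g (r n) *v fst z) * norm (g (r n) *v snd z))) \<longlonglongrightarrow> 0"
        by (intro real_tendsto_divide_at_top[OF tendsto_const])
      from tendsto_power[OF this, of 2] show ?case using nz g(1) by (simp add: sgn_wedge)
    qed
  qed auto
  then have "(\<lambda>n::nat. 1 - \<Phi>0 2) \<longlonglongrightarrow> 0" using wedge_second_moment g by simp
  then show False using inner_moment_less_1 by (simp add: LIMSEQ_const_iff)
qed

lemma drift_fubini: "(\<integral>x. \<integral>g. ln (norm (g *v x)) \<partial>k \<partial>\<nu>) = (\<integral>g. \<integral>x. ln (norm (g *v x)) \<partial>\<nu> \<partial>k)"
proof -
  interpret kN: pair_prob_space k \<nu> ..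
  have "integrable (distr (k \<Otimes>\<^sub>M \<nu>) k fst) (\<lambda>g. ln (norm g))"
    using il by (simp add: N.distr_pair_fst)
  then have 1: "integrable (k \<Otimes>\<^sub>M \<nu>) (\<lambda>t. ln (norm (fst t)))" by (subst (asm) integrable_distr_eq) auto
  have "AE t in k \<Otimes>\<^sub>M \<nu>. norm (ln (norm (fst t *v snd t))) \<le> norm (ln (norm (fst t)))"
  proof (rule kN.AE_pair_measure)
    show "AE g in k. AE x in \<nu>. norm (ln (norm (fst (g, x) *v snd (g, x)))) \<le> norm (ln (norm (fst (g, x))))"
      using lawD(3)[OF lawk] by (rule eventually_mono) (rule eventually_mono[OF AE_norm1], use ln_mv_bound in fastforce)
  qed measurable
  then have "integrable (k \<Otimes>\<^sub>M \<nu>) (\<lambda>t. ln (norm (fst t *v snd t)))"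
    by (intro Bochner_Integration.integrable_bound[OF 1]) auto
  then show ?thesis using kN.Fubini_integral[of "\<lambda>g x. ln (norm (g *v x))"] by (simp add: case_prod_unfold)
qed

end

context SL2_walk begin

lemma circle_act_K: assumes nu: "circle_prob \<nu>" and st: "circle_act \<kappa> \<nu> = \<nu>" shows "circle_act (K n) \<nu> = \<nu>"
proof (induction n)
  have I: "circle_act A \<nu> = \<nu>" if "\<And>f. f \<in> borel_measurable borel \<Longrightarrow> (\<integral>\<^sup>+x. f x \<partial>circle_act A \<nu>) = (\<integral>\<^sup>+x. f x \<partial>\<nu>)" for A
  proof (rule measure_eqI)
    show "sets (circle_act A \<nu>) = sets \<nu>" using circle_probD(2)[OF nu] by (simp add: circle_act_def)
    fix X assume "X \<in> sets (circle_act A \<nu>)"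
    then have X: "X \<in> sets borel" "X \<in> sets (circle_act A \<nu>)" "X \<in> sets \<nu>" using circle_probD(2)[OF nu] by (auto simp: circle_act_def)
    show "emeasure (circle_act A \<nu>) X = emeasure \<nu> X" using that[of "indicator X"] X by simp
  qed
  note [measurable_cong] = circle_probD(2)[OF nu]
  interpret N: prob_space \<nu> by (rule circle_probD(1)[OF nu])
  {
    case 0
    show ?case
    proof (rule I)
      fix f :: "real^2 \<Rightarrow> ennreal" assume [measurable]: "f \<in> borel_measurable borel"
      have "(\<integral>\<^sup>+x. f x \<partial>circle_act (K 0) \<nu>) = (\<integral>\<^sup>+x. f (sgn x) \<partial>\<nu>)"
        using nn_integral_act[OF lawK nu, of f 0] by (simp add: nn_integral_return)
      also have "\<dots> = (\<integral>\<^sup>+x. f x \<partial>\<nu>)"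
        by (rule nn_integral_cong_AE) (rule eventually_mono[OF circle_probD(3)[OF nu]], simp add: sgn_div_norm)
      finally show "(\<integral>\<^sup>+x. f x \<partial>circle_act (K 0) \<nu>) = (\<integral>\<^sup>+x. f x \<partial>\<nu>)" .
    qed
  next
    case (Suc n)
    show ?case
    proof (rule I)
      fix f :: "real^2 \<Rightarrow> ennreal" assume [measurable]: "f \<in> borel_measurable borel"
      have "(\<integral>\<^sup>+x. f x \<partial>circle_act (K (Suc n)) \<nu>) = (\<integral>\<^sup>+g. \<integral>\<^sup>+x. f (sgn (g *v x)) \<partial>\<nu> \<partial>K (Suc n))"
        by (rule nn_integral_act[OF lawK nu]) measurable
      also have "\<dots> = (\<integral>\<^sup>+g. \<integral>\<^sup>+h. \<integral>\<^sup>+x. f (sgn ((g ** h) *v x)) \<partial>\<nu> \<partial>K n \<partial>\<kappa>)"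
        by (simp add: nn_integral_mconv[OF SL2_law lawK])
      also have "\<dots> = (\<integral>\<^sup>+g. \<integral>\<^sup>+h. \<integral>\<^sup>+x. f (sgn (g *v sgn (h *v x))) \<partial>\<nu> \<partial>K n \<partial>\<kappa>)"
      proof (rule nn_integral_cong)
        fix g :: "real^2^2"
        show "(\<integral>\<^sup>+h. \<integral>\<^sup>+x. f (sgn ((g ** h) *v x)) \<partial>\<nu> \<partial>K n) = (\<integral>\<^sup>+h. \<integral>\<^sup>+x. f (sgn (g *v sgn (h *v x))) \<partial>\<nu> \<partial>K n)"
        proof (rule nn_integral_cong_AE, rule eventually_mono[OF AE_det_K], rule nn_integral_cong_AE)
          fix h :: "real^2^2" assume h: "det h = 1"
          show "AE x in \<nu>. f (sgn ((g ** h) *v x)) = f (sgn (g *v sgn (h *v x)))"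
            by (rule eventually_mono[OF circle_probD(3)[OF nu]])
              (use det1_unit_nz[OF h] in \<open>simp add: sgn_mv_sgn matrix_vector_mul_assoc\<close>)
        qed
      qed
      also have "\<dots> = (\<integral>\<^sup>+g. \<integral>\<^sup>+x. f (sgn (g *v x)) \<partial>circle_act (K n) \<nu> \<partial>\<kappa>)"
        by (intro nn_integral_cong nn_integral_act[OF lawK nu, symmetric]) measurable
      also have "\<dots> = (\<integral>\<^sup>+x. f x \<partial>circle_act \<kappa> \<nu>)" unfolding Suc by (rule nn_integral_act[OF SL2_law nu, symmetric]) measurable
      finally show "(\<integral>\<^sup>+x. f x \<partial>circle_act (K (Suc n)) \<nu>) = (\<integral>\<^sup>+x. f x \<partial>\<nu>)" by (simp only: st)
    qed
  }
qed

lemma drift_integral: assumes nu: "circle_prob \<nu>" and st: "circle_act \<kappa> \<nu> = \<nu>" 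
  shows "(\<integral>x. drift n x \<partial>\<nu>) = real n * (\<integral>x. drift 1 x \<partial>\<nu>)"
proof (induction n)
  note [measurable_cong] = circle_probD(2)[OF nu]
  note AEn = circle_probD(3)[OF nu]
  interpret N: prob_space \<nu> by (rule circle_probD(1)[OF nu])
  {
    case 0
    have "(\<integral>x. drift 0 x \<partial>\<nu>) = (\<integral>x. 0 \<partial>\<nu>)"
      by (rule integral_cong_AE; (measurable)?) (rule eventually_mono[OF AEn drift_0])
    then show ?case by simp
  next
    case (Suc n)
    interpret Kn: prob_space "K n" by (rule prob_K)
    have ib: "integrable \<nu> (drift m)" for m
      by (rule N.integrable_const_bound[where B="(\<integral>g. ln (norm g) \<partial>K m)"]; (measurable)?) (rule eventually_mono[OF AEn], use drift_bound in auto)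
    have i2: "integrable \<nu> (\<lambda>x. \<integral>h. drift 1 (sgn (h *v x)) \<partial>K n)"
    proof (rule N.integrable_const_bound[where B="(\<integral>g. ln (norm g) \<partial>K 1)"])
      show "AE x in \<nu>. norm (\<integral>h. drift 1 (sgn (h *v x)) \<partial>K n) \<le> (\<integral>g. ln (norm g) \<partial>K 1)"
      proof (rule eventually_mono[OF AEn])
        fix x :: "real^2" assume x: "norm x = 1"
        have "norm (\<integral>h. drift 1 (sgn (h *v x)) \<partial>K n) \<le> (\<integral>h. \<bar>drift 1 (sgn (h *v x))\<bar> \<partial>K n)" by (simp add: integral_abs_bound)
        also have "\<dots> \<le> (\<integral>g. ln (norm g) \<partial>K 1)"
          by (rule Kn.integral_le_const[OF integrable_abs[OF drift_add(2)[OF x]]])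
            (rule eventually_mono[OF AE_det_K], rule drift_bound[OF det1_sgn[OF _ x]])
        finally show "norm (\<integral>h. drift 1 (sgn (h *v x)) \<partial>K n) \<le> (\<integral>g. ln (norm g) \<partial>K 1)" .
      qed
    qed measurable
    have "(\<integral>x. drift (Suc n) x \<partial>\<nu>) = (\<integral>x. drift n x + (\<integral>h. drift 1 (sgn (h *v x)) \<partial>K n) \<partial>\<nu>)"
      by (rule integral_cong_AE; (measurable)?) (rule eventually_mono[OF AEn], use drift_add(1)[of _ 1 n] in simp)
    also have "\<dots> = (\<integral>x. drift n x \<partial>\<nu>) + (\<integral>x. (\<integral>h. drift 1 (sgn (h *v x)) \<partial>K n) \<partial>\<nu>)"
      by (rule Bochner_Integration.integral_add[OF ib i2])
    also have "(\<integral>x. (\<integral>h. drift 1 (sgn (h *v x)) \<partial>K n) \<partial>\<nu>) = (\<integral>x. drift 1 x \<partial>circle_act (K n) \<nu>)"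
      by (rule integral_act(2)[symmetric, OF lawK nu drift_measurable drift_bound])
    also have "circle_act (K n) \<nu> = \<nu>" by (rule circle_act_K[OF nu st])
    finally show ?case using Suc by (simp add: algebra_simps)
  }
qed

text \<open>Otherwise \<open>stationary_exists\<close> gives a stationary measure with nonpositive drift, also for all the
powers \<open>K n\<close>. The energy inequality makes \<open>\<Phi> 2\<close> constant, \<open>moment_level_bounded\<close> bounds the norm by the
same constant for all \<open>n\<close>, and \<open>no_uniform_norm_bound\<close> is contradicted.\<close>

theorem drift_positive: "\<exists>N\<ge>1. \<exists>a>0. \<forall>x. norm x = 1 \<longrightarrow> a \<le> drift N x"
proof (rule ccontr)
  assume n: "\<not> ?thesis"
  have "\<exists>x. norm x = 1 \<and> (n \<ge> 1 \<longrightarrow> drift n x \<le> 1)" for n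
  proof (cases "n \<ge> 1")
    case True
    then show ?thesis using n by (meson less_eq_real_def not_le zero_less_one)
  next
    case False
    have "norm (axis 1 1 :: real^2) = 1" by simp
    then show ?thesis using False by blast
  qed
  then obtain x where x: "\<And>n. norm (x n) = 1" "\<And>n. n \<ge> 1 \<Longrightarrow> drift n (x n) \<le> 1" by metis
  from stationary_exists[OF x] obtain \<nu> where nu: "circle_prob \<nu>" and st: "circle_act \<kappa> \<nu> = \<nu>" and d: "(\<integral>x. drift 1 x \<partial>\<nu>) \<le> 0" by blast
  have S: "stationary_pair (K n) \<nu>" for n
    by unfold_locales (auto simp: lawK nu circle_act_K[OF nu st] int_ln_norm no_atoms[OF nu st] simp del: mconv_pow.simps)
  interpret S0: stationary_pair "K 0" \<nu> by (rule S)
  from S0.moment_level_bounded obtain C where C: "\<And>g. det g = 1 \<Longrightarrow> S0.\<Phi> 2 g = S0.\<Phi>0 2 \<Longrightarrow> norm g \<le> C" by blast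
  have "AE g in K n. norm g \<le> C" for n
  proof -
    interpret Sn: stationary_pair "K n" \<nu> by (rule S)
    have "(\<integral>g. \<integral>x. ln (norm (g *v x)) \<partial>\<nu> \<partial>K n) = real n * (\<integral>x. drift 1 x \<partial>\<nu>)"
      using Sn.drift_fubini drift_integral[OF nu st, of n] by (simp add: drift_def[of n])
    also have "\<dots> \<le> 0" using d by (simp add: mult_nonneg_nonpos)
    finally have "AE g in K n. Sn.\<Phi> 2 g = Sn.\<Phi>0 2" by (rule Sn.energy_rigidity)
    then show ?thesis using AE_det_K[of n] by eventually_elim (rule C)
  qed
  then show False by (rule no_uniform_norm_bound)
qed

end

section \<open>Contraction and linear growth of the drift\<close>

text \<open>A Taylor bound with an error of second order that holds on the whole line; it carries the passage from drift to
exponential moments.\<close>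

lemma exp_quad: "exp (u::real) \<le> 1 + u + u\<^sup>2 * exp \<bar>u\<bar>"
proof -
  obtain t where t: "\<bar>t\<bar> \<le> \<bar>u\<bar>" "exp u = (\<Sum>m<2. u ^ m / fact m) + exp t / fact 2 * u ^ 2"
    using Maclaurin_exp_le[of u 2] by blast
  have "exp t \<le> exp \<bar>u\<bar>" using t(1) by simp
  then have "exp t / 2 \<le> exp \<bar>u\<bar>" using exp_gt_zero[of t] by linarith
  then have "exp t / 2 * u\<^sup>2 \<le> exp \<bar>u\<bar> * u\<^sup>2" by (intro mult_right_mono) auto
  moreover have "exp u = 1 + u + exp t / 2 * u\<^sup>2" using t(2) by (simp add: numeral_2_eq_2)
  ultimately show ?thesis by (simp add: mult.commute)
qed

text \<open>The same formula with the left factor integrated first.\<close>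

lemma nn_integral_mconv':
  assumes "SL2_law A" "SL2_law B" and [measurable]: "f \<in> borel_measurable borel"
  shows "(\<integral>\<^sup>+g. f g \<partial>mconv A B) = (\<integral>\<^sup>+h. \<integral>\<^sup>+g. f (g ** h) \<partial>A \<partial>B)"
proof -
  interpret A: prob_space A by (rule lawD) fact
  interpret B: prob_space B by (rule lawD) fact
  interpret pair_sigma_finite A B ..
  note [measurable_cong] = lawD(2)[OF assms(1)] lawD(2)[OF assms(2)]
  show ?thesis unfolding nn_integral_mconv[OF assms] by (rule Fubini'[symmetric]) measurable
qed

text \<open>Logarithms are dominated by small powers, which turns Lipschitz bounds with a large constant into Hoelder
bounds with an integrable constant.\<close>

lemma ln_add1_le: assumes s: "0 < s" "s \<le> 1" and u: "(u::real) \<ge> 0" shows "ln (1 + u) \<le> 2 * u powr s / s"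
proof (cases "u \<le> 1")
  case True
  have "ln (1 + u) \<le> u" using u by (rule ln_add_one_self_le_self)
  also have "u \<le> u powr s"
  proof (cases "u = 0")
    case False
    then have "u powr 1 \<le> u powr s" using u True s by (intro powr_mono') auto
    then show ?thesis using u False by simp
  qed simp
  also have "\<dots> \<le> 2 * u powr s / s" using s by (simp add: pos_le_divide_eq mult_left_le) (smt (verit) mult_left_le powr_ge_zero)
  finally show ?thesis .
next
  case False
  have e: "exp (s * ln u) = u powr s" using False by (simp add: powr_def)
  have "ln (1 + u) \<le> ln (2 * u)" using False by (subst ln_le_cancel_iff) auto
  also have "\<dots> = ln 2 + ln u" using False by (simp add: ln_mult)
  also have "\<dots> \<le> 1 + ln u" using ln_2_less_1 by simp
  also have "\<dots> \<le> (1 + s * ln u) / s" using s by (simp add: field_simps)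
  also have "\<dots> \<le> u powr s / s" using s exp_ge_add_one_self[of "s * ln u"] by (intro divide_right_mono) (auto simp: e)
  also have "\<dots> \<le> 2 * u powr s / s" using s by (intro divide_right_mono) auto
  finally show ?thesis .
qed

text \<open>Up to replacing \<open>y\<close> by \<open>-y\<close>, the distance of two unit vectors is at most \<open>2 |x \<and> y|\<close>, and
\<open>|gy|\<close> is at least \<open>1 / |g|\<close>.\<close>

lemma ln_mv_diff:
  assumes g: "det (g::real^2^2) = 1" and x: "norm x = 1" and y: "norm y = 1"
  shows "ln (norm (g *v x)) - ln (norm (g *v y)) \<le> ln (1 + 2 * (norm g)\<^sup>2 * \<bar>wedge x y\<bar>)"
proof -
  have *: "ln (norm (g *v x)) - ln (norm (g *v y)) \<le> ln (1 + 2 * (norm g)\<^sup>2 * \<bar>wedge x y\<bar>)"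
    if y: "norm y = 1" and i: "inner x y \<ge> 0" for y
  proof -
    have nz: "norm (g *v x) > 0" "norm (g *v y) > 0" using det1_unit_nz[OF g] x y by auto
    have i1: "inner x y \<le> 1" using Cauchy_Schwarz_ineq2[of x y] x y by simp
    have "(norm (x - y))\<^sup>2 = 2 - 2 * inner x y"
      using x y by (simp add: power2_norm_eq_inner inner_diff inner_commute norm_eq_1)
    also have "\<dots> \<le> 2 * (1 - (inner x y)\<^sup>2)"
    proof -
      have "2 - 2 * t \<le> 2 * (1 - t\<^sup>2)" if "0 \<le> t" "t \<le> 1" for t :: real
        using that by (simp add: power2_eq_square mult_left_le)
      then show ?thesis using i i1 by blast
    qed
    also have "\<dots> = 2 * (wedge x y)\<^sup>2" using wedge_inner[of x y] x y by simp
    also have "\<dots> \<le> (2 * \<bar>wedge x y\<bar>)\<^sup>2" by (simp add: power_mult_distrib)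
    finally have d: "norm (x - y) \<le> 2 * \<bar>wedge x y\<bar>" by (rule power2_le_imp_le) simp
    have b: "1 \<le> norm (g *v y) * norm g" using det1_norm_mv_ge[OF g, of y] y by simp
    have "norm (g *v x) \<le> norm (g *v y) + norm (g *v (x - y))"
      using norm_triangle_ineq[of "g *v y" "g *v (x - y)"] by (simp add: matrix_vector_mult_diff_distrib)
    also have "norm (g *v (x - y)) \<le> norm g * (2 * \<bar>wedge x y\<bar>)"
      by (rule order_trans[OF norm_mv_le mult_left_mono[OF d]]) simp
    also have "\<dots> \<le> (norm (g *v y) * norm g) * (norm g * (2 * \<bar>wedge x y\<bar>))"
      using mult_right_mono[OF b, of "norm g * (2 * \<bar>wedge x y\<bar>)"] by simp
    finally have "norm (g *v x) \<le> norm (g *v y) * (1 + 2 * (norm g)\<^sup>2 * \<bar>wedge x y\<bar>)"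
      by (simp add: power2_eq_square algebra_simps)
    moreover have p: "1 + 2 * (norm g)\<^sup>2 * \<bar>wedge x y\<bar> > 0" by (intro add_pos_nonneg) auto
    ultimately have "ln (norm (g *v x)) \<le> ln (norm (g *v y) * (1 + 2 * (norm g)\<^sup>2 * \<bar>wedge x y\<bar>))"
      using nz by (intro ln_mono) auto
    also have "\<dots> = ln (norm (g *v y)) + ln (1 + 2 * (norm g)\<^sup>2 * \<bar>wedge x y\<bar>)"
      by (rule ln_mult_pos[OF nz(2) p])
    finally show ?thesis by simp
  qed
  show ?thesis
  proof (cases "inner x y \<ge> 0")
    case True then show ?thesis using * y by blast
  next
    case False
    have "g *v (- y) = - (g *v y)" by (metis matrix_vector_mult_scaleR scaleR_minus1_left)
    moreover have "wedge x (- y) = - wedge x y" by (simp add: wedge_def)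
    ultimately show ?thesis using *[of "- y"] y False by simp
  qed
qed

context SL2_walk begin

text \<open>A bound for the moment of order \<open>p\<close> of \<open>|S\<^sub>n x|\<close>, uniform in the unit vector \<open>x\<close>. The
order may be negative.\<close>

definition moment_le :: "real \<Rightarrow> nat \<Rightarrow> real \<Rightarrow> bool" where
  "moment_le p n a \<longleftrightarrow> 0 \<le> a \<and> (\<forall>x. norm x = 1 \<longrightarrow> (\<integral>\<^sup>+g. ennreal (norm (g *v x) powr p) \<partial>K n) \<le> ennreal a)"

lemma moment_le_mono: "moment_le p n a \<Longrightarrow> a \<le> b \<Longrightarrow> moment_le p n b"
  unfolding moment_le_def using order_trans ennreal_leI by (metis (no_types, lifting))

lemma moment_le_0: "moment_le p 0 1"
  unfolding moment_le_def by (simp add: nn_integral_return)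

text \<open>The uniformity in \<open>x\<close> makes the bounds multiplicative, since \<open>|ghx| = |hx| |g y|\<close> where \<open>y\<close>
is the direction of \<open>hx\<close>.\<close>

lemma moment_le_add: assumes "moment_le p m a" "moment_le p n b" shows "moment_le p (m + n) (a * b)"
  unfolding moment_le_def
proof (intro conjI allI impI)
  show "0 \<le> a * b" using assms by (simp add: moment_le_def)
  fix x :: "real^2" assume x: "norm x = 1"
  have "(\<integral>\<^sup>+g. ennreal (norm (g *v x) powr p) \<partial>K (m + n)) = (\<integral>\<^sup>+h. \<integral>\<^sup>+g. ennreal (norm ((g ** h) *v x) powr p) \<partial>K m \<partial>K n)"
    unfolding K_add by (rule nn_integral_mconv'[OF lawK lawK]) measurable
  also have "\<dots> \<le> (\<integral>\<^sup>+h. ennreal (norm (h *v x) powr p) * ennreal a \<partial>K n)"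
  proof (rule nn_integral_mono_AE, rule eventually_mono[OF AE_det_K])
    fix h :: "real^2^2" assume h: "det h = 1"
    have nz: "h *v x \<noteq> 0" by (rule det1_unit_nz[OF h x])
    have "norm ((g ** h) *v x) = norm (h *v x) * norm (g *v sgn (h *v x))" for g :: "real^2^2"
      using nz by (simp add: mv_sgn matrix_vector_mul_assoc)
    then have "(\<integral>\<^sup>+g. ennreal (norm ((g ** h) *v x) powr p) \<partial>K m) = (\<integral>\<^sup>+g. ennreal (norm (h *v x) powr p) * ennreal (norm (g *v sgn (h *v x)) powr p) \<partial>K m)"
      by (simp add: powr_mult ennreal_mult)
    also have "\<dots> = ennreal (norm (h *v x) powr p) * (\<integral>\<^sup>+g. ennreal (norm (g *v sgn (h *v x)) powr p) \<partial>K m)"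
      by (rule nn_integral_cmult) measurable
    also have "\<dots> \<le> ennreal (norm (h *v x) powr p) * ennreal a"
      using assms(1) det1_sgn[OF h x] by (intro mult_left_mono) (auto simp: moment_le_def)
    finally show "(\<integral>\<^sup>+g. ennreal (norm ((g ** h) *v x) powr p) \<partial>K m) \<le> ennreal (norm (h *v x) powr p) * ennreal a" .
  qed
  also have "\<dots> = (\<integral>\<^sup>+h. ennreal (norm (h *v x) powr p) \<partial>K n) * ennreal a"
    by (rule nn_integral_multc) measurable
  also have "\<dots> \<le> ennreal b * ennreal a" using assms(2) x by (intro mult_right_mono) (auto simp: moment_le_def)
  also have "\<dots> = ennreal (a * b)" using assms by (simp add: ennreal_mult moment_le_def mult.commute)
  finally show "(\<integral>\<^sup>+g. ennreal (norm (g *v x) powr p) \<partial>K (m + n)) \<le> ennreal (a * b)" .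
qed

lemma mv_powr_le: assumes "det (g::real^2^2) = 1" "norm x = 1" shows "norm (g *v x) powr p \<le> norm g powr \<bar>p\<bar>"
proof -
  have nz: "norm (g *v x) > 0" using det1_unit_nz[OF assms] by simp
  have g: "norm g > 0" using det1_norm_ge1[OF assms(1)] by linarith
  have "p * ln (norm (g *v x)) \<le> \<bar>p\<bar> * \<bar>ln (norm (g *v x))\<bar>" by (metis abs_ge_self abs_mult)
  also have "\<dots> \<le> \<bar>p\<bar> * ln (norm g)" using ln_mv_bound[OF assms] by (intro mult_left_mono) auto
  finally show ?thesis using nz g unfolding powr_def by auto
qed

lemma moment_le_triv: assumes "\<bar>p\<bar> \<le> \<tau>" shows "\<exists>b. moment_le p n b"
proof -
  have fin: "(\<integral>\<^sup>+g. ennreal (norm g powr \<bar>p\<bar>) \<partial>K n) < \<infinity>" using assms by (intro nn_mom_fin) auto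
  have "moment_le p n (enn2real (\<integral>\<^sup>+g. ennreal (norm g powr \<bar>p\<bar>) \<partial>K n))"
    unfolding moment_le_def
  proof (intro conjI allI impI)
    fix x :: "real^2" assume x: "norm x = 1"
    have "(\<integral>\<^sup>+g. ennreal (norm (g *v x) powr p) \<partial>K n) \<le> (\<integral>\<^sup>+g. ennreal (norm g powr \<bar>p\<bar>) \<partial>K n)"
      by (rule nn_integral_mono_AE, rule eventually_mono[OF AE_det_K]) (intro ennreal_leI mv_powr_le x)
    then show "(\<integral>\<^sup>+g. ennreal (norm (g *v x) powr p) \<partial>K n) \<le> ennreal (enn2real (\<integral>\<^sup>+g. ennreal (norm g powr \<bar>p\<bar>) \<partial>K n))"
      using fin by (simp add: ennreal_enn2real)
  qed simp
  then show ?thesis ..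
qed

lemma moment_le_power: assumes "moment_le p N a" shows "moment_le p (q * N) (a ^ q)"
proof (induction q)
  case (Suc q)
  then show ?case using moment_le_add[OF assms Suc] by simp
qed (simp add: moment_le_0)

lemma moment_le_exp: assumes p: "\<bar>p\<bar> \<le> \<tau>" and N: "N \<ge> 1" and b: "moment_le p N (exp (real N * c))"
  shows "\<exists>C. \<forall>n. moment_le p n (C * exp (c * real n))"
proof -
  obtain b0 where b0: "\<And>r. moment_le p r (b0 r)" using moment_le_triv[OF p] by metis
  have b0n: "0 \<le> b0 r" for r using b0[of r] by (simp add: moment_le_def)
  define C where "C = (\<Sum>r<N. b0 r) * exp (\<bar>c\<bar> * real N)"
  have "moment_le p n (C * exp (c * real n))" for n
  proof -
    define q r where "q = n div N" and "r = n mod N"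
    have n: "n = q * N + r" and r: "r < N" using N by (auto simp: q_def r_def)
    have "moment_le p n (exp (real N * c) ^ q * b0 r)" unfolding n by (intro moment_le_add moment_le_power b b0)
    moreover have "exp (real N * c) ^ q * b0 r \<le> C * exp (c * real n)"
    proof -
      have "exp (real N * c) ^ q = exp (c * real n - c * real r)" unfolding exp_of_nat_mult[symmetric] n by (simp add: algebra_simps)
      also have "\<dots> \<le> exp (\<bar>c\<bar> * real N + c * real n)"
      proof -
        have "- c * real r \<le> \<bar>c\<bar> * real r" by (intro mult_right_mono) auto
        also have "\<dots> \<le> \<bar>c\<bar> * real N" using r by (intro mult_left_mono) auto
        finally show ?thesis by simp
      qed
      also have "\<dots> = exp (\<bar>c\<bar> * real N) * exp (c * real n)" by (simp add: exp_add)
      finally have "exp (real N * c) ^ q * b0 r \<le> (exp (\<bar>c\<bar> * real N) * exp (c * real n)) * (\<Sum>r<N. b0 r)"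
        using b0n r by (intro mult_mono member_le_sum) auto
      then show ?thesis by (simp add: C_def algebra_simps)
    qed
    ultimately show ?thesis by (rule moment_le_mono)
  qed
  then show ?thesis by blast
qed

text \<open>The expansion \<open>|gx|\<^sup>\<sigma>\<^sup>s \<le> 1 + \<sigma> s ln |gx| + O(s\<^sup>2 |g|\<^sup>\<tau>)\<close> is integrated; for small
\<open>s\<close> the linear term decides.\<close>

lemma moment_le_taylor:
  assumes sg: "\<bar>\<sigma>\<bar> = 1" and c: "\<And>x. norm x = 1 \<Longrightarrow> \<sigma> * drift N x \<le> c" "c < c'"
  shows "\<exists>s0>0. s0 \<le> \<tau> \<and> (\<forall>s. 0 < s \<and> s \<le> s0 \<longrightarrow> moment_le (\<sigma> * s) N (exp (s * c')))"
proof -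
  interpret prob_space "K N" by (rule prob_K)
  have im: "integrable (K N) (\<lambda>g. norm g powr \<tau>)" using tau by (intro mom_K) auto
  define B where "B = (16 / \<tau>\<^sup>2) * (\<integral>g. norm g powr \<tau> \<partial>K N)"
  have B: "B \<ge> 0" unfolding B_def by (intro mult_nonneg_nonneg integral_nonneg_AE) auto
  \<comment> \<open>Half of the moment is spent on \<open>m\<^sup>2\<close>, the other half on \<open>exp (s m)\<close>.\<close>
  define s0 where "s0 = min (\<tau> / 2) ((c' - c) / (B + 1))"
  have s0: "s0 > 0" "s0 \<le> \<tau>" using tau c B by (auto simp: s0_def)
  have "moment_le (\<sigma> * s) N (exp (s * c'))" if s: "0 < s" "s \<le> s0" for s
    unfolding moment_le_def
  proof (intro conjI allI impI)
    fix x :: "real^2" assume x: "norm x = 1"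
    define l where "l g = \<sigma> * ln (norm (g *v x))" for g :: "real^2^2"
    have [measurable]: "l \<in> borel_measurable borel" unfolding l_def by measurable
    have pt: "norm (g *v x) powr (\<sigma> * s) \<le> 1 + s * l g + s\<^sup>2 * ((16 / \<tau>\<^sup>2) * norm g powr \<tau>)" if g: "det g = 1" for g :: "real^2^2"
    proof -
      have nz: "norm (g *v x) > 0" using det1_unit_nz[OF g x] by simp
      have gg: "norm g \<ge> 1" by (rule det1_norm_ge1[OF g])
      define m where "m = ln (norm g)"
      have m0: "m \<ge> 0" using gg by (simp add: m_def)
      have lm: "\<bar>l g\<bar> \<le> m" using ln_mv_bound[OF g x] sg by (simp add: l_def m_def abs_mult)
      have "m \<le> norm g powr (\<tau>/4) / (\<tau>/4)" unfolding m_def using tau gg by (intro ln_le_powr) auto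
      then have "m\<^sup>2 \<le> (norm g powr (\<tau>/4) / (\<tau>/4))\<^sup>2" using m0 by (intro power_mono)
      also have "\<dots> = (16 / \<tau>\<^sup>2) * norm g powr (\<tau>/2)"
        using gg by (simp add: power_divide power2_eq_square powr_add[symmetric])
      finally have m2: "m\<^sup>2 \<le> (16 / \<tau>\<^sup>2) * norm g powr (\<tau>/2)" .
      have se: "exp (s * m) \<le> norm g powr (\<tau>/2)"
      proof -
        have "exp (s * m) = norm g powr s" using gg by (auto simp: powr_def m_def)
        also have "\<dots> \<le> norm g powr (\<tau>/2)" using s gg by (intro powr_mono) (auto simp: s0_def)
        finally show ?thesis .
      qed
      have "norm (g *v x) powr (\<sigma> * s) = exp (s * l g)" using nz by (auto simp: powr_def l_def algebra_simps)
      also have "\<dots> \<le> 1 + s * l g + (s * l g)\<^sup>2 * exp \<bar>s * l g\<bar>" by (rule exp_quad)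
      also have "(s * l g)\<^sup>2 * exp \<bar>s * l g\<bar> \<le> (s\<^sup>2 * m\<^sup>2) * exp (s * m)"
      proof (rule mult_mono)
        show "(s * l g)\<^sup>2 \<le> s\<^sup>2 * m\<^sup>2" using lm power_mono[OF lm, of 2] by (simp add: power_mult_distrib mult_left_mono)
        show "exp \<bar>s * l g\<bar> \<le> exp (s * m)" using lm s by (simp add: abs_mult)
      qed auto
      also have "\<dots> \<le> (s\<^sup>2 * ((16 / \<tau>\<^sup>2) * norm g powr (\<tau>/2))) * norm g powr (\<tau>/2)"
        using m2 se by (intro mult_mono) auto
      also have "\<dots> = s\<^sup>2 * ((16 / \<tau>\<^sup>2) * norm g powr \<tau>)" using gg by (simp add: powr_add[symmetric])
      finally show ?thesis by simp
    qed
    have il: "integrable (K N) l" unfolding l_def using int_ln[OF x] by simp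
    define F where "F g = 1 + s * l g + s\<^sup>2 * ((16 / \<tau>\<^sup>2) * norm g powr \<tau>)" for g
    have iF: "integrable (K N) F" unfolding F_def using il im by simp
    have F0: "AE g in K N. 0 \<le> F g" by (rule eventually_mono[OF AE_det_K]) (use pt order_trans[OF powr_ge_zero] in \<open>unfold F_def, blast\<close>)
    have "(\<integral>g. F g \<partial>K N) = 1 + s * (\<integral>g. l g \<partial>K N) + s\<^sup>2 * B"
      unfolding F_def B_def using il im prob_space by simp
    also have "(\<integral>g. l g \<partial>K N) = \<sigma> * drift N x" unfolding l_def drift_def by simp
    also have "1 + s * (\<sigma> * drift N x) + s\<^sup>2 * B \<le> 1 + s * c'"
    proof -
      have "s * B \<le> (c' - c) / (B + 1) * (B + 1)" using s B by (intro mult_mono) (auto simp: s0_def)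
      then have "s * B \<le> c' - c" using B by simp
      then have "s * (\<sigma> * drift N x + s * B) \<le> s * c'" using c(1)[OF x] s by (intro mult_left_mono) auto
      then show ?thesis by (simp add: power2_eq_square algebra_simps)
    qed
    also have "\<dots> \<le> exp (s * c')" by (rule exp_ge_add_one_self)
    finally have FI: "(\<integral>g. F g \<partial>K N) \<le> exp (s * c')" .
    have "(\<integral>\<^sup>+g. ennreal (norm (g *v x) powr (\<sigma> * s)) \<partial>K N) \<le> (\<integral>\<^sup>+g. ennreal (F g) \<partial>K N)"
      by (rule nn_integral_mono_AE, rule eventually_mono[OF AE_det_K]) (unfold F_def, intro ennreal_leI pt)
    also have "\<dots> = ennreal (\<integral>g. F g \<partial>K N)" by (rule nn_integral_eq_integral[OF iF F0])
    also have "\<dots> \<le> ennreal (exp (s * c'))" by (rule ennreal_leI[OF FI])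
    finally show "(\<integral>\<^sup>+g. ennreal (norm (g *v x) powr (\<sigma> * s)) \<partial>K N) \<le> ennreal (exp (s * c'))" .
  qed simp
  then show ?thesis using s0 by blast
qed

text \<open>The one step estimate of \<open>moment_le_taylor\<close> for the block length \<open>N\<close>, propagated to all lengths.\<close>

lemma moment_le_rate:
  assumes sg: "\<bar>\<sigma>\<bar> = 1" and N: "N \<ge> 1" and c: "\<And>x. norm x = 1 \<Longrightarrow> \<sigma> * drift N x \<le> real N * c" "c < c'"
  shows "\<exists>s0>0. s0 \<le> \<tau> \<and> (\<forall>s. 0 < s \<and> s \<le> s0 \<longrightarrow> (\<exists>C. \<forall>n. moment_le (\<sigma> * s) n (C * exp (s * c' * real n))))"
proof -
  have "real N * c < real N * c'" using N c(2) by simp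
  from moment_le_taylor[OF sg c(1) this] obtain s0 where s0: "s0 > 0" "s0 \<le> \<tau>" 
    and b: "\<And>s. 0 < s \<Longrightarrow> s \<le> s0 \<Longrightarrow> moment_le (\<sigma> * s) N (exp (s * (real N * c')))" by auto
  have "\<exists>C. \<forall>n. moment_le (\<sigma> * s) n (C * exp (s * c' * real n))" if s: "0 < s" "s \<le> s0" for s
    using b[OF s] s s0 sg by (intro moment_le_exp[OF _ N]) (auto simp: abs_mult algebra_simps)
  then show ?thesis using s0 by blast
qed

text \<open>Negative moments of the norm decay because the drift is positive.\<close>

lemma contraction: "\<exists>s0>0. \<exists>d>0. s0 \<le> \<tau> \<and> (\<forall>s. 0 < s \<and> s \<le> s0 \<longrightarrow> (\<exists>C. \<forall>n. moment_le (- s) n (C * exp (- (s * d * real n)))))"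
proof -
  obtain N a where N: "N \<ge> 1" and a: "a > 0" "\<And>x. norm x = 1 \<Longrightarrow> a \<le> drift N x" using drift_positive by blast
  have "- 1 * drift N x \<le> real N * (- a / real N)" if "norm x = 1" for x using a(2)[OF that] N by simp
  from moment_le_rate[OF _ N this, of "- a / (2 * real N)"] N a obtain s0 where s0: "s0 > 0" "s0 \<le> \<tau>"
    and b: "\<And>s. 0 < s \<Longrightarrow> s \<le> s0 \<Longrightarrow> \<exists>C. \<forall>n. moment_le (- 1 * s) n (C * exp (s * (- a / (2 * real N)) * real n))"
    by (auto simp: field_simps)
  show ?thesis
    using s0 b a N by (intro exI[of _ s0] conjI exI[of _ "a / (2 * real N)"]) auto
qed

text \<open>The mean stretch in the step after the \<open>k\<close>-th; the drift is the sum of these numbers.\<close>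

definition drift_step :: "nat \<Rightarrow> real^2 \<Rightarrow> real" where "drift_step k x = (\<integral>h. drift 1 (sgn (h *v x)) \<partial>K k)"

lemma drift_holder:
  assumes s: "0 < s" "2 * s \<le> \<tau>"
  shows "\<exists>H\<ge>0. \<forall>x y. norm x = 1 \<longrightarrow> norm y = 1 \<longrightarrow> \<bar>drift 1 x - drift 1 y\<bar> \<le> H * \<bar>wedge x y\<bar> powr s"
proof -
  have im: "integrable (K 1) (\<lambda>g. norm g powr (2 * s))" using s by (intro mom_K) auto
  define H where "H = (2 * 2 powr s / s) * (\<integral>g. norm g powr (2 * s) \<partial>K 1)"
  have H: "H \<ge> 0" unfolding H_def using s by (intro mult_nonneg_nonneg integral_nonneg_AE) auto
  have "drift 1 x - drift 1 y \<le> H * \<bar>wedge x y\<bar> powr s" if x: "norm x = 1" and y: "norm y = 1" for x y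
  proof -
    have "drift 1 x - drift 1 y = (\<integral>g. ln (norm (g *v x)) - ln (norm (g *v y)) \<partial>K 1)"
      unfolding drift_def using int_ln[OF x, of 1] int_ln[OF y, of 1] by simp
    also have "\<dots> \<le> (\<integral>g. (2 * 2 powr s / s) * norm g powr (2 * s) * \<bar>wedge x y\<bar> powr s \<partial>K 1)"
    proof (rule integral_mono_AE)
      show "integrable (K 1) (\<lambda>g. ln (norm (g *v x)) - ln (norm (g *v y)))" by (rule Bochner_Integration.integrable_diff[OF int_ln[OF x] int_ln[OF y]])
      show "integrable (K 1) (\<lambda>g. (2 * 2 powr s / s) * norm g powr (2 * s) * \<bar>wedge x y\<bar> powr s)" by (intro integrable_mult_left integrable_mult_right im)
      show "AE g in K 1. ln (norm (g *v x)) - ln (norm (g *v y)) \<le> (2 * 2 powr s / s) * norm g powr (2 * s) * \<bar>wedge x y\<bar> powr s"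
      proof (rule eventually_mono[OF AE_det_K])
        fix g :: "real^2^2" assume g: "det g = 1"
        have gg: "norm g \<ge> 1" by (rule det1_norm_ge1[OF g])
        have "ln (norm (g *v x)) - ln (norm (g *v y)) \<le> ln (1 + 2 * (norm g)\<^sup>2 * \<bar>wedge x y\<bar>)" by (rule ln_mv_diff[OF g x y])
        also have "\<dots> \<le> 2 * (2 * (norm g)\<^sup>2 * \<bar>wedge x y\<bar>) powr s / s" using s tau by (intro ln_add1_le) auto
        also have "(2 * (norm g)\<^sup>2 * \<bar>wedge x y\<bar>) powr s = 2 powr s * norm g powr (2 * s) * \<bar>wedge x y\<bar> powr s"
        proof -
          have "(norm g)\<^sup>2 powr s = norm g powr (2 * s)" using gg by (simp add: powr_powr[symmetric] powr_numeral)
          then show ?thesis by (simp add: powr_mult)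
        qed
        finally show "ln (norm (g *v x)) - ln (norm (g *v y)) \<le> (2 * 2 powr s / s) * norm g powr (2 * s) * \<bar>wedge x y\<bar> powr s" by simp
      qed
    qed
    also have "\<dots> = H * \<bar>wedge x y\<bar> powr s" unfolding H_def by simp
    finally show ?thesis .
  qed note * = this
  have "\<bar>drift 1 x - drift 1 y\<bar> \<le> H * \<bar>wedge x y\<bar> powr s" if x: "norm x = 1" and y: "norm y = 1" for x y
  proof -
    have "\<bar>wedge y x\<bar> = \<bar>wedge x y\<bar>" by (simp add: wedge_def abs_minus_commute mult.commute)
    then show ?thesis using *[OF x y] *[OF y x] by (simp add: abs_le_iff)
  qed
  then show ?thesis using H by blast
qed

text \<open>The directions of \<open>hx\<close> and \<open>hy\<close> are at distance at most \<open>1 / (|hx| |hy|)\<close>, which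
is small in mean by \<open>contraction\<close>, and the mean stretch is Hoelder continuous in the direction.\<close>

lemma drift_step_oscillation: "\<exists>D\<ge>0. \<exists>d>0. \<forall>k x y. norm x = 1 \<longrightarrow> norm y = 1 \<longrightarrow> \<bar>drift_step k x - drift_step k y\<bar> \<le> D * exp (- (d * real k))"
proof -
  obtain s0 d where s0: "s0 > 0" "s0 \<le> \<tau>" "d > 0" and b: "\<And>s. 0 < s \<Longrightarrow> s \<le> s0 \<Longrightarrow> \<exists>C. \<forall>n. moment_le (- s) n (C * exp (- (s * d * real n)))"
    using contraction by blast
  obtain C where C: "\<And>n. moment_le (- s0) n (C * exp (- (s0 * d * real n)))" using b[of s0] s0 by auto
  define s where "s = s0 / 2"
  have s: "s > 0" "2 * s \<le> \<tau>" using s0 by (auto simp: s_def)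
  obtain H where H: "H \<ge> 0" "\<And>x y. norm x = 1 \<Longrightarrow> norm y = 1 \<Longrightarrow> \<bar>drift 1 x - drift 1 y\<bar> \<le> H * \<bar>wedge x y\<bar> powr s"
    using drift_holder[OF s] by blast
  have C0: "C \<ge> 0" using C[of 0] by (simp add: moment_le_def)
  have "\<bar>drift_step k x - drift_step k y\<bar> \<le> (H * C) * exp (- (s0 * d * real k))" if x: "norm x = 1" and y: "norm y = 1" for k x y
  proof -
    have i1: "integrable (K k) (\<lambda>h. norm (h *v u) powr (- s0))" if u: "norm u = 1" for u
    proof (rule integrableI_nonneg)
      have "(\<integral>\<^sup>+h. ennreal (norm (h *v u) powr - s0) \<partial>K k) \<le> ennreal (C * exp (- (s0 * d * real k)))"
        using C[of k] u by (simp add: moment_le_def)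
      then show "(\<integral>\<^sup>+h. ennreal (norm (h *v u) powr - s0) \<partial>K k) < \<infinity>" by (auto intro: le_less_trans)
    qed auto
    have I1: "(\<integral>h. norm (h *v u) powr (- s0) \<partial>K k) \<le> C * exp (- (s0 * d * real k))" if u: "norm u = 1" for u
    proof -
      have "ennreal (\<integral>h. norm (h *v u) powr (- s0) \<partial>K k) = (\<integral>\<^sup>+h. ennreal (norm (h *v u) powr - s0) \<partial>K k)"
        by (rule nn_integral_eq_integral[symmetric, OF i1[OF u]]) auto
      also have "\<dots> \<le> ennreal (C * exp (- (s0 * d * real k)))" using C[of k] u by (simp add: moment_le_def)
      finally show ?thesis using C0 by (subst (asm) ennreal_le_iff) auto
    qed
    have "drift_step k x - drift_step k y = (\<integral>h. drift 1 (sgn (h *v x)) - drift 1 (sgn (h *v y)) \<partial>K k)"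
      unfolding drift_step_def using drift_add(2)[OF x, of k 1] drift_add(2)[OF y, of k 1] by simp
    also have "\<bar>\<dots>\<bar> \<le> (\<integral>h. \<bar>drift 1 (sgn (h *v x)) - drift 1 (sgn (h *v y))\<bar> \<partial>K k)" by (rule integral_abs_bound)
    also have "\<dots> \<le> (\<integral>h. H * ((norm (h *v x) powr (- s0) + norm (h *v y) powr (- s0)) / 2) \<partial>K k)"
    proof (rule integral_mono_AE)
      show "integrable (K k) (\<lambda>h. \<bar>drift 1 (sgn (h *v x)) - drift 1 (sgn (h *v y))\<bar>)"
        using drift_add(2)[OF x, of k 1] drift_add(2)[OF y, of k 1] by simp
      show "integrable (K k) (\<lambda>h. H * ((norm (h *v x) powr (- s0) + norm (h *v y) powr (- s0)) / 2))"
        using i1 x y by simp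
      show "AE h in K k. \<bar>drift 1 (sgn (h *v x)) - drift 1 (sgn (h *v y))\<bar> \<le> H * ((norm (h *v x) powr (- s0) + norm (h *v y) powr (- s0)) / 2)"
      proof (rule eventually_mono[OF AE_det_K])
        fix h :: "real^2^2" assume h: "det h = 1"
        have p: "norm (h *v x) > 0" "norm (h *v y) > 0" using det1_unit_nz[OF h] x y by auto
        have "\<bar>drift 1 (sgn (h *v x)) - drift 1 (sgn (h *v y))\<bar> \<le> H * \<bar>wedge (sgn (h *v x)) (sgn (h *v y))\<bar> powr s"
          by (intro H det1_sgn h x y)
        also have "\<bar>wedge (sgn (h *v x)) (sgn (h *v y))\<bar> powr s \<le> (1 / (norm (h *v x) * norm (h *v y))) powr s"
        proof (rule powr_mono2)
          have "wedge (sgn (h *v x)) (sgn (h *v y)) = wedge x y / (norm (h *v x) * norm (h *v y))"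
            using h by (simp add: sgn_div_norm wedge_mv divide_inverse)
          moreover have "\<bar>wedge x y\<bar> \<le> 1" using wedge_le[of x y] x y by simp
          ultimately show "\<bar>wedge (sgn (h *v x)) (sgn (h *v y))\<bar> \<le> 1 / (norm (h *v x) * norm (h *v y))"
            using p by (simp add: abs_mult divide_right_mono)
        qed (use s in auto)
        also have "\<dots> = norm (h *v x) powr (- s) * norm (h *v y) powr (- s)"
          using p by (simp add: powr_divide powr_mult powr_minus_divide)
        also have "\<dots> \<le> ((norm (h *v x) powr (- s))\<^sup>2 + (norm (h *v y) powr (- s))\<^sup>2) / 2"
          using sum_squares_bound[of "norm (h *v x) powr (- s)" "norm (h *v y) powr (- s)"] by simp
        also have "\<dots> = (norm (h *v x) powr (- s0) + norm (h *v y) powr (- s0)) / 2"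
          using p by (simp add: power2_eq_square powr_add[symmetric] s_def)
        finally show "\<bar>drift 1 (sgn (h *v x)) - drift 1 (sgn (h *v y))\<bar> \<le> H * ((norm (h *v x) powr (- s0) + norm (h *v y) powr (- s0)) / 2)"
          using H(1) by (simp add: mult_left_mono)
      qed
    qed
    also have "\<dots> = H * (((\<integral>h. norm (h *v x) powr (- s0) \<partial>K k) + (\<integral>h. norm (h *v y) powr (- s0) \<partial>K k)) / 2)"
      using i1 x y by simp
    also have "\<dots> \<le> H * (C * exp (- (s0 * d * real k)))" using I1[OF x] I1[OF y] H(1) by (intro mult_left_mono) auto
    finally show ?thesis by simp
  qed
  then show ?thesis using H(1) C0 s0 by (intro exI[of _ "H * C"] conjI exI[of _ "s0 * d"]) auto
qed

lemma drift_sum_steps: "norm x = 1 \<Longrightarrow> drift n x = (\<Sum>k<n. drift_step k x)"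
proof (induction n)
  case (Suc n)
  then show ?case using drift_add(1)[of x 1 n] by (simp add: drift_step_def)
qed (simp add: drift_0)

lemma drift_oscillation: "\<exists>D\<ge>0. \<forall>n x y. norm x = 1 \<longrightarrow> norm y = 1 \<longrightarrow> \<bar>drift n x - drift n y\<bar> \<le> D"
proof -
  obtain D d where D: "D \<ge> 0" "d > 0" "\<And>k x y. norm x = 1 \<Longrightarrow> norm y = 1 \<Longrightarrow> \<bar>drift_step k x - drift_step k y\<bar> \<le> D * exp (- (d * real k))"
    using drift_step_oscillation by blast
  have e: "exp (- (d * real k)) = exp (- d) ^ k" for k by (simp add: exp_of_nat_mult[symmetric] mult.commute)
  have sm: "summable (\<lambda>k. exp (- d) ^ k)" using D by (intro summable_geometric) auto
  have "\<bar>drift n x - drift n y\<bar> \<le> D * (\<Sum>k. exp (- d) ^ k)" if x: "norm x = 1" and y: "norm y = 1" for n x y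
  proof -
    have "\<bar>drift n x - drift n y\<bar> \<le> (\<Sum>k<n. D * exp (- d) ^ k)"
      unfolding drift_sum_steps[OF x] drift_sum_steps[OF y] sum_subtractf[symmetric]
      by (rule order_trans[OF sum_abs sum_mono]) (use D(3)[OF x y] in \<open>simp add: e\<close>)
    also have "\<dots> = D * (\<Sum>k<n. exp (- d) ^ k)" by (simp add: sum_distrib_left)
    also have "\<dots> \<le> D * (\<Sum>k. exp (- d) ^ k)" using D sm by (intro mult_left_mono sum_le_suminf) auto
    finally show ?thesis .
  qed
  moreover have "0 \<le> D * (\<Sum>k. exp (- d) ^ k)" using D sm by (intro mult_nonneg_nonneg suminf_nonneg) auto
  ultimately show ?thesis by blast
qed

text \<open>As the drift hardly depends on \<open>x\<close>, the sequence \<open>a n\<close> is additive up to a bounded error.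
Comparing \<open>a (m n)\<close> with \<open>m (a n)\<close> and with \<open>n (a m)\<close> shows that \<open>a n / n\<close> is a Cauchy
sequence and that its distance to the limit is \<open>O(1/n)\<close>.\<close>

theorem drift_linear_growth: "\<exists>l>0. \<exists>D. \<forall>n x. norm x = 1 \<longrightarrow> \<bar>drift n x - real n * l\<bar> \<le> D"
proof -
  obtain D where D: "D \<ge> 0" "\<And>n x y. norm x = 1 \<Longrightarrow> norm y = 1 \<Longrightarrow> \<bar>drift n x - drift n y\<bar> \<le> D" using drift_oscillation by blast
  define e1 :: "real^2" where "e1 = axis 1 1"
  have e1: "norm e1 = 1" by (simp add: e1_def)
  define a where "a n = drift n e1" for n
  have qa: "\<bar>a (m + n) - a m - a n\<bar> \<le> D" for m n
  proof -
    interpret prob_space "K n" by (rule prob_K)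
    have "a (m + n) - a m - a n = (\<integral>h. drift m (sgn (h *v e1)) - a m \<partial>K n)"
      using drift_add(1)[OF e1, of m n] drift_add(2)[OF e1, of n m] prob_space by (simp add: a_def)
    also have "\<bar>\<dots>\<bar> \<le> (\<integral>h. \<bar>drift m (sgn (h *v e1)) - a m\<bar> \<partial>K n)" by (rule integral_abs_bound)
    also have "\<dots> \<le> D"
      by (rule integral_le_const) (use drift_add(2)[OF e1, of n m] in simp, rule eventually_mono[OF AE_det_K], 
        unfold a_def, intro D det1_sgn e1)
    finally show ?thesis .
  qed
  have a0: "a 0 = 0" by (simp add: a_def drift_0 e1)
  have mul: "\<bar>a (k * n) - real k * a n\<bar> \<le> real k * D" for k n
  proof (induction k)
    case (Suc k)
    then show ?case using qa[of n "k * n"] by (simp add: algebra_simps)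
  qed (simp add: a0)
  \<comment> \<open>Both terms are compared with \<open>a (m n) / (m n)\<close>.\<close>
  have cmp: "\<bar>a n / real n - a m / real m\<bar> \<le> D / real n + D / real m" if "n > 0" "m > 0" for n m
  proof -
    have "\<bar>a (m * n) - real m * a n\<bar> \<le> real m * D" "\<bar>a (m * n) - real n * a m\<bar> \<le> real n * D"
      using mul[of m n] mul[of n m] by (simp_all add: mult.commute)
    then have "\<bar>real m * a n - real n * a m\<bar> \<le> real m * D + real n * D" by linarith
    then have "\<bar>real m * a n - real n * a m\<bar> / (real m * real n) \<le> (real m * D + real n * D) / (real m * real n)"
      using that by (intro divide_right_mono) auto
    moreover have "\<bar>real m * a n - real n * a m\<bar> / (real m * real n) = \<bar>a n / real n - a m / real m\<bar>"
    proof -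
      have "(real m * a n - real n * a m) / (real m * real n) = a n / real n - a m / real m"
        using that by (simp add: field_simps)
      then show ?thesis by (metis abs_divide abs_mult abs_of_nat)
    qed
    moreover have "(real m * D + real n * D) / (real m * real n) = D / real n + D / real m"
      using that by (simp add: add_divide_distrib)
    ultimately show ?thesis by simp
  qed
  have inv: "(\<lambda>n. w / real (Suc n)) \<longlonglongrightarrow> 0" for w :: real
    using lim_inverse_n'[THEN LIMSEQ_Suc, THEN tendsto_mult_left[of _ _ _ w]] by simp
  have "Cauchy (\<lambda>n. a (Suc n) / real (Suc n))"
  proof (rule metric_CauchyI)
    fix e :: real assume e: "e > 0"
    obtain M where M: "\<And>n. n \<ge> M \<Longrightarrow> D / real (Suc n) < e / 2"
      using order_tendstoD(2)[OF inv[of D], of "e/2"] e by (auto simp: eventually_sequentially)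
    show "\<exists>M. \<forall>m\<ge>M. \<forall>n\<ge>M. dist (a (Suc m) / real (Suc m)) (a (Suc n) / real (Suc n)) < e"
    proof (intro exI allI impI)
      fix m n assume "M \<le> m" "M \<le> n"
      then show "dist (a (Suc m) / real (Suc m)) (a (Suc n) / real (Suc n)) < e"
        using M[of m] M[of n] cmp[of "Suc m" "Suc n"] unfolding dist_real_def by linarith
    qed
  qed
  then obtain l where l: "(\<lambda>n. a (Suc n) / real (Suc n)) \<longlonglongrightarrow> l" using Cauchy_convergent convergent_def by metis
  have al: "\<bar>a n - real n * l\<bar> \<le> D" for n
  proof (cases "n = 0")
    case False
    have "\<bar>a n / real n - l\<bar> \<le> D / real n + 0"
    proof (rule LIMSEQ_le)
      show "(\<lambda>m. \<bar>a n / real n - a (Suc m) / real (Suc m)\<bar>) \<longlonglongrightarrow> \<bar>a n / real n - l\<bar>" by (intro tendsto_intros l)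
      show "(\<lambda>m. D / real n + D / real (Suc m)) \<longlonglongrightarrow> D / real n + 0" by (intro tendsto_intros inv)
      show "\<exists>N. \<forall>m\<ge>N. \<bar>a n / real n - a (Suc m) / real (Suc m)\<bar> \<le> D / real n + D / real (Suc m)"
        using cmp[of n] False by blast
    qed
    then have "real n * \<bar>a n / real n - l\<bar> \<le> real n * (D / real n)" by (intro mult_left_mono) auto
    moreover have "real n * \<bar>a n / real n - l\<bar> = \<bar>a n - real n * l\<bar>"
    proof -
      have "real n * \<bar>a n / real n - l\<bar> = \<bar>real n * (a n / real n - l)\<bar>" by (simp add: abs_mult)
      then show ?thesis using False by (simp add: right_diff_distrib)
    qed
    ultimately show ?thesis using False by simp
  qed (use D a0 in simp)
  have "l > 0"
  proof -
    obtain N b where N: "N \<ge> 1" and b: "b > 0" "\<And>x. norm x = 1 \<Longrightarrow> b \<le> drift N x" using drift_positive by blast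
    \<comment> \<open>Blocks of length \<open>N\<close> have drift at least \<open>b\<close>, whatever the starting direction.\<close>
    have lb: "real q * b \<le> a (q * N)" for q
    proof (induction q)
      case (Suc q)
      interpret prob_space "K (q * N)" by (rule prob_K)
      have "b \<le> (\<integral>h. drift N (sgn (h *v e1)) \<partial>K (q * N))"
        by (rule integral_ge_const[OF drift_add(2)[OF e1]]) (rule eventually_mono[OF AE_det_K], intro b det1_sgn e1)
      then show ?case using Suc drift_add(1)[OF e1, of N "q * N"] by (simp add: a_def algebra_simps)
    qed (simp add: a0)
    have "b / real N \<le> l"
    proof (rule ccontr)
      assume "\<not> ?thesis"
      then have p: "b - real N * l > 0" using N by (simp add: field_simps)
      obtain q :: nat where q: "D / (b - real N * l) < real q" using reals_Archimedean2 by blast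
      then have "D < real q * (b - real N * l)" using p by (simp add: pos_divide_less_eq)
      moreover have "real q * b \<le> real (q * N) * l + D" using lb[of q] al[of "q * N"] by linarith
      ultimately show False by (simp add: algebra_simps)
    qed
    moreover have "0 < b / real N" using b N by simp
    ultimately show ?thesis by linarith
  qed
  moreover have "\<bar>drift n x - real n * l\<bar> \<le> 2 * D" if "norm x = 1" for n x
    using D(2)[OF that e1, of n] al[of n] unfolding a_def by linarith
  ultimately show ?thesis by blast
qed

definition lyap :: real where "lyap = (SOME l. l > 0 \<and> (\<exists>D. \<forall>n x. norm x = 1 \<longrightarrow> \<bar>drift n x - real n * l\<bar> \<le> D))"

lemma lyap: "lyap > 0" "\<exists>D. \<forall>n x. norm x = 1 \<longrightarrow> \<bar>drift n x - real n * lyap\<bar> \<le> D"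
  using someI_ex[of "\<lambda>l. l > 0 \<and> (\<exists>D. \<forall>n x. norm x = 1 \<longrightarrow> \<bar>drift n x - real n * l\<bar> \<le> D)"] drift_linear_growth
  by (auto simp: lyap_def)

text \<open>Markov's inequality for \<open>|gx|\<^sup>\<sigma>\<^sup>s\<close>. The two signs \<open>\<sigma>\<close> give the two tails.\<close>

lemma ldp_one_sided: assumes sg: "\<bar>\<sigma>\<bar> = 1" and e: "e > 0"
  shows "\<exists>c>0. \<exists>C. \<forall>n x. norm x = 1 \<longrightarrow> measure (K n) {g. \<sigma> * ln (norm (g *v x)) \<ge> real n * (\<sigma> * lyap + e)} \<le> C * exp (- (c * real n))"
proof -
  obtain D where D: "\<And>n x. norm x = 1 \<Longrightarrow> \<bar>drift n x - real n * lyap\<bar> \<le> D" using lyap by blast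
  obtain N0 :: nat where N0: "4 * D / e < real N0" using reals_Archimedean2 by blast
  define N where "N = Suc N0"
  have "4 * D / e < real N" using N0 by (simp add: N_def)
  then have "D \<le> real N * (e / 4)" using e by (simp add: pos_divide_less_eq)
  then have b: "\<sigma> * drift N x \<le> real N * (\<sigma> * lyap + e / 4)" if "norm x = 1" for x
  proof -
    have "\<sigma> * (drift N x - real N * lyap) \<le> \<bar>\<sigma>\<bar> * \<bar>drift N x - real N * lyap\<bar>" by (metis abs_ge_self abs_mult)
    also have "\<dots> \<le> real N * (e / 4)" using sg D[OF that, of N] \<open>D \<le> _\<close> by simp
    finally show ?thesis by (simp add: algebra_simps)
  qed
  have "\<sigma> * lyap + e / 4 < \<sigma> * lyap + e / 2" using e by simp
  from moment_le_rate[OF sg _ b this] obtain s where s: "s > 0" and "\<exists>C. \<forall>n. moment_le (\<sigma> * s) n (C * exp (s * (\<sigma> * lyap + e / 2) * real n))"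
    by (auto simp: N_def)
  then obtain C where C: "\<And>n. moment_le (\<sigma> * s) n (C * exp (s * (\<sigma> * lyap + e / 2) * real n))" by blast
  have "measure (K n) {g. \<sigma> * ln (norm (g *v x)) \<ge> real n * (\<sigma> * lyap + e)} \<le> C * exp (- (s * e / 2 * real n))" if x: "norm x = 1" for n x
  proof -
    interpret prob_space "K n" by (rule prob_K)
    \<comment> \<open>The reciprocal of the threshold in Markov's inequality.\<close>
    define c where "c = exp (- (s * (real n * (\<sigma> * lyap + e))))"
    have m: "(\<lambda>g. ennreal (norm (g *v x) powr (\<sigma> * s))) \<in> borel_measurable (K n)" by measurable
    have "emeasure (K n) {g. \<sigma> * ln (norm (g *v x)) \<ge> real n * (\<sigma> * lyap + e)} \<le> emeasure (K n) {g \<in> space (K n). 1 \<le> ennreal c * ennreal (norm (g *v x) powr (\<sigma> * s))}"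
    proof (rule emeasure_mono_AE)
      show "AE g in K n. g \<in> {g. \<sigma> * ln (norm (g *v x)) \<ge> real n * (\<sigma> * lyap + e)} \<longrightarrow> g \<in> {g \<in> space (K n). 1 \<le> ennreal c * ennreal (norm (g *v x) powr (\<sigma> * s))}"
      proof (rule eventually_mono[OF AE_det_K], rule impI)
        fix g :: "real^2^2" assume g: "det g = 1" "g \<in> {g. \<sigma> * ln (norm (g *v x)) \<ge> real n * (\<sigma> * lyap + e)}"
        have nz: "g *v x \<noteq> 0" by (rule det1_unit_nz[OF g(1) x])
        have "c * norm (g *v x) powr (\<sigma> * s) = exp (s * (\<sigma> * ln (norm (g *v x)) - real n * (\<sigma> * lyap + e)))"
          using nz by (simp add: c_def powr_def exp_add[symmetric] algebra_simps)
        also have "\<dots> \<ge> 1" using g(2) s by simp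
        finally have "1 \<le> c * norm (g *v x) powr (\<sigma> * s)" .
        then show "g \<in> {g \<in> space (K n). 1 \<le> ennreal c * ennreal (norm (g *v x) powr (\<sigma> * s))}"
          by (simp add: ennreal_mult[symmetric] c_def)
      qed
      show "{g \<in> space (K n). 1 \<le> ennreal c * ennreal (norm (g *v x) powr (\<sigma> * s))} \<in> sets (K n)" by measurable
    qed
    also have "\<dots> \<le> ennreal c * (\<integral>\<^sup>+g. ennreal (norm (g *v x) powr (\<sigma> * s)) \<partial>K n)"
      using nn_integral_Markov_inequality[of "\<lambda>g. ennreal (norm (g *v x) powr (\<sigma> * s))" UNIV "K n" "ennreal c"] m by simp
    also have "\<dots> \<le> ennreal c * ennreal (C * exp (s * (\<sigma> * lyap + e / 2) * real n))"
      using C[of n] x by (intro mult_left_mono) (auto simp: moment_le_def)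
    also have "\<dots> = ennreal (c * (C * exp (s * (\<sigma> * lyap + e / 2) * real n)))"
      by (simp add: ennreal_mult'[symmetric] c_def)
    also have "c * (C * exp (s * (\<sigma> * lyap + e / 2) * real n)) = C * exp (- (s * e / 2 * real n))"
      unfolding c_def by (simp add: exp_add[symmetric] algebra_simps)
    finally have "emeasure (K n) {g. \<sigma> * ln (norm (g *v x)) \<ge> real n * (\<sigma> * lyap + e)} \<le> ennreal (C * exp (- (s * e / 2 * real n)))" .
    moreover have "0 \<le> C * exp (- (s * e / 2 * real n))" using C[of 0] by (simp add: moment_le_def)
    ultimately show ?thesis by (simp add: emeasure_eq_measure)
  qed
  then show ?thesis using s e by (intro exI[of _ "s * e / 2"] conjI exI[of _ C]) auto
qed

end

section \<open>Exponentially small probabilities and deviations of the norm\<close>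

text \<open>Exponential decay in \<open>n\<close> with constants that are uniform over the index set.\<close>

definition exp_small :: "'i set \<Rightarrow> ('i \<Rightarrow> nat \<Rightarrow> real) \<Rightarrow> bool" where
  "exp_small I F \<longleftrightarrow> (\<exists>c>0. \<exists>C. \<forall>n. \<forall>i\<in>I. F i n \<le> C * exp (- (c * real n)))"

lemma exp_smallI: "c > 0 \<Longrightarrow> (\<And>n i. i \<in> I \<Longrightarrow> F i n \<le> C * exp (- (c * real n))) \<Longrightarrow> exp_small I F"
  unfolding exp_small_def by blast

lemma exp_smallE: assumes "exp_small I F" 
  obtains c C where "c > 0" "C \<ge> 0" "\<And>n i. i \<in> I \<Longrightarrow> F i n \<le> C * exp (- (c * real n))"
proof -
  obtain c C where c: "c > 0" "\<And>n i. i \<in> I \<Longrightarrow> F i n \<le> C * exp (- (c * real n))" using assms unfolding exp_small_def by blast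
  have "F i n \<le> max C 0 * exp (- (c * real n))" if "i \<in> I" for n i
    by (rule order_trans[OF c(2)[OF that]]) (intro mult_right_mono, auto)
  then show ?thesis using that[of c "max C 0"] c(1) by auto
qed

lemma exp_small_mono: assumes "exp_small I G" "\<And>i n. i \<in> I \<Longrightarrow> F i n \<le> G i n" shows "exp_small I F"
  using assms unfolding exp_small_def by (meson order_trans)

lemma exp_small_add: assumes "exp_small I F" "exp_small I G" shows "exp_small I (\<lambda>i n. F i n + G i n)"
proof -
  obtain c C where c: "c > 0" "C \<ge> 0" "\<And>n i. i \<in> I \<Longrightarrow> F i n \<le> C * exp (- (c * real n))" by (rule exp_smallE[OF assms(1)], rule that)
  obtain d D where d: "d > 0" "D \<ge> 0" "\<And>n i. i \<in> I \<Longrightarrow> G i n \<le> D * exp (- (d * real n))" by (rule exp_smallE[OF assms(2)], rule that)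
  show ?thesis
  proof (rule exp_smallI)
    show "min c d > 0" using c d by simp
    fix n i assume i: "i \<in> I"
    have "C * exp (- (c * real n)) \<le> C * exp (- (min c d * real n))" "D * exp (- (d * real n)) \<le> D * exp (- (min c d * real n))"
      using c d by (auto intro!: mult_left_mono mult_right_mono)
    then show "F i n + G i n \<le> (C + D) * exp (- (min c d * real n))" using c(3)[OF i, of n] d(3)[OF i, of n] by (simp add: algebra_simps)
  qed
qed

text \<open>Finitely many indices \<open>n\<close> are absorbed in the constant.\<close>

lemma exp_small_eventually:
  assumes "exp_small I G" "\<And>i n. i \<in> I \<Longrightarrow> n \<ge> start \<Longrightarrow> F i n \<le> G i n" "\<And>i n. i \<in> I \<Longrightarrow> F i n \<le> 1"
  shows "exp_small I F"
proof -
  obtain c C where c: "c > 0" "C \<ge> 0" "\<And>n i. i \<in> I \<Longrightarrow> G i n \<le> C * exp (- (c * real n))" by (rule exp_smallE[OF assms(1)], rule that)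
  show ?thesis
  proof (rule exp_smallI[OF c(1)])
    fix n i assume i: "i \<in> I"
    show "F i n \<le> (C + exp (c * real start)) * exp (- (c * real n))"
    proof (cases "n \<ge> start")
      case True
      have "F i n \<le> C * exp (- (c * real n))" using assms(2)[OF i True] c(3)[OF i, of n] by linarith
      also have "\<dots> \<le> (C + exp (c * real start)) * exp (- (c * real n))" by (intro mult_right_mono) auto
      finally show ?thesis .
    next
      case False
      then have "1 \<le> exp (c * real start) * exp (- (c * real n))" using c(1) by (simp add: exp_add[symmetric])
      also have "\<dots> \<le> (C + exp (c * real start)) * exp (- (c * real n))" using c by (intro mult_right_mono) auto
      finally show ?thesis using assms(3)[OF i, of n] by linarith
    qed
  qed
qed

lemma exp_small_image: assumes "exp_small J G" "\<And>i. i \<in> I \<Longrightarrow> h i \<in> J" shows "exp_small I (\<lambda>i n. G (h i) n)"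
proof -
  obtain c C where c: "c > 0" "C \<ge> 0" "\<And>n i. i \<in> J \<Longrightarrow> G i n \<le> C * exp (- (c * real n))" by (rule exp_smallE[OF assms(1)], rule that)
  show ?thesis by (rule exp_smallI[OF c(1), where C=C]) (auto intro!: c(3) assms(2))
qed

lemma exp_small_less: assumes "exp_small I F" "i \<in> I" "e > 0" shows "\<exists>n0. \<forall>n\<ge>n0. F i n < e"
proof -
  obtain c C where c: "c > 0" "C \<ge> 0" "\<And>n i. i \<in> I \<Longrightarrow> F i n \<le> C * exp (- (c * real n))" by (rule exp_smallE[OF assms(1)], rule that)
  have "(\<lambda>n. C * exp (- (c * real n))) \<longlonglongrightarrow> 0" using c(1) by real_asymp
  from order_tendstoD(2)[OF this assms(3)] obtain n0 where "\<And>n. n \<ge> n0 \<Longrightarrow> C * exp (- (c * real n)) < e"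
    by (auto simp: eventually_sequentially)
  then show ?thesis using c(3)[OF assms(2)] le_less_trans by blast
qed

lemma sets_CollectI: "Measurable.pred borel P \<Longrightarrow> {g. P g} \<in> sets borel"
  by (simp add: pred_def)

context SL2_walk begin

lemma prob_K_le_1: "measure (K n) A \<le> 1"
  using prob_space.prob_le_1[OF prob_K] .

text \<open>The smaller set need not be measurable: its measure is then 0.\<close>

lemma meas_mono_AE:
  assumes "AE g in K n. g \<in> A \<longrightarrow> g \<in> B" "B \<in> sets borel" shows "measure (K n) A \<le> measure (K n) B"
proof -
  interpret prob_space "K n" by (rule prob_K)
  show ?thesis
  proof (cases "A \<in> sets (K n)")
    case True
    then show ?thesis using assms by (intro finite_measure_mono_AE) auto
  next
    case False then show ?thesis by (simp add: measure_notin_sets)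
  qed
qed

lemma meas_Un: assumes "A \<in> sets borel" "B \<in> sets borel" shows "measure (K n) (A \<union> B) \<le> measure (K n) A + measure (K n) B"
  using assms by (intro measure_Un_le) auto

lemma ldp_upper: assumes "e > 0" shows "exp_small {x. norm x = 1} (\<lambda>x n. measure (K n) {g. ln (norm (g *v x)) \<ge> real n * (lyap + e)})"
  using ldp_one_sided[of 1 e] assms unfolding exp_small_def by simp

lemma ldp_lower: assumes "e > 0" shows "exp_small {x. norm x = 1} (\<lambda>x n. measure (K n) {g. ln (norm (g *v x)) \<le> real n * (lyap - e)})"
proof -
  have e: "{g. - 1 * ln (norm (g *v x)) \<ge> real n * (- 1 * lyap + e)} = {g. ln (norm (g *v x)) \<le> real n * (lyap - e)}" for x :: "real^2" and n
    by (auto simp: algebra_simps)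
  have "\<exists>c>0. \<exists>C. \<forall>n x. norm x = 1 \<longrightarrow> measure (K n) {g. - 1 * ln (norm (g *v x)) \<ge> real n * (- 1 * lyap + e)} \<le> C * exp (- (c * real n))"
    by (rule ldp_one_sided[OF _ assms]) simp
  then show ?thesis unfolding e exp_small_def by blast
qed

text \<open>The norm is controlled by the images of the two basis vectors.\<close>

lemma norm_cols: "norm (g::real^2^2) \<le> norm (g *v axis 1 1) + norm (g *v axis 2 1)"
proof -
  have "(norm g)\<^sup>2 = (norm (g *v axis 1 1))\<^sup>2 + (norm (g *v axis 2 1))\<^sup>2"
    unfolding normm_sq norm2_sq mv_nth by (simp add: axis_def)
  also have "\<dots> \<le> (norm (g *v axis 1 1) + norm (g *v axis 2 1))\<^sup>2" by (simp add: power2_sum)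
  finally show ?thesis by (rule power2_le_imp_le) simp
qed

lemma axis_unit: "norm (axis i (1::real) :: real^2) = 1" by simp

lemma ldp_norm_lower: assumes "e > 0" shows "exp_small UNIV (\<lambda>_::unit. \<lambda>n. measure (K n) {g. ln (norm g) \<le> real n * (lyap - e)})"
proof (rule exp_small_mono)
  show "exp_small UNIV (\<lambda>_::unit. \<lambda>n. measure (K n) {g. ln (norm (g *v axis 1 1)) \<le> real n * (lyap - e)})"
    using exp_small_image[OF ldp_lower[OF assms], of UNIV "\<lambda>_. axis 1 1"] by simp
  fix i :: unit and n
  show "measure (K n) {g. ln (norm g) \<le> real n * (lyap - e)} \<le> measure (K n) {g. ln (norm (g *v axis 1 1)) \<le> real n * (lyap - e)}"
  proof (rule meas_mono_AE, rule eventually_mono[OF AE_det_K])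
    fix g :: "real^2^2" assume "det g = 1"
    from ln_mv_bound[OF this axis_unit[of 1]]
    show "g \<in> {g. ln (norm g) \<le> real n * (lyap - e)} \<longrightarrow> g \<in> {g. ln (norm (g *v axis 1 1)) \<le> real n * (lyap - e)}" by auto
  qed (rule sets_CollectI, measurable)
qed

lemma ldp_norm_upper: assumes e: "e > 0" shows "exp_small UNIV (\<lambda>_::unit. \<lambda>n. measure (K n) {g. ln (norm g) \<ge> real n * (lyap + e)})"
proof -
  define B where "B i n = {g::real^2^2. ln (norm (g *v axis i 1)) \<ge> real n * (lyap + e / 2)}" for i :: 2 and n :: nat
  have Bs: "B i n \<in> sets borel" for i n unfolding B_def by (rule sets_CollectI, measurable)
  have u: "exp_small UNIV (\<lambda>_::unit. \<lambda>n. measure (K n) (B i n))" for i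
    unfolding B_def using exp_small_image[OF ldp_upper[of "e/2"], of UNIV "\<lambda>_. axis i 1"] e by simp
  obtain n0 :: nat where n0: "2 * ln 2 / e < real n0" using reals_Archimedean2 by blast
  show ?thesis
  proof (rule exp_small_eventually[OF exp_small_add[OF u[of 1] u[of 2]], where start=n0])
    fix i :: unit and n assume n: "n0 \<le> n"
    have "measure (K n) {g. ln (norm g) \<ge> real n * (lyap + e)} \<le> measure (K n) (B 1 n \<union> B 2 n)"
    proof (rule meas_mono_AE, rule eventually_mono[OF AE_det_K], rule impI)
      fix g :: "real^2^2" assume g: "det g = 1" "g \<in> {g. ln (norm g) \<ge> real n * (lyap + e)}"
      define m where "m = max (norm (g *v axis 1 1)) (norm (g *v axis 2 1))"
      have p: "norm (g *v axis 1 1) > 0" using det1_unit_nz[OF g(1) axis_unit] by simp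
      then have mp: "m > 0" unfolding m_def by (simp add: less_max_iff_disj)
      have "norm g \<le> 2 * m" using norm_cols[of g] unfolding m_def by linarith
      moreover have "norm g > 0" using det1_norm_ge1[OF g(1)] by linarith
      ultimately have "ln (norm g) \<le> ln (2 * m)" by (intro ln_mono) auto
      also have "\<dots> = ln 2 + ln m" using mp by (intro ln_mult_pos) auto
      finally have "real n * (lyap + e) - ln 2 \<le> ln m" using g(2) by simp
      moreover have "ln 2 \<le> real n * (e / 2)"
      proof -
        have "2 * ln 2 / e < real n" using n0 n by linarith
        then have "2 * ln 2 < real n * e" using e by (simp add: pos_divide_less_eq)
        then show ?thesis by simp
      qed
      ultimately have "real n * (lyap + e / 2) \<le> ln m" by (simp add: algebra_simps)
      then show "g \<in> B 1 n \<union> B 2 n" unfolding B_def m_def by (auto simp: max_def split: if_splits)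
    qed (use Bs in auto)
    also have "\<dots> \<le> measure (K n) (B 1 n) + measure (K n) (B 2 n)" by (intro meas_Un Bs)
    finally show "measure (K n) {g. ln (norm g) \<ge> real n * (lyap + e)} \<le> measure (K n) (B 1 n) + measure (K n) (B 2 n)" .
  qed (rule prob_K_le_1)
qed

end

section \<open>The transposed walk and regularity of coefficients\<close>

text \<open>The exponent can be read off the law of the norm alone: otherwise one event and its complement would both be
unlikely.\<close>

lemma lyap_le_of_norm_law:
  assumes w1: "SL2_walk k1 t1" and w2: "SL2_walk k2 t2" 
    and eq: "\<And>n A. A \<in> sets borel \<Longrightarrow> measure (mconv_pow k1 n) {g. ln (norm g) \<in> A} = measure (mconv_pow k2 n) {g. ln (norm g) \<in> A}"
  shows "SL2_walk.lyap k1 \<le> SL2_walk.lyap k2"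
proof (rule ccontr)
  interpret a: SL2_walk k1 t1 by fact
  interpret b: SL2_walk k2 t2 by fact
  assume "\<not> ?thesis"
  define e where "e = (a.lyap - b.lyap) / 2"
  have e: "e > 0" using \<open>\<not> _\<close> by (simp add: e_def)
  obtain n1 where n1: "\<And>n. n \<ge> n1 \<Longrightarrow> measure (a.K n) {g. ln (norm g) \<le> real n * (a.lyap - e)} < 1/4"
    using exp_small_less[OF a.ldp_norm_lower[OF e], of "()" "1/4"] by auto
  obtain n2 where n2: "\<And>n. n \<ge> n2 \<Longrightarrow> measure (b.K n) {g. ln (norm g) \<ge> real n * (b.lyap + e)} < 1/4"
    using exp_small_less[OF b.ldp_norm_upper[OF e], of "()" "1/4"] by auto
  define n where "n = max n1 n2"
  interpret B: prob_space "b.K n" by (rule b.prob_K)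
  have le: "a.lyap - e = b.lyap + e" by (simp add: e_def field_simps)
  have "measure (b.K n) {g. ln (norm g) \<le> real n * (b.lyap + e)} < 1/4"
    using n1[of n] eq[of "{..real n * (b.lyap + e)}" n] by (simp add: n_def le)
  moreover have "measure (b.K n) {g. ln (norm g) \<ge> real n * (b.lyap + e)} < 1/4" using n2[of n] by (simp add: n_def)
  moreover have "measure (b.K n) ({g. ln (norm g) \<le> real n * (b.lyap + e)} \<union> {g. ln (norm g) \<ge> real n * (b.lyap + e)})
     \<le> measure (b.K n) {g. ln (norm g) \<le> real n * (b.lyap + e)} + measure (b.K n) {g. ln (norm g) \<ge> real n * (b.lyap + e)}"
    by (intro b.meas_Un; rule sets_CollectI; measurable)
  moreover have "{g. ln (norm g) \<le> real n * (b.lyap + e)} \<union> {g. ln (norm g) \<ge> real n * (b.lyap + e)} = (UNIV :: (real^2^2) set)" by auto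
  ultimately show False using B.prob_space by simp
qed

lemma transpose_linear: "linear (transpose :: real^2^2 \<Rightarrow> real^2^2)"
  by (rule linearI) (simp_all add: transpose_def vec_eq_iff)

lemma transpose_mv: "inner ((g::real^2^2) *v x) l = inner x (transpose g *v l)"
  by (simp add: inner2 mv_nth transpose_def algebra_simps)

context SL2_walk begin

definition transpose_law :: "(real^2^2) measure" where "transpose_law = distr \<kappa> borel transpose"

lemma transpose_measurable [measurable]: "(transpose :: real^2^2 \<Rightarrow> real^2^2) \<in> borel_measurable borel"
  using borel_transpose[of "\<lambda>x. x" borel] by simp

lemma law_distr_T: assumes "SL2_law A" shows "SL2_law (distr A borel transpose)"
proof -
  interpret A: prob_space A by (rule lawD) fact
  note [measurable_cong] = lawD(2)[OF assms(1)]
  have "prob_space (distr A borel transpose)" by (rule A.prob_space_distr) measurable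
  moreover have "AE g in distr A borel transpose. det g = 1"
    using lawD(3)[OF assms] sets_det1 by (subst AE_distr_iff) (auto simp: det_transpose)
  ultimately show ?thesis by (simp add: SL2_law_def)
qed

lemma law_transpose: "SL2_law transpose_law" unfolding transpose_law_def by (rule law_distr_T[OF SL2_law])

text \<open>Transposition reverses the order of the factors, which is harmless for convolution powers.\<close>

lemma mconv_pow_transpose: "mconv_pow transpose_law n = distr (K n) borel transpose"
proof (induction n)
  case 0
  show ?case by (simp add: distr_return transpose_mat)
next
  case (Suc n)
  have "mconv (distr \<kappa> borel transpose) (distr (K n) borel transpose) = distr (mconv (K n) \<kappa>) borel transpose"
  proof (rule law_eqI)
    show "SL2_law (mconv (distr \<kappa> borel transpose) (distr (K n) borel transpose))" by (intro law_mconv law_distr_T SL2_law lawK)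
    show "SL2_law (distr (mconv (K n) \<kappa>) borel transpose)" by (intro law_mconv law_distr_T SL2_law lawK)
    fix f :: "real^2^2 \<Rightarrow> ennreal" assume [measurable]: "f \<in> borel_measurable borel"
    interpret K: prob_space "K n" by (rule prob_K)
    have "(\<integral>\<^sup>+g. f g \<partial>mconv (distr \<kappa> borel transpose) (distr (K n) borel transpose)) 
       = (\<integral>\<^sup>+g. \<integral>\<^sup>+h. f (transpose g ** transpose h) \<partial>K n \<partial>\<kappa>)"
      by (simp add: nn_integral_mconv law_distr_T SL2_law lawK nn_integral_distr)
    also have "\<dots> = (\<integral>\<^sup>+g. \<integral>\<^sup>+h. f (transpose (h ** g)) \<partial>K n \<partial>\<kappa>)" by (simp add: matrix_transpose_mul)
    also have "\<dots> = (\<integral>\<^sup>+g. f (transpose g) \<partial>mconv (K n) \<kappa>)"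
      by (rule nn_integral_mconv'[symmetric, OF lawK SL2_law]) measurable
    also have "\<dots> = (\<integral>\<^sup>+g. f g \<partial>distr (mconv (K n) \<kappa>) borel transpose)"
      by (subst nn_integral_distr) (auto simp: measurable_cong_sets[OF sets_mconv refl])
    finally show "(\<integral>\<^sup>+g. f g \<partial>mconv (distr \<kappa> borel transpose) (distr (K n) borel transpose)) = (\<integral>\<^sup>+g. f g \<partial>distr (mconv (K n) \<kappa>) borel transpose)" .
  qed
  then show ?case using Suc mconv_pow_Suc'[OF SL2_law, of n] by (simp add: transpose_law_def)
qed

text \<open>Transposes of algebraic subgroups are algebraic subgroups.\<close>

lemma walk_transpose: "SL2_walk transpose_law \<tau>"
proof
  show "SL2_law transpose_law" by (rule law_transpose)
  show "integrable transpose_law (\<lambda>g. norm g powr \<tau>)" unfolding transpose_law_def using moment by (subst integrable_distr_eq) auto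
  fix V assume V: "algebraic_subvariety V" "subgroup V SL2" "AE g in transpose_law. g \<in> V"
  obtain F where F: "\<And>P. P \<in> F \<Longrightarrow> real_polynomial_function P" "V = {A \<in> carrier SL2. \<forall>P\<in>F. P A = 0}"
    using V(1) unfolding algebraic_subvariety_def by blast
  define V' where "V' = {A. transpose A \<in> V}"
  interpret subgroup V SL2 by fact
  have "algebraic_subvariety V'" unfolding algebraic_subvariety_def
  proof (intro exI conjI ballI)
    show "V' = {A \<in> carrier SL2. \<forall>P\<in>(\<lambda>P. P \<circ> transpose) ` F. P A = 0}" unfolding V'_def F(2) by (auto simp: SL2_simps det_transpose)
    fix P assume "P \<in> (\<lambda>P. P \<circ> (transpose :: real^2^2 \<Rightarrow> real^2^2)) ` F"
    then show "real_polynomial_function P"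
      using F(1) transpose_linear by (auto intro!: real_polynomial_function_compose polynomial_function_bounded_linear simp: linear_conv_bounded_linear)
  qed
  moreover have "subgroup V' SL2"
  proof (rule subgroup_SL2I)
    show "V' \<subseteq> {A. det A = 1}" unfolding V'_def using F(2) by (auto simp: SL2_simps det_transpose)
    show "mat 1 \<in> V'" using one_closed by (simp add: V'_def SL2_simps transpose_mat)
    show "g ** h \<in> V'" if "g \<in> V'" "h \<in> V'" for g h using m_closed[of "transpose h" "transpose g"] that by (simp add: V'_def SL2_simps matrix_transpose_mul)
    show "h \<in> V'" if g: "g \<in> V'" "det h = 1" "g ** h = mat 1" "h ** g = mat 1" for g h
    proof -
      interpret G: group SL2 by (rule group_SL2)
      have c: "transpose g \<in> carrier SL2" "transpose h \<in> carrier SL2" using g F(2) by (auto simp: V'_def SL2_simps det_transpose)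
      have "transpose h ** transpose g = mat 1" using g(3) matrix_transpose_mul[of g h] by (simp add: transpose_mat)
      then have "transpose h = inv\<^bsub>SL2\<^esub> (transpose g)" using c by (intro G.inv_equality[symmetric]) (auto simp: SL2_simps)
      then show ?thesis using m_inv_closed[of "transpose g"] g by (simp add: V'_def)
    qed
  qed
  moreover have "AE g in \<kappa>. g \<in> V'"
    using AE_distrD[OF _ V(3)[unfolded transpose_law_def]] by (simp add: V'_def)
  ultimately have "V' = carrier SL2" by (rule nonel)
  show "V = carrier SL2"
  proof (rule Set.set_eqI)
    fix A :: "real^2^2"
    have "A \<in> V \<longleftrightarrow> transpose A \<in> V'" by (simp add: V'_def)
    also have "\<dots> \<longleftrightarrow> A \<in> carrier SL2" using \<open>V' = carrier SL2\<close> by (simp add: SL2_simps det_transpose)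
    finally show "A \<in> V \<longleftrightarrow> A \<in> carrier SL2" .
  qed
qed (use tau in auto)

lemma measure_transpose: assumes "A \<in> sets borel" shows "measure (mconv_pow transpose_law n) A = measure (K n) {g. transpose g \<in> A}"
  unfolding mconv_pow_transpose using assms by (subst measure_distr) (auto simp: vimage_def)

text \<open>A matrix and its transpose have the same norm.\<close>

lemma lyap_transpose: "SL2_walk.lyap transpose_law = lyap"
proof -
  have s: "{g::real^2^2. ln (norm g) \<in> A} \<in> sets borel" if "A \<in> sets borel" for A
    using measurable_sets[of "\<lambda>g::real^2^2. ln (norm g)" borel borel A] that by (simp add: vimage_def)
  have "measure (mconv_pow transpose_law n) {g. ln (norm g) \<in> A} = measure (K n) {g. ln (norm g) \<in> A}" if "A \<in> sets borel" for n A
    using measure_transpose[OF s[OF that], of n] by simp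
  then show ?thesis using lyap_le_of_norm_law[OF walk_transpose SL2_walk_axioms] lyap_le_of_norm_law[OF SL2_walk_axioms walk_transpose] by (simp add: antisym)
qed

lemma ldp_transpose_lower: assumes "e > 0" shows "exp_small {l. norm l = 1} (\<lambda>l n. measure (K n) {g. ln (norm (transpose g *v l)) \<le> real n * (lyap - e)})"
proof -
  interpret T: SL2_walk transpose_law \<tau> by (rule walk_transpose)
  have "measure (mconv_pow transpose_law n) {g. ln (norm (g *v l)) \<le> real n * (lyap - e)} = measure (K n) {g. ln (norm (transpose g *v l)) \<le> real n * (lyap - e)}" for n l
    by (subst measure_transpose) (auto intro!: sets_CollectI)
  then show ?thesis using T.ldp_lower[OF assms] by (simp add: lyap_transpose)
qed

text \<open>In the plane \<open>\<langle>b, l\<rangle> a - \<langle>a, l\<rangle> b\<close> is \<open>a \<and> b\<close> times a unit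
vector.\<close>

lemma coefficient_identity: 
  assumes "wedge a b = 1" "norm l = 1" shows "\<bar>inner b l\<bar> * norm a \<le> 1 + \<bar>inner a l\<bar> * norm b"
proof -
  have e: "inner b l *\<^sub>R a = inner a l *\<^sub>R b - wedge a b *\<^sub>R quarter_turn l"
    by (rule vec2_eqI) (simp_all add: inner2 wedge_def algebra_simps)
  have "\<bar>inner b l\<bar> * norm a = norm (inner a l *\<^sub>R b - wedge a b *\<^sub>R quarter_turn l)" using e by (metis norm_scaleR)
  also have "\<dots> \<le> norm (inner a l *\<^sub>R b) + norm (wedge a b *\<^sub>R quarter_turn l)" by (rule norm_triangle_ineq4)
  finally show ?thesis using assms by simp
qed

text \<open>Put \<open>a = gx\<close> and \<open>b = gx'\<close> with \<open>x'\<close> orthogonal to \<open>x\<close>. Outside an exponentially small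
event all of \<open>|a|\<close>, \<open>|b|\<close>, \<open>|g\<^sup>T l|\<close> are close to \<open>e\<^sup>n\<^sup>\<lambda>\<close>. If \<open>\<langle>a, l\<rangle>\<close> were much
smaller, then so would be \<open>\<langle>b, l\<rangle>\<close> by \<open>coefficient_identity\<close>; but these two numbers are the
coordinates of \<open>g\<^sup>T l\<close> in the basis \<open>x, x'\<close>.\<close>

theorem coefficient_regularity: assumes e: "e > 0"
  shows "exp_small {(x,l). norm x = 1 \<and> norm l = 1} (\<lambda>(x,l) n. measure (K n) {g. \<bar>inner (g *v x) l\<bar> < exp (real n * (lyap - e))})"
proof -
  \<comment> \<open>A quarter of the allowed loss for each estimate; the second bound makes \<open>X\<^sup>2 \<le> Y\<close> below.\<close>
  define d where "d = min (e / 4) (lyap / 2)"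
  have d: "d > 0" "4 * d \<le> e" "2 * d \<le> lyap" using e lyap by (auto simp: d_def)
  define B1 where "B1 x n = {g::real^2^2. ln (norm (g *v x)) \<le> real n * (lyap - d)}" for x and n :: nat
  define B2 where "B2 x n = {g::real^2^2. ln (norm (g *v quarter_turn x)) \<ge> real n * (lyap + d)}" for x and n :: nat
  define B3 where "B3 l n = {g::real^2^2. ln (norm (transpose g *v l)) \<le> real n * (lyap - d)}" for l and n :: nat
  have Bs: "B1 x n \<in> sets borel" "B2 x n \<in> sets borel" "B3 x n \<in> sets borel" for x n
    unfolding B1_def B2_def B3_def by (rule sets_CollectI, measurable)+
  let ?I = "{(x::real^2,l::real^2). norm x = 1 \<and> norm l = 1}"
  have u1: "exp_small ?I (\<lambda>i n. measure (K n) (B1 (fst i) n))" unfolding B1_def by (rule exp_small_image[OF ldp_lower[OF d(1)]]) auto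
  have u2: "exp_small ?I (\<lambda>i n. measure (K n) (B2 (fst i) n))" unfolding B2_def by (rule exp_small_image[OF ldp_upper[OF d(1)], where h="\<lambda>i. quarter_turn (fst i)"]) auto
  have u3: "exp_small ?I (\<lambda>i n. measure (K n) (B3 (snd i) n))" unfolding B3_def by (rule exp_small_image[OF ldp_transpose_lower[OF d(1)]]) auto
  obtain n0 :: nat where n0: "ln 3 / d < real n0" using reals_Archimedean2 by blast
  show ?thesis
  proof (rule exp_small_eventually[OF exp_small_add[OF u1 exp_small_add[OF u2 u3]], where start=n0])
    fix i :: "(real^2) \<times> (real^2)" and n assume i: "i \<in> ?I" and n: "n0 \<le> n"
    obtain x l where xl: "i = (x, l)" by (cases i)
    have x: "norm x = 1" and l: "norm l = 1" using i xl by auto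
    have n3: "3 \<le> exp (real n * d)"
    proof -
      have "ln 3 / d < real n" using n0 n by linarith
      then have "ln 3 \<le> real n * d" using d by (simp add: pos_divide_less_eq)
      then have "exp (ln 3) \<le> exp (real n * d)" by (simp only: exp_le_cancel_iff)
      then show ?thesis by simp
    qed
    have "measure (K n) {g. \<bar>inner (g *v x) l\<bar> < exp (real n * (lyap - e))} \<le> measure (K n) (B1 x n \<union> (B2 x n \<union> B3 l n))"
    proof (rule meas_mono_AE, rule eventually_mono[OF AE_det_K], rule impI, rule ccontr)
      fix g :: "real^2^2" assume g: "det g = 1" "g \<in> {g. \<bar>inner (g *v x) l\<bar> < exp (real n * (lyap - e))}" "g \<notin> B1 x n \<union> (B2 x n \<union> B3 l n)"
      define a b where "a = g *v x" and "b = g *v quarter_turn x"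
      have nz: "a \<noteq> 0" "b \<noteq> 0" unfolding a_def b_def using det1_unit_nz[OF g(1)] x by auto
      have "det (transpose g) = 1" using g(1) by (simp add: det_transpose)
      from det1_unit_nz[OF this l] have nzl: "transpose g *v l \<noteq> 0" .
      define X where "X = exp (real n * d)"
      define Y where "Y = exp (real n * lyap)"
      have X: "X \<ge> 3" "X > 0" and Y: "Y > 0" using n3 by (auto simp: X_def Y_def)
      have XY: "X\<^sup>2 \<le> Y"
      proof -
        have "X\<^sup>2 = exp (real n * (2 * d))" by (simp add: X_def power2_eq_square exp_add[symmetric])
        also have "\<dots> \<le> Y" unfolding Y_def using d by (simp add: mult_left_mono)
        finally show ?thesis .
      qed
      have em: "exp (real n * (lyap - d)) = Y / X" "exp (real n * (lyap + d)) = Y * X"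
        by (simp_all add: X_def Y_def exp_add[symmetric] exp_diff[symmetric] algebra_simps)
      have "exp (real n * (lyap - e)) \<le> exp (real n * (lyap - 4 * d))" using d by (simp add: mult_left_mono)
      also have "\<dots> = Y / X ^ 4" by (simp add: X_def Y_def exp_of_nat_mult[symmetric] exp_diff[symmetric] algebra_simps)
      finally have t: "\<bar>inner a l\<bar> < Y / X ^ 4" using g(2) by (simp add: a_def)
      have "real n * (lyap - d) < ln (norm a)" using g(3) by (simp add: B1_def a_def)
      then have no_line_atoms: "Y / X < norm a" using nz em(1) by (metis exp_less_cancel_iff exp_ln zero_less_norm_iff)
      have "ln (norm b) < real n * (lyap + d)" using g(3) by (simp add: B2_def b_def)
      then have nb: "norm b < Y * X" using nz em(2) by (metis exp_less_cancel_iff exp_ln zero_less_norm_iff)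
      have "real n * (lyap - d) < ln (norm (transpose g *v l))" using g(3) by (simp add: B3_def)
      then have nl: "Y / X < norm (transpose g *v l)" using nzl em(1) by (metis exp_less_cancel_iff exp_ln zero_less_norm_iff)
      have w: "wedge a b = 1" using g(1) x by (simp add: a_def b_def wedge_mv wedge_quarter_turn)
      have "\<bar>inner b l\<bar> * (Y / X) \<le> \<bar>inner b l\<bar> * norm a" using no_line_atoms by (intro mult_left_mono) auto
      also have "\<dots> \<le> 1 + \<bar>inner a l\<bar> * norm b" by (rule coefficient_identity[OF w l])
      also have "\<dots> \<le> 1 + (Y / X ^ 4) * (Y * X)" using t nb Y X by (intro add_left_mono mult_mono) auto
      finally have "\<bar>inner b l\<bar> \<le> (1 + (Y / X ^ 4) * (Y * X)) / (Y / X)" using X Y by (subst pos_le_divide_eq) auto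
      also have "\<dots> = X / Y + Y / X\<^sup>2" using X Y by (simp add: field_simps power2_eq_square power4_eq_xxxx)
      also have "X / Y \<le> Y / X\<^sup>2 / 3"
      proof -
        have "3 * X ^ 3 \<le> X * X ^ 3" using X by (intro mult_right_mono) auto
        also have "\<dots> = X\<^sup>2 * X\<^sup>2" by (simp add: power2_eq_square power3_eq_cube)
        also have "\<dots> \<le> Y * Y" using XY Y X by (intro mult_mono) auto
        finally show ?thesis using X Y by (simp add: field_simps power2_eq_square power3_eq_cube)
      qed
      finally have b1: "\<bar>inner b l\<bar> \<le> 4 / 3 * (Y / X\<^sup>2)" by simp
      have "Y / X ^ 4 \<le> Y / X\<^sup>2" using X Y by (intro divide_left_mono power_increasing mult_pos_pos) auto
      then have t1: "\<bar>inner a l\<bar> \<le> Y / X\<^sup>2" using t by linarith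
      have "norm (transpose g *v l) \<le> \<bar>inner a l\<bar> + \<bar>inner b l\<bar>"
      proof -
        have "(norm (transpose g *v l))\<^sup>2 = (inner x (transpose g *v l))\<^sup>2 + (inner (quarter_turn x) (transpose g *v l))\<^sup>2"
          using wedge_inner[of x "transpose g *v l"] x by (simp add: wedge_def inner2[of "quarter_turn x"] algebra_simps power2_commute)
        also have "\<dots> = \<bar>inner a l\<bar>\<^sup>2 + \<bar>inner b l\<bar>\<^sup>2" by (simp add: a_def b_def transpose_mv)
        also have "\<dots> \<le> (\<bar>inner a l\<bar> + \<bar>inner b l\<bar>)\<^sup>2" by (simp add: power2_sum)
        finally show ?thesis by (rule power2_le_imp_le) simp
      qed
      also have "\<dots> \<le> 3 * (Y / X\<^sup>2)" using b1 t1 Y X zero_le_divide_iff[of Y "X\<^sup>2"] by simp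
      also have "\<dots> \<le> X * (Y / X\<^sup>2)" using X Y by (intro mult_right_mono) auto
      also have "\<dots> = Y / X" using X by (simp add: power2_eq_square)
      finally show False using nl by simp
    qed (use Bs in auto)
    also have "\<dots> \<le> measure (K n) (B1 x n) + (measure (K n) (B2 x n) + measure (K n) (B3 l n))"
      by (rule order_trans[OF meas_Un add_left_mono[OF meas_Un]]) (use Bs in auto)
    finally show "(case i of (x, l) \<Rightarrow> \<lambda>n. measure (K n) {g. \<bar>inner (g *v x) l\<bar> < exp (real n * (lyap - e))}) n
       \<le> measure (K n) (B1 (fst i) n) + (measure (K n) (B2 (fst i) n) + measure (K n) (B3 (snd i) n))" by (simp add: xl)
  qed (auto simp: prob_K_le_1)
qed

end

section \<open>Polynomial functions modulo the determinant relation\<close>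

text \<open>The monomials of degree \<open>D\<close> that do not contain both diagonal entries. They are indexed so that at the
rank one matrix \<open>u w\<^sup>T\<close> the value is \<open>u\<^sub>1\<^sup>p u\<^sub>2\<^sup>D\<^sup>-\<^sup>p w\<^sub>1\<^sup>q w\<^sub>2\<^sup>D\<^sup>-\<^sup>q\<close>.\<close>

definition normal_mono :: "nat \<Rightarrow> nat \<Rightarrow> nat \<Rightarrow> real^2^2 \<Rightarrow> real" where
  "normal_mono D p q g = (if D \<le> p + q then g$1$1 ^ (p + q - D) * g$1$2 ^ (D - q) * g$2$1 ^ (D - p)
     else g$2$2 ^ (D - p - q) * g$1$2 ^ p * g$2$1 ^ q)"

inductive normal_span :: "(real^2^2 \<Rightarrow> real) \<Rightarrow> bool" where
  nf_N: "p \<le> D \<Longrightarrow> q \<le> D \<Longrightarrow> normal_span (normal_mono D p q)"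
| nf_add: "normal_span f \<Longrightarrow> normal_span g \<Longrightarrow> normal_span (\<lambda>x. f x + g x)"
| nf_scale: "normal_span f \<Longrightarrow> normal_span (\<lambda>x. a * f x)"
| nf_cong: "normal_span f \<Longrightarrow> (\<And>g. det g = 1 \<Longrightarrow> f g = h g) \<Longrightarrow> normal_span h"

text \<open>A product of both diagonal entries is replaced by one plus the product of the other two; this produces a
second monomial whose degree is smaller by two.\<close>

lemma normal_mono_mult_entry:
  assumes pq: "p \<le> D" "q \<le> D"
  shows "normal_span (\<lambda>g. g$1$1 * normal_mono D p q g)" "normal_span (\<lambda>g. g$1$2 * normal_mono D p q g)" 
    "normal_span (\<lambda>g. g$2$1 * normal_mono D p q g)" "normal_span (\<lambda>g. g$2$2 * normal_mono D p q g)"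
proof -
  have dd: "g$1$1 * g$2$2 = 1 + g$1$2 * g$2$1" if "det g = 1" for g :: "real^2^2"
    using that by (simp add: det_2 algebra_simps)
  show "normal_span (\<lambda>g. g$1$1 * normal_mono D p q g)"
  proof (cases "D \<le> p + q")
    case True
    then have "normal_mono (Suc D) (Suc p) (Suc q) g = g$1$1 * normal_mono D p q g" for g
      by (simp add: normal_mono_def Suc_diff_le)
    then show ?thesis using nf_cong[OF nf_N[of "Suc p" "Suc D" "Suc q"], of "\<lambda>g. g$1$1 * normal_mono D p q g"] pq by simp
  next
    case False
    then obtain j where j: "D = p + q + Suc j" by (metis add_Suc_right less_imp_Suc_add not_le)
    have "normal_mono (p + q + j) p q g + normal_mono (Suc D) (Suc p) (Suc q) g = g$1$1 * normal_mono D p q g" if "det g = 1" for g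
    proof -
      have "g$1$1 * normal_mono D p q g = (g$1$1 * g$2$2) * (g$2$2 ^ j * g$1$2 ^ p * g$2$1 ^ q)"
        unfolding normal_mono_def j by simp
      also have "\<dots> = g$2$2 ^ j * g$1$2 ^ p * g$2$1 ^ q + g$2$2 ^ j * g$1$2 ^ Suc p * g$2$1 ^ Suc q"
        unfolding dd[OF that] by (simp add: algebra_simps)
      also have "g$2$2 ^ j * g$1$2 ^ p * g$2$1 ^ q = normal_mono (p + q + j) p q g" by (cases j) (simp_all add: normal_mono_def)
      also have "g$2$2 ^ j * g$1$2 ^ Suc p * g$2$1 ^ Suc q = normal_mono (Suc D) (Suc p) (Suc q) g" unfolding j by (cases j) (simp_all add: normal_mono_def)
      finally show ?thesis ..
    qed
    then show ?thesis using pq by (intro nf_cong[OF nf_add[OF nf_N[of p "p + q + j" q] nf_N[of "Suc p" "Suc D" "Suc q"]]]) auto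
  qed
  have "normal_mono (Suc D) (Suc p) q g = g$1$2 * normal_mono D p q g" for g
    using pq by (cases "D \<le> p + q") (simp_all add: normal_mono_def Suc_diff_le)
  then show "normal_span (\<lambda>g. g$1$2 * normal_mono D p q g)" using nf_cong[OF nf_N[of "Suc p" "Suc D" q], of "\<lambda>g. g$1$2 * normal_mono D p q g"] pq by simp
  have "normal_mono (Suc D) p (Suc q) g = g$2$1 * normal_mono D p q g" for g
    using pq by (cases "D \<le> p + q") (simp_all add: normal_mono_def Suc_diff_le)
  then show "normal_span (\<lambda>g. g$2$1 * normal_mono D p q g)" using nf_cong[OF nf_N[of p "Suc D" "Suc q"], of "\<lambda>g. g$2$1 * normal_mono D p q g"] pq by simp
  show "normal_span (\<lambda>g. g$2$2 * normal_mono D p q g)"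
  proof (cases "p + q \<le> D")
    case True
    have "normal_mono (Suc D) p q g = g$2$2 * normal_mono D p q g" for g
    proof (cases "p + q = D")
      case True then show ?thesis by (auto simp: normal_mono_def)
    next
      case False
      then obtain j where "D = p + q + Suc j" using True by (metis add_Suc_right less_imp_Suc_add le_neq_implies_less)
      then show ?thesis by (simp add: normal_mono_def)
    qed
    then show ?thesis using nf_cong[OF nf_N[of p "Suc D" q], of "\<lambda>g. g$2$2 * normal_mono D p q g"] pq by simp
  next
    case False
    then obtain j where j: "p + q = D + Suc j" by (metis add_Suc_right less_imp_Suc_add not_le)
    obtain p' q' where pq': "p = Suc p'" "q = Suc q'" using j pq by (cases p; cases q) auto
    obtain D' where D': "D = Suc D'" using pq pq' by (cases D) auto
    have j': "p' + q' = D' + j" using j pq' D' by simp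
    have "normal_mono D' p' q' g + normal_mono (Suc D) p q g = g$2$2 * normal_mono D p q g" if "det g = 1" for g
    proof -
      have "g$2$2 * normal_mono D p q g = (g$1$1 * g$2$2) * (g$1$1 ^ j * g$1$2 ^ (D - q) * g$2$1 ^ (D - p))"
        unfolding normal_mono_def j by simp
      also have "\<dots> = g$1$1 ^ j * g$1$2 ^ (D - q) * g$2$1 ^ (D - p) + g$1$1 ^ j * g$1$2 ^ Suc (D - q) * g$2$1 ^ Suc (D - p)"
        unfolding dd[OF that] by (simp add: algebra_simps)
      also have "g$1$1 ^ j * g$1$2 ^ (D - q) * g$2$1 ^ (D - p) = normal_mono D' p' q' g" unfolding normal_mono_def j' pq' D' by simp
      also have "g$1$1 ^ j * g$1$2 ^ Suc (D - q) * g$2$1 ^ Suc (D - p) = normal_mono (Suc D) p q g"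
        unfolding normal_mono_def j using pq by (simp add: Suc_diff_le)
      finally show ?thesis ..
    qed
    moreover have "p' \<le> D'" "q' \<le> D'" using pq pq' D' by auto
    ultimately show ?thesis using pq by (intro nf_cong[OF nf_add[OF nf_N[of p' D' q'] nf_N[of p "Suc D" q]]]) auto
  qed
qed

lemma normal_span_mult_entry: "normal_span f \<Longrightarrow> normal_span (\<lambda>g. g$i$j * f g)"
proof (induction f rule: normal_span.induct)
  case (nf_N p D q)
  then show ?case using normal_mono_mult_entry[OF nf_N] exhaust_2[of i] exhaust_2[of j] by auto
next
  case (nf_add f g)
  then show ?case using normal_span.nf_add[OF nf_add.IH] by (simp add: distrib_left)
next
  case (nf_scale f a)
  then show ?case using normal_span.nf_scale[OF nf_scale.IH, of a] by (simp add: mult.left_commute)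
next
  case (nf_cong f h)
  then show ?case by (intro normal_span.nf_cong[OF nf_cong.IH]) auto
qed

text \<open>Induction over the polynomial works because the claim is stated for multiplication operators: sums and
products of multipliers are again multipliers.\<close>

lemma normal_span_mult_polynomial: "real_polynomial_function P \<Longrightarrow> normal_span f \<Longrightarrow> normal_span (\<lambda>g. P g * f g)"
proof (induction P arbitrary: f rule: real_polynomial_function.induct)
  case (linear P)
  note nff = linear.prems
  interpret bounded_linear P by fact
  let ?E = "\<lambda>i j. axis i (axis j 1) :: real^2^2"
  have e0: "P g = P (?E 1 1) * g$1$1 + P (?E 1 2) * g$1$2 + P (?E 2 1) * g$2$1 + P (?E 2 2) * g$2$2" for g
    using arg_cong[OF mat2_axis[of g], of P] by (simp only: add scaleR real_scaleR_def mult.commute)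
  have e: "P g * f g = ((P (?E 1 1) * (g$1$1 * f g) + P (?E 1 2) * (g$1$2 * f g)) + P (?E 2 1) * (g$2$1 * f g)) + P (?E 2 2) * (g$2$2 * f g)" for g
    by (subst e0[of g]) (simp only: distrib_right mult.assoc)
  show ?case unfolding e by (intro nf_add nf_scale normal_span_mult_entry nff)
next
  case (const c) then show ?case by (rule nf_scale)
next
  case (add P Q) then show ?case using nf_add[OF add.IH(1)[OF add.prems] add.IH(2)[OF add.prems]] by (simp add: distrib_right)
next
  case (mult P Q) then show ?case using mult.IH(1)[OF mult.IH(2)[OF mult.prems]] by (simp add: mult.assoc)
qed

lemma normal_span_polynomial: assumes "real_polynomial_function P" shows "normal_span P"
proof -
  have "normal_span (\<lambda>g. P g * normal_mono 0 0 0 g)" by (intro normal_span_mult_polynomial assms nf_N) auto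
  then show ?thesis by (simp add: normal_mono_def)
qed

definition normal_mono3 :: "nat \<times> nat \<times> nat \<Rightarrow> real^2^2 \<Rightarrow> real" where "normal_mono3 t = (case t of (D, p, q) \<Rightarrow> normal_mono D p q)"

text \<open>A finite expansion in normal monomials whose coefficients vanish outside the index set, so that expansions over
different index sets can be added.\<close>

definition normal_expansion :: "(real^2^2 \<Rightarrow> real) \<Rightarrow> (nat \<times> nat \<times> nat) set \<Rightarrow> (nat \<times> nat \<times> nat \<Rightarrow> real) \<Rightarrow> bool" where
  "normal_expansion f T c \<longleftrightarrow> finite T \<and> T \<subseteq> {(D,p,q). p \<le> D \<and> q \<le> D} \<and> (\<forall>t. t \<notin> T \<longrightarrow> c t = 0) \<and>
   (\<forall>g. det g = 1 \<longrightarrow> f g = (\<Sum>t\<in>T. c t * normal_mono3 t g))"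

lemma normal_expansionD: assumes "normal_expansion f T c" shows "finite T" "T \<subseteq> {(D,p,q). p \<le> D \<and> q \<le> D}" "\<And>t. t \<notin> T \<Longrightarrow> c t = 0"
  "\<And>g. det g = 1 \<Longrightarrow> f g = (\<Sum>t\<in>T. c t * normal_mono3 t g)"
  using assms unfolding normal_expansion_def by auto

lemma normal_span_expansion: "normal_span f \<Longrightarrow> \<exists>T c. normal_expansion f T c"
proof (induction f rule: normal_span.induct)
  case (nf_N p D q)
  have "normal_expansion (normal_mono D p q) {(D,p,q)} (\<lambda>t. if t = (D,p,q) then 1 else 0)" using nf_N by (simp add: normal_expansion_def normal_mono3_def)
  then show ?case by blast
next
  case (nf_add f g)
  obtain T c where T: "normal_expansion f T c" using nf_add.IH(1) by blast
  obtain T' c' where T': "normal_expansion g T' c'" using nf_add.IH(2) by blast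
  have 1: "(\<Sum>t\<in>T. c t * normal_mono3 t h) = (\<Sum>t\<in>T \<union> T'. c t * normal_mono3 t h)" for h
    using normal_expansionD(1,3)[OF T] normal_expansionD(1)[OF T'] by (intro sum.mono_neutral_left) auto
  have 2: "(\<Sum>t\<in>T'. c' t * normal_mono3 t h) = (\<Sum>t\<in>T \<union> T'. c' t * normal_mono3 t h)" for h
    using normal_expansionD(1,3)[OF T'] normal_expansionD(1)[OF T] by (intro sum.mono_neutral_left) auto
  have "f h + g h = (\<Sum>t\<in>T \<union> T'. (c t + c' t) * normal_mono3 t h)" if "det h = 1" for h
    unfolding normal_expansionD(4)[OF T that] normal_expansionD(4)[OF T' that] 1 2 by (simp add: distrib_right sum.distrib)
  then have "normal_expansion (\<lambda>x. f x + g x) (T \<union> T') (\<lambda>t. c t + c' t)"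
    unfolding normal_expansion_def using normal_expansionD(1-3)[OF T] normal_expansionD(1-3)[OF T'] by simp
  then show ?case by blast
next
  case (nf_scale f a)
  obtain T c where T: "normal_expansion f T c" using nf_scale.IH by blast
  have "normal_expansion (\<lambda>x. a * f x) T (\<lambda>t. a * c t)"
    unfolding normal_expansion_def using normal_expansionD[OF T] by (simp add: sum_distrib_left mult.assoc)
  then show ?case by blast
next
  case (nf_cong f h)
  obtain T c where T: "normal_expansion f T c" using nf_cong.IH by blast
  have "normal_expansion h T c" unfolding normal_expansion_def using normal_expansionD[OF T] nf_cong.hyps(2) by simp
  then show ?case by blast
qed

lemma normal_mono_bound: assumes "p \<le> D" "q \<le> D" "\<And>i j. \<bar>g$i$j\<bar> \<le> R" shows "\<bar>normal_mono D p q g\<bar> \<le> R ^ D"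
proof -
  have b: "\<bar>x ^ i * y ^ j * z ^ k\<bar> \<le> R ^ (i + j + k)" if "\<bar>x\<bar> \<le> R" "\<bar>y\<bar> \<le> R" "\<bar>z\<bar> \<le> R" for x y z :: real and i j k
    unfolding abs_mult power_abs power_add using that by (intro mult_mono power_mono) auto
  show ?thesis
  proof (cases "D \<le> p + q")
    case True
    have "p + q - D + (D - q) + (D - p) = D" using True assms by linarith
    then show ?thesis using b[OF assms(3)[of 1 1] assms(3)[of 1 2] assms(3)[of 2 1], of "p + q - D" "D - q" "D - p"] True by (simp add: normal_mono_def)
  next
    case False
    have "D - p - q + p + q = D" using False by linarith
    then show ?thesis using b[OF assms(3)[of 2 2] assms(3)[of 1 2] assms(3)[of 2 1], of "D - p - q" p q] False by (simp add: normal_mono_def)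
  qed
qed

lemma pow_lip: assumes "\<bar>x\<bar> \<le> R" "\<bar>x'\<bar> \<le> R" "\<bar>x - x'\<bar> \<le> \<delta>" "1 \<le> (R::real)" shows "\<bar>x ^ i - x' ^ i\<bar> \<le> real i * \<delta> * R ^ i"
proof (induction i)
  case (Suc i)
  have "\<bar>x ^ Suc i - x' ^ Suc i\<bar> = \<bar>x * (x ^ i - x' ^ i) + (x - x') * x' ^ i\<bar>" by (simp add: algebra_simps)
  also have "\<dots> \<le> \<bar>x\<bar> * \<bar>x ^ i - x' ^ i\<bar> + \<bar>x - x'\<bar> * \<bar>x'\<bar> ^ i" by (metis abs_mult abs_triangle_ineq power_abs)
  also have "\<dots> \<le> R * (real i * \<delta> * R ^ i) + \<delta> * R ^ i"
    using assms Suc by (intro add_mono mult_mono power_mono) auto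
  also have "\<dots> \<le> R * (real i * \<delta> * R ^ i) + \<delta> * R ^ Suc i"
    using assms by (intro add_left_mono mult_left_mono power_increasing) auto
  also have "\<dots> = real (Suc i) * \<delta> * R ^ Suc i" by (simp add: algebra_simps)
  finally show ?case .
qed simp

text \<open>The bound loses a factor \<open>R\<close> against the optimal one, which the cut of the walk into unequal parts
compensates.\<close>

lemma mono_lip: 
  assumes x: "\<bar>x\<bar> \<le> R" "\<bar>x'\<bar> \<le> R" "\<bar>x - x'\<bar> \<le> \<delta>" and y: "\<bar>y\<bar> \<le> R" "\<bar>y'\<bar> \<le> R" "\<bar>y - y'\<bar> \<le> \<delta>"
    and z: "\<bar>z\<bar> \<le> R" "\<bar>z'\<bar> \<le> R" "\<bar>z - z'\<bar> \<le> \<delta>" and R: "1 \<le> (R::real)"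
  shows "\<bar>x ^ i * y ^ j * z ^ k - x' ^ i * y' ^ j * z' ^ k\<bar> \<le> real (i + j + k) * \<delta> * R ^ (i + j + k)"
proof -
  have d: "\<delta> \<ge> 0" using x(3) by linarith
  have "x ^ i * y ^ j * z ^ k - x' ^ i * y' ^ j * z' ^ k = 
     (x ^ i - x' ^ i) * (y ^ j * z ^ k) + x' ^ i * ((y ^ j - y' ^ j) * z ^ k) + x' ^ i * (y' ^ j * (z ^ k - z' ^ k))"
    by (simp add: algebra_simps)
  also have "\<bar>\<dots>\<bar> \<le> \<bar>(x ^ i - x' ^ i) * (y ^ j * z ^ k)\<bar> + \<bar>x' ^ i * ((y ^ j - y' ^ j) * z ^ k)\<bar> + \<bar>x' ^ i * (y' ^ j * (z ^ k - z' ^ k))\<bar>"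
    by (intro order_trans[OF abs_triangle_ineq] add_mono abs_triangle_ineq) auto
  also have "\<dots> = \<bar>x ^ i - x' ^ i\<bar> * (\<bar>y\<bar> ^ j * \<bar>z\<bar> ^ k) + \<bar>x'\<bar> ^ i * (\<bar>y ^ j - y' ^ j\<bar> * \<bar>z\<bar> ^ k) + \<bar>x'\<bar> ^ i * (\<bar>y'\<bar> ^ j * \<bar>z ^ k - z' ^ k\<bar>)"
    by (simp add: abs_mult power_abs)
  also have "\<dots> \<le> (real i * \<delta> * R ^ i) * (R ^ j * R ^ k) + R ^ i * ((real j * \<delta> * R ^ j) * R ^ k) + R ^ i * (R ^ j * (real k * \<delta> * R ^ k))"
  proof -
    have R0: "0 \<le> R" using R by simp
    have pw: "\<bar>w\<bar> ^ n \<le> R ^ n" if "\<bar>w\<bar> \<le> R" for w n by (rule power_mono[OF that abs_ge_zero])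
    have nn: "0 \<le> R ^ n" "0 \<le> real n * \<delta> * R ^ n" for n using R0 d by simp_all
    have 1: "\<bar>y\<bar> ^ j * \<bar>z\<bar> ^ k \<le> R ^ j * R ^ k" by (rule mult_mono[OF pw[OF y(1)] pw[OF z(1)]]) (simp_all add: nn)
    have 2: "\<bar>y ^ j - y' ^ j\<bar> * \<bar>z\<bar> ^ k \<le> (real j * \<delta> * R ^ j) * R ^ k" by (rule mult_mono[OF pow_lip[OF y R] pw[OF z(1)]]) (simp_all add: nn)
    have 3: "\<bar>y'\<bar> ^ j * \<bar>z ^ k - z' ^ k\<bar> \<le> R ^ j * (real k * \<delta> * R ^ k)" by (rule mult_mono[OF pw[OF y(2)] pow_lip[OF z R]]) (simp_all add: nn)
    show ?thesis
      by (intro add_mono mult_mono[OF pow_lip[OF x R] 1] mult_mono[OF pw[OF x(2)] 2] mult_mono[OF pw[OF x(2)] 3]) (simp_all add: nn)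
  qed
  also have "\<dots> = real (i + j + k) * \<delta> * R ^ (i + j + k)" by (simp add: power_add algebra_simps)
  finally show ?thesis .
qed

lemma normal_mono_lip:
  assumes "p \<le> D" "q \<le> D" and b: "\<And>i j. \<bar>g$i$j\<bar> \<le> R" "\<And>i j. \<bar>h$i$j\<bar> \<le> R" "\<And>i j. \<bar>g$i$j - h$i$j\<bar> \<le> \<delta>" and R: "1 \<le> R"
  shows "\<bar>normal_mono D p q g - normal_mono D p q h\<bar> \<le> real D * \<delta> * R ^ D"
proof (cases "D \<le> p + q")
  case True
  have "p + q - D + (D - q) + (D - p) = D" using True assms by linarith
  then show ?thesis using mono_lip[OF b(1-3)[of 1 1] b(1-3)[of 1 2] b(1-3)[of 2 1] R, of "p + q - D" "D - q" "D - p"] True by (simp add: normal_mono_def)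
next
  case False
  have "D - p - q + p + q = D" using False by linarith
  then show ?thesis using mono_lip[OF b(1-3)[of 2 2] b(1-3)[of 1 2] b(1-3)[of 2 1] R, of "D - p - q" p q] False by (simp add: normal_mono_def)
qed

definition outer :: "real^2 \<Rightarrow> real^2 \<Rightarrow> real^2^2" where "outer u w = (\<chi> i j. u$i * w$j)"

lemma outer_nth [simp]: "outer u w $ i $ j = u$i * w$j" by (simp add: outer_def)

lemma normal_mono_outer: assumes "p \<le> D" "q \<le> D" 
  shows "normal_mono D p q (outer u w) = u$1 ^ p * u$2 ^ (D - p) * (w$1 ^ q * w$2 ^ (D - q))"
proof (cases "D \<le> p + q")
  case True
  define i j k where "i = p + q - D" and "j = D - q" and "k = D - p"
  have e: "p = i + j" "q = i + k" "D - p = k" "D - q = j" using True assms by (auto simp: i_def j_def k_def)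
  have "normal_mono D p q (outer u w) = (u$1 * w$1) ^ i * (u$1 * w$2) ^ j * (u$2 * w$1) ^ k" using True by (simp add: normal_mono_def i_def j_def k_def)
  also have "\<dots> = u$1 ^ (i + j) * u$2 ^ k * (w$1 ^ (i + k) * w$2 ^ j)" by (simp add: power_mult_distrib power_add algebra_simps)
  finally show ?thesis using e by simp
next
  case False
  define i where "i = D - p - q"
  have e: "D - p = i + q" "D - q = i + p" using False assms by (auto simp: i_def)
  have "normal_mono D p q (outer u w) = (u$2 * w$2) ^ i * (u$1 * w$2) ^ p * (u$2 * w$1) ^ q" using False by (simp add: normal_mono_def i_def)
  also have "\<dots> = u$1 ^ p * u$2 ^ (i + q) * (w$1 ^ q * w$2 ^ (i + p))" by (simp add: power_mult_distrib power_add algebra_simps)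
  finally show ?thesis using e by simp
qed

text \<open>The number \<open>d\<close> is the largest degree that occurs in the expansion in normal monomials; it is positive because
the only normal monomial of degree 0 is constant.\<close>

theorem top_form:
  assumes P: "real_polynomial_function P" and nc: "\<not> P constant_on carrier SL2"
  shows "\<exists>d\<ge>1. \<exists>k L p0 q0. p0 \<le> d \<and> q0 \<le> d \<and> k p0 q0 \<noteq> 0 \<and> 
    (\<forall>g. det g = 1 \<longrightarrow> \<bar>P g - (\<Sum>p\<le>d. \<Sum>q\<le>d. k p q * normal_mono d p q g)\<bar> \<le> L * norm g ^ (d - 1))"
proof -
  obtain T0 c where "normal_expansion P T0 c" using normal_span_expansion[OF normal_span_polynomial[OF P]] by blast
  note T0 = normal_expansionD[OF this]
  define T where "T = {t \<in> T0. c t \<noteq> 0}"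
  have T: "finite T" "T \<subseteq> {(D,p,q). p \<le> D \<and> q \<le> D}" using T0 by (auto simp: T_def)
  have Tc: "c t \<noteq> 0 \<longleftrightarrow> t \<in> T" for t using T0(3)[of t] unfolding T_def by blast
  have PT: "P g = (\<Sum>t\<in>T. c t * normal_mono3 t g)" if "det g = 1" for g
    unfolding T0(4)[OF that] T_def using T0(1) by (intro sum.mono_neutral_right) auto
  have ex: "\<exists>t\<in>T. fst t \<ge> 1"
  proof (rule ccontr)
    assume "\<not> ?thesis"
    then have sub: "T \<subseteq> {(0,0,0)}" using T(2) by fastforce
    have "P g = (\<Sum>t\<in>T. c t)" if "g \<in> carrier SL2" for g
      using PT[of g] that sub by (auto simp: SL2_simps normal_mono3_def normal_mono_def intro!: sum.cong)
    then show False using nc by (auto simp: constant_on_def)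
  qed
  define d where "d = Max (fst ` T)"
  have dT: "fst t \<le> d" if "t \<in> T" for t unfolding d_def using T that by (intro Max_ge) auto
  have "d \<in> fst ` T" unfolding d_def using T ex by (intro Max_in) auto
  then obtain p0 q0 where pq0: "(d, p0, q0) \<in> T" by force
  have d1: "d \<ge> 1" using ex dT by (meson order_trans)
  define k where "k p q = c (d, p, q)" for p q
  define S where "S = {t \<in> T. fst t < d}"
  define L where "L = (\<Sum>t\<in>S. \<bar>c t\<bar>)"
  have dec: "P g - (\<Sum>p\<le>d. \<Sum>q\<le>d. k p q * normal_mono d p q g) = (\<Sum>t\<in>S. c t * normal_mono3 t g)" if "det g = 1" for g
  proof -
    have "(\<Sum>p\<le>d. \<Sum>q\<le>d. k p q * normal_mono d p q g) = (\<Sum>t\<in>{d} \<times> {..d} \<times> {..d}. c t * normal_mono3 t g)"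
      by (simp add: sum.cartesian_product' k_def normal_mono3_def)
    also have "\<dots> = (\<Sum>t\<in>T - S. c t * normal_mono3 t g)"
    proof (rule sum.mono_neutral_right)
      show "T - S \<subseteq> {d} \<times> {..d} \<times> {..d}" using T(2) dT by (fastforce simp: S_def)
      show "\<forall>t\<in>{d} \<times> {..d} \<times> {..d} - (T - S). c t * normal_mono3 t g = 0" using Tc by (auto simp: S_def)
    qed simp
    moreover have "P g = (\<Sum>t\<in>S. c t * normal_mono3 t g) + (\<Sum>t\<in>T - S. c t * normal_mono3 t g)"
      unfolding PT[OF that] using T(1) by (subst sum.subset_diff[of S T]) (auto simp: S_def)
    ultimately show ?thesis by simp
  qed
  have "\<bar>P g - (\<Sum>p\<le>d. \<Sum>q\<le>d. k p q * normal_mono d p q g)\<bar> \<le> L * norm g ^ (d - 1)" if g: "det g = 1" for g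
  proof -
    have n1: "norm g \<ge> 1" by (rule det1_norm_ge1[OF g])
    have "\<bar>\<Sum>t\<in>S. c t * normal_mono3 t g\<bar> \<le> (\<Sum>t\<in>S. \<bar>c t\<bar> * norm g ^ (d - 1))"
    proof (rule order_trans[OF sum_abs sum_mono])
      fix t assume t: "t \<in> S"
      obtain D p q where Dpq: "t = (D, p, q)" by (cases t)
      have D: "p \<le> D" "q \<le> D" "D \<le> d - 1" using t T(2) d1 by (auto simp: S_def Dpq)
      have "\<bar>normal_mono D p q g\<bar> \<le> norm g ^ D" by (rule normal_mono_bound[OF D(1,2) entry_le])
      also have "\<dots> \<le> norm g ^ (d - 1)" using n1 D by (intro power_increasing) auto
      finally show "\<bar>c t * normal_mono3 t g\<bar> \<le> \<bar>c t\<bar> * norm g ^ (d - 1)" by (simp add: abs_mult normal_mono3_def Dpq mult_left_mono)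
    qed
    then show ?thesis unfolding dec[OF g] L_def by (simp add: sum_distrib_right)
  qed
  moreover have "p0 \<le> d" "q0 \<le> d" "k p0 q0 \<noteq> 0" using pq0 T(2) Tc by (auto simp: k_def)
  ultimately show ?thesis using d1 by blast
qed

section \<open>Lower bounds for binary forms\<close>

text \<open>The homogenisation of degree \<open>d\<close> of a polynomial in one variable. Complex coefficients allow a complete
factorisation.\<close>

definition homog_eval :: "nat \<Rightarrow> complex poly \<Rightarrow> real^2 \<Rightarrow> complex" where
  "homog_eval d q u = (\<Sum>i\<le>d. coeff q i * of_real (u$1) ^ i * of_real (u$2) ^ (d - i))"

lemma homog_eval_Suc_low: assumes "degree q \<le> d" shows "homog_eval (Suc d) q u = of_real (u$2) * homog_eval d q u"
proof -
  have "coeff q (Suc d) = 0" using assms by (intro coeff_eq_0) simp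
  then have "homog_eval (Suc d) q u = (\<Sum>i\<le>d. coeff q i * of_real (u$1) ^ i * of_real (u$2) ^ (Suc d - i))" by (simp add: homog_eval_def)
  also have "\<dots> = of_real (u$2) * homog_eval d q u"
    unfolding homog_eval_def sum_distrib_left by (intro sum.cong) (auto simp: Suc_diff_le algebra_simps)
  finally show ?thesis .
qed

lemma homog_eval_root: assumes "degree q \<le> d" shows "homog_eval (Suc d) ([:-z, 1:] * q) u = (of_real (u$1) - z * of_real (u$2)) * homog_eval d q u"
proof -
  have "[:-z, 1:] * q = pCons 0 q + smult (-z) q" by simp
  then have c: "coeff ([:-z, 1:] * q) i = coeff (pCons 0 q) i - z * coeff q i" for i by simp
  have "homog_eval (Suc d) ([:-z, 1:] * q) u = homog_eval (Suc d) (pCons 0 q) u - z * homog_eval (Suc d) q u"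
    unfolding homog_eval_def c by (simp only: sum_subtractf[symmetric] sum_distrib_left) (simp add: algebra_simps sum_subtractf)
  also have "homog_eval (Suc d) (pCons 0 q) u = of_real (u$1) * homog_eval d q u"
    unfolding homog_eval_def sum.atMost_Suc_shift by (simp add: sum_distrib_left algebra_simps)
  also have "homog_eval (Suc d) q u = of_real (u$2) * homog_eval d q u" by (rule homog_eval_Suc_low[OF assms])
  finally show ?thesis by (simp add: algebra_simps)
qed

text \<open>The real part controls \<open>u\<^sub>1 - Re z u\<^sub>2\<close> and the imaginary part is \<open>Im z u\<^sub>2\<close>, so a
complex linear factor is bounded below by two real ones.\<close>

lemma linear_factor_lower:
  fixes z :: complex and u :: "real^2"
  assumes t: "t \<ge> 0" and 1: "t \<le> \<bar>u$2\<bar>" and 2: "t * sqrt (1 + (Re z)\<^sup>2) \<le> \<bar>u$1 - Re z * u$2\<bar>"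
  shows "(1 + cmod z) * t / 4 \<le> cmod (of_real (u$1) - z * of_real (u$2))"
proof -
  define w where "w = complex_of_real (u$1) - z * of_real (u$2)"
  have r: "Re w = u$1 - Re z * u$2" and i: "Im w = - (Im z * u$2)" by (simp_all add: w_def)
  have s1: "1 \<le> sqrt (1 + (Re z)\<^sup>2)" by simp
  have s2: "\<bar>Re z\<bar> \<le> sqrt (1 + (Re z)\<^sup>2)" by (rule real_le_rsqrt) simp
  have "t * 1 \<le> t * sqrt (1 + (Re z)\<^sup>2)" "t * \<bar>Re z\<bar> \<le> t * sqrt (1 + (Re z)\<^sup>2)" using t s1 s2 by (intro mult_left_mono; simp)+
  then have a: "t \<le> cmod w" "t * \<bar>Re z\<bar> \<le> cmod w" using 2 abs_Re_le_cmod[of w] r by auto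
  have "t * \<bar>Im z\<bar> \<le> \<bar>u$2\<bar> * \<bar>Im z\<bar>" using 1 by (intro mult_right_mono) auto
  also have "\<dots> \<le> cmod w" using abs_Im_le_cmod[of w] i by (simp add: abs_mult mult.commute)
  finally have b: "t * \<bar>Im z\<bar> \<le> cmod w" .
  have "(1 + cmod z) * t \<le> (1 + (\<bar>Re z\<bar> + \<bar>Im z\<bar>)) * t" using t cmod_le[of z] by (intro mult_right_mono) auto
  also have "\<dots> = t + t * \<bar>Re z\<bar> + t * \<bar>Im z\<bar>" by (simp add: algebra_simps)
  also have "\<dots> \<le> 4 * cmod w" using a b norm_ge_zero[of w] by linarith
  finally show ?thesis by (simp add: w_def)
qed

text \<open>A binary form is a product of linear forms, and it is large at \<open>u\<close> when \<open>u\<close> is far from the kernel of each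
of them. Splitting off one root at a time keeps track of the coefficients: multiplication by \<open>x - z\<close> increases them by at
most the factor \<open>1 + |z|\<close>. The set \<open>Y\<close> depends on the form, but its size does not.\<close>

lemma form_lower:
  "degree q \<le> d \<Longrightarrow> \<exists>Y::(real^2) set. finite Y \<and> card Y \<le> 2 * d \<and> (\<forall>l\<in>Y. norm l = 1) \<and>
     (\<forall>u t. 0 \<le> t \<longrightarrow> (\<forall>l\<in>Y. t \<le> \<bar>inner u l\<bar>) \<longrightarrow> (\<forall>i. (t / 4) ^ d * cmod (coeff q i) \<le> cmod (homog_eval d q u)))"
proof (induction d arbitrary: q)
  case 0
  then have "cmod (coeff q i) \<le> cmod (coeff q 0)" for i by (cases "i = 0") (auto simp: coeff_eq_0)
  then show ?case by (intro exI[of _ "{}"]) (auto simp: homog_eval_def)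
next
  case (Suc d)
  define e2 :: "real^2" where "e2 = axis 2 1"
  have e2: "norm e2 = 1" "inner u e2 = u$2" for u by (simp_all add: e2_def inner_axis)
  show ?case
  proof (cases "degree q \<le> d")
    case True
    obtain Y :: "(real^2) set" where Y: "finite Y" "card Y \<le> 2 * d" "\<And>l. l \<in> Y \<Longrightarrow> norm l = 1" 
      "\<And>u t i. 0 \<le> t \<Longrightarrow> (\<And>l. l \<in> Y \<Longrightarrow> t \<le> \<bar>inner u l\<bar>) \<Longrightarrow> (t / 4) ^ d * cmod (coeff q i) \<le> cmod (homog_eval d q u)"
      using Suc.IH[OF True] by metis
    have "(t / 4) ^ Suc d * cmod (coeff q i) \<le> cmod (homog_eval (Suc d) q u)" 
      if t: "0 \<le> t" "\<forall>l\<in>insert e2 Y. t \<le> \<bar>inner u l\<bar>" for u t i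
    proof -
      have "(t / 4) ^ Suc d * cmod (coeff q i) = (t / 4) * ((t / 4) ^ d * cmod (coeff q i))" by simp
      also have "\<dots> \<le> \<bar>u$2\<bar> * cmod (homog_eval d q u)" using t e2 Y(4)[of t u i] by (intro mult_mono) auto
      finally show ?thesis unfolding homog_eval_Suc_low[OF True] by (simp add: norm_mult)
    qed
    moreover have "card (insert e2 Y) \<le> 2 * Suc d" using Y(1,2) card_insert_le_m1[of "2 * Suc d" Y e2] by simp
    moreover have "\<forall>l\<in>insert e2 Y. norm l = 1" using Y(3) e2(1) by blast
    moreover have "finite (insert e2 Y)" using Y(1) by simp
    ultimately show ?thesis by (intro exI[of _ "insert e2 Y"] conjI) blast+
  next
    case False
    then have dq: "degree q = Suc d" using Suc.prems by simp
    have "\<not> constant (poly q)" using dq by (simp add: constant_degree)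
    \<comment> \<open>The degree is exactly \<open>Suc d\<close>, so there is a root to split off.\<close>
    then obtain z where z: "poly q z = 0" using fundamental_theorem_of_algebra by blast
    then obtain q' where q': "q = [:-z, 1:] * q'" by (auto simp: poly_eq_0_iff_dvd elim: dvdE)
    have q0: "q' \<noteq> 0" using q' dq by auto
    have "degree q = degree [:-z, 1:] + degree q'" unfolding q' using q0 by (intro degree_mult_eq) auto
    then have d': "degree q' \<le> d" using dq by simp
    obtain Y :: "(real^2) set" where Y: "finite Y" "card Y \<le> 2 * d" "\<And>l. l \<in> Y \<Longrightarrow> norm l = 1" 
      "\<And>u t i. 0 \<le> t \<Longrightarrow> (\<And>l. l \<in> Y \<Longrightarrow> t \<le> \<bar>inner u l\<bar>) \<Longrightarrow> (t / 4) ^ d * cmod (coeff q' i) \<le> cmod (homog_eval d q' u)"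
      using Suc.IH[OF d'] by metis
    define s where "s = sqrt (1 + (Re z)\<^sup>2)"
    have s: "s > 0" "s\<^sup>2 = 1 + (Re z)\<^sup>2" unfolding s_def by (auto intro!: add_pos_nonneg)
    define l0 :: "real^2" where "l0 = vector [1 / s, - Re z / s]"
    have "(norm l0)\<^sup>2 = 1" unfolding norm2_sq l0_def using s(1) by (simp add: power_divide add_divide_distrib[symmetric] s(2)[symmetric])
    then have l0: "norm l0 = 1" by (simp add: power2_eq_1_iff) (smt (verit) norm_ge_zero)
    have il0: "inner u l0 = (u$1 - Re z * u$2) / s" for u by (simp add: inner2 l0_def diff_divide_distrib)
    have "(t / 4) ^ Suc d * cmod (coeff q i) \<le> cmod (homog_eval (Suc d) q u)" 
      if t: "0 \<le> t" "\<forall>l\<in>insert l0 (insert e2 Y). t \<le> \<bar>inner u l\<bar>" for u t i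
    proof -
      define h where "h = cmod (homog_eval d q' u)"
      have H: "(t / 4) ^ d * cmod (coeff q' j) \<le> h" for j unfolding h_def using t Y(4) by auto
      have "t \<le> \<bar>u$1 - Re z * u$2\<bar> / s" using t s by (auto simp: il0 abs_divide)
      then have "t * s \<le> \<bar>u$1 - Re z * u$2\<bar>" using s by (simp add: pos_le_divide_eq)
      then have lf: "(1 + cmod z) * t / 4 \<le> cmod (of_real (u$1) - z * of_real (u$2))"
        using t e2 by (intro linear_factor_lower) (auto simp: s_def)
      have "(t / 4) ^ d * cmod (coeff q i) \<le> (1 + cmod z) * h"
      proof -
        have "q = pCons 0 q' + smult (-z) q'" unfolding q' by simp
        then have "coeff q i = coeff (pCons 0 q') i - z * coeff q' i" by (metis coeff_add coeff_smult diff_conv_add_uminus mult_minus_left)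
        then have "cmod (coeff q i) \<le> cmod (coeff (pCons 0 q') i) + cmod z * cmod (coeff q' i)"
          by (metis norm_mult norm_triangle_ineq4)
        then have "(t / 4) ^ d * cmod (coeff q i) \<le> (t / 4) ^ d * (cmod (coeff (pCons 0 q') i) + cmod z * cmod (coeff q' i))"
          using t by (intro mult_left_mono) auto
        also have "\<dots> = (t / 4) ^ d * cmod (coeff (pCons 0 q') i) + cmod z * ((t / 4) ^ d * cmod (coeff q' i))" by (simp add: algebra_simps)
        also have "\<dots> \<le> h + cmod z * h"
        proof (intro add_mono mult_left_mono H)
          show "(t / 4) ^ d * cmod (coeff (pCons 0 q') i) \<le> h"
            using H by (cases i) (auto simp: h_def)
        qed simp
        finally show ?thesis by (simp add: algebra_simps)
      qed
      then have "(t / 4) * ((t / 4) ^ d * cmod (coeff q i)) \<le> (t / 4) * ((1 + cmod z) * h)" using t by (intro mult_left_mono) auto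
      then have "(t / 4) ^ Suc d * cmod (coeff q i) \<le> ((1 + cmod z) * t / 4) * h" by (simp add: algebra_simps)
      also have "\<dots> \<le> cmod (of_real (u$1) - z * of_real (u$2)) * h" using lf by (intro mult_right_mono) (auto simp: h_def)
      also have "\<dots> = cmod (homog_eval (Suc d) q u)" unfolding q' homog_eval_root[OF d'] h_def by (simp add: norm_mult)
      finally show ?thesis .
    qed
    moreover have "card (insert l0 (insert e2 Y)) \<le> 2 * Suc d" 
      using Y(1,2) card_insert_if[of Y e2] card_insert_if[of "insert e2 Y" l0] by (simp split: if_splits)
    moreover have "\<forall>l\<in>insert l0 (insert e2 Y). norm l = 1" using Y(3) e2(1) l0 by blast
    moreover have "finite (insert l0 (insert e2 Y))" using Y(1) by simp
    ultimately show ?thesis by (intro exI[of _ "insert l0 (insert e2 Y)"] conjI) blast+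
  qed
qed

definition binary_form :: "nat \<Rightarrow> (nat \<Rightarrow> real) \<Rightarrow> real^2 \<Rightarrow> real" where
  "binary_form d f u = (\<Sum>p\<le>d. f p * (u$1 ^ p * u$2 ^ (d - p)))"

lemma binary_form_lower:
  "\<exists>Y::(real^2) set. finite Y \<and> card Y \<le> 2 * d \<and> (\<forall>l\<in>Y. norm l = 1) \<and>
     (\<forall>u t. 0 \<le> t \<longrightarrow> (\<forall>l\<in>Y. t \<le> \<bar>inner u l\<bar>) \<longrightarrow> (\<forall>i\<le>d. (t / 4) ^ d * \<bar>f i\<bar> \<le> \<bar>binary_form d f u\<bar>))"
proof -
  define q where "q = (\<Sum>p\<le>d. monom (complex_of_real (f p)) p)"
  have cq: "coeff q i = (if i \<le> d then complex_of_real (f i) else 0)" for i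
    unfolding q_def coeff_sum by simp
  have dq: "degree q \<le> d" by (rule degree_le) (simp add: cq)
  have "homog_eval d q u = of_real (binary_form d f u)" for u by (simp add: homog_eval_def binary_form_def cq mult.assoc)
  then have e: "cmod (homog_eval d q u) = \<bar>binary_form d f u\<bar>" for u by simp
  have c: "cmod (coeff q i) = \<bar>f i\<bar>" if "i \<le> d" for i using that by (simp add: cq)
  obtain Y :: "(real^2) set" where Y: "finite Y" "card Y \<le> 2 * d" "\<forall>l\<in>Y. norm l = 1"
    "\<forall>u t. 0 \<le> t \<longrightarrow> (\<forall>l\<in>Y. t \<le> \<bar>inner u l\<bar>) \<longrightarrow> (\<forall>i. (t / 4) ^ d * cmod (coeff q i) \<le> \<bar>binary_form d f u\<bar>)"
    using form_lower[OF dq, unfolded e] by (elim exE conjE) (rule that)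
  have "(t / 4) ^ d * \<bar>f i\<bar> \<le> \<bar>binary_form d f u\<bar>" if "0 \<le> t" "\<forall>l\<in>Y. t \<le> \<bar>inner u l\<bar>" "i \<le> d" for u t i
    using Y(4)[rule_format, of t u i] that c[OF that(3)] by simp
  then show ?thesis using Y(1-3) by (intro exI[of _ Y] conjI allI impI) simp_all
qed

lemma binary_form_scale: "binary_form d f (r *\<^sub>R u) = r ^ d * binary_form d f u"
  unfolding binary_form_def sum_distrib_left
proof (rule sum.cong[OF refl])
  fix p assume "p \<in> {..d}"
  then have "r ^ d = r ^ p * r ^ (d - p)" by (simp add: power_add[symmetric])
  then show "f p * ((r *\<^sub>R u) $ 1 ^ p * (r *\<^sub>R u) $ 2 ^ (d - p)) = r ^ d * (f p * (u $ 1 ^ p * u $ 2 ^ (d - p)))"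
    by (simp add: power_mult_distrib)
qed

text \<open>A union bound over the linear forms of \<open>binary_form_lower\<close>; their number depends only on the degree, so
the estimate is uniform over all forms.\<close>

lemma (in SL2_walk) binary_form_regular:
  assumes e: "e > 0"
  shows "exp_small {(x, f, i). norm x = 1 \<and> i \<le> d} (\<lambda>(x, f, i) n. measure (K n) {g. \<bar>binary_form d f (g *v x)\<bar> < (exp (real n * (lyap - e)) / 4) ^ d * \<bar>f i\<bar>})"
proof -
  obtain c C where c: "c > 0" "C \<ge> 0" and "\<And>n i. i \<in> {(x,l). norm x = 1 \<and> norm l = 1} \<Longrightarrow> 
     (\<lambda>(x,l) n. measure (K n) {g. \<bar>inner (g *v x) l\<bar> < exp (real n * (lyap - e))}) i n \<le> C * exp (- (c * real n))"
    by (rule exp_smallE[OF coefficient_regularity[OF e]], rule that)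
  then have C: "measure (K n) {g. \<bar>inner (g *v x) l\<bar> < exp (real n * (lyap - e))} \<le> C * exp (- (c * real n))" if "norm x = 1" "norm l = 1" for x l n
    using that by fastforce
  have "measure (K n) {g. \<bar>binary_form d f (g *v x)\<bar> < (exp (real n * (lyap - e)) / 4) ^ d * \<bar>f i\<bar>} \<le> (real (2 * d) * C) * exp (- (c * real n))"
    if x: "norm x = 1" and i: "i \<le> d" for x f i n
  proof -
    interpret prob_space "K n" by (rule prob_K)
    obtain Y :: "(real^2) set" where Y: "finite Y" "card Y \<le> 2 * d" "\<forall>l\<in>Y. norm l = 1"
       "\<forall>u t. 0 \<le> t \<longrightarrow> (\<forall>l\<in>Y. t \<le> \<bar>inner u l\<bar>) \<longrightarrow> (\<forall>i\<le>d. (t / 4) ^ d * \<bar>f i\<bar> \<le> \<bar>binary_form d f u\<bar>)" using binary_form_lower[of d f] by (elim exE conjE) (rule that)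
    define B where "B l = {g::real^2^2. \<bar>inner (g *v x) l\<bar> < exp (real n * (lyap - e))}" for l
    have Bs: "B l \<in> sets borel" for l unfolding B_def by (rule sets_CollectI, measurable)
    have "{g. \<bar>binary_form d f (g *v x)\<bar> < (exp (real n * (lyap - e)) / 4) ^ d * \<bar>f i\<bar>} \<subseteq> (\<Union>l\<in>Y. B l)"
    proof
      fix g assume g: "g \<in> {g. \<bar>binary_form d f (g *v x)\<bar> < (exp (real n * (lyap - e)) / 4) ^ d * \<bar>f i\<bar>}"
      show "g \<in> (\<Union>l\<in>Y. B l)"
      proof (rule ccontr)
        assume "g \<notin> (\<Union>l\<in>Y. B l)"
        then have "\<forall>l\<in>Y. exp (real n * (lyap - e)) \<le> \<bar>inner (g *v x) l\<bar>" by (auto simp: B_def not_less)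
        then show False using Y(4)[rule_format, of "exp (real n * (lyap - e))" "g *v x" i] i g by auto
      qed
    qed
    then have "measure (K n) {g. \<bar>binary_form d f (g *v x)\<bar> < (exp (real n * (lyap - e)) / 4) ^ d * \<bar>f i\<bar>} \<le> measure (K n) (\<Union>l\<in>Y. B l)"
      using Bs Y(1) by (intro finite_measure_mono) auto
    also have "\<dots> \<le> (\<Sum>l\<in>Y. measure (K n) (B l))" using Bs Y(1) by (intro finite_measure_subadditive_finite) auto
    also have "\<dots> \<le> (\<Sum>l\<in>Y. C * exp (- (c * real n)))" unfolding B_def using C[OF x] Y(3) by (intro sum_mono) auto
    also have "\<dots> = real (card Y) * (C * exp (- (c * real n)))" by simp
    also have "\<dots> \<le> real (2 * d) * (C * exp (- (c * real n)))" using Y(2) c by (intro mult_right_mono) auto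
    finally show ?thesis by simp
  qed
  then show ?thesis by (intro exp_smallI[OF c(1)]) auto
qed

section \<open>Growth of a polynomial along the walk\<close>

text \<open>For the two factors of the walk, which have lengths about \<open>n / 3\<close> and \<open>2 n / 3\<close>.\<close>

lemma exp_small_reindex:
  assumes "exp_small I F" "\<And>n. real n / 3 - 1 \<le> real (r n)" shows "exp_small I (\<lambda>i n. F i (r n))"
proof -
  obtain c C where c: "c > 0" "C \<ge> 0" "\<And>n i. i \<in> I \<Longrightarrow> F i n \<le> C * exp (- (c * real n))" by (rule exp_smallE[OF assms(1)], rule that)
  show ?thesis
  proof (rule exp_smallI)
    show "c / 3 > 0" using c by simp
    fix n i assume i: "i \<in> I"
    have "c * (real n / 3 - 1) \<le> c * real (r n)" using assms(2) c by (intro mult_left_mono) auto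
    then have "exp (- (c * real (r n))) \<le> exp (c + - (c / 3 * real n))" by (simp add: algebra_simps)
    then have "C * exp (- (c * real (r n))) \<le> C * exp (c + - (c / 3 * real n))" using c by (intro mult_left_mono)
    moreover have "C * exp (c + - (c / 3 * real n)) = (C * exp c) * exp (- (c / 3 * real n))" by (simp only: exp_add mult.assoc)
    ultimately show "F i (r n) \<le> (C * exp c) * exp (- (c / 3 * real n))" using c(3)[OF i, of "r n"] by linarith
  qed
qed

text \<open>Let \<open>a\<close> be the upper left entry of \<open>G\<close>, let \<open>v\<close> be the first column and let \<open>a w\<close> be
the first row. As \<open>det G = 1\<close>, the matrix \<open>G - v w\<^sup>T\<close> has a single nonzero entry, \<open>1 / a\<close>. Hence
\<open>A G\<close> is within \<open>|A| / |a|\<close> of the rank one matrix \<open>(Av) w\<^sup>T\<close>, where the top form is a binary form in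
\<open>Av\<close> whose coefficients are binary forms in \<open>w\<close>.\<close>

lemma product_form_lower:
  fixes A G :: "real^2^2" and k :: "nat \<Rightarrow> nat \<Rightarrow> real"
  assumes det: "det A = 1" "det G = 1" and LA: "norm A \<le> LA" and LG: "norm G \<le> LG"
    and sa: "sa \<le> \<bar>G$1$1\<bar>" "sa > 0" "1 \<le> sa * LG" and sl: "sl \<ge> 0" and pq: "p0 \<le> d"
    and H1: "(sa / 4) ^ d * \<bar>k p0 q0\<bar> \<le> \<bar>binary_form d (k p0) (transpose G *v axis 1 1)\<bar>"
    and H2: "(sl / 4) ^ d * \<bar>binary_form d (k p0) ((1 / G$1$1) *\<^sub>R (transpose G *v axis 1 1))\<bar> 
       \<le> \<bar>binary_form d (\<lambda>p. binary_form d (k p) ((1 / G$1$1) *\<^sub>R (transpose G *v axis 1 1))) (A *v sgn (G *v axis 1 1))\<bar>"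
  shows "(sl * sa / 4) ^ d * ((sa / (4 * LG)) ^ d * \<bar>k p0 q0\<bar>) - (\<Sum>p\<le>d. \<Sum>q\<le>d. \<bar>k p q\<bar>) * (real d * (LA / sa) * (2 * LA * LG) ^ d)
     \<le> \<bar>\<Sum>p\<le>d. \<Sum>q\<le>d. k p q * normal_mono d p q (A ** G)\<bar>"
proof -
  define a where "a = G$1$1"
  define v where "v = G *v axis 1 1"
  define r where "r = transpose G *v axis 1 1"
  define w where "w = (1 / a) *\<^sub>R r"
  define u where "u = A *v v"
  define fw where "fw p = binary_form d (k p) w" for p
  have LA1: "1 \<le> LA" using det1_norm_ge1[OF det(1)] LA by linarith
  have LG1: "1 \<le> LG" using det1_norm_ge1[OF det(2)] LG by linarith
  have a: "a \<noteq> 0" "sa \<le> \<bar>a\<bar>" using sa by (auto simp: a_def)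
  have aLG: "\<bar>a\<bar> \<le> LG" using entry_le[of G 1 1] LG by (simp add: a_def)
  have v: "v$1 = G$1$1" "v$2 = G$2$1" by (simp_all add: v_def mv_nth axis_def)
  have r: "r$1 = G$1$1" "r$2 = G$1$2" by (simp_all add: r_def mv_nth axis_def transpose_def)
  have w: "w$1 = 1" "w$2 = G$1$2 / a" using a by (simp_all add: w_def r a_def)
  have nv: "sa \<le> norm v" using component_le_norm_cart[of v 1] a by (simp add: v a_def)
  have v0: "v \<noteq> 0" using nv sa by auto
  have fwp: "(sa / (4 * LG)) ^ d * \<bar>k p0 q0\<bar> \<le> \<bar>fw p0\<bar>"
  proof -
    have "\<bar>a\<bar> ^ d * \<bar>fw p0\<bar> = \<bar>binary_form d (k p0) r\<bar>"
      unfolding fw_def w_def binary_form_scale using a by (simp add: abs_mult power_abs[symmetric] power_divide)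
    moreover have "\<bar>a\<bar> ^ d * \<bar>fw p0\<bar> \<le> LG ^ d * \<bar>fw p0\<bar>" using aLG by (intro mult_right_mono power_mono) auto
    ultimately have "(sa / 4) ^ d * \<bar>k p0 q0\<bar> \<le> LG ^ d * \<bar>fw p0\<bar>" using H1 by (simp add: r_def)
    then have "(sa / 4) ^ d * \<bar>k p0 q0\<bar> / LG ^ d \<le> \<bar>fw p0\<bar>" using LG1 by (simp add: pos_divide_le_eq mult.commute)
    then show ?thesis using LG1 by (simp add: power_divide power_mult_distrib)
  qed
  have main: "(sl * sa / 4) ^ d * ((sa / (4 * LG)) ^ d * \<bar>k p0 q0\<bar>) \<le> \<bar>binary_form d fw u\<bar>"
  proof -
    have "u = norm v *\<^sub>R (A *v sgn v)" unfolding u_def using v0 by (simp add: mv_sgn)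
    then have e: "\<bar>binary_form d fw u\<bar> = norm v ^ d * \<bar>binary_form d fw (A *v sgn v)\<bar>" by (simp add: binary_form_scale abs_mult)
    have "(sl * sa / 4) ^ d * ((sa / (4 * LG)) ^ d * \<bar>k p0 q0\<bar>) = sa ^ d * ((sl / 4) ^ d * ((sa / (4 * LG)) ^ d * \<bar>k p0 q0\<bar>))"
      by (simp add: power_mult_distrib power_divide)
    also have "\<dots> \<le> norm v ^ d * ((sl / 4) ^ d * \<bar>fw p0\<bar>)"
      using sa nv sl fwp LG1 by (intro mult_mono power_mono) (auto intro!: mult_nonneg_nonneg)
    also have "\<dots> \<le> norm v ^ d * \<bar>binary_form d fw (A *v sgn v)\<bar>"
      using H2 by (intro mult_left_mono) (auto simp: fw_def[abs_def] w_def r_def a_def v_def)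
    finally show ?thesis unfolding e .
  qed
  define R where "R = 2 * LA * LG"
  define \<delta> where "\<delta> = LA / sa"
  have d0: "\<delta> \<ge> 0" using LA1 sa by (simp add: \<delta>_def)
  have dR: "\<delta> \<le> LA * LG"
  proof -
    have "LA * 1 \<le> LA * (sa * LG)" using sa LA1 by (intro mult_left_mono) auto
    then show ?thesis using sa by (simp add: \<delta>_def pos_divide_le_eq algebra_simps)
  qed
  have LL: "1 \<le> LA * LG" using mult_mono[OF LA1 LG1] LA1 by simp
  have AG: "\<bar>(A ** G)$i$j\<bar> \<le> LA * LG" for i j
    by (rule order_trans[OF entry_le order_trans[OF norm_mm_le mult_mono[OF LA LG]]]) (use LA1 in auto)
  have diff: "\<bar>(A ** G)$i$j - outer u w $i$j\<bar> \<le> \<delta>" for i j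
  proof (cases "j = 1")
    case True
    then show ?thesis using d0 by (simp add: mm_nth u_def mv_nth v w)
  next
    case False
    then have j: "j = 2" using exhaust_2 by blast
    have "G$2$2 - G$2$1 * (G$1$2 / a) = 1 / a" using det(2) a by (simp add: det_2 a_def field_simps)
    then have "(A ** G)$i$2 - outer u w $i$2 = A$i$2 * (1 / a)"
      using a by (simp add: mm_nth u_def mv_nth v w a_def[symmetric] algebra_simps)
    then have "\<bar>(A ** G)$i$2 - outer u w $i$2\<bar> = \<bar>A$i$2\<bar> / \<bar>a\<bar>" by (simp add: abs_divide)
    also have "\<dots> \<le> LA / sa" using entry_le[of A i 2] LA a sa by (intro frac_le) auto
    finally show ?thesis by (simp add: j \<delta>_def)
  qed
  have bR: "\<bar>(A ** G)$i$j\<bar> \<le> R" "\<bar>outer u w $i$j\<bar> \<le> R" for i j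
    using AG[of i j] diff[of i j] dR LL unfolding R_def by linarith+
  have R1: "1 \<le> R" using LL by (simp add: R_def)
  have "\<bar>(\<Sum>p\<le>d. \<Sum>q\<le>d. k p q * normal_mono d p q (A ** G)) - binary_form d fw u\<bar> \<le> (\<Sum>p\<le>d. \<Sum>q\<le>d. \<bar>k p q\<bar>) * (real d * \<delta> * R ^ d)"
  proof -
    have "binary_form d fw u = (\<Sum>p\<le>d. \<Sum>q\<le>d. k p q * normal_mono d p q (outer u w))"
      unfolding binary_form_def fw_def sum_distrib_right by (auto simp: normal_mono_outer algebra_simps intro!: sum.cong)
    then have "\<bar>(\<Sum>p\<le>d. \<Sum>q\<le>d. k p q * normal_mono d p q (A ** G)) - binary_form d fw u\<bar> = \<bar>\<Sum>p\<le>d. \<Sum>q\<le>d. k p q * (normal_mono d p q (A ** G) - normal_mono d p q (outer u w))\<bar>"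
      by (simp add: sum_subtractf[symmetric] right_diff_distrib)
    also have "\<dots> \<le> (\<Sum>p\<le>d. \<Sum>q\<le>d. \<bar>k p q\<bar> * (real d * \<delta> * R ^ d))"
    proof (rule order_trans[OF sum_abs sum_mono], rule order_trans[OF sum_abs sum_mono])
      fix p q assume "p \<in> {..d}" "q \<in> {..d}"
      then have "\<bar>normal_mono d p q (A ** G) - normal_mono d p q (outer u w)\<bar> \<le> real d * \<delta> * R ^ d"
        by (intro normal_mono_lip bR diff R1) auto
      then show "\<bar>k p q * (normal_mono d p q (A ** G) - normal_mono d p q (outer u w))\<bar> \<le> \<bar>k p q\<bar> * (real d * \<delta> * R ^ d)"
        by (simp add: abs_mult mult_left_mono)
    qed
    also have "\<dots> = (\<Sum>p\<le>d. \<Sum>q\<le>d. \<bar>k p q\<bar>) * (real d * \<delta> * R ^ d)" by (simp add: sum_distrib_right)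
    finally show ?thesis .
  qed
  then show ?thesis using main unfolding R_def \<delta>_def by linarith
qed

text \<open>Collects the constants of the two applications of the lower bound for binary forms.\<close>

lemma quarter_powers:
  fixes X s L K :: real shows "(X / 4) ^ d * ((s / (4 * L)) ^ d * K) = ((1 / 16) ^ d * K) * (X ^ d * (s / L) ^ d)"
proof -
  have e: "X / 4 = X * (1 / 4)" "s / (4 * L) = (s / L) * (1 / 4)" "(1 / 16 :: real) = (1 / 4) * (1 / 4)" by simp_all
  show ?thesis unfolding e power_mult_distrib by (simp only: mult_ac)
qed

context SL2_walk begin

text \<open>Fubini for the two independent factors, the right factor being fixed first.\<close>

lemma mconv_measure_bound:
  assumes [measurable]: "E \<in> sets borel" "B \<in> sets borel" and "\<beta> \<ge> 0"
    and H: "\<And>G. det G = 1 \<Longrightarrow> G \<notin> B \<Longrightarrow> measure (K l) {A. A ** G \<in> E} \<le> \<beta>"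
  shows "measure (K (l + m)) E \<le> measure (K m) B + \<beta>"
proof -
  interpret L: prob_space "K l" by (rule prob_K)
  interpret M: prob_space "K m" by (rule prob_K)
  interpret LM: prob_space "K (l + m)" by (rule prob_K)
  have sE: "{A. A ** G \<in> E} \<in> sets (K l)" for G :: "real^2^2"
    using measurable_sets[of "\<lambda>A. A ** G" borel borel E] by (simp add: vimage_def)
  have "emeasure (K (l + m)) E = (\<integral>\<^sup>+g. indicator E g \<partial>K (l + m))" by simp
  also have "\<dots> = (\<integral>\<^sup>+G. \<integral>\<^sup>+A. indicator E (A ** G) \<partial>K l \<partial>K m)"
    unfolding K_add by (rule nn_integral_mconv'[OF lawK lawK]) measurable
  also have "\<dots> \<le> (\<integral>\<^sup>+G. indicator B G + ennreal \<beta> \<partial>K m)"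
  proof (rule nn_integral_mono_AE, rule eventually_mono[OF AE_det_K])
    fix G :: "real^2^2" assume G: "det G = 1"
    have e: "(\<integral>\<^sup>+A. indicator E (A ** G) \<partial>K l) = emeasure (K l) {A. A ** G \<in> E}"
    proof -
      have "(\<integral>\<^sup>+A. indicator E (A ** G) \<partial>K l) = (\<integral>\<^sup>+A. indicator {A. A ** G \<in> E} A \<partial>K l)"
        by (rule nn_integral_cong) (simp add: indicator_def)
      then show ?thesis using sE by simp
    qed
    show "(\<integral>\<^sup>+A. indicator E (A ** G) \<partial>K l) \<le> indicator B G + ennreal \<beta>"
    proof (cases "G \<in> B")
      case True
      have "emeasure (K l) {A. A ** G \<in> E} \<le> 1" by (rule L.emeasure_le_1)
      then show ?thesis unfolding e using True by (simp add: add_increasing2)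
    next
      case False
      have "emeasure (K l) {A. A ** G \<in> E} \<le> ennreal \<beta>" using H[OF G False] by (simp add: L.emeasure_eq_measure ennreal_leI)
      then show ?thesis unfolding e using False by simp
    qed
  qed
  also have "\<dots> = emeasure (K m) B + ennreal \<beta>"
    using M.emeasure_space_1 by (subst nn_integral_add) auto
  finally have "ennreal (measure (K (l + m)) E) \<le> ennreal (measure (K m) B + \<beta>)"
    using assms(3) by (simp add: LM.emeasure_eq_measure M.emeasure_eq_measure)
  then show ?thesis using assms(3) by (subst (asm) ennreal_le_iff) auto
qed

text \<open>The walk is cut as \<open>A G\<close> with \<open>A\<close> of length \<open>n div 3\<close>. The exceptional set for \<open>G\<close> is
\<open>B1 \<union> B2 \<union> B3\<close> (norm too large, upper left entry too small, leading coefficient too small); for \<open>G\<close>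
outside it, \<open>A\<close> has to avoid \<open>BA\<close>, where the form in \<open>Av\<close> is too small, and a large norm. With
\<open>Y = e\<^sup>n\<^sup>d\<^sup>\<eta>\<close> and \<open>Z = e\<^sup>n\<^sup>d\<^sup>\<lambda>\<close> the main term is at least \<open>\<kappa>' Z / Y\<^sup>3\<close> and all
errors are at most \<open>M Z / Y\<^sup>6\<close>.\<close>

theorem poly_lower:
  assumes Pm: "P \<in> borel_measurable borel" and d: "d \<ge> 1" and pq: "p0 \<le> d" "q0 \<le> d" and k0: "k p0 q0 \<noteq> 0"
    and R: "\<And>g. det g = 1 \<Longrightarrow> \<bar>P g - (\<Sum>p\<le>d. \<Sum>q\<le>d. k p q * normal_mono d p q g)\<bar> \<le> L * norm g ^ (d - 1)" 
    and e: "\<epsilon> > 0"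
  shows "exp_small UNIV (\<lambda>_::unit. \<lambda>n. measure (K n) {g. \<bar>P g\<bar> < exp (real n * (real d * lyap - \<epsilon>))})"
proof -
  interpret T: SL2_walk transpose_law \<tau> by (rule walk_transpose)
  \<comment> \<open>Small enough that the gain \<open>\<lambda> / 3\<close> from the unequal lengths beats all the losses \<open>d \<eta>\<close>.\<close>
  define \<eta> where "\<eta> = min \<epsilon> lyap / (24 * real d)"
  have eta: "\<eta> > 0" "24 * real d * \<eta> \<le> lyap" "24 * real d * \<eta> \<le> \<epsilon>" using e lyap d by (auto simp: \<eta>_def min_def field_simps)
  define S where "S = (\<Sum>p\<le>d. \<Sum>q\<le>d. \<bar>k p q\<bar>)"
  have S0: "S \<ge> 0" unfolding S_def by (intro sum_nonneg) auto
  define \<kappa>' where "\<kappa>' = (1 / 16) ^ d * \<bar>k p0 q0\<bar>"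
  have k': "\<kappa>' > 0" using k0 by (simp add: \<kappa>'_def)
  define M where "M = S * real d * 2 ^ d + \<bar>L\<bar>"
  have M0: "M \<ge> 0" using S0 by (simp add: M_def)
  define B1 where "B1 m = {G::real^2^2. ln (norm G) \<ge> real m * (lyap + \<eta>)}" for m :: nat
  define B2 where "B2 m = {G::real^2^2. \<bar>inner (G *v axis 1 1) (axis 1 1)\<bar> < exp (real m * (lyap - \<eta>))}" for m :: nat
  define B3 where "B3 m = {G::real^2^2. \<bar>binary_form d (k p0) (transpose G *v axis 1 1)\<bar> < (exp (real m * (lyap - \<eta>)) / 4) ^ d * \<bar>k p0 q0\<bar>}" for m :: nat
  have B12s: "B1 m \<in> sets borel" "B2 m \<in> sets borel" for m
    unfolding B1_def B2_def by (rule sets_CollectI, measurable)+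
  have B3s: "B3 m \<in> sets borel" for m
    unfolding B3_def binary_form_def by (rule sets_CollectI, measurable)
  have b1: "exp_small UNIV (\<lambda>_::unit. \<lambda>m. measure (K m) (B1 m))" unfolding B1_def by (rule ldp_norm_upper[OF eta(1)])
  have b2: "exp_small UNIV (\<lambda>_::unit. \<lambda>m. measure (K m) (B2 m))" 
    unfolding B2_def using exp_small_image[OF coefficient_regularity[OF eta(1)], of UNIV "\<lambda>_::unit. (axis 1 1, axis 1 1)"] by simp
  have b3: "exp_small UNIV (\<lambda>_::unit. \<lambda>m. measure (K m) (B3 m))"
  proof -
    have "exp_small UNIV (\<lambda>_::unit. \<lambda>m. measure (T.K m) {g. \<bar>binary_form d (k p0) (g *v axis 1 1)\<bar> < (exp (real m * (lyap - \<eta>)) / 4) ^ d * \<bar>k p0 q0\<bar>})"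
      using exp_small_image[OF T.binary_form_regular[OF eta(1), of d], of UNIV "\<lambda>_::unit. (axis 1 1, k p0, q0)"] pq by (simp add: lyap_transpose)
    moreover have "measure (T.K m) {g. \<bar>binary_form d (k p0) (g *v axis 1 1)\<bar> < (exp (real m * (lyap - \<eta>)) / 4) ^ d * \<bar>k p0 q0\<bar>} = measure (K m) (B3 m)" for m
    proof -
      have "{g::real^2^2. \<bar>binary_form d (k p0) (g *v axis 1 1)\<bar> < (exp (real m * (lyap - \<eta>)) / 4) ^ d * \<bar>k p0 q0\<bar>} \<in> sets borel"
        unfolding binary_form_def by (rule sets_CollectI, measurable)
      from measure_transpose[OF this, of m] show ?thesis by (simp only: B3_def mem_Collect_eq)
    qed
    ultimately show ?thesis by simp
  qed
  obtain c1 C1 where c1: "c1 > 0" "C1 \<ge> 0" and "\<And>n i. i \<in> {(x, f, i). norm x = 1 \<and> i \<le> d} \<Longrightarrow> 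
     (\<lambda>(x, f, i) n. measure (K n) {g. \<bar>binary_form d f (g *v x)\<bar> < (exp (real n * (lyap - \<eta>)) / 4) ^ d * \<bar>f i\<bar>}) i n \<le> C1 * exp (- (c1 * real n))"
    by (rule exp_smallE[OF binary_form_regular[OF eta(1), of d]], rule that)
  then have C1: "measure (K n) {g. \<bar>binary_form d f (g *v x)\<bar> < (exp (real n * (lyap - \<eta>)) / 4) ^ d * \<bar>f i\<bar>} \<le> C1 * exp (- (c1 * real n))"
    if "norm x = 1" "i \<le> d" for x f i n using that by fastforce
  define l m where "l n = n div 3" and "m n = n - n div 3" for n :: nat
  have lm: "l n + m n = n" for n by (simp add: l_def m_def)
  have lm3: "3 * real (l n) \<le> real n" "real n / 3 - 1 \<le> real (l n)" "real n / 3 - 1 \<le> real (m n)" "real (m n) \<le> real n" for n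
    unfolding l_def m_def by linarith+
  have rlm: "real (l n) + real (m n) = real n" for n using lm[of n] by linarith
  define \<beta> where "\<beta> n = C1 * exp (- (c1 * real (l n))) + measure (K (l n)) (B1 (l n))" for n
  have ub: "exp_small UNIV (\<lambda>_::unit. \<beta>)"
    unfolding \<beta>_def
    by (intro exp_small_add exp_small_reindex[OF b1, of l] exp_small_reindex[of UNIV "\<lambda>_ n. C1 * exp (- (c1 * real n))" l] exp_smallI[OF c1(1), where C=C1] lm3) auto
  \<comment> \<open>From \<open>n0\<close> on, one factor \<open>y\<close> absorbs all constants.\<close>
  define y where "y n = exp (real n * (real d * \<eta>))" for n :: nat
  obtain n0 :: nat where n0: "((1 + M) / \<kappa>') / (real d * \<eta>) < real n0" using reals_Archimedean2 by blast
  have yn: "1 + M \<le> \<kappa>' * y n" if "n \<ge> n0" for n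
  proof -
    have de: "real d * \<eta> > 0" using d eta by simp
    have "((1 + M) / \<kappa>') / (real d * \<eta>) < real n" using n0 that by linarith
    then have "(1 + M) / \<kappa>' < real n * (real d * \<eta>)" by (simp only: pos_divide_less_eq[OF de])
    also have "\<dots> \<le> y n" unfolding y_def using exp_ge_add_one_self[of "real n * (real d * \<eta>)"] by linarith
    finally show ?thesis using k' by (simp add: pos_divide_less_eq mult.commute)
  qed
  show ?thesis
  proof (rule exp_small_eventually[where start=n0])
    show "exp_small UNIV (\<lambda>_::unit. \<lambda>n. measure (K (m n)) (B1 (m n)) + (measure (K (m n)) (B2 (m n)) + measure (K (m n)) (B3 (m n))) + \<beta> n)"
      by (intro exp_small_add ub exp_small_reindex[OF b1, of m] exp_small_reindex[OF b2, of m] exp_small_reindex[OF b3, of m] lm3)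
    fix i :: unit and n assume n: "n0 \<le> n"
    define E where "E = {g. \<bar>P g\<bar> < exp (real n * (real d * lyap - \<epsilon>))}"
    have Es: "E \<in> sets borel" unfolding E_def using Pm by (intro sets_CollectI) measurable
    define B where "B = B1 (m n) \<union> (B2 (m n) \<union> B3 (m n))"
    have Bs: "B \<in> sets borel" unfolding B_def using B12s B3s by auto
    have "measure (K (l n + m n)) E \<le> measure (K (m n)) B + \<beta> n"
    proof (rule mconv_measure_bound[OF Es Bs])
      show "0 \<le> \<beta> n" unfolding \<beta>_def using c1 by simp
      fix G :: "real^2^2" assume G: "det G = 1" "G \<notin> B"
      define a where "a = G$1$1"
      define w where "w = (1 / a) *\<^sub>R (transpose G *v axis 1 1)"
      define fw where "fw p = binary_form d (k p) w" for p
      define v where "v = sgn (G *v axis 1 1)"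
      define BA where "BA = {A::real^2^2. \<bar>binary_form d fw (A *v v)\<bar> < (exp (real (l n) * (lyap - \<eta>)) / 4) ^ d * \<bar>fw p0\<bar>}"
      have nv: "norm v = 1" unfolding v_def by (rule det1_sgn[OF G(1) axis_unit])
      have BAs: "BA \<in> sets borel" unfolding BA_def binary_form_def by (rule sets_CollectI, measurable)
      have Gn: "norm G \<le> exp (real (m n) * (lyap + \<eta>))"
      proof -
        have "ln (norm G) < real (m n) * (lyap + \<eta>)" using G(2) by (simp add: B_def B1_def)
        moreover have "norm G > 0" using det1_norm_ge1[OF G(1)] by linarith
        ultimately show ?thesis by (metis exp_less_cancel_iff exp_ln less_imp_le)
      qed
      have Ga: "exp (real (m n) * (lyap - \<eta>)) \<le> \<bar>G$1$1\<bar>"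
        using G(2) by (simp add: B_def B2_def inner_axis mv_nth) (simp add: axis_def)
      have GH1: "(exp (real (m n) * (lyap - \<eta>)) / 4) ^ d * \<bar>k p0 q0\<bar> \<le> \<bar>binary_form d (k p0) (transpose G *v axis 1 1)\<bar>"
        using G(2) by (simp add: B_def B3_def)
      have "measure (K (l n)) {A. A ** G \<in> E} \<le> measure (K (l n)) (BA \<union> B1 (l n))"
      proof (rule meas_mono_AE, rule eventually_mono[OF AE_det_K], rule impI, rule ccontr)
        fix A :: "real^2^2" assume A: "det A = 1" "A \<in> {A. A ** G \<in> E}" "A \<notin> BA \<union> B1 (l n)"
        define LA where "LA = exp (real (l n) * (lyap + \<eta>))"
        define LG where "LG = exp (real (m n) * (lyap + \<eta>))"
        define sa where "sa = exp (real (m n) * (lyap - \<eta>))"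
        define sl where "sl = exp (real (l n) * (lyap - \<eta>))"
        define D where "D = real d"
        have D: "D \<ge> 1" using d by (simp add: D_def)
        have An: "norm A \<le> LA"
        proof -
          have "ln (norm A) < real (l n) * (lyap + \<eta>)" using A(3) by (simp add: B1_def)
          then have "exp (ln (norm A)) < LA" unfolding LA_def by (simp only: exp_less_cancel_iff)
          moreover have "norm A > 0" using det1_norm_ge1[OF A(1)] by linarith
          ultimately show ?thesis by simp
        qed
        have H2: "(sl / 4) ^ d * \<bar>fw p0\<bar> \<le> \<bar>binary_form d fw (A *v v)\<bar>" using A(3) by (simp add: BA_def sl_def)
        have saLG: "1 \<le> sa * LG" unfolding sa_def LG_def exp_add[symmetric] using lyap by (simp add: algebra_simps)
        have f: "(sl * sa / 4) ^ d * ((sa / (4 * LG)) ^ d * \<bar>k p0 q0\<bar>) - S * (real d * (LA / sa) * (2 * LA * LG) ^ d)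
          \<le> \<bar>\<Sum>p\<le>d. \<Sum>q\<le>d. k p q * normal_mono d p q (A ** G)\<bar>"
          unfolding S_def
        proof (rule product_form_lower[OF A(1) G(1) An])
          show "norm G \<le> LG" using Gn by (simp add: LG_def)
          show "sa \<le> \<bar>G$1$1\<bar>" using Ga by (simp add: sa_def)
          show "(sl / 4) ^ d * \<bar>binary_form d (k p0) ((1 / G$1$1) *\<^sub>R (transpose G *v axis 1 1))\<bar> 
             \<le> \<bar>binary_form d (\<lambda>p. binary_form d (k p) ((1 / G$1$1) *\<^sub>R (transpose G *v axis 1 1))) (A *v sgn (G *v axis 1 1))\<bar>"
            using H2 by (simp add: fw_def[abs_def] w_def a_def v_def)
        qed (use saLG GH1 pq in \<open>auto simp: sa_def sl_def\<close>)
        define Z where "Z = exp (real n * (D * lyap))"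
        define Y where "Y = y n"
        have Yp: "Y \<ge> 1" "Y > 0" unfolding Y_def y_def using eta by auto
        have Ye: "exp (real n * (D * lyap - real j * (D * \<eta>))) = Z / Y ^ j" for j
          unfolding Z_def Y_def y_def by (simp add: exp_of_nat_mult[symmetric] exp_diff[symmetric] D_def algebra_simps)
        have m1: "\<kappa>' * (Z / Y ^ 3) \<le> (sl * sa / 4) ^ d * ((sa / (4 * LG)) ^ d * \<bar>k p0 q0\<bar>)"
        proof -
          have s1: "sl * sa = exp (real n * (lyap - \<eta>))" unfolding sl_def sa_def exp_add[symmetric] 
            by (simp add: distrib_right[symmetric] rlm)
          have s2: "sa / LG = exp (- (2 * real (m n) * \<eta>))" unfolding sa_def LG_def exp_diff[symmetric] by (simp add: algebra_simps)
          have "(sl * sa / 4) ^ d * ((sa / (4 * LG)) ^ d * \<bar>k p0 q0\<bar>) = \<kappa>' * ((sl * sa) ^ d * (sa / LG) ^ d)"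
            unfolding \<kappa>'_def by (rule quarter_powers)
          moreover have "(sl * sa) ^ d * (sa / LG) ^ d = exp (D * (real n * (lyap - \<eta>)) + D * (- (2 * real (m n) * \<eta>)))"
            unfolding s1 s2 by (simp only: exp_add exp_of_nat_mult D_def)
          moreover have "exp (real n * (D * lyap - real 3 * (D * \<eta>))) \<le> exp (D * (real n * (lyap - \<eta>)) + D * (- (2 * real (m n) * \<eta>)))"
          proof -
            have "2 * D * \<eta> * real (m n) \<le> 2 * D * \<eta> * real n" using D eta lm3(4)[of n] by (intro mult_left_mono) auto
            then show ?thesis by (simp add: algebra_simps)
          qed
          ultimately show ?thesis unfolding Ye using k' by (metis mult_left_mono less_imp_le)
        qed
        have LALG: "LA * LG = exp (real n * (lyap + \<eta>))" unfolding LA_def LG_def exp_add[symmetric] by (simp add: distrib_right[symmetric] rlm)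
        have m2: "S * (real d * (LA / sa) * (2 * LA * LG) ^ d) \<le> (S * real d * 2 ^ d) * (Z / Y ^ 6)"
        proof -
          have "(LA / sa) * (LA * LG) ^ d = exp (real (l n) * (lyap + \<eta>) - real (m n) * (lyap - \<eta>) + D * (real n * (lyap + \<eta>)))"
            unfolding LALG unfolding LA_def sa_def by (simp only: exp_add exp_diff exp_of_nat_mult D_def)
          also have "\<dots> \<le> exp (real n * (D * lyap - real 6 * (D * \<eta>)))"
          proof -
            have ml: "real (m n) = real n - real (l n)" using rlm[of n] by linarith
            have "2 * real (l n) * lyap \<le> 2 / 3 * real n * lyap" using lm3(1)[of n] lyap by (intro mult_right_mono) auto
            then have 1: "real (l n) * lyap - real (m n) * lyap \<le> - (real n * (lyap / 3))" unfolding ml by (simp add: algebra_simps)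
            have 2: "\<eta> * 1 \<le> \<eta> * D" using D eta by (intro mult_left_mono) auto
            have "8 * (D * \<eta>) \<le> lyap / 3" using eta(2) by (simp add: D_def)
            then have "\<eta> + D * \<eta> + 6 * (D * \<eta>) \<le> lyap / 3" using 2 by (simp add: mult.commute)
            then have "real n * (\<eta> + D * \<eta> + 6 * (D * \<eta>)) \<le> real n * (lyap / 3)" by (intro mult_left_mono) auto
            moreover have "real (l n) * \<eta> + real (m n) * \<eta> = real n * \<eta>" by (simp add: distrib_right[symmetric] rlm)
            ultimately have "real (l n) * (lyap + \<eta>) - real (m n) * (lyap - \<eta>) + D * (real n * (lyap + \<eta>)) \<le> real n * (D * lyap - 6 * (D * \<eta>))"
              using 1 by (simp add: algebra_simps)
            then show ?thesis by simp
          qed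
          also have "\<dots> = Z / Y ^ 6" by (rule Ye)
          finally have "(S * real d * 2 ^ d) * ((LA / sa) * (LA * LG) ^ d) \<le> (S * real d * 2 ^ d) * (Z / Y ^ 6)" using S0 by (intro mult_left_mono) auto
          then show ?thesis by (simp add: power_mult_distrib mult.assoc mult.left_commute)
        qed
        have m3: "L * norm (A ** G) ^ (d - 1) \<le> \<bar>L\<bar> * (Z / Y ^ 6)"
        proof -
          have "norm (A ** G) \<le> LA * LG" by (rule order_trans[OF norm_mm_le mult_mono]) (use An Gn in \<open>auto simp: LG_def LA_def\<close>)
          then have "norm (A ** G) ^ (d - 1) \<le> (LA * LG) ^ (d - 1)" by (intro power_mono) auto
          also have "\<dots> = exp (real (d - 1) * (real n * (lyap + \<eta>)))" unfolding LALG by (simp only: exp_of_nat_mult)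
          also have "\<dots> \<le> exp (real n * (D * lyap - real 6 * (D * \<eta>)))"
          proof -
            have "real (d - 1) * (lyap + \<eta>) = D * lyap - lyap + D * \<eta> - \<eta>" using d by (simp add: D_def of_nat_diff algebra_simps)
            also have "\<dots> \<le> D * lyap - 6 * (D * \<eta>)"
            proof -
              have "24 * (D * \<eta>) \<le> lyap" using eta(2) by (simp add: D_def)
              moreover have "D * \<eta> \<ge> 0" using D eta by simp
              ultimately show ?thesis using eta(1) by linarith
            qed
            finally have "real n * (real (d - 1) * (lyap + \<eta>)) \<le> real n * (D * lyap - 6 * (D * \<eta>))" by (intro mult_left_mono) auto
            then show ?thesis by (simp add: mult.left_commute)
          qed
          also have "\<dots> = Z / Y ^ 6" by (rule Ye)
          finally have "\<bar>L\<bar> * norm (A ** G) ^ (d - 1) \<le> \<bar>L\<bar> * (Z / Y ^ 6)" by (intro mult_left_mono) auto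
          moreover have "L * norm (A ** G) ^ (d - 1) \<le> \<bar>L\<bar> * norm (A ** G) ^ (d - 1)" by (intro mult_right_mono) auto
          ultimately show ?thesis by linarith
        qed
        have "det (A ** G) = 1" using A(1) G(1) by (simp add: det_mul)
        from R[OF this] have "\<kappa>' * (Z / Y ^ 3) - (S * real d * 2 ^ d) * (Z / Y ^ 6) - \<bar>L\<bar> * (Z / Y ^ 6) \<le> \<bar>P (A ** G)\<bar>"
          using f m1 m2 m3 by linarith
        then have low: "\<kappa>' * (Z / Y ^ 3) - M * (Z / Y ^ 6) \<le> \<bar>P (A ** G)\<bar>" by (simp add: M_def algebra_simps)
        have Zp: "Z > 0" by (simp add: Z_def)
        have "Z / Y ^ 4 \<le> \<kappa>' * (Z / Y ^ 3) - M * (Z / Y ^ 6)"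
        proof -
          have "(1 + M) * (Z / Y ^ 4) \<le> (\<kappa>' * Y) * (Z / Y ^ 4)" using yn[OF n] Zp Yp by (intro mult_right_mono) (auto simp: Y_def)
          also have "\<dots> = \<kappa>' * (Z / Y ^ 3)" using Yp by (simp add: power3_eq_cube power4_eq_xxxx)
          finally have 1: "Z / Y ^ 4 + M * (Z / Y ^ 4) \<le> \<kappa>' * (Z / Y ^ 3)" by (simp only: distrib_right mult_1_left)
          have "Z / Y ^ 6 \<le> Z / Y ^ 4" using Yp Zp by (intro divide_left_mono power_increasing mult_pos_pos) auto
          then have "M * (Z / Y ^ 6) \<le> M * (Z / Y ^ 4)" using M0 by (intro mult_left_mono)
          then show ?thesis using 1 by linarith
        qed
        also have "Z / Y ^ 4 = exp (real n * (D * lyap - real 4 * (D * \<eta>)))" by (rule Ye[symmetric])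
        finally have "exp (real n * (D * lyap - 4 * (D * \<eta>))) \<le> \<bar>P (A ** G)\<bar>" using low by simp
        moreover have "exp (real n * (real d * lyap - \<epsilon>)) \<le> exp (real n * (D * lyap - 4 * (D * \<eta>)))"
        proof -
          have "D * \<eta> \<ge> 0" using D eta(1) by simp
          moreover have "24 * (D * \<eta>) \<le> \<epsilon>" using eta(3) by (simp add: D_def)
          ultimately have "4 * (D * \<eta>) \<le> \<epsilon>" by linarith
          then show ?thesis by (simp add: D_def mult_left_mono)
        qed
        moreover have "\<bar>P (A ** G)\<bar> < exp (real n * (real d * lyap - \<epsilon>))" using A(2) by (simp add: E_def)
        ultimately show False by linarith
      qed (use BAs B12s in auto)
      also have "\<dots> \<le> measure (K (l n)) BA + measure (K (l n)) (B1 (l n))" by (intro meas_Un BAs B12s)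
      also have "\<dots> \<le> \<beta> n" unfolding \<beta>_def BA_def using C1[OF nv pq(1), of "l n" fw] by simp
      finally show "measure (K (l n)) {A. A ** G \<in> E} \<le> \<beta> n" .
    qed
    moreover have "measure (K (m n)) B \<le> measure (K (m n)) (B1 (m n)) + (measure (K (m n)) (B2 (m n)) + measure (K (m n)) (B3 (m n)))"
      unfolding B_def by (rule order_trans[OF meas_Un add_left_mono[OF meas_Un]]) (use B12s B3s in auto)
    ultimately show "measure (K n) {g. \<bar>P g\<bar> < exp (real n * (real d * lyap - \<epsilon>))}
       \<le> measure (K (m n)) (B1 (m n)) + (measure (K (m n)) (B2 (m n)) + measure (K (m n)) (B3 (m n))) + \<beta> n"
      unfolding lm E_def by linarith
  qed (rule prob_K_le_1)
qed

text \<open>On \<open>SL\<^sub>2\<close> a polynomial with top degree \<open>d\<close> is bounded by a multiple of \<open>|g|\<^sup>d\<close>.\<close>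

theorem poly_upper:
  assumes d: "d \<ge> 1"
    and R: "\<And>g. det g = 1 \<Longrightarrow> \<bar>P g - (\<Sum>p\<le>d. \<Sum>q\<le>d. k p q * normal_mono d p q g)\<bar> \<le> L * norm g ^ (d - 1)" 
    and e: "\<epsilon> > 0"
  shows "exp_small UNIV (\<lambda>_::unit. \<lambda>n. measure (K n) {g. \<bar>P g\<bar> > exp (real n * (real d * lyap + \<epsilon>))})"
proof -
  define S where "S = (\<Sum>p\<le>d. \<Sum>q\<le>d. \<bar>k p q\<bar>) + \<bar>L\<bar> + 1"
  have S1: "S \<ge> 1" unfolding S_def using sum_nonneg[of "{..d}" "\<lambda>p. \<Sum>q\<le>d. \<bar>k p q\<bar>"] by (simp add: sum_nonneg)
  have up: "\<bar>P g\<bar> \<le> S * norm g ^ d" if g: "det g = 1" for g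
  proof -
    have n1: "norm g \<ge> 1" by (rule det1_norm_ge1[OF g])
    have "\<bar>\<Sum>p\<le>d. \<Sum>q\<le>d. k p q * normal_mono d p q g\<bar> \<le> (\<Sum>p\<le>d. \<Sum>q\<le>d. \<bar>k p q\<bar> * norm g ^ d)"
    proof (rule order_trans[OF sum_abs sum_mono], rule order_trans[OF sum_abs sum_mono])
      fix p q assume "p \<in> {..d}" "q \<in> {..d}"
      then show "\<bar>k p q * normal_mono d p q g\<bar> \<le> \<bar>k p q\<bar> * norm g ^ d"
        unfolding abs_mult by (intro mult_left_mono normal_mono_bound entry_le) auto
    qed
    also have "\<dots> = (\<Sum>p\<le>d. \<Sum>q\<le>d. \<bar>k p q\<bar>) * norm g ^ d" by (simp add: sum_distrib_right)
    finally have 1: "\<bar>\<Sum>p\<le>d. \<Sum>q\<le>d. k p q * normal_mono d p q g\<bar> \<le> (\<Sum>p\<le>d. \<Sum>q\<le>d. \<bar>k p q\<bar>) * norm g ^ d" .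
    have "L * norm g ^ (d - 1) \<le> \<bar>L\<bar> * norm g ^ d" using n1 by (intro mult_mono power_increasing) auto
    then have "\<bar>P g\<bar> \<le> (\<Sum>p\<le>d. \<Sum>q\<le>d. \<bar>k p q\<bar>) * norm g ^ d + \<bar>L\<bar> * norm g ^ d" using R[OF g] 1 by linarith
    also have "\<dots> \<le> S * norm g ^ d" by (simp add: S_def algebra_simps)
    finally show ?thesis .
  qed
  define \<eta> where "\<eta> = \<epsilon> / (2 * real d)"
  have eta: "\<eta> > 0" "real d * \<eta> = \<epsilon> / 2" using e d by (auto simp: \<eta>_def)
  obtain n0 :: nat where n0: "2 * ln S / \<epsilon> < real n0" using reals_Archimedean2 by blast
  show ?thesis
  proof (rule exp_small_eventually[OF ldp_norm_upper[OF eta(1)], where start=n0])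
    fix i :: unit and n assume n: "n0 \<le> n"
    show "measure (K n) {g. \<bar>P g\<bar> > exp (real n * (real d * lyap + \<epsilon>))} \<le> measure (K n) {g. real n * (lyap + \<eta>) \<le> ln (norm g)}"
    proof (rule meas_mono_AE, rule eventually_mono[OF AE_det_K], rule impI, rule ccontr)
      fix g :: "real^2^2" assume g: "det g = 1" "g \<in> {g. \<bar>P g\<bar> > exp (real n * (real d * lyap + \<epsilon>))}" "g \<notin> {g. real n * (lyap + \<eta>) \<le> ln (norm g)}"
      have n1: "norm g > 0" using det1_norm_ge1[OF g(1)] by linarith
      have "norm g = exp (ln (norm g))" using n1 by simp
      also have "\<dots> \<le> exp (real n * (lyap + \<eta>))" using g(3) by simp
      finally have "norm g ^ d \<le> exp (real n * (lyap + \<eta>)) ^ d" by (intro power_mono) auto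
      also have "\<dots> = exp (real n * (real d * lyap + \<epsilon> / 2))" 
        unfolding exp_of_nat_mult[symmetric] eta(2)[symmetric] by (simp add: algebra_simps)
      finally have "\<bar>P g\<bar> \<le> S * exp (real n * (real d * lyap + \<epsilon> / 2))" using up[OF g(1)] S1 by (meson mult_left_mono order_trans zero_le_one)
      also have "S \<le> exp (real n * (\<epsilon> / 2))"
      proof -
        have "2 * ln S / \<epsilon> < real n" using n0 n by linarith
        then have "2 * ln S < real n * \<epsilon>" using e by (simp add: pos_divide_less_eq)
        then have "exp (ln S) \<le> exp (real n * (\<epsilon> / 2))" by simp
        then show ?thesis using S1 by simp
      qed
      also have "exp (real n * (\<epsilon> / 2)) * exp (real n * (real d * lyap + \<epsilon> / 2)) = exp (real n * (real d * lyap + \<epsilon>))"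
        unfolding exp_add[symmetric] by (simp add: algebra_simps)
      finally show False using g(2) by simp
    qed (rule sets_CollectI, measurable)
  qed (rule prob_K_le_1)
qed

end

section \<open>From laws to trajectories\<close>

lemma real_polynomial_continuous: "real_polynomial_function (P :: real^2^2 \<Rightarrow> real) \<Longrightarrow> continuous_on UNIV P"
  by (simp add: continuous_at_imp_continuous_on continuous_real_polymonial_function)

lemma real_polynomial_measurable: "real_polynomial_function (P :: real^2^2 \<Rightarrow> real) \<Longrightarrow> P \<in> borel_measurable borel"
  by (intro borel_measurable_continuous_onI real_polynomial_continuous)

lemma root_limsup_less_1:
  assumes u: "exp_small UNIV (\<lambda>_::unit. f)" and f0: "\<And>n. 0 \<le> f n"
  shows "limsup (\<lambda>n. ereal (root n (f n))) < 1"
proof -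
  obtain c C where c: "c > 0" "C \<ge> 0" and C: "\<And>n i. i \<in> (UNIV::unit set) \<Longrightarrow> f n \<le> C * exp (- (c * real n))" by (rule exp_smallE[OF u], rule that)
  obtain n0 :: nat where n0: "2 * C / c < real n0" using reals_Archimedean2 by blast
  have "root n (f n) \<le> exp (- (c / 2))" if n: "n \<ge> Suc n0" for n
  proof -
    have "2 * C / c < real n" using n0 n by linarith
    then have "C < real n * (c / 2)" using c by (simp add: pos_divide_less_eq)
    also have "\<dots> \<le> exp (real n * (c / 2))" using exp_ge_add_one_self[of "real n * (c / 2)"] by linarith
    finally have "C * exp (- (c * real n)) \<le> exp (real n * (c / 2)) * exp (- (c * real n))" by (intro mult_right_mono) auto
    also have "\<dots> = exp (- (c / 2)) ^ n" unfolding exp_add[symmetric] exp_of_nat_mult[symmetric] by (simp add: algebra_simps)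
    finally have "f n \<le> exp (- (c / 2)) ^ n" using C[of "()" n] by simp
    then have "root n (f n) \<le> root n (exp (- (c / 2)) ^ n)" using n by (intro real_root_le_mono) auto
    also have "\<dots> = exp (- (c / 2))" using n by (intro real_root_power_cancel) auto
    finally show ?thesis .
  qed
  then have "\<forall>\<^sub>F n in sequentially. ereal (root n (f n)) \<le> ereal (exp (- (c / 2)))"
    unfolding eventually_sequentially by (intro exI[of _ "Suc n0"]) simp
  then have "limsup (\<lambda>n. ereal (root n (f n))) \<le> ereal (exp (- (c / 2)))" by (rule Limsup_bounded)
  also have "\<dots> < 1" using c by simp
  finally show ?thesis .
qed

lemma exp_small_summable:
  assumes u: "exp_small UNIV (\<lambda>_::unit. f)" and f0: "\<And>n. 0 \<le> f n" shows "summable f"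
proof -
  obtain c C where c: "c > 0" "C \<ge> 0" and C: "\<And>n i. i \<in> (UNIV::unit set) \<Longrightarrow> f n \<le> C * exp (- (c * real n))" by (rule exp_smallE[OF u], rule that)
  have "summable (\<lambda>n. exp (- c) ^ n)" using c by (intro summable_geometric) auto
  then have "summable (\<lambda>n. C * exp (- c) ^ n)" by (rule summable_mult)
  moreover have "norm (f n) \<le> C * exp (- c) ^ n" for n
    using C[of "()" n] f0[of n] by (simp add: exp_of_nat_mult[symmetric] mult.commute)
  ultimately show ?thesis by (rule summable_comparison_test'[where N=0])
qed

text \<open>The growth rate is \<open>d\<close> times the Lyapunov exponent, with \<open>d\<close> from \<open>top_form\<close>.\<close>

theorem (in SL2_walk) poly_ldp:
  assumes P: "real_polynomial_function P" and nc: "\<not> P constant_on carrier SL2"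
  shows "\<exists>l>0. \<forall>\<epsilon>>0. exp_small UNIV (\<lambda>_::unit. \<lambda>n. measure (K n) {g. \<bar>P g\<bar> < exp (real n * (l - \<epsilon>)) \<or> exp (real n * (l + \<epsilon>)) < \<bar>P g\<bar>})"
proof -
  obtain d k L p0 q0 where d: "d \<ge> 1" and pq: "p0 \<le> d" "q0 \<le> d" and k: "k p0 q0 \<noteq> 0" 
    and R: "\<And>g. det g = 1 \<Longrightarrow> \<bar>P g - (\<Sum>p\<le>d. \<Sum>q\<le>d. k p q * normal_mono d p q g)\<bar> \<le> L * norm g ^ (d - 1)"
    using top_form[OF P nc] by (elim exE conjE) (rule that, auto)
  have Pm: "P \<in> borel_measurable borel" by (rule real_polynomial_measurable[OF P])
  have "exp_small UNIV (\<lambda>_::unit. \<lambda>n. measure (K n) {g. \<bar>P g\<bar> < exp (real n * (real d * lyap - \<epsilon>)) \<or> exp (real n * (real d * lyap + \<epsilon>)) < \<bar>P g\<bar>})"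
    if e: "\<epsilon> > 0" for \<epsilon>
  proof (rule exp_small_mono[OF exp_small_add[OF poly_lower[where P=P and k=k, OF Pm d pq k R e] poly_upper[where P=P and k=k, OF d R e]]])
    fix i :: unit and n
    have s: "{g. \<bar>P g\<bar> < exp (real n * (real d * lyap - \<epsilon>))} \<in> sets borel" "{g. exp (real n * (real d * lyap + \<epsilon>)) < \<bar>P g\<bar>} \<in> sets borel"
      using Pm by (intro sets_CollectI; measurable)+
    show "measure (K n) {g. \<bar>P g\<bar> < exp (real n * (real d * lyap - \<epsilon>)) \<or> exp (real n * (real d * lyap + \<epsilon>)) < \<bar>P g\<bar>}
       \<le> measure (K n) {g. \<bar>P g\<bar> < exp (real n * (real d * lyap - \<epsilon>))} + measure (K n) {g. exp (real n * (real d * lyap + \<epsilon>)) < \<bar>P g\<bar>}"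
      using meas_Un[OF s] by (simp add: Un_def)
  qed auto
  moreover have "real d * lyap > 0" using d lyap by simp
  ultimately show ?thesis by blast
qed

text \<open>A subvariety that carries almost all the mass is closed, so it contains the support; if it is also a
subgroup, it contains the group generated by the support.\<close>

lemma walk_of_non_elementary:
  assumes "prob_space \<mu>" and s: "sets \<mu> = sets SL2_borel" and ne: "non_elementary \<mu>" and em: "exponential_moment \<mu>"
  shows "\<exists>\<tau>. SL2_walk (distr \<mu> borel (\<lambda>g. g)) \<tau>"
proof -
  interpret prob_space \<mu> by fact
  have sp: "space \<mu> = carrier SL2" using sets_eq_imp_space_eq[OF s] by (simp add: space_restrict_space)
  have m: "(\<lambda>g. g) \<in> borel_measurable \<mu>"
    by (subst measurable_cong_sets[OF s refl]) (rule measurable_restrict_space1, simp)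
  have SL2_law: "SL2_law (distr \<mu> borel (\<lambda>g. g))"
    unfolding SL2_law_def
  proof (intro conjI)
    show "prob_space (distr \<mu> borel (\<lambda>g. g))" by (rule prob_space_distr[OF m])
    show "AE g in distr \<mu> borel (\<lambda>g. g). det g = 1"
      using sets_det1 by (subst AE_distr_iff[OF m]) (auto intro!: AE_I2 simp: sp SL2_simps)
  qed simp
  obtain t where t: "t > 0" "integrable \<mu> (\<lambda>g. norm g powr t)" using em by (auto simp: exponential_moment_def)
  define \<tau> where "\<tau> = min t 1"
  have "SL2_walk (distr \<mu> borel (\<lambda>g. g)) \<tau>"
  proof
    show "SL2_law (distr \<mu> borel (\<lambda>g. g))" by (rule SL2_law)
    show "0 < \<tau>" "\<tau> \<le> 1" using t by (auto simp: \<tau>_def)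
    have pm: "(\<lambda>g::real^2^2. norm g powr \<tau>) \<in> borel_measurable borel" by measurable
    have "integrable \<mu> (\<lambda>g. norm g powr \<tau>)"
    proof (rule Bochner_Integration.integrable_bound[OF t(2)])
      show "(\<lambda>g. norm g powr \<tau>) \<in> borel_measurable \<mu>" using measurable_compose[OF m pm] .
      show "AE g in \<mu>. norm (norm g powr \<tau>) \<le> norm (norm g powr t)"
      proof (rule AE_I2)
        fix g assume "g \<in> space \<mu>"
        then have "norm g \<ge> 1" by (intro det1_norm_ge1) (simp add: sp SL2_simps)
        then show "norm (norm g powr \<tau>) \<le> norm (norm g powr t)" by (simp add: \<tau>_def powr_mono)
      qed
    qed
    then show "integrable (distr \<mu> borel (\<lambda>g. g)) (\<lambda>g. norm g powr \<tau>)" by (subst integrable_distr_eq[OF m pm])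
    fix V assume V: "algebraic_subvariety V" "subgroup V SL2" "AE g in distr \<mu> borel (\<lambda>g. g). g \<in> V"
    obtain F where F: "\<And>P. P \<in> F \<Longrightarrow> real_polynomial_function P" "V = {A \<in> carrier SL2. \<forall>P\<in>F. P A = 0}"
      using V(1) unfolding algebraic_subvariety_def by blast
    have ae: "AE g in \<mu>. g \<in> V" using AE_distrD[OF m V(3)] by simp
    have "measure_support \<mu> \<subseteq> V"
    proof
      fix A assume A: "A \<in> measure_support \<mu>"
      show "A \<in> V"
      proof (rule ccontr)
        assume "A \<notin> V"
        then obtain P where P: "P \<in> F" "P A \<noteq> 0" using A F(2) by (auto simp: measure_support_def)
        define U where "U = {B. P B \<noteq> 0}"
        have U: "open U" unfolding U_def using real_polynomial_continuous[OF F(1)[OF P(1)]] by (intro open_Collect_neq continuous_intros) auto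
        have "emeasure \<mu> (U \<inter> carrier SL2) > 0" using A U P(2) by (auto simp: measure_support_def U_def)
        moreover have "U \<inter> carrier SL2 \<in> sets \<mu>" unfolding s using U by (auto simp: sets_restrict_space intro!: image_eqI[of _ _ U])
        moreover have "AE g in \<mu>. g \<notin> U \<inter> carrier SL2" using ae by (rule eventually_mono) (use P(1) in \<open>auto simp: F(2) U_def\<close>)
        ultimately show False using AE_iff_null_sets[of "U \<inter> carrier SL2" \<mu>] by (simp add: null_sets_def)
      qed
    qed
    then have "generate SL2 (measure_support \<mu>) \<subseteq> V" by (rule group.generate_subgroup_incl[OF group_SL2 _ V(2)])
    then show "V = carrier SL2" using ne V(1) by (simp add: non_elementary_def zariski_dense_def)
  qed
  then show ?thesis ..
qed

lemma random_walk_restrict: "{1..n} \<subseteq> J \<Longrightarrow> random_walk (\<lambda>i x. x i) n (restrict (\<lambda>i. X i \<omega>) J) = random_walk X n \<omega>"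
proof (induction n)
  case (Suc n)
  have "Suc n \<in> J" "{1..n} \<subseteq> J" using Suc.prems by auto
  then show ?case using Suc.IH by simp
qed simp

lemma random_walk_measurable_PiM: "{1..n} \<subseteq> J \<Longrightarrow> random_walk (\<lambda>i x. x i) n \<in> borel_measurable (PiM J (\<lambda>_. SL2_borel))"
proof (induction n)
  case 0
  show ?case by simp
next
  case (Suc n)
  have "Suc n \<in> J" using Suc.prems by auto
  then have c: "(\<lambda>x. x (Suc n)) \<in> measurable (PiM J (\<lambda>_. SL2_borel)) SL2_borel" by (rule measurable_component_singleton)
  have "(\<lambda>g. g) \<in> measurable SL2_borel borel" by (rule measurable_restrict_space1) simp
  from measurable_compose[OF c this] have 1: "(\<lambda>x. x (Suc n)) \<in> borel_measurable (PiM J (\<lambda>_. SL2_borel))" .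
  have "{1..n} \<subseteq> J" using Suc.prems by auto
  then have 2: "random_walk (\<lambda>i x. x i) n \<in> borel_measurable (PiM J (\<lambda>_. SL2_borel))" by (rule Suc.IH)
  have e: "random_walk (\<lambda>i x. x i) (Suc n) = (\<lambda>x. x (Suc n) ** random_walk (\<lambda>i x. x i) n x)" by (rule ext) simp
  show ?case unfolding e by (rule borel_mm[OF 1 2])
qed

text \<open>The first \<open>n\<close> steps and the next one are independent, so the law of \<open>S\<^sub>n\<^sub>+\<^sub>1\<close> is a convolution.\<close>

lemma random_walk_law:
  fixes M :: "'a measure" and X :: "nat \<Rightarrow> 'a \<Rightarrow> real^2^2"
  assumes pM: "prob_space M" and ind: "prob_space.indep_vars M (\<lambda>_. SL2_borel) X {1..}"
    and dist: "\<And>n. n \<ge> 1 \<Longrightarrow> distr M SL2_borel (X n) = \<mu>"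
  shows "random_walk X n \<in> borel_measurable M" "distr M borel (random_walk X n) = mconv_pow (distr \<mu> borel (\<lambda>g. g)) n"
proof -
  interpret prob_space M by fact
  have idm: "(\<lambda>g. g) \<in> measurable SL2_borel borel" by (rule measurable_restrict_space1) simp
  have Xm: "X n \<in> measurable M SL2_borel" if "n \<ge> 1" for n using ind that by (auto simp: indep_vars_def)
  have Xb: "X n \<in> borel_measurable M" if "n \<ge> 1" for n using measurable_compose[OF Xm[OF that] idm] by simp
  have Xd: "distr M borel (X n) = distr \<mu> borel (\<lambda>g. g)" if "n \<ge> 1" for n
    unfolding dist[OF that, symmetric] using distr_distr[OF idm Xm[OF that]] by (simp add: o_def)
  have "random_walk X n \<in> borel_measurable M \<and> distr M borel (random_walk X n) = mconv_pow (distr \<mu> borel (\<lambda>g. g)) n"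
  proof (induction n)
    case 0
    have "random_walk X 0 = (\<lambda>_. mat 1)" by (rule ext) simp
    then show ?case by simp
  next
    case (Suc n)
    have S: "random_walk X n \<in> borel_measurable M" using Suc by simp
    have Xs: "X (Suc n) \<in> borel_measurable M" by (rule Xb) simp
    note [measurable] = S Xs
    have e: "random_walk X (Suc n) = (\<lambda>\<omega>. (case (X (Suc n) \<omega>, random_walk X n \<omega>) of (g, h) \<Rightarrow> g ** h))" by (rule ext) simp
    have m: "random_walk X (Suc n) \<in> borel_measurable M" unfolding e by simp
    have "indep_var (PiM {Suc n} (\<lambda>_. SL2_borel)) (\<lambda>\<omega>. restrict (\<lambda>i. X i \<omega>) {Suc n}) (PiM {1..n} (\<lambda>_. SL2_borel)) (\<lambda>\<omega>. restrict (\<lambda>i. X i \<omega>) {1..n})"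
      by (rule indep_var_restrict[OF ind]) auto
    from indep_var_compose[OF this, of "\<lambda>x. x (Suc n)" borel "random_walk (\<lambda>i x. x i) n" borel]
    have "indep_var borel ((\<lambda>x. x (Suc n)) \<circ> (\<lambda>\<omega>. restrict (\<lambda>i. X i \<omega>) {Suc n})) borel (random_walk (\<lambda>i x. x i) n \<circ> (\<lambda>\<omega>. restrict (\<lambda>i. X i \<omega>) {1..n}))"
      using random_walk_measurable_PiM[of n "{1..n}"] measurable_compose[OF measurable_component_singleton[of "Suc n" "{Suc n}" "\<lambda>_. SL2_borel"] idm] by simp
    then have "indep_var borel (X (Suc n)) borel (random_walk X n)"
      by (simp add: o_def random_walk_restrict)
    then have p: "distr M borel (X (Suc n)) \<Otimes>\<^sub>M distr M borel (random_walk X n) = distr M (borel \<Otimes>\<^sub>M borel) (\<lambda>\<omega>. (X (Suc n) \<omega>, random_walk X n \<omega>))"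
      unfolding indep_var_distribution_eq by simp
    have "distr M borel (random_walk X (Suc n)) = distr (distr M (borel \<Otimes>\<^sub>M borel) (\<lambda>\<omega>. (X (Suc n) \<omega>, random_walk X n \<omega>))) borel (\<lambda>(g, h). g ** h)"
      unfolding e by (subst distr_distr) (auto simp: o_def)
    also have "\<dots> = mconv_pow (distr \<mu> borel (\<lambda>g. g)) (Suc n)"
      unfolding p[symmetric] using Suc Xd[of "Suc n"] by (simp add: mconv_def)
    finally show ?case using m by blast
  qed
  then show "random_walk X n \<in> borel_measurable M" "distr M borel (random_walk X n) = mconv_pow (distr \<mu> borel (\<lambda>g. g)) n" by auto
qed

theorem theorem1p1:
  fixes \<mu> :: "(real^2^2) measure"
    and M :: "'a measure"
    and X :: "nat \<Rightarrow> 'a \<Rightarrow> real^2^2"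
  assumes "prob_space \<mu>"
    and "sets \<mu> = sets SL2_borel"
    and "non_elementary \<mu>"
    and "exponential_moment \<mu>"
    and "prob_space M"
    and "prob_space.indep_vars M (\<lambda>_. SL2_borel) X {1..}"
    and "\<And>n. n \<ge> 1 \<Longrightarrow> distr M SL2_borel (X n) = \<mu>"
  shows
    "(\<forall>V. proper_algebraic_subvariety V \<longrightarrow>
        limsup (\<lambda>n. ereal (root n (measure M {\<omega> \<in> space M. random_walk X n \<omega> \<in> V}))) < 1
        \<and> (AE \<omega> in M. \<forall>\<^sub>F n in sequentially. random_walk X n \<omega> \<notin> V))
     \<and> (\<forall>P. real_polynomial_function P \<and> \<not> P constant_on carrier SL2 \<longrightarrow>
        (\<exists>l::real. l > 0
          \<and> (AE \<omega> in M. (\<lambda>n. elog \<bar>P (random_walk X n \<omega>)\<bar> / ereal (real n)) \<longlonglongrightarrow> ereal l)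
          \<and> (\<forall>\<epsilon>::real. \<epsilon> > 0 \<longrightarrow>
               limsup (\<lambda>n. ereal (root n (measure M
                 {\<omega> \<in> space M.
                    \<bar>elog \<bar>P (random_walk X n \<omega>)\<bar> / ereal (real n) - ereal l\<bar> > ereal \<epsilon>}))) < 1)))"
proof -
  obtain \<tau> where "SL2_walk (distr \<mu> borel (\<lambda>g. g)) \<tau>" using walk_of_non_elementary[OF assms(1-4)] by blast
  then interpret w: SL2_walk "distr \<mu> borel (\<lambda>g. g)" \<tau> .
  interpret M: prob_space M by fact
  define S where "S = random_walk X"
  have Sm [measurable]: "S n \<in> borel_measurable M" and Sd: "distr M borel (S n) = w.K n" for n
    unfolding S_def using random_walk_law[OF assms(5,6,7)] by auto
  define bad where "bad P l \<epsilon> n = {g::real^2^2. \<bar>P g\<bar> < exp (real n * (l - \<epsilon>)) \<or> exp (real n * (l + \<epsilon>)) < \<bar>P g\<bar>}" for P l \<epsilon> n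
  have bads: "bad P l \<epsilon> n \<in> sets borel" if "real_polynomial_function P" for P l \<epsilon> n
  proof -
    note real_polynomial_measurable[OF that, measurable]
    show ?thesis unfolding bad_def by (rule sets_CollectI) measurable
  qed
  have evs: "{\<omega> \<in> space M. S n \<omega> \<in> B} \<in> sets M" if "B \<in> sets borel" for n B
    using measurable_sets[OF Sm that, of n] by (simp add: vimage_def Int_def conj_commute)
  have evm: "measure M {\<omega> \<in> space M. S n \<omega> \<in> B} = measure (w.K n) B" if "B \<in> sets borel" for n B
    unfolding Sd[symmetric] using that by (subst measure_distr[OF Sm]) (auto simp: vimage_def Int_def conj_commute)
  have main: "\<exists>l>0. \<forall>\<epsilon>>0. exp_small UNIV (\<lambda>_::unit. \<lambda>n. measure M {\<omega> \<in> space M. S n \<omega> \<in> bad P l \<epsilon> n}) \<and>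
      (AE \<omega> in M. \<forall>\<^sub>F n in sequentially. S n \<omega> \<notin> bad P l \<epsilon> n)"
    if P: "real_polynomial_function P" "\<not> P constant_on carrier SL2" for P
  proof -
    obtain l where l: "l > 0" "\<And>\<epsilon>. \<epsilon> > 0 \<Longrightarrow> exp_small UNIV (\<lambda>_::unit. \<lambda>n. measure (w.K n) (bad P l \<epsilon> n))"
      using w.poly_ldp[OF P] unfolding bad_def by blast
    have "exp_small UNIV (\<lambda>_::unit. \<lambda>n. measure M {\<omega> \<in> space M. S n \<omega> \<in> bad P l \<epsilon> n}) \<and>
      (AE \<omega> in M. \<forall>\<^sub>F n in sequentially. S n \<omega> \<notin> bad P l \<epsilon> n)" if e: "\<epsilon> > 0" for \<epsilon>
    proof
      show u: "exp_small UNIV (\<lambda>_::unit. \<lambda>n. measure M {\<omega> \<in> space M. S n \<omega> \<in> bad P l \<epsilon> n})"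
        using l(2)[OF e] by (simp add: evm[OF bads[OF P(1)]])
      have "AE \<omega> in M. \<forall>\<^sub>F n in sequentially. \<omega> \<in> space M - {\<omega> \<in> space M. S n \<omega> \<in> bad P l \<epsilon> n}"
        by (rule borel_cantelli_AE1[OF evs[OF bads[OF P(1)]] _ exp_small_summable[OF u]]) (auto simp: M.emeasure_eq_measure)
      then show "AE \<omega> in M. \<forall>\<^sub>F n in sequentially. S n \<omega> \<notin> bad P l \<epsilon> n"
        by (rule eventually_mono) (auto elim!: eventually_mono)
    qed
    then show ?thesis using l(1) by blast
  qed
  have part1: "limsup (\<lambda>n. ereal (root n (measure M {\<omega> \<in> space M. S n \<omega> \<in> V}))) < 1 \<and> (AE \<omega> in M. \<forall>\<^sub>F n in sequentially. S n \<omega> \<notin> V)"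
    if V: "proper_algebraic_subvariety V" for V
  proof -
    obtain F where F: "\<And>P. P \<in> F \<Longrightarrow> real_polynomial_function P" "V = {A \<in> carrier SL2. \<forall>P\<in>F. P A = 0}" "V \<noteq> carrier SL2"
      using V unfolding proper_algebraic_subvariety_def algebraic_subvariety_def by blast
    then obtain A P where A: "A \<in> carrier SL2" "P \<in> F" "P A \<noteq> 0" by blast
    have P: "real_polynomial_function P" by (rule F(1)[OF A(2)])
    show ?thesis
    proof (cases "P constant_on carrier SL2")
      case True
      then have "P B \<noteq> 0" if "B \<in> carrier SL2" for B using A that unfolding constant_on_def by metis
      then have "V = {}" using F(2) A(2) by auto
      then show ?thesis by (simp add: Limsup_const)
    next
      case False
      obtain l where l: "exp_small UNIV (\<lambda>_::unit. \<lambda>n. measure M {\<omega> \<in> space M. S n \<omega> \<in> bad P l 1 n})"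
        "AE \<omega> in M. \<forall>\<^sub>F n in sequentially. S n \<omega> \<notin> bad P l 1 n" using main[OF P False] zero_less_one by blast
      \<comment> \<open>A zero of \<open>P\<close> violates the lower bound.\<close>
      have sub: "V \<subseteq> bad P l 1 n" for n using F(2) A(2) by (auto simp: bad_def)
      have "exp_small UNIV (\<lambda>_::unit. \<lambda>n. measure M {\<omega> \<in> space M. S n \<omega> \<in> V})"
        by (rule exp_small_mono[OF l(1)], rule M.finite_measure_mono[OF _ evs[OF bads[OF P]]]) (use sub in auto)
      moreover have "AE \<omega> in M. \<forall>\<^sub>F n in sequentially. S n \<omega> \<notin> V"
        using l(2) by (rule eventually_mono) (use sub in \<open>auto elim!: eventually_mono\<close>)
      ultimately show ?thesis using root_limsup_less_1 by (simp add: measure_nonneg)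
    qed
  qed
  have part2: "\<exists>l::real. l > 0
          \<and> (AE \<omega> in M. (\<lambda>n. elog \<bar>P (S n \<omega>)\<bar> / ereal (real n)) \<longlonglongrightarrow> ereal l)
          \<and> (\<forall>\<epsilon>::real. \<epsilon> > 0 \<longrightarrow>
               limsup (\<lambda>n. ereal (root n (measure M
                 {\<omega> \<in> space M. \<bar>elog \<bar>P (S n \<omega>)\<bar> / ereal (real n) - ereal l\<bar> > ereal \<epsilon>}))) < 1)"
    if P: "real_polynomial_function P" "\<not> P constant_on carrier SL2" for P
  proof -
    obtain l where l0: "l > 0" and l: "\<And>\<epsilon>. \<epsilon> > 0 \<Longrightarrow> exp_small UNIV (\<lambda>_::unit. \<lambda>n. measure M {\<omega> \<in> space M. S n \<omega> \<in> bad P l \<epsilon> n})"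
      "\<And>\<epsilon>. \<epsilon> > 0 \<Longrightarrow> AE \<omega> in M. \<forall>\<^sub>F n in sequentially. S n \<omega> \<notin> bad P l \<epsilon> n" using main[OF P] by blast
    have good: "\<bar>P g\<bar> \<noteq> 0 \<and> \<bar>ln \<bar>P g\<bar> / real n - l\<bar> \<le> \<epsilon>" if g: "g \<notin> bad P l \<epsilon> n" and n: "n \<ge> 1" for g \<epsilon> n
    proof -
      have b: "exp (real n * (l - \<epsilon>)) \<le> \<bar>P g\<bar>" "\<bar>P g\<bar> \<le> exp (real n * (l + \<epsilon>))" using g by (auto simp: bad_def)
      have p: "\<bar>P g\<bar> > 0" using b(1) exp_gt_zero less_le_trans by blast
      have "real n * (l - \<epsilon>) \<le> ln \<bar>P g\<bar>" using b(1) p by (simp add: ln_ge_iff)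
      moreover have "ln \<bar>P g\<bar> \<le> real n * (l + \<epsilon>)" using b(2) p by (metis ln_exp ln_mono)
      moreover have n0: "real n > 0" using n by simp
      ultimately have "l - \<epsilon> \<le> ln \<bar>P g\<bar> / real n" "ln \<bar>P g\<bar> / real n \<le> l + \<epsilon>"
        by (simp_all add: pos_le_divide_eq pos_divide_le_eq mult.commute)
      then show ?thesis using p by linarith
    qed
    have mconv: "AE \<omega> in M. (\<lambda>n. elog \<bar>P (S n \<omega>)\<bar> / ereal (real n)) \<longlonglongrightarrow> ereal l"
    proof -
      have "AE \<omega> in M. \<forall>j. \<forall>\<^sub>F n in sequentially. S n \<omega> \<notin> bad P l (1 / real (Suc j)) n"
        unfolding AE_all_countable using l(2) by simp
      then show ?thesis
      proof (rule eventually_mono)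
        fix \<omega> assume a: "\<forall>j. \<forall>\<^sub>F n in sequentially. S n \<omega> \<notin> bad P l (1 / real (Suc j)) n"
        have e: "\<forall>\<^sub>F n in sequentially. \<bar>P (S n \<omega>)\<bar> \<noteq> 0 \<and> \<bar>ln \<bar>P (S n \<omega>)\<bar> / real n - l\<bar> \<le> 1 / real (Suc j)" for j
          using a[rule_format, of j] eventually_ge_at_top[of "1::nat"] by eventually_elim (rule good)
        have "(\<lambda>n. ln \<bar>P (S n \<omega>)\<bar> / real n) \<longlonglongrightarrow> l"
        proof (rule tendstoI)
          fix r :: real assume "r > 0"
          then obtain j where "1 / real (Suc j) < r" using nat_approx_posE by blast
          then show "\<forall>\<^sub>F n in sequentially. dist (ln \<bar>P (S n \<omega>)\<bar> / real n) l < r"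
            using e[of j] by (auto simp: dist_real_def elim!: eventually_mono)
        qed
        then have "(\<lambda>n. ereal (ln \<bar>P (S n \<omega>)\<bar> / real n)) \<longlonglongrightarrow> ereal l" by simp
        moreover have "\<forall>\<^sub>F n in sequentially. ereal (ln \<bar>P (S n \<omega>)\<bar> / real n) = elog \<bar>P (S n \<omega>)\<bar> / ereal (real n)"
          using e[of 0] eventually_ge_at_top[of "1::nat"] by eventually_elim (auto simp: elog_def)
        ultimately show "(\<lambda>n. elog \<bar>P (S n \<omega>)\<bar> / ereal (real n)) \<longlonglongrightarrow> ereal l" by (rule Lim_transform_eventually)
      qed
    qed
    have "limsup (\<lambda>n. ereal (root n (measure M {\<omega> \<in> space M. \<bar>elog \<bar>P (S n \<omega>)\<bar> / ereal (real n) - ereal l\<bar> > ereal \<epsilon>}))) < 1"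
      if e: "\<epsilon> > 0" for \<epsilon>
    proof (rule root_limsup_less_1[OF exp_small_eventually[OF l(1)[OF e], where start=1]])
      fix i :: unit and n :: nat assume n: "1 \<le> n"
      have sub: "g \<in> bad P l \<epsilon> n" if "\<bar>elog \<bar>P g\<bar> / ereal (real n) - ereal l\<bar> > ereal \<epsilon>" for g
      proof (rule ccontr)
        assume "g \<notin> bad P l \<epsilon> n"
        from good[OF this n] have "elog \<bar>P g\<bar> / ereal (real n) = ereal (ln \<bar>P g\<bar> / real n)" "\<bar>ln \<bar>P g\<bar> / real n - l\<bar> \<le> \<epsilon>"
          using n by (auto simp: elog_def)
        then show False using that by simp
      qed
      show "measure M {\<omega> \<in> space M. \<bar>elog \<bar>P (S n \<omega>)\<bar> / ereal (real n) - ereal l\<bar> > ereal \<epsilon>} \<le> measure M {\<omega> \<in> space M. S n \<omega> \<in> bad P l \<epsilon> n}"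
        by (rule M.finite_measure_mono[OF _ evs[OF bads[OF P(1)]]]) (use sub in auto)
    qed (auto simp: measure_nonneg)
    then show ?thesis using l0 mconv by blast
  qed
  show ?thesis using part1 part2 unfolding S_def by blast
qed

end
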